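(* Let $\Omega\subset\mathbb{R}^n$ be a bounded domain and let $u\in H^1(\Omega)\cap L^{p+1}(\Omega)$ be a stationary solution of $-\Delta u=|u|^{p-1}u$ in $\Omega$. For any $x\in\Omega$, $\mathcal{F}_x(u)\ne\emptyset$ and $\mathcal{M}_x(u)\ne\emptyset$. If $x\notin\operatorname{sing}(u)$, that is, if there exists $r>0$ such that $u$ is smooth in $B_r(x)$, then $\mathcal{F}_x(u)$ contains only the zero function and $\mathcal{M}_x(u)$ contains only the zero measure.
   Context: Standing assumptions: $n\ge 3$ is an integer, $p>\frac{n+2}{n-2}$, $\alpha_p:=\frac{2(p+1)}{p-1}\in(2,n)$. $B_r(x)$ is the open ball in $\mathbb{R}^n$, $B_r=B_r(0)$. Stationary solution in $\Omega$: $u\in H^1(\Omega)\cap L^{p+1}(\Omega)$ with (1) $\int_\Omega(\nabla u\cdot\nabla\varphi-|u|^{p-1}u\varphi)=0$ for all $\varphi\in C_0^\infty(\Omega)$, and (2) $\int_\Omega\big[\big(\frac{|\nabla u|^2}{2}-\frac{|u|^{p+1}}{p+1}\big)\operatorname{div}Y-DY(\nabla u,\nabla u)\big]=0$ for all $Y\in C_0^\infty(\Omega,\mathbb{R}^n)$, where $DY(\nabla u,\nabla u)=\sum_{i,j}\partial_iY_j\,\partial_iu\,\partial_ju$. $\operatorname{sing}(u)$ is the complement in $\Omega$ of the set of points $x$ such that $u$ is smooth in $B_r(x)$ for some $r>0$. Measures: $\mathcal{M}(U)$ is the set of nonnegative Radon measures on $U$; $\mu_i\rightharpoonup^*\mu$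 in $\mathcal{M}(\mathbb{R}^n)$ means $\int f\,d\mu_i\to\int f\,d\mu$ for all continuous compactly supported $f$. $m_u:=\big(\frac{p-1}{2}|\nabla u|^2+\frac{p-1}{p+1}|u|^{p+1}\big)dy$. Blow-ups (on $r^{-1}(\Omega-x)$): $T_{x,r}u(y):=r^{\frac{2}{p-1}}u(x+ry)$, $T_{x,r}\mu(A):=r^{\alpha_p-n}\mu(x+rA)$. $\mathcal{F}_x(u)$ (tangent functions) is the set of $v\in H^1_{\rm loc}\cap L^{p+1}_{\rm loc}(\mathbb{R}^n)$ such that for some sequence $r_i\to0^+$, $T_{x,r_i}u\rightharpoonup v$ weakly in $H^1(B_R)$ and $L^{p+1}(B_R)$ for every $R>0$. $\mathcal{M}_x(u)$ (tangent measures) is the set of $\mu\in\mathcal{M}(\mathbb{R}^n)$ such that $T_{x,s_i}m_u\rightharpoonup^*\mu$ in $\mathcal{M}(\mathbb{R}^n)$ for some sequence $s_i\to0^+$. *)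

theory Defs
  imports "HOL-Analysis.Analysis"
begin

text \<open>
  Elements of Lebesgue and Sobolev spaces are represented by total functions, of which only the
  values on the domain, up to Lebesgue null sets, are relevant.
\<close>

section \<open>Smooth functions\<close>

definition partial_deriv :: "'n \<Rightarrow> (real ^ 'n \<Rightarrow> 'b::real_normed_vector) \<Rightarrow> real ^ 'n \<Rightarrow> 'b"
  where "partial_deriv i f x = frechet_derivative f (at x) (axis i 1)"

definition divergence :: "(real ^ 'n \<Rightarrow> real ^ 'n) \<Rightarrow> real ^ 'n \<Rightarrow> real"
  where "divergence Y x = (\<Sum>i\<in>UNIV. partial_deriv i Y x $ i)"

text \<open>\<open>C_on k S f\<close> is meant for open \<open>S\<close>.\<close>

primrec C_on :: "nat \<Rightarrow> (real ^ 'n) set \<Rightarrow> (real ^ 'n \<Rightarrow> 'b::real_normed_vector) \<Rightarrow> bool"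
  where
    "C_on 0 S f \<longleftrightarrow> continuous_on S f"
  | "C_on (Suc k) S f \<longleftrightarrow>
      (\<forall>x\<in>S. f differentiable (at x)) \<and> (\<forall>i. C_on k S (partial_deriv i f))"

definition smooth_on :: "(real ^ 'n) set \<Rightarrow> (real ^ 'n \<Rightarrow> 'b::real_normed_vector) \<Rightarrow> bool"
  where "smooth_on S f \<longleftrightarrow> (\<forall>k. C_on k S f)"

text \<open>\<open>C\<^sub>0\<^sup>\<infinity>(U)\<close>; its elements are extended by zero to the whole space.\<close>

definition test_functions :: "(real ^ 'n) set \<Rightarrow> (real ^ 'n \<Rightarrow> 'b::real_normed_vector) set"
  where "test_functions U =
    {f. smooth_on UNIV f \<and> compact (closure {x. f x \<noteq> 0}) \<and> closure {x. f x \<noteq> 0} \<subseteq> U}"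

section \<open>Lebesgue and Sobolev spaces\<close>

definition L_space :: "real \<Rightarrow> (real ^ 'n) set \<Rightarrow> (real ^ 'n \<Rightarrow> 'b::euclidean_space) set"
  where "L_space q U =
    {f. f \<in> borel_measurable (lebesgue_on U) \<and>
        integrable (lebesgue_on U) (\<lambda>x. norm (f x) powr q)}"

definition L_norm :: "real \<Rightarrow> (real ^ 'n) set \<Rightarrow> (real ^ 'n \<Rightarrow> 'b::euclidean_space) \<Rightarrow> real"
  where "L_norm q U f = (LINT x|lebesgue_on U. norm (f x) powr q) powr (1 / q)"

definition L_loc :: "real \<Rightarrow> (real ^ 'n) set \<Rightarrow> (real ^ 'n \<Rightarrow> 'b::euclidean_space) set"
  where "L_loc q U = {f. \<forall>K. compact K \<and> K \<subseteq> U \<longrightarrow> f \<in> L_space q K}"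

definition has_weak_gradient ::
    "(real ^ 'n) set \<Rightarrow> (real ^ 'n \<Rightarrow> real) \<Rightarrow> (real ^ 'n \<Rightarrow> real ^ 'n) \<Rightarrow> bool"
  where "has_weak_gradient U u G \<longleftrightarrow>
    u \<in> L_loc 1 U \<and> G \<in> L_loc 1 U \<and>
    (\<forall>\<phi>\<in>test_functions U. \<forall>i.
      (LINT x|lebesgue_on U. u x * partial_deriv i \<phi> x) = - (LINT x|lebesgue_on U. G x $ i * \<phi> x))"

text \<open>On open sets the weak gradient is unique up to null sets, so the choice is immaterial.\<close>

definition weak_gradient :: "(real ^ 'n) set \<Rightarrow> (real ^ 'n \<Rightarrow> real) \<Rightarrow> real ^ 'n \<Rightarrow> real ^ 'n"
  where "weak_gradient U u = (SOME G. has_weak_gradient U u G)"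

definition H1 :: "(real ^ 'n) set \<Rightarrow> (real ^ 'n \<Rightarrow> real) set"
  where "H1 U = {u \<in> L_space 2 U. \<exists>G \<in> L_space 2 U. has_weak_gradient U u G}"

definition H1_norm :: "(real ^ 'n) set \<Rightarrow> (real ^ 'n \<Rightarrow> real) \<Rightarrow> real"
  where "H1_norm U u =
    sqrt ((LINT x|lebesgue_on U. (u x)\<^sup>2) + (LINT x|lebesgue_on U. (norm (weak_gradient U u x))\<^sup>2))"

definition H1_loc :: "(real ^ 'n) set \<Rightarrow> (real ^ 'n \<Rightarrow> real) set"
  where "H1_loc U = {u. \<forall>V. open V \<and> compact (closure V) \<and> closure V \<subseteq> U \<longrightarrow> u \<in> H1 V}"

section \<open>Weak convergence\<close>

text \<open>
  \<open>X\<close> is a vector space of functions and \<open>N\<close> its (semi)norm. Boundedness of a linear functional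
  forces it to agree on functions at distance zero, so functionals are well defined on classes.
\<close>

definition bounded_functional ::
    "('a \<Rightarrow> real) set \<Rightarrow> (('a \<Rightarrow> real) \<Rightarrow> real) \<Rightarrow> (('a \<Rightarrow> real) \<Rightarrow> real) \<Rightarrow> bool"
  where "bounded_functional X N l \<longleftrightarrow>
    (\<forall>f\<in>X. \<forall>g\<in>X. l (\<lambda>x. f x + g x) = l f + l g) \<and>
    (\<forall>f\<in>X. \<forall>c. l (\<lambda>x. c * f x) = c * l f) \<and>
    (\<exists>C. \<forall>f\<in>X. \<bar>l f\<bar> \<le> C * N f)"

text \<open>
  Membership in \<open>X\<close> is only required eventually: the blow-ups live on \<open>r\<^sup>-\<^sup>1(\<Omega> - x)\<close>, which
  contains a given ball only for small \<open>r\<close>.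
\<close>

definition weakly_converges ::
    "('a \<Rightarrow> real) set \<Rightarrow> (('a \<Rightarrow> real) \<Rightarrow> real) \<Rightarrow> (nat \<Rightarrow> 'a \<Rightarrow> real) \<Rightarrow> ('a \<Rightarrow> real) \<Rightarrow> bool"
  where "weakly_converges X N f v \<longleftrightarrow>
    (\<forall>\<^sub>F i in sequentially. f i \<in> X) \<and> v \<in> X \<and>
    (\<forall>l. bounded_functional X N l \<longrightarrow> (\<lambda>i. l (f i)) \<longlonglongrightarrow> l v)"

text \<open>On Euclidean space, a Borel measure that is finite on compact sets is regular.\<close>

definition radon_measures :: "(real ^ 'n) measure set"
  where "radon_measures = {\<mu>. sets \<mu> = sets borel \<and> (\<forall>K. compact K \<longrightarrow> emeasure \<mu> K < \<infinity>)}"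

definition weak_star_converges :: "(nat \<Rightarrow> (real ^ 'n) measure) \<Rightarrow> (real ^ 'n) measure \<Rightarrow> bool"
  where "weak_star_converges \<nu> \<mu> \<longleftrightarrow>
    (\<forall>f :: real ^ 'n \<Rightarrow> real. continuous_on UNIV f \<and> compact (closure {x. f x \<noteq> 0}) \<longrightarrow>
      (\<lambda>i. LINT y|\<nu> i. f y) \<longlonglongrightarrow> (LINT y|\<mu>. f y))"

section \<open>Stationary solutions and their singular set\<close>

definition stationary_solution :: "real \<Rightarrow> (real ^ 'n) set \<Rightarrow> (real ^ 'n \<Rightarrow> real) \<Rightarrow> bool"
  where "stationary_solution p \<Omega> u \<longleftrightarrow>
    u \<in> H1 \<Omega> \<inter> L_space (p + 1) \<Omega> \<and>
    (\<forall>\<phi>\<in>test_functions \<Omega>.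
      (LINT x|lebesgue_on \<Omega>.
        (\<Sum>i\<in>UNIV. weak_gradient \<Omega> u x $ i * partial_deriv i \<phi> x)
        - \<bar>u x\<bar> powr (p - 1) * u x * \<phi> x) = 0) \<and>
    (\<forall>Y\<in>test_functions \<Omega>.
      (LINT x|lebesgue_on \<Omega>.
        ((norm (weak_gradient \<Omega> u x))\<^sup>2 / 2 - \<bar>u x\<bar> powr (p + 1) / (p + 1)) * divergence Y x
        - (\<Sum>i\<in>UNIV. \<Sum>j\<in>UNIV.
            partial_deriv i Y x $ j * weak_gradient \<Omega> u x $ i * weak_gradient \<Omega> u x $ j)) = 0)"

text \<open>Being smooth on a ball means having a smooth representative there.\<close>

definition sing :: "(real ^ 'n) set \<Rightarrow> (real ^ 'n \<Rightarrow> real) \<Rightarrow> (real ^ 'n) set"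
  where "sing \<Omega> u = \<Omega> - {x. \<exists>r>0. ball x r \<subseteq> \<Omega> \<and>
    (\<exists>g. smooth_on (ball x r) g \<and> (AE y in lebesgue_on (ball x r). u y = g y))}"

section \<open>Blow-ups, tangent functions and tangent measures\<close>

definition blow_up :: "real \<Rightarrow> real ^ 'n \<Rightarrow> real \<Rightarrow> (real ^ 'n \<Rightarrow> real) \<Rightarrow> real ^ 'n \<Rightarrow> real"
  where "blow_up p x r u y = r powr (2 / (p - 1)) * u (x + r *\<^sub>R y)"

definition alpha :: "real \<Rightarrow> real"
  where "alpha p = 2 * (p + 1) / (p - 1)"

text \<open>
  For a measure \<open>\<mu>\<close> on \<open>\<Omega>\<close> this is the blow-up on \<open>r\<^sup>-\<^sup>1(\<Omega> - x)\<close> extended by zero;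
  see \<open>emeasure_blow_up_measure\<close> below.
\<close>

definition blow_up_measure ::
    "real \<Rightarrow> real ^ 'n \<Rightarrow> real \<Rightarrow> (real ^ 'n) measure \<Rightarrow> (real ^ 'n) measure"
  where "blow_up_measure p x r \<mu> =
    scale_measure (ennreal (r powr (alpha p - real CARD('n))))
      (distr \<mu> borel (\<lambda>z. (z - x) /\<^sub>R r))"

definition energy_measure ::
    "real \<Rightarrow> (real ^ 'n) set \<Rightarrow> (real ^ 'n \<Rightarrow> real) \<Rightarrow> (real ^ 'n) measure"
  where "energy_measure p \<Omega> u =
    density (lebesgue_on \<Omega>)
      (\<lambda>y. ennreal ((p - 1) / 2 * (norm (weak_gradient \<Omega> u y))\<^sup>2
                    + (p - 1) / (p + 1) * \<bar>u y\<bar> powr (p + 1)))"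

lemma emeasure_blow_up_measure:
  fixes x :: "real ^ 'n"
  assumes r: "r > 0" and A: "A \<in> sets borel"
  shows "emeasure (blow_up_measure p x r (energy_measure p \<Omega> u)) A =
    ennreal (r powr (alpha p - real CARD('n))) *
      emeasure (energy_measure p \<Omega> u) (((\<lambda>y. x + r *\<^sub>R y) ` A) \<inter> \<Omega>)"
proof -
  have "(\<lambda>z. (z - x) /\<^sub>R r) \<in> borel_measurable (borel :: (real ^ 'n) measure)"
    by measurable
  then have "(\<lambda>z. (z - x) /\<^sub>R r) \<in> borel_measurable lebesgue"
    by (simp add: measurable_completion)
  then have m: "(\<lambda>z. (z - x) /\<^sub>R r) \<in> energy_measure p \<Omega> u \<rightarrow>\<^sub>M borel"
    unfolding energy_measure_def by (simp add: measurable_restrict_space1)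
  have "(\<lambda>z. (z - x) /\<^sub>R r) -` A \<inter> space (energy_measure p \<Omega> u) = ((\<lambda>y. x + r *\<^sub>R y) ` A) \<inter> \<Omega>"
  proof -
    have "z \<in> (\<lambda>y. x + r *\<^sub>R y) ` A \<longleftrightarrow> (z - x) /\<^sub>R r \<in> A" for z
    proof
      assume "(z - x) /\<^sub>R r \<in> A"
      moreover have "z = x + r *\<^sub>R ((z - x) /\<^sub>R r)" using r by simp
      ultimately show "z \<in> (\<lambda>y. x + r *\<^sub>R y) ` A" by blast
    qed (use r in auto)
    then show ?thesis
      by (auto simp: energy_measure_def space_restrict_space)
  qed
  then show ?thesis
    unfolding blow_up_measure_def by (simp add: emeasure_distr[OF m A])
qed

definition tangent_functions ::
    "real \<Rightarrow> (real ^ 'n \<Rightarrow> real) \<Rightarrow> real ^ 'n \<Rightarrow> (real ^ 'n \<Rightarrow> real) set"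
  where "tangent_functions p u x =
    {v \<in> H1_loc UNIV \<inter> L_loc (p + 1) UNIV.
      \<exists>r. (\<forall>i. r i > 0) \<and> r \<longlonglongrightarrow> 0 \<and>
        (\<forall>R>0.
          weakly_converges (H1 (ball 0 R)) (H1_norm (ball 0 R)) (\<lambda>i. blow_up p x (r i) u) v \<and>
          weakly_converges (L_space (p + 1) (ball 0 R)) (L_norm (p + 1) (ball 0 R))
            (\<lambda>i. blow_up p x (r i) u) v)}"

definition tangent_measures ::
    "real \<Rightarrow> (real ^ 'n) set \<Rightarrow> (real ^ 'n \<Rightarrow> real) \<Rightarrow> real ^ 'n \<Rightarrow> (real ^ 'n) measure set"
  where "tangent_measures p \<Omega> u x =
    {\<mu> \<in> radon_measures.
      \<exists>s. (\<forall>i. s i > 0) \<and> s \<longlonglongrightarrow> 0 \<and>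
        weak_star_converges (\<lambda>i. blow_up_measure p x (s i) (energy_measure p \<Omega> u)) \<mu>}"

end

theory Submission
  imports Defs "HOL-Probability.Helly_Selection" "HOL-Computational_Algebra.Polynomial"
    "HOL-Library.Diagonal_Subsequence"
begin

text \<open>
  All assertions rest on one estimate. Put \<open>\<alpha> = 2 (p + 1) / (p - 1)\<close>; the lower bound on \<open>p\<close>
  says exactly that \<open>\<alpha> < n\<close>. The energy of a stationary solution, the integral of
  \<open>\<bar>\<nabla>u\<bar>\<^sup>2 + \<bar>u\<bar>\<^bsup>p+1\<^esup>\<close>, over the ball of radius \<open>r\<close> around \<open>x\<close> is at most a constant times
  \<open>r\<^bsup>n-\<alpha>\<^esup>\<close> (\<open>energy_bound\<close>). Blowing up multiplies energies by \<open>r\<^bsup>\<alpha>-n\<^esup>\<close>, so the blow-ups at \<open>x\<close>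
  are bounded in \<open>H\<^sup>1\<close> and in \<open>L\<^bsup>p+1\<^esup>\<close> on every fixed ball, and their energy measures have
  bounded mass there. Compactness then provides tangent functions and tangent measures.

  The estimate is a consequence of the monotonicity formula, here in a smooth form. Integrals
  over balls are replaced by integrals against the cut-off \<open>h (1 - t \<bar>y - x\<bar>\<^sup>2)\<close> with
  \<open>h s = exp (- 1 / s)\<close> for \<open>s > 0\<close> and \<open>h s = 0\<close> otherwise, so that \<open>t\<close> stands for \<open>r\<^sup>-\<^sup>2\<close> and
  no traces on spheres occur. Testing the equation with \<open>u\<close> times the cut-off, the stationarity
  condition with the field \<open>y - x\<close> times the cut-off, and integrating \<open>u\<^sup>2\<close> by parts yields
  three identities between such integrals (\<open>energy_identity\<close>, \<open>pohozaev_identity\<close>,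
  \<open>divergence_identity\<close>). They make a certain scaled quantity monotone in \<open>t\<close>, because its
  derivative is minus the integral of a square with a positive weight. The monotone quantity is
  not a sum of nonnegative terms, but it differs from a nonnegative one by a derivative, and the
  resulting differential inequality, confronted with the boundedness of \<open>u\<^sup>2\<close> in the mean,
  bounds the energy (\<open>monotonicity_bound\<close>). The product of \<open>u\<close> with a cut-off is not smooth; it
  is an admissible test function because it is a weak limit of mollifications
  (\<open>H1_product_density\<close>).

  Weak compactness is obtained by convexity. In a complete space with Clarkson's inequality,
  near-minimisers of the norm over the midpoint hulls of the tails of a bounded sequence form a
  Cauchy sequence, and a functional that converges along the sequence converges to its value at
  their limit (\<open>bounded_sequence_hull_point\<close>). After a diagonal extraction the integrals over
  all boxes with rational corners converge, which leaves only one candidate for the weak limit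
  of any subsequence (\<open>weak_compactness\<close>). Weak-* compactness of measures
  (\<open>weak_star_compactness\<close>) is reduced to Helly's selection theorem on the line: the measures,
  damped by a weight, are carried to the unit interval by a Borel right inverse of a
  space-filling curve, and the limit is carried back by the curve. Since the curve is
  continuous, test functions on the space become continuous functions on the line.

  Near a regular point \<open>u\<close> is bounded, and a Caccioppoli-type estimate gives energy of order
  \<open>r\<^bsup>n-2\<^esup>\<close> (\<open>energy_decay_bounded\<close>). Since \<open>\<alpha> > 2\<close>, the rescaled energies tend to zero. So the
  blow-ups converge to zero strongly, and every tangent function and tangent measure vanishes.
\<close>

section \<open>Smooth functions\<close>

lemma C_on_Suc_imp: "C_on (Suc k) S f \<Longrightarrow> C_on k S f"
proof (induction k arbitrary: f)
  case 0
  then show ?case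
    by (auto intro!: continuous_at_imp_continuous_on differentiable_imp_continuous_within)
next
  case (Suc k)
  have "\<forall>x\<in>S. f differentiable (at x)" "\<forall>i. C_on (Suc k) S (partial_deriv i f)"
    using Suc.prems C_on.simps(2)[of "Suc k" S f] by simp_all
  then show ?case using Suc.IH by simp
qed

lemma partial_deriv_has_derivative:
  "(f has_derivative D) (at x) \<Longrightarrow> partial_deriv i f x = D (axis i 1)"
  unfolding partial_deriv_def by (metis frechet_derivative_at)

lemma smooth_on_UNIV_differentiable:
  "smooth_on UNIV f \<Longrightarrow> f differentiable (at x)"
  unfolding smooth_on_def by (metis C_on.simps(2) UNIV_I)

lemma smooth_on_UNIV_partial: "smooth_on UNIV f \<Longrightarrow> smooth_on UNIV (partial_deriv i f)"
  unfolding smooth_on_def by (metis C_on.simps(2))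

lemma smooth_on_continuous: "smooth_on S f \<Longrightarrow> continuous_on S f"
  unfolding smooth_on_def by (metis C_on.simps(1))

lemma partial_deriv_zero: "partial_deriv i (\<lambda>x. c) = (\<lambda>x. 0)"
  by (rule ext, subst partial_deriv_has_derivative[of _ "\<lambda>_. 0"]) auto

lemma smooth_on_const: "smooth_on UNIV (\<lambda>x :: real ^ 'n. c :: 'b :: real_normed_vector)"
proof -
  have "C_on k UNIV (\<lambda>x :: real ^ 'n. c)" for k and c :: 'b
    by (induction k arbitrary: c) (auto simp: partial_deriv_zero)
  then show ?thesis by (simp add: smooth_on_def)
qed

lemma smooth_on_bounded_linear:
  fixes L :: "real ^ 'n \<Rightarrow> 'b :: real_normed_vector"
  assumes "bounded_linear L" shows "smooth_on UNIV L"
proof -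
  have d: "(L has_derivative L) (at x)" for x
    using assms bounded_linear_imp_has_derivative by blast
  have "C_on k UNIV L" for k
  proof (cases k)
    case 0 then show ?thesis using assms by (simp add: linear_continuous_on)
  next
    case (Suc m)
    have "partial_deriv i L = (\<lambda>x. L (axis i 1))" for i
      using partial_deriv_has_derivative[OF d] by auto
    moreover have "C_on m UNIV (\<lambda>x :: real ^ 'n. L (axis i 1))" for i
      using smooth_on_const unfolding smooth_on_def by blast
    ultimately show ?thesis using Suc d by (auto simp: differentiable_def)
  qed
  then show ?thesis by (simp add: smooth_on_def)
qed

lemma partial_deriv_add:
  assumes "f differentiable (at x)" "g differentiable (at x)"
  shows "partial_deriv i (\<lambda>x. f x + g x) x = partial_deriv i f x + partial_deriv i g x"
proof -
  obtain D E where *: "(f has_derivative D) (at x)" "(g has_derivative E) (at x)"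
    using assms by (auto simp: differentiable_def)
  show ?thesis
    using partial_deriv_has_derivative[OF has_derivative_add[OF *]]
      partial_deriv_has_derivative[OF *(1)] partial_deriv_has_derivative[OF *(2)] by metis
qed

lemma partial_deriv_scaleR:
  assumes "f differentiable (at x)" "g differentiable (at x)"
  shows "partial_deriv i (\<lambda>x. f x *\<^sub>R g x) x = f x *\<^sub>R partial_deriv i g x + partial_deriv i f x *\<^sub>R g x"
proof -
  obtain D E where *: "(f has_derivative D) (at x)" "(g has_derivative E) (at x)"
    using assms by (auto simp: differentiable_def)
  show ?thesis
    using partial_deriv_has_derivative[OF has_derivative_scaleR[OF *]]
      partial_deriv_has_derivative[OF *(1)] partial_deriv_has_derivative[OF *(2)] by metis
qed

lemma C_on_add: "C_on k UNIV f \<Longrightarrow> C_on k UNIV g \<Longrightarrow> C_on k UNIV (\<lambda>x. f x + g x)"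
proof (induction k arbitrary: f g)
  case 0 then show ?case by (simp add: continuous_on_add)
next
  case (Suc k)
  have "partial_deriv i (\<lambda>x. f x + g x) = (\<lambda>x. partial_deriv i f x + partial_deriv i g x)" for i
    using Suc.prems by (intro ext partial_deriv_add) auto
  then show ?case using Suc by auto
qed

lemma C_on_scaleR: "C_on k UNIV f \<Longrightarrow> C_on k UNIV g \<Longrightarrow> C_on k UNIV (\<lambda>x. f x *\<^sub>R g x)"
proof (induction k arbitrary: f g)
  case 0 then show ?case by (simp add: continuous_on_scaleR)
next
  case (Suc k)
  have "partial_deriv i (\<lambda>x. f x *\<^sub>R g x) = (\<lambda>x. f x *\<^sub>R partial_deriv i g x + partial_deriv i f x *\<^sub>R g x)" for i
    using Suc.prems by (intro ext partial_deriv_scaleR) auto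
  moreover have "C_on k UNIV (\<lambda>x. f x *\<^sub>R partial_deriv i g x + partial_deriv i f x *\<^sub>R g x)" for i
  proof (rule C_on_add; rule Suc.IH)
    show "C_on k UNIV (partial_deriv i g)" "C_on k UNIV (partial_deriv i f)"
      using Suc.prems by simp_all
  qed (use Suc.prems C_on_Suc_imp in blast)+
  ultimately show ?case using Suc.prems by simp
qed

lemma smooth_on_add: "smooth_on UNIV f \<Longrightarrow> smooth_on UNIV g \<Longrightarrow> smooth_on UNIV (\<lambda>x. f x + g x)"
  by (simp add: smooth_on_def C_on_add)

lemma smooth_on_scaleR: "smooth_on UNIV f \<Longrightarrow> smooth_on UNIV g \<Longrightarrow> smooth_on UNIV (\<lambda>x. f x *\<^sub>R g x)"
  by (simp add: smooth_on_def C_on_scaleR)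

lemma smooth_on_mult:
  fixes f g :: "real ^ 'n \<Rightarrow> real"
  shows "smooth_on UNIV f \<Longrightarrow> smooth_on UNIV g \<Longrightarrow> smooth_on UNIV (\<lambda>x. f x * g x)"
  using smooth_on_scaleR[of f g] by simp

lemma smooth_on_sum:
  "(\<And>i. i \<in> I \<Longrightarrow> smooth_on UNIV (f i)) \<Longrightarrow> smooth_on UNIV (\<lambda>x. \<Sum>i\<in>I. f i x)"
  by (induction I rule: infinite_finite_induct) (auto simp: smooth_on_const smooth_on_add)

lemma smooth_on_prod:
  fixes f :: "'i \<Rightarrow> real ^ 'n \<Rightarrow> real"
  shows "(\<And>i. i \<in> I \<Longrightarrow> smooth_on UNIV (f i)) \<Longrightarrow> smooth_on UNIV (\<lambda>x. \<Prod>i\<in>I. f i x)"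
  by (induction I rule: infinite_finite_induct) (auto simp: smooth_on_const smooth_on_mult)

lemma partial_deriv_compose:
  fixes q :: "real ^ 'n \<Rightarrow> real" and h :: "real \<Rightarrow> real"
  assumes "(h has_real_derivative d) (at (q x))" "q differentiable (at x)"
  shows "(\<lambda>x. h (q x)) differentiable (at x)"
    "partial_deriv i (\<lambda>x. h (q x)) x = d * partial_deriv i q x"
proof -
  obtain D where D: "(q has_derivative D) (at x)"
    using assms by (auto simp: differentiable_def)
  have "((\<lambda>x. h (q x)) has_derivative (\<lambda>v. d * D v)) (at x)"
    using has_derivative_compose[OF D] assms(1) unfolding has_field_derivative_def by blast
  then show "(\<lambda>x. h (q x)) differentiable (at x)"
    "partial_deriv i (\<lambda>x. h (q x)) x = d * partial_deriv i q x"
    by (auto simp: differentiable_def partial_deriv_has_derivative partial_deriv_has_derivative[OF D])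
qed

text \<open>
  The outer function comes as the family of all its derivatives, since induction on the order of
  differentiability needs the same statement for \<open>h (Suc j)\<close>.
\<close>

lemma smooth_on_compose:
  fixes q :: "real ^ 'n \<Rightarrow> real" and h :: "nat \<Rightarrow> real \<Rightarrow> real"
  assumes h: "\<And>j t. (h j has_real_derivative h (Suc j) t) (at t)" and q: "smooth_on UNIV q"
  shows "smooth_on UNIV (\<lambda>x. h j (q x))"
proof -
  have "C_on k UNIV (\<lambda>x. h j (q x))" for k j
  proof (induction k arbitrary: j)
    case 0
    have "continuous_on UNIV (h j)"
      using h DERIV_isCont continuous_at_imp_continuous_on by blast
    then show ?case using smooth_on_continuous[OF q]
      by (auto intro: continuous_on_compose2)
  next
    case (Suc k)
    have "partial_deriv i (\<lambda>x. h j (q x)) = (\<lambda>x. h (Suc j) (q x) *\<^sub>R partial_deriv i q x)" for i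
      using partial_deriv_compose(2)[OF h smooth_on_UNIV_differentiable[OF q]] by auto
    moreover have "C_on k UNIV (\<lambda>x. h (Suc j) (q x) *\<^sub>R partial_deriv i q x)" for i
      using C_on_scaleR[OF Suc] smooth_on_UNIV_partial[OF q] unfolding smooth_on_def by blast
    ultimately show ?case
      using partial_deriv_compose(1)[OF h smooth_on_UNIV_differentiable[OF q]] by auto
  qed
  then show ?thesis by (simp add: smooth_on_def)
qed

section \<open>A flat function and its derivatives\<close>

text \<open>
  The \<open>j\<close>-th derivative of \<open>exp (- 1 / t)\<close> is a polynomial in \<open>1 / t\<close> times \<open>exp (- 1 / t)\<close>; the
  recursion is the product rule, with \<open>1 / t\<close> having derivative \<open>- (1 / t)\<^sup>2\<close>.
\<close>

primrec flat_poly :: "nat \<Rightarrow> real poly" where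
  "flat_poly 0 = 1"
| "flat_poly (Suc j) = monom 1 2 * (flat_poly j - pderiv (flat_poly j))"

text \<open>
  The \<open>j\<close>-th derivative of the smooth function that is \<open>exp (- 1 / t)\<close> for positive \<open>t\<close> and zero
  otherwise. All derivatives are kept in one family because the cut-offs and their derivatives
  are treated alike.
\<close>

definition flat :: "nat \<Rightarrow> real \<Rightarrow> real" where
  "flat j t = (if t > 0 then poly (flat_poly j) (1 / t) * exp (- 1 / t) else 0)"

lemma poly_div_exp_tendsto_0: "((\<lambda>s::real. poly P s * exp (- s)) \<longlongrightarrow> 0) at_top"
proof -
  have "((\<lambda>s::real. \<Sum>i\<le>degree P. coeff P i * (s ^ i / exp s)) \<longlongrightarrow> (\<Sum>i\<le>degree P. coeff P i * 0)) at_top"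
    by (intro tendsto_sum tendsto_mult tendsto_const tendsto_power_div_exp_0)
  moreover have "(\<lambda>s::real. \<Sum>i\<le>degree P. coeff P i * (s ^ i / exp s)) = (\<lambda>s. poly P s * exp (- s))"
    by (auto simp: poly_altdef exp_minus field_simps sum_distrib_right sum_divide_distrib)
  ultimately show ?thesis by simp
qed

lemma flat_tendsto_0: "((\<lambda>t. poly P (1 / t) * exp (- 1 / t)) \<longlongrightarrow> 0) (at_right (0::real))"
proof -
  have "filterlim (\<lambda>t::real. 1 / t) at_top (at_right 0)"
    using filterlim_inverse_at_top_right by (simp add: inverse_eq_divide)
  from filterlim_compose[OF poly_div_exp_tendsto_0 this] show ?thesis by simp
qed

lemma DERIV_flat: "(flat j has_real_derivative flat (Suc j) t) (at t)"
proof -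
  consider "t > 0" | "t < 0" | "t = 0" by linarith
  then show ?thesis
  proof cases
    case 1
    have "((\<lambda>t. poly (flat_poly j) (1 / t) * exp (- 1 / t)) has_real_derivative flat (Suc j) t) (at t)"
      using 1 by (auto intro!: derivative_eq_intros DERIV_chain2[OF poly_DERIV]
        simp: flat_def poly_monom power2_eq_square field_simps)
    moreover have "\<forall>\<^sub>F x in nhds t. poly (flat_poly j) (1 / x) * exp (- 1 / x) = flat j x"
      using eventually_nhds_in_open[of "{0<..}" t] 1
      by (auto simp: flat_def elim!: eventually_mono)
    ultimately show ?thesis by (subst (asm) DERIV_cong_ev) auto
  next
    case 2
    have "((\<lambda>t. 0) has_real_derivative 0) (at t)" by simp
    moreover have "\<forall>\<^sub>F x in nhds t. 0 = flat j x"
      using eventually_nhds_in_open[of "{..<0}" t] 2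
      by (auto simp: flat_def elim!: eventually_mono)
    ultimately show ?thesis using 2 by (subst (asm) DERIV_cong_ev) (auto simp: flat_def)
  next
    case 3
    (* the difference quotient at 0 is a function of the same form: dividing by t multiplies the
       polynomial in 1 / t by its argument *)
    have "((\<lambda>t. poly (monom 1 1 * flat_poly j) (1 / t) * exp (- 1 / t)) \<longlongrightarrow> 0) (at_right (0::real))"
      by (rule flat_tendsto_0)
    then have r: "((\<lambda>t. (flat j (0 + t) - flat j 0) / t) \<longlongrightarrow> 0) (at_right (0::real))"
      by (rule Lim_transform_eventually)
        (auto simp: flat_def poly_monom eventually_at_right_less intro!: eventually_at_rightI[of 0 1])
    have l: "((\<lambda>t. (flat j (0 + t) - flat j 0) / t) \<longlongrightarrow> 0) (at_left (0::real))"
      by (rule Lim_transform_eventually[OF tendsto_const])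
        (auto simp: flat_def intro!: eventually_at_leftI[of "-1" 0])
    from r l have "((\<lambda>t. (flat j (0 + t) - flat j 0) / t) \<longlongrightarrow> 0) (at (0::real))"
      using filterlim_split_at_real by blast
    then show ?thesis using 3 by (simp add: DERIV_def flat_def)
  qed
qed

lemma flat_nonpos: "t \<le> 0 \<Longrightarrow> flat j t = 0"
  by (simp add: flat_def)

lemma flat_0: "t > 0 \<Longrightarrow> flat 0 t = exp (- 1 / t)"
  by (simp add: flat_def)

lemma flat_1: "t > 0 \<Longrightarrow> flat (Suc 0) t = exp (- 1 / t) / t\<^sup>2"
  by (simp add: flat_def poly_monom power_divide)

lemma continuous_on_flat: "continuous_on A (flat j)"
  using DERIV_flat DERIV_isCont continuous_at_imp_continuous_on by blast

lemma flat_measurable [measurable]: "flat j \<in> borel_measurable borel"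
  by (simp add: continuous_on_flat borel_measurable_continuous_onI)

lemma flat_0_nonneg: "0 \<le> flat 0 t" and flat_1_nonneg: "0 \<le> flat (Suc 0) t"
   and flat_0_le_1: "flat 0 t \<le> 1"
  by (auto simp: flat_def poly_monom)

lemma flat_bounded:
  obtains C where "C > 0" "\<And>t. t \<le> b \<Longrightarrow> \<bar>flat j t\<bar> \<le> C"
proof -
  have "compact (flat j ` {0..b})"
    by (intro compact_continuous_image continuous_on_flat compact_Icc)
  then obtain C where "C > 0" "\<And>t. t \<in> {0..b} \<Longrightarrow> \<bar>flat j t\<bar> \<le> C"
    using compact_imp_bounded[of "flat j ` {0..b}"] unfolding bounded_pos by auto
  moreover have "\<bar>flat j t\<bar> \<le> C" if "t < 0" for t
    using that \<open>C > 0\<close> by (simp add: flat_nonpos)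
  ultimately show ?thesis using that by (metis atLeastAtMost_iff not_le)
qed

text \<open>
  The derivative is \<open>exp (- 1 / t) / t\<^sup>2\<close>, and the pole is absorbed by the factor
  \<open>exp ((1 - s) / t)\<close> gained by lowering the exponent. A multiple of \<open>flat 0\<close> itself would not
  do; a power below the first is just what Hoelder's inequality leaves room for.
\<close>

lemma flat_1_le_powr:
  assumes "0 < s" "s < 1"
  obtains C where "C > 0" "\<And>t. flat (Suc 0) t \<le> C * flat 0 t powr s"
proof -
  define C where "C = 2 / (1 - s)\<^sup>2"
  have C: "C > 0" using assms by (simp add: C_def)
  have "flat (Suc 0) t \<le> C * flat 0 t powr s" for t
  proof (cases "t > 0")
    case True
    have "((1 - s) / t)\<^sup>2 / 2 \<le> exp ((1 - s) / t)"
      using exp_lower_Taylor_quadratic[of "(1 - s) / t"] True assms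
        divide_nonneg_pos[of "1 - s" t] by linarith
    then have "1 / t\<^sup>2 \<le> C * exp ((1 - s) / t)"
    proof -
      have "1 / t\<^sup>2 = C * (((1 - s) / t)\<^sup>2 / 2)"
        using assms by (simp add: C_def power_divide)
      also have "\<dots> \<le> C * exp ((1 - s) / t)"
        using C \<open>((1 - s) / t)\<^sup>2 / 2 \<le> _\<close> by (intro mult_left_mono) auto
      finally show ?thesis .
    qed
    then have "exp (- 1 / t) * (1 / t\<^sup>2) \<le> exp (- 1 / t) * (C * exp ((1 - s) / t))"
      by (intro mult_left_mono) auto
    also have "\<dots> = C * (exp (- 1 / t) * exp ((1 - s) / t))" by simp
    also have "exp (- 1 / t) * exp ((1 - s) / t) = exp (s * (- 1 / t))"
      by (simp add: exp_add[symmetric] diff_divide_distrib)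
    also have "\<dots> = flat 0 t powr s"
      using True by (simp add: flat_0 powr_def)
    finally show ?thesis using True by (simp add: flat_1)
  qed (use C in \<open>simp add: flat_nonpos\<close>)
  with C that show ?thesis by blast
qed

section \<open>Weak compactness in uniformly convex spaces\<close>

text \<open>
  Closure under midpoints replaces the convex hull: Clarkson's inequality speaks of midpoints
  only, and properties of the hull follow by rule induction.
\<close>

inductive_set mid_hull :: "('a \<Rightarrow> real) set \<Rightarrow> ('a \<Rightarrow> real) set" for A where
  base: "f \<in> A \<Longrightarrow> f \<in> mid_hull A"
| mid: "f \<in> mid_hull A \<Longrightarrow> g \<in> mid_hull A \<Longrightarrow> (\<lambda>x. (f x + g x) / 2) \<in> mid_hull A"

lemma mid_hull_mono: "A \<subseteq> B \<Longrightarrow> mid_hull A \<subseteq> mid_hull B"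
proof
  fix f assume "A \<subseteq> B" "f \<in> mid_hull A"
  show "f \<in> mid_hull B" using \<open>f \<in> mid_hull A\<close>
    by induction (use \<open>A \<subseteq> B\<close> in \<open>auto intro: mid_hull.intros\<close>)
qed

text \<open>
  A complete space of functions with a seminorm whose \<open>q\<close>-th power \<open>\<Theta>\<close> satisfies Clarkson's
  inequality. With powers in place of norms the inequality is additive, hence inherited by
  \<open>H\<^sup>1\<close>, where \<open>\<Theta>\<close> is the sum of an integral for the function and one for its gradient. The
  elements are functions rather than classes of functions, so \<open>\<Theta>\<close> may vanish on nonzero
  elements.
\<close>

locale uniformly_convex_space =
  fixes X :: "('a \<Rightarrow> real) set" and \<Theta> :: "('a \<Rightarrow> real) \<Rightarrow> real" and q :: real
  assumes q_pos: "q > 0"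
    and add_closed: "\<And>f g. f \<in> X \<Longrightarrow> g \<in> X \<Longrightarrow> (\<lambda>x. f x + g x) \<in> X"
    and scale_closed: "\<And>f c. f \<in> X \<Longrightarrow> (\<lambda>x. c * f x) \<in> X"
    and nonneg: "\<And>f. 0 \<le> \<Theta> f"
    and homogeneous: "\<And>f c. f \<in> X \<Longrightarrow> \<Theta> (\<lambda>x. c * f x) = \<bar>c\<bar> powr q * \<Theta> f"
    and clarkson: "\<And>f g. f \<in> X \<Longrightarrow> g \<in> X \<Longrightarrow>
      \<Theta> (\<lambda>x. (f x + g x) / 2) + \<Theta> (\<lambda>x. (f x - g x) / 2) \<le> (\<Theta> f + \<Theta> g) / 2"
    and complete: "\<And>f. (\<And>n. f n \<in> X) \<Longrightarrow>
      (\<And>e. e > 0 \<Longrightarrow> \<exists>M. \<forall>m\<ge>M. \<forall>n\<ge>M. \<Theta> (\<lambda>x. f m x - f n x) < e) \<Longrightarrow>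
      \<exists>v\<in>X. (\<lambda>n. \<Theta> (\<lambda>x. f n x - v x)) \<longlonglongrightarrow> 0"
begin

abbreviation functional :: "(('a \<Rightarrow> real) \<Rightarrow> real) \<Rightarrow> bool" where
  "functional \<equiv> bounded_functional X (\<lambda>f. \<Theta> f powr (1 / q))"

lemma diff_closed: "f \<in> X \<Longrightarrow> g \<in> X \<Longrightarrow> (\<lambda>x. f x - g x) \<in> X"
  using add_closed[of f "\<lambda>x. (-1) * g x"] scale_closed[of g "-1"] by simp

lemma mid_closed: "f \<in> X \<Longrightarrow> g \<in> X \<Longrightarrow> (\<lambda>x. (f x + g x) / 2) \<in> X"
  using scale_closed[OF add_closed, of f g "1/2"] by simp

lemma functional_scale: "functional l \<Longrightarrow> f \<in> X \<Longrightarrow> l (\<lambda>x. c * f x) = c * l f"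
  by (simp add: bounded_functional_def)

lemma functional_add: "functional l \<Longrightarrow> f \<in> X \<Longrightarrow> g \<in> X \<Longrightarrow> l (\<lambda>x. f x + g x) = l f + l g"
  by (simp add: bounded_functional_def)

lemma functional_diff:
  assumes "functional l" "f \<in> X" "g \<in> X"
  shows "l (\<lambda>x. f x - g x) = l f - l g"
  using functional_add[OF assms(1,2) scale_closed[OF assms(3), of "-1"]]
    functional_scale[OF assms(1,3), of "-1"] by simp

lemma functional_mid:
  assumes "functional l" "f \<in> X" "g \<in> X"
  shows "l (\<lambda>x. (f x + g x) / 2) = (l f + l g) / 2"
  using functional_scale[OF assms(1) add_closed[OF assms(2,3)], of "1/2"]
    functional_add[OF assms] by simp

lemma functional_bound:
  assumes "functional l"
  obtains C where "C \<ge> 0" "\<And>f. f \<in> X \<Longrightarrow> \<bar>l f\<bar> \<le> C * \<Theta> f powr (1 / q)"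
proof -
  obtain C where C: "\<And>f. f \<in> X \<Longrightarrow> \<bar>l f\<bar> \<le> C * \<Theta> f powr (1 / q)"
    using assms unfolding bounded_functional_def by blast
  have "C * \<Theta> f powr (1 / q) \<le> max C 0 * \<Theta> f powr (1 / q)" for f
    by (intro mult_right_mono) auto
  with C show ?thesis by (meson that max.cobounded2 order_trans)
qed

lemma functional_tendsto:
  assumes "functional l" "\<forall>\<^sub>F n in sequentially. f n \<in> X" "v \<in> X"
    "(\<lambda>n. \<Theta> (\<lambda>x. f n x - v x)) \<longlonglongrightarrow> 0"
  shows "(\<lambda>n. l (f n)) \<longlonglongrightarrow> l v"
proof -
  obtain C where C: "C \<ge> 0" "\<And>f. f \<in> X \<Longrightarrow> \<bar>l f\<bar> \<le> C * \<Theta> f powr (1 / q)"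
    using functional_bound[OF assms(1)] by blast
  have "(\<lambda>n. \<Theta> (\<lambda>x. f n x - v x) powr (1 / q)) \<longlonglongrightarrow> 0"
    using tendsto_zero_powrI[OF assms(4) tendsto_const, of "1/q"] q_pos nonneg by simp
  then have 0: "(\<lambda>n. C * \<Theta> (\<lambda>x. f n x - v x) powr (1 / q)) \<longlonglongrightarrow> 0"
    by (rule tendsto_mult_right_zero)
  have "\<forall>\<^sub>F n in sequentially. \<bar>l (f n) - l v\<bar> \<le> C * \<Theta> (\<lambda>x. f n x - v x) powr (1 / q)"
    using assms(2) by eventually_elim
      (use C(2) functional_diff[OF assms(1)] assms(3) diff_closed in metis)
  then have "(\<lambda>n. l (f n) - l v) \<longlonglongrightarrow> 0"
    by (intro Lim_null_comparison[OF _ 0]) simp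
  then show ?thesis using LIM_zero_iff by blast
qed

lemma functional_zero:
  assumes "functional l" "v \<in> X" "\<Theta> v = 0" shows "l v = 0"
proof -
  obtain C where C: "C \<ge> 0" "\<And>f. f \<in> X \<Longrightarrow> \<bar>l f\<bar> \<le> C * \<Theta> f powr (1 / q)"
    using functional_bound[OF assms(1)] by blast
  show ?thesis using C(2)[OF assms(2)] assms(3) by simp
qed

lemma mid_hull_subset: "A \<subseteq> X \<Longrightarrow> mid_hull A \<subseteq> X"
proof
  fix f assume "A \<subseteq> X" "f \<in> mid_hull A"
  show "f \<in> X" using \<open>f \<in> mid_hull A\<close>
    by induction (use \<open>A \<subseteq> X\<close> in \<open>auto intro: mid_closed\<close>)
qed

lemma mid_hull_functional_bounds:
  assumes "functional l" "A \<subseteq> X" "\<And>f. f \<in> A \<Longrightarrow> \<bar>l f - c\<bar> \<le> e" "g \<in> mid_hull A"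
  shows "\<bar>l g - c\<bar> \<le> e"
  using assms(4)
proof induction
  case (mid f g)
  have "f \<in> X" "g \<in> X" using mid mid_hull_subset[OF assms(2)] by auto
  then have "l (\<lambda>x. (f x + g x) / 2) = (l f + l g) / 2" using functional_mid[OF assms(1)] by blast
  then show ?case using mid.IH by (simp add: abs_le_iff field_simps)
qed (use assms in auto)

text \<open>
  The infima of \<open>\<Theta>\<close> over the midpoint hulls of the tails increase to a finite limit. The
  midpoint of two near-minimisers from the hull of a tail lies in that hull again, so \<open>\<Theta>\<close> of it
  is not below the infimum; Clarkson's inequality then makes \<open>\<Theta>\<close> of the difference small. So the
  near-minimisers form a Cauchy sequence. A functional that converges along \<open>f\<close> converges to the
  same value along the near-minimisers, as these lie in hulls of later and later tails.
\<close>

proposition bounded_sequence_hull_point: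
  assumes f: "\<And>n. f n \<in> X" and B: "\<And>n. \<Theta> (f n) \<le> B"
  shows "\<exists>v\<in>X. \<forall>l c. functional l \<longrightarrow> (\<lambda>n. l (f n)) \<longlonglongrightarrow> c \<longrightarrow> l v = c"
proof -
  define K where "K n = mid_hull (f ` {n..})" for n
  (* the hulls K n decrease, so the infima d n increase *)
  define d where "d n = Inf (\<Theta> ` K n)" for n
  have KX: "K n \<subseteq> X" for n
    unfolding K_def by (rule mid_hull_subset) (use f in auto)
  have Kmono: "K m \<subseteq> K n" if "n \<le> m" for m n
    unfolding K_def by (rule mid_hull_mono) (use that in auto)
  have fK: "f n \<in> K n" for n unfolding K_def by (auto intro: mid_hull.base)
  have bdd: "bdd_below (\<Theta> ` K n)" for n by (auto intro: bdd_belowI2[of _ 0] nonneg)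
  have d_le: "d n \<le> \<Theta> g" if "g \<in> K n" for g n
    unfolding d_def using that bdd by (auto intro: cInf_lower)
  have d_mono: "d n \<le> d m" if "n \<le> m" for m n
    unfolding d_def using that bdd Kmono[OF that] fK by (intro cInf_superset_mono) auto
  have "\<exists>g\<in>K n. \<Theta> g < d n + 1 / real (Suc n)" for n
    using cInf_lessD[of "\<Theta> ` K n" "d n + 1 / real (Suc n)"] fK[of n] unfolding d_def by force
  then obtain w where w: "\<And>n. w n \<in> K n" "\<And>n. \<Theta> (w n) < d n + 1 / real (Suc n)" by metis
  have "incseq d" using d_mono by (simp add: incseq_def)
  moreover have "d n \<le> B" for n using d_le[OF fK] B order_trans by blast
  ultimately obtain D where D: "d \<longlonglongrightarrow> D" "\<And>n. d n \<le> D"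
    using incseq_convergent[of d B] by auto
  have wX: "w n \<in> X" for n using w KX by auto
  have est: "\<Theta> (\<lambda>x. w m x - w n x) \<le> 2 powr q * (D - d M + 1 / real (Suc M))"
    if "M \<le> m" "M \<le> n" for m n M
  proof -
    have "w m \<in> K M" "w n \<in> K M" using w Kmono that by blast+
    then have "(\<lambda>x. (w m x + w n x) / 2) \<in> K M" unfolding K_def by (rule mid_hull.mid)
    then have "d M \<le> \<Theta> (\<lambda>x. (w m x + w n x) / 2)" by (rule d_le)
    moreover have wD: "\<Theta> (w m) \<le> D + 1 / real (Suc M)" if "M \<le> m" for m
    proof -
      have "1 / real (Suc m) \<le> 1 / real (Suc M)" using that by (simp add: frac_le)
      then show ?thesis using w(2)[of m] D(2)[of m] by linarith
    qed
    ultimately have "\<Theta> (\<lambda>x. (w m x - w n x) / 2) \<le> (D - d M) + 1 / real (Suc M)"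
      using clarkson[OF wX wX, of m n] wD[OF that(1)] wD[OF that(2)] by argo
    moreover have two: "(\<lambda>x. 2 * ((w m x - w n x) / 2)) = (\<lambda>x. w m x - w n x)" by auto
    have "\<Theta> (\<lambda>x. w m x - w n x) = 2 powr q * \<Theta> (\<lambda>x. (w m x - w n x) / 2)"
      using homogeneous[of "\<lambda>x. (w m x - w n x) / 2" 2]
        scale_closed[OF diff_closed[OF wX wX], of "1/2" m n]
      by (simp only: two abs_numeral) simp
    ultimately show ?thesis by (simp add: mult_left_mono)
  qed
  have "(\<lambda>M. 2 powr q * (D - d M + 1 / real (Suc M))) \<longlonglongrightarrow> 2 powr q * (D - D + 0)"
    using lim_inverse_n'[THEN LIMSEQ_Suc] by (intro tendsto_intros D(1)) simp
  then have lim0: "(\<lambda>M. 2 powr q * (D - d M + 1 / real (Suc M))) \<longlonglongrightarrow> 0" by simp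
  have cauchy: "\<exists>M. \<forall>m\<ge>M. \<forall>n\<ge>M. \<Theta> (\<lambda>x. w m x - w n x) < e" if e: "e > 0" for e
  proof -
    obtain M where "2 powr q * (D - d M + 1 / real (Suc M)) < e"
      using order_tendstoD(2)[OF lim0 e] unfolding eventually_sequentially by auto
    then show ?thesis by (intro exI[of _ M] allI impI) (rule le_less_trans[OF est])
  qed
  from complete[of w, OF wX cauchy]
  obtain v where v: "v \<in> X" "(\<lambda>n. \<Theta> (\<lambda>x. w n x - v x)) \<longlonglongrightarrow> 0"
    by auto
  have "l v = c" if l: "functional l" and c: "(\<lambda>n. l (f n)) \<longlonglongrightarrow> c" for l c
  proof -
    have "(\<lambda>n. l (w n)) \<longlonglongrightarrow> l v"
      by (rule functional_tendsto[OF l _ v]) (simp add: wX)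
    moreover have "(\<lambda>n. l (w n)) \<longlonglongrightarrow> c"
    proof (rule LIMSEQ_I)
      fix e :: real assume "e > 0"
      then obtain N where N: "\<And>n. n \<ge> N \<Longrightarrow> \<bar>l (f n) - c\<bar> < e / 2"
        using LIMSEQ_D[OF c, of "e/2"] by auto
      have "\<bar>l (w n) - c\<bar> \<le> e / 2" if "n \<ge> N" for n
        by (rule mid_hull_functional_bounds[OF l, of "f ` {n..}"])
          (use f N that w(1)[of n] in \<open>auto simp: K_def intro: less_imp_le\<close>)
      then show "\<exists>N. \<forall>n\<ge>N. norm (l (w n) - c) < e"
        using \<open>e > 0\<close> by (intro exI[of _ N]) force
    qed
    ultimately show ?thesis using LIMSEQ_unique by blast
  qed
  with v(1) show ?thesis by blast
qed

lemma bounded_functional_image: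
  assumes "functional l" "\<And>n. f n \<in> X" "\<And>n. \<Theta> (f n) \<le> B"
  shows "bounded (range (\<lambda>n. l (f n)))"
proof -
  obtain C where C: "C \<ge> 0" "\<And>f. f \<in> X \<Longrightarrow> \<bar>l f\<bar> \<le> C * \<Theta> f powr (1 / q)"
    using functional_bound[OF assms(1)] by blast
  have "\<bar>l (f n)\<bar> \<le> C * B powr (1 / q)" for n
    using C(2)[OF assms(2)[of n]] q_pos nonneg C(1)
    by (rule_tac order_trans) (auto intro!: mult_left_mono powr_mono2 assms)
  then show ?thesis unfolding bounded_iff by auto
qed

text \<open>
  The countable family \<open>T\<close> pins down the candidate \<open>v\<close>. If \<open>l (f n)\<close> failed to converge to
  \<open>l v\<close>, some subsequence would have \<open>l\<close> converging to a different value. The point belonging to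
  that subsequence agrees with \<open>v\<close> on all of \<open>T\<close>, hence has distance zero from \<open>v\<close>, and
  therefore the same value of \<open>l\<close>.
\<close>

theorem weak_compactness:
  assumes f: "\<And>n. f n \<in> X" and B: "\<And>n. \<Theta> (f n) \<le> B"
    and sep: "\<And>k. functional (T k)" "\<And>v. v \<in> X \<Longrightarrow> (\<And>k. T k v = 0) \<Longrightarrow> \<Theta> v = 0"
    and conv: "\<And>k. convergent (\<lambda>n. T k (f n))"
  shows "\<exists>v\<in>X. \<forall>l. functional l \<longrightarrow> (\<lambda>n. l (f n)) \<longlonglongrightarrow> l v"
proof -
  obtain v where v: "v \<in> X" "\<And>l c. functional l \<Longrightarrow> (\<lambda>n. l (f n)) \<longlonglongrightarrow> c \<Longrightarrow> l v = c"
    using bounded_sequence_hull_point[of f B, OF f B] by blast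
  have vk: "(\<lambda>n. T k (f n)) \<longlonglongrightarrow> T k v" for k
  proof -
    obtain c where "(\<lambda>n. T k (f n)) \<longlonglongrightarrow> c" using conv by (auto simp: convergent_def)
    with v(2)[OF sep(1)] show ?thesis by blast
  qed
  have "(\<lambda>n. l (f n)) \<longlonglongrightarrow> l v" if l: "functional l" for l
  proof (rule ccontr)
    assume "\<not> ?thesis"
    then obtain e where e: "e > 0" "\<And>N. \<exists>n\<ge>N. \<not> dist (l (f n)) (l v) < e"
      unfolding lim_sequentially by blast
    have inf: "infinite {n. \<not> dist (l (f n)) (l v) < e}"
      unfolding infinite_nat_iff_unbounded_le using e(2) by blast
    define s where "s = enumerate {n. \<not> dist (l (f n)) (l v) < e}"
    have s: "strict_mono s" "\<And>n. e \<le> dist (l (f (s n))) (l v)"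
      using strict_mono_enumerate[OF inf] enumerate_in_set[OF inf] by (auto simp: s_def not_less)
    obtain c r where r: "strict_mono r" "((\<lambda>n. l (f (s n))) \<circ> r) \<longlonglongrightarrow> c"
      using bounded_imp_convergent_subsequence[OF bounded_functional_image[OF l, of "\<lambda>n. f (s n)" B]] f B
      by auto
    obtain v' where v': "v' \<in> X"
      "\<And>l c. functional l \<Longrightarrow> (\<lambda>n. l (f (s (r n)))) \<longlonglongrightarrow> c \<Longrightarrow> l v' = c"
      using bounded_sequence_hull_point[of "\<lambda>n. f (s (r n))" B, OF f B] by blast
    have "strict_mono (s \<circ> r)" using s(1) r(1) by (rule strict_mono_o)
    then have "(\<lambda>n. T k (f (s (r n)))) \<longlonglongrightarrow> T k v" for k
      using LIMSEQ_subseq_LIMSEQ[OF vk] by (simp add: o_def)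
    then have "T k v' = T k v" for k using v'(2)[OF sep(1)] by blast
    then have "\<Theta> (\<lambda>x. v' x - v x) = 0"
      by (intro sep(2)) (auto simp: functional_diff[OF sep(1)] v v' diff_closed)
    then have "l v' = l v"
      using functional_zero[OF l diff_closed[OF v'(1) v(1)]] functional_diff[OF l v'(1) v(1)] by simp
    moreover have "l v' = c" using v'(2)[OF l] r(2) by (simp add: o_def)
    moreover have "e \<le> dist c (l v)"
      by (rule tendsto_lowerbound[OF tendsto_dist[OF r(2) tendsto_const]]) (auto simp: s)
    ultimately show False using e(1) by simp
  qed
  with v(1) show ?thesis by blast
qed

end

text \<open>
  Boundedness from some index on, depending on the row, is what blow-ups have: on a large ball
  they are defined only at small scales.
\<close>

lemma diagonal_convergent_subsequence:
  fixes a :: "nat \<Rightarrow> nat \<Rightarrow> real"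
  assumes "\<And>k. \<exists>N. bounded (a k ` {N..})"
  obtains s where "strict_mono s" "\<And>k. convergent (\<lambda>i. a k (s i))"
proof -
  interpret d: subseqs "\<lambda>k s. convergent (\<lambda>i. a k (s i))"
  proof
    fix k and s :: "nat \<Rightarrow> nat" assume s: "strict_mono s"
    obtain N where N: "bounded (a k ` {N..})" using assms by blast
    have "bounded (range (\<lambda>i. a k (s i)))"
    proof (rule bounded_subset)
      show "bounded (a k ` {N..} \<union> (\<lambda>i. a k (s i)) ` {..<N})" using N by (simp add: finite_imp_bounded)
      show "range (\<lambda>i. a k (s i)) \<subseteq> a k ` {N..} \<union> (\<lambda>i. a k (s i)) ` {..<N}"
        using seq_suble[OF s] by (force intro: order_trans simp: not_less)
    qed
    then obtain l r where "strict_mono r" "((\<lambda>i. a k (s i)) \<circ> r) \<longlonglongrightarrow> l"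
      using bounded_imp_convergent_subsequence by blast
    then show "\<exists>r'. strict_mono r' \<and> convergent (\<lambda>i. a k ((s \<circ> r') i))"
      by (auto simp: o_def convergent_def)
  qed
  have "convergent (\<lambda>i. a k (d.diagseq i))" for k
  proof -
    have "convergent (\<lambda>i. a k ((d.diagseq \<circ> (+) (Suc k)) i))"
    proof (rule d.diagseq_holds)
      fix r s :: "nat \<Rightarrow> nat" and n
      assume "strict_mono r" "convergent (\<lambda>i. a n (s i))"
      then show "convergent (\<lambda>i. a n ((s \<circ> r) i))"
        using convergent_subseq_convergent[of "\<lambda>i. a n (s i)" r] by (simp add: o_def)
    qed
    then have "convergent (\<lambda>i. a k (d.diagseq (i + Suc k)))" by (simp add: add.commute)
    then show ?thesis using convergent_ignore_initial_segment[of "\<lambda>i. a k (d.diagseq i)"] by blast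
  qed
  with d.subseq_diagseq that show ?thesis by blast
qed

section \<open>Boxes with rational corners\<close>

definition rational_boxes :: "'a::euclidean_space set set" where
  "rational_boxes = {box a b | a b. (\<forall>i\<in>Basis. a \<bullet> i \<in> \<rat>) \<and> (\<forall>i\<in>Basis. b \<bullet> i \<in> \<rat>)}"

lemma countable_rational_boxes: "countable (rational_boxes :: 'a::euclidean_space set set)"
proof -
  define D where "D = {a :: 'a. \<forall>i\<in>Basis. a \<bullet> i \<in> \<rat>}"
  have "D \<subseteq> (\<lambda>f. \<Sum>i\<in>Basis. f i *\<^sub>R i) ` (Basis \<rightarrow>\<^sub>E \<rat>)"
  proof
    fix a assume "a \<in> D"
    then show "a \<in> (\<lambda>f. \<Sum>i\<in>Basis. f i *\<^sub>R i) ` (Basis \<rightarrow>\<^sub>E \<rat>)"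
      by (intro image_eqI[of _ _ "\<lambda>i\<in>Basis. a \<bullet> i"]) (auto simp: euclidean_representation D_def)
  qed
  then have "countable D"
    by (rule countable_subset) (intro countable_image countable_PiE finite_Basis countable_rat)
  then have "countable ((\<lambda>(a, b). box a b) ` (D \<times> D))" by simp
  moreover have "rational_boxes = (\<lambda>(a, b). box a b) ` (D \<times> D)"
    by (auto simp: rational_boxes_def D_def)
  ultimately show ?thesis by simp
qed

lemma open_Union_rational_boxes:
  fixes S :: "'a::euclidean_space set"
  assumes "open S"
  shows "\<Union>{B \<in> rational_boxes. B \<subseteq> S} = S"
proof
  show "S \<subseteq> \<Union>{B \<in> rational_boxes. B \<subseteq> S}"
  proof
    fix x assume "x \<in> S"
    then obtain e where e: "e > 0" "ball x e \<subseteq> S" using assms openE by blast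
    obtain a b where "x \<in> box a b" "\<forall>i \<in> Basis. a \<bullet> i \<in> \<rat>" "\<forall>i\<in>Basis. b \<bullet> i \<in> \<rat>"
      "box a b \<subseteq> ball x e"
      using rational_boxes[OF e(1)] by metis
    then show "x \<in> \<Union>{B \<in> rational_boxes. B \<subseteq> S}"
      using e unfolding rational_boxes_def by blast
  qed
qed auto

lemma Int_stable_rational_boxes: "Int_stable (rational_boxes :: 'a::euclidean_space set set)"
proof (rule Int_stableI)
  fix A B :: "'a set" assume "A \<in> rational_boxes" "B \<in> rational_boxes"
  then obtain a b c d where ab: "A = box a b" "B = box c d"
    "\<forall>i\<in>Basis. a \<bullet> i \<in> \<rat>" "\<forall>i\<in>Basis. b \<bullet> i \<in> \<rat>" "\<forall>i\<in>Basis. c \<bullet> i \<in> \<rat>" "\<forall>i\<in>Basis. d \<bullet> i \<in> \<rat>"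
    by (auto simp: rational_boxes_def)
  have "A \<inter> B = box (\<Sum>i\<in>Basis. max (a\<bullet>i) (c\<bullet>i) *\<^sub>R i) (\<Sum>i\<in>Basis. min (b\<bullet>i) (d\<bullet>i) *\<^sub>R i)"
    unfolding ab box_Int_box ..
  then show "A \<inter> B \<in> rational_boxes"
    unfolding rational_boxes_def using ab
    by (auto simp: max_def min_def intro!: exI)
qed

lemma sigma_sets_rational_boxes:
  "sigma_sets UNIV rational_boxes = sets (borel :: 'a::euclidean_space measure)"
proof
  show "sigma_sets UNIV rational_boxes \<subseteq> sets (borel :: 'a measure)"
    by (rule sets.sigma_sets_subset'[of _ borel, simplified]) (auto simp: rational_boxes_def)
  interpret sigma_algebra UNIV "sigma_sets UNIV (rational_boxes :: 'a set set)"
    by (rule sigma_algebra_sigma_sets) simp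
  have "S \<in> sigma_sets UNIV rational_boxes" if "open S" for S :: "'a set"
  proof -
    have "\<Union>{B \<in> rational_boxes. B \<subseteq> S} \<in> sigma_sets UNIV rational_boxes"
      by (intro countable_Union countable_subset[OF _ countable_rational_boxes]) auto
    then show ?thesis using open_Union_rational_boxes[OF that] by simp
  qed
  then show "sets (borel :: 'a measure) \<subseteq> sigma_sets UNIV rational_boxes"
    unfolding borel_def by (subst sets_measure_of) (auto intro!: sigma_sets_mono)
qed

text \<open>
  The positive and the negative part of \<open>h\<close> are densities of finite measures which agree on the
  boxes, an intersection-stable generator, and are therefore equal. Uniqueness of densities
  leaves \<open>ennreal (h x) = ennreal (- h x)\<close>, and \<open>ennreal\<close> maps negative numbers to zero.
\<close>

lemma AE_zero_if_box_integrals_zero_borel: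
  fixes h :: "'a::euclidean_space \<Rightarrow> real"
  assumes h: "integrable lborel h"
    and 0: "\<And>B. B \<in> rational_boxes \<Longrightarrow> (\<integral>x. indicator B x * h x \<partial>lborel) = 0"
  shows "AE x in lborel. h x = 0"
proof -
  have [measurable]: "h \<in> borel_measurable borel" using h by auto
  define P where "P = density lborel (\<lambda>x. ennreal (h x))"
  define N where "N = density lborel (\<lambda>x. ennreal (- h x))"
  have eq: "emeasure P B = emeasure N B" if "B \<in> rational_boxes" for B
  proof -
    have [measurable]: "B \<in> sets borel" using that by (auto simp: rational_boxes_def)
    have i1: "integrable lborel (\<lambda>x. indicator B x * max 0 (h x))"
      by (rule Bochner_Integration.integrable_bound[OF h]) (auto simp: indicator_def)
    have i2: "integrable lborel (\<lambda>x. indicator B x * max 0 (- h x))"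
      by (rule Bochner_Integration.integrable_bound[OF h]) (auto simp: indicator_def)
    have "emeasure P B = (\<integral>\<^sup>+x. ennreal (indicator B x * max 0 (h x)) \<partial>lborel)"
      unfolding P_def by (subst emeasure_density) (auto intro!: nn_integral_cong simp: indicator_def max_def ennreal_neg)
    also have "\<dots> = ennreal (\<integral>x. indicator B x * max 0 (h x) \<partial>lborel)"
      by (rule nn_integral_eq_integral[OF i1]) (auto simp: indicator_def)
    also have "(\<integral>x. indicator B x * max 0 (h x) \<partial>lborel) = (\<integral>x. indicator B x * max 0 (- h x) \<partial>lborel)"
    proof -
      have "(\<integral>x. indicator B x * max 0 (h x) \<partial>lborel) - (\<integral>x. indicator B x * max 0 (- h x) \<partial>lborel)
         = (\<integral>x. indicator B x * h x \<partial>lborel)"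
        unfolding Bochner_Integration.integral_diff[OF i1 i2, symmetric]
        by (intro Bochner_Integration.integral_cong) (auto simp: max_def indicator_def)
      then show ?thesis using 0[OF that] by simp
    qed
    also have "ennreal \<dots> = (\<integral>\<^sup>+x. ennreal (indicator B x * max 0 (- h x)) \<partial>lborel)"
      by (rule nn_integral_eq_integral[OF i2, symmetric]) (auto simp: indicator_def)
    also have "\<dots> = emeasure N B"
      unfolding N_def by (subst emeasure_density) (auto intro!: nn_integral_cong simp: indicator_def max_def ennreal_neg)
    finally show ?thesis .
  qed
  have fin: "emeasure P B \<noteq> \<infinity>" for B :: "'a set"
  proof -
    have "emeasure P B \<le> emeasure P (space P)" by (rule emeasure_space)
    also have "\<dots> \<le> (\<integral>\<^sup>+x. norm (h x) \<partial>lborel)"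
      unfolding P_def by (subst emeasure_density) (auto intro!: nn_integral_mono ennreal_leI)
    also have "\<dots> < \<infinity>" using h integrable_iff_bounded by blast
    finally show ?thesis by simp
  qed
  have "P = N"
  proof (rule measure_eqI_generator_eq_countable[of rational_boxes UNIV _ _ rational_boxes])
    show "\<Union>rational_boxes = (UNIV :: 'a set)"
      using open_Union_rational_boxes[of "UNIV :: 'a set"] by simp
    show "emeasure P a \<noteq> \<infinity>" for a by (rule fin)
  qed (auto simp: Int_stable_rational_boxes eq sigma_sets_rational_boxes countable_rational_boxes
      P_def[THEN arg_cong, of sets] N_def[THEN arg_cong, of sets])
  then have "AE x in lborel. ennreal (h x) = ennreal (- h x)"
    unfolding P_def N_def by (subst (asm) sigma_finite_measure.density_unique_iff[OF lborel.sigma_finite_measure_axioms]) auto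
  then show ?thesis
  proof eventually_elim
    case (elim x)
    then show ?case by (cases "h x" "0::real" rule: linorder_cases) (auto simp: ennreal_neg)
  qed
qed

lemma AE_zero_if_box_integrals_zero:
  fixes h :: "'a::euclidean_space \<Rightarrow> real"
  assumes h: "integrable lebesgue h"
    and 0: "\<And>B. B \<in> rational_boxes \<Longrightarrow> (\<integral>x. indicator B x * h x \<partial>lebesgue) = 0"
  shows "AE x in lebesgue. h x = 0"
proof -
  obtain g where g[measurable]: "g \<in> borel_measurable lborel" and hg: "AE x in lborel. h x = g x"
    using completion_ex_borel_measurable_real[of h lborel] h by auto
  have hg': "AE x in lebesgue. h x = g x" by (rule AE_completion[OF hg])
  have g': "g \<in> borel_measurable lebesgue" by (rule measurable_completion[OF g])
  have hm: "h \<in> borel_measurable lebesgue" using h by auto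
  have "integrable lebesgue g"
    using integrable_cong_AE[OF hm g' hg'] h by blast
  then have gi: "integrable lborel g" using integrable_completion[OF g] by blast
  have "AE x in lborel. g x = 0"
  proof (rule AE_zero_if_box_integrals_zero_borel[OF gi])
    fix B :: "'a set" assume B: "B \<in> rational_boxes"
    have [measurable]: "B \<in> sets borel" using B by (auto simp: rational_boxes_def)
    have [measurable]: "B \<in> sets lebesgue" by simp
    have "(\<integral>x. indicator B x * g x \<partial>lborel) = (\<integral>x. indicator B x * g x \<partial>lebesgue)"
      by (rule integral_completion[symmetric]) measurable
    also have "\<dots> = (\<integral>x. indicator B x * h x \<partial>lebesgue)"
      by (rule integral_cong_AE) (use hg' g' hm in \<open>auto intro!: borel_measurable_times\<close>)
    finally show "(\<integral>x. indicator B x * g x \<partial>lborel) = 0" using 0[OF B] by simp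
  qed
  then have "AE x in lebesgue. g x = 0" by (rule AE_completion)
  with hg' show ?thesis by eventually_elim simp
qed

section \<open>Lebesgue spaces\<close>

lemma norm_add_powr_le:
  fixes a b :: "'b::real_normed_vector"
  assumes "q > 0"
  shows "norm (a + b) powr q \<le> 2 powr q * (norm a powr q + norm b powr q)"
proof -
  have "norm (a + b) \<le> 2 * max (norm a) (norm b)"
    by (rule order_trans[OF norm_triangle_ineq]) auto
  then have "norm (a + b) powr q \<le> (2 * max (norm a) (norm b)) powr q"
    using assms by (intro powr_mono2) auto
  also have "\<dots> = 2 powr q * max (norm a) (norm b) powr q"
    by (simp add: powr_mult)
  also have "max (norm a) (norm b) powr q \<le> norm a powr q + norm b powr q"
    by (auto simp: max_def)
  finally show ?thesis by simp
qed

lemma integrable_norm_powr_add: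
  fixes f g :: "'a \<Rightarrow> 'b::euclidean_space"
  assumes "q > 0" and [measurable]: "f \<in> borel_measurable M" "g \<in> borel_measurable M"
    and "integrable M (\<lambda>x. norm (f x) powr q)" "integrable M (\<lambda>x. norm (g x) powr q)"
  shows "integrable M (\<lambda>x. norm (f x + g x) powr q)"
proof (rule Bochner_Integration.integrable_bound)
  show "integrable M (\<lambda>x. 2 powr q * (norm (f x) powr q + norm (g x) powr q))"
    using assms by auto
qed (auto intro!: AE_I2 norm_add_powr_le[OF assms(1), THEN order_trans])

lemma norm_scaleR_powr: "norm (c *\<^sub>R x) powr q = \<bar>c\<bar> powr q * norm x powr q"
  by (simp add: powr_mult)

lemma L_space_add:
  assumes "q > 0" "f \<in> L_space q U" "g \<in> L_space q U"
  shows "(\<lambda>x. f x + g x) \<in> L_space q U"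
  using assms integrable_norm_powr_add[OF assms(1)] unfolding L_space_def by auto

lemma L_space_scaleR: "f \<in> L_space q U \<Longrightarrow> (\<lambda>x. c *\<^sub>R f x) \<in> L_space q U"
  unfolding L_space_def by (auto simp: norm_scaleR_powr simp del: norm_scaleR)

lemma L_space_diff:
  assumes "q > 0" "f \<in> L_space q U" "g \<in> L_space q U"
  shows "(\<lambda>x. f x - g x) \<in> L_space q U"
  using L_space_add[OF assms(1,2) L_space_scaleR[OF assms(3), of "-1"]] by simp

lemma powr_add_superadditive:
  fixes x y s :: real
  assumes "x \<ge> 0" "y \<ge> 0" "s \<ge> 1"
  shows "x powr s + y powr s \<le> (x + y) powr s"
proof (cases "x + y = 0")
  case False
  then have p: "x + y > 0" using assms by linarith
  have *: "z powr s \<le> (z / (x + y)) * (x + y) powr s" if "0 \<le> z" "z \<le> x + y" for z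
  proof -
    have "z powr s = (z / (x + y)) powr s * (x + y) powr s"
      using that p by (simp flip: powr_mult)
    also have "(z / (x + y)) powr s \<le> (z / (x + y)) powr 1"
      using that p assms by (intro powr_mono') auto
    also have "\<dots> = z / (x + y)" using that p by simp
    finally show ?thesis by (simp add: mult_right_mono)
  qed
  have "x powr s + y powr s \<le> (x / (x + y)) * (x + y) powr s + (y / (x + y)) * (x + y) powr s"
    using *[of x] *[of y] assms by simp
  also have "\<dots> = (x / (x + y) + y / (x + y)) * (x + y) powr s" by (rule distrib_right[symmetric])
  also have "x / (x + y) + y / (x + y) = 1" using p by (simp flip: add_divide_distrib)
  finally show ?thesis by simp
qed (use assms in \<open>simp add: add_nonneg_eq_0_iff\<close>)

lemma powr_mean_le:
  fixes x y s :: real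
  assumes "x \<ge> 0" "y \<ge> 0" "s \<ge> 1"
  shows "((x + y) / 2) powr s \<le> (x powr s + y powr s) / 2"
proof -
  have half: "(z / 2) powr s \<le> z powr s / 2" if "z \<ge> 0" for z
  proof -
    have "(1/2::real) powr s \<le> (1/2) powr 1" using assms by (intro powr_mono') auto
    then have "z powr s * (1/2) powr s \<le> z powr s * (1/2)" by (intro mult_left_mono) auto
    then show ?thesis using that by (simp flip: powr_mult)
  qed
  show ?thesis
  proof (cases "x = 0 \<or> y = 0")
    case True
    then show ?thesis using half assms by auto
  next
    case False
    then have "((1 - 1/2) *\<^sub>R x + (1/2) *\<^sub>R y) powr s \<le> (1 - 1/2) * x powr s + (1/2) * y powr s"
      using assms by (intro convex_onD[OF powr_convex]) auto
    then show ?thesis by (simp add: field_simps)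
  qed
qed

text \<open>
  The parallelogram law, followed by superadditivity and convexity of \<open>t \<mapsto> t\<^bsup>q/2\<^esup>\<close> on the
  nonnegative numbers.
\<close>

lemma clarkson_pointwise:
  fixes a b :: "'b::real_inner"
  assumes "q \<ge> 2"
  shows "norm ((a + b) /\<^sub>R 2) powr q + norm ((a - b) /\<^sub>R 2) powr q \<le> (norm a powr q + norm b powr q) / 2"
proof -
  have pq: "(x\<^sup>2) powr (q / 2) = x powr q" if "x \<ge> 0" for x :: real
    using that by (cases "x = 0") (simp_all add: powr_powr flip: powr_numeral)
  have par: "(norm ((a + b) /\<^sub>R 2))\<^sup>2 + (norm ((a - b) /\<^sub>R 2))\<^sup>2 = ((norm a)\<^sup>2 + (norm b)\<^sup>2) / 2"
    by (simp add: power2_norm_eq_inner inner_simps inner_commute field_simps)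
  have "norm ((a + b) /\<^sub>R 2) powr q + norm ((a - b) /\<^sub>R 2) powr q
    = ((norm ((a + b) /\<^sub>R 2))\<^sup>2) powr (q/2) + ((norm ((a - b) /\<^sub>R 2))\<^sup>2) powr (q/2)"
    by (simp only: pq norm_ge_zero)
  also have "\<dots> \<le> (((norm a)\<^sup>2 + (norm b)\<^sup>2) / 2) powr (q/2)"
    unfolding par[symmetric] using assms by (intro powr_add_superadditive) auto
  also have "\<dots> \<le> (((norm a)\<^sup>2) powr (q/2) + ((norm b)\<^sup>2) powr (q/2)) / 2"
    using assms by (intro powr_mean_le) auto
  finally show ?thesis by (simp only: pq norm_ge_zero)
qed

lemma clarkson_integral:
  fixes f g :: "real ^ 'n \<Rightarrow> 'b::euclidean_space"
  assumes q: "q \<ge> 2" and fg: "f \<in> L_space q U" "g \<in> L_space q U"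
  shows "(LINT x|lebesgue_on U. norm ((f x + g x) /\<^sub>R 2) powr q) + (LINT x|lebesgue_on U. norm ((f x - g x) /\<^sub>R 2) powr q)
     \<le> ((LINT x|lebesgue_on U. norm (f x) powr q) + (LINT x|lebesgue_on U. norm (g x) powr q)) / 2"
proof -
  have q0: "q > 0" using q by simp
  have i: "integrable (lebesgue_on U) (\<lambda>x. norm ((f x + g x) /\<^sub>R 2) powr q)"
    "integrable (lebesgue_on U) (\<lambda>x. norm ((f x - g x) /\<^sub>R 2) powr q)"
    "integrable (lebesgue_on U) (\<lambda>x. norm (f x) powr q)" "integrable (lebesgue_on U) (\<lambda>x. norm (g x) powr q)"
    using L_space_scaleR[OF L_space_add[OF q0 fg], of "inverse 2"] L_space_scaleR[OF L_space_diff[OF q0 fg], of "inverse 2"] fg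
    unfolding L_space_def by auto
  have "(LINT x|lebesgue_on U. norm ((f x + g x) /\<^sub>R 2) powr q + norm ((f x - g x) /\<^sub>R 2) powr q)
     \<le> (LINT x|lebesgue_on U. (norm (f x) powr q + norm (g x) powr q) / 2)"
    by (intro integral_mono clarkson_pointwise[OF q] integrable_divide Bochner_Integration.integrable_add i)
  then show ?thesis using i by simp
qed

lemma ex_fast_subseq:
  fixes \<Theta> :: "nat \<Rightarrow> nat \<Rightarrow> real" and d :: "nat \<Rightarrow> real"
  assumes "\<And>e. e > 0 \<Longrightarrow> \<exists>M. \<forall>m\<ge>M. \<forall>n\<ge>M. \<Theta> m n < e" "\<And>k. d k > 0"
  obtains s where "strict_mono s" "\<And>k m n. m \<ge> s k \<Longrightarrow> n \<ge> s k \<Longrightarrow> \<Theta> m n < d k"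
proof -
  have "\<forall>k. \<exists>M. \<forall>m\<ge>M. \<forall>n\<ge>M. \<Theta> m n < d k" using assms by blast
  then obtain M where M: "\<And>k m n. m \<ge> M k \<Longrightarrow> n \<ge> M k \<Longrightarrow> \<Theta> m n < d k" by metis
  define s where "s k = (\<Sum>i\<le>k. M i) + k" for k
  have "strict_mono s" unfolding strict_mono_Suc_iff s_def by simp
  moreover have "M k \<le> s k" for k
    unfolding s_def using member_le_sum[of k "{..k}" M] by force
  ultimately show ?thesis using that M order_trans by meson
qed

text \<open>
  The Riesz--Fischer theorem. Along a subsequence the \<open>q\<close>-th powers of the differences have
  integrals below \<open>4\<^bsup>-qk\<^esup>\<close>, so that even the integrals weighted by \<open>2\<^bsup>qk\<^esup>\<close> are summable. Almost
  everywhere the weighted powers thus tend to zero, which makes the increments geometrically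
  small and the subsequence convergent. Fatou's lemma turns the pointwise limit into a limit in
  the space.
\<close>

proposition L_space_complete:
  fixes f :: "nat \<Rightarrow> real ^ 'n \<Rightarrow> 'b::euclidean_space"
  assumes q: "q \<ge> 1" and f: "\<And>n. f n \<in> L_space q U"
    and cauchy: "\<And>e. e > 0 \<Longrightarrow>
      \<exists>M. \<forall>m\<ge>M. \<forall>n\<ge>M. (LINT x|lebesgue_on U. norm (f m x - f n x) powr q) < e"
  shows "\<exists>v\<in>L_space q U. (\<lambda>n. LINT x|lebesgue_on U. norm (f n x - v x) powr q) \<longlonglongrightarrow> 0"
proof -
  let ?M = "lebesgue_on U"
  define \<Theta> where "\<Theta> m n = (LINT x|?M. norm (f m x - f n x) powr q)" for m n
  have q0: "q > 0" using q by simp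
  have fm[measurable]: "f n \<in> borel_measurable ?M" for n using f by (auto simp: L_space_def)
  have fi: "integrable ?M (\<lambda>x. norm (f m x - f n x) powr q)" for m n
    using L_space_diff[OF q0 f f] by (auto simp: L_space_def)
  (* small enough to beat the weight 2^(q k) in h with a summable factor to spare *)
  define d :: "nat \<Rightarrow> real" where "d k = (1/4) powr (q * real k)" for k
  obtain s where s: "strict_mono s" "\<And>k m n. m \<ge> s k \<Longrightarrow> n \<ge> s k \<Longrightarrow> \<Theta> m n < d k"
    using ex_fast_subseq[of \<Theta> d] cauchy unfolding \<Theta>_def d_def by auto
  define h where "h k x = 2 powr (q * real k) * norm (f (s (Suc k)) x - f (s k) x) powr q" for k x
  have hi: "integrable ?M (h k)" for k unfolding h_def using fi by auto
  have "AE x in ?M. summable (\<lambda>k. norm (h k x))"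
  proof (rule AE_mp[OF _ AE_I2])
    have "(\<integral>\<^sup>+x. (\<Sum>k. ennreal (h k x)) \<partial>?M) = (\<Sum>k. \<integral>\<^sup>+x. h k x \<partial>?M)"
      by (rule nn_integral_suminf) (simp add: h_def)
    also have "\<dots> = (\<Sum>k. ennreal (LINT x|?M. h k x))"
      by (intro suminf_cong nn_integral_eq_integral hi) (simp add: h_def)
    also have "\<dots> \<le> (\<Sum>k. ennreal ((1/2) ^ k))"
    proof (intro suminf_le summableI ennreal_leI)
      fix k
      have "(LINT x|?M. h k x) = 2 powr (q * real k) * \<Theta> (s (Suc k)) (s k)"
        by (simp add: h_def \<Theta>_def)
      also have "\<dots> \<le> 2 powr (q * real k) * d k"
        using s(2)[of k "s (Suc k)" "s k"] strict_mono_leD[OF s(1), of k "Suc k"] by (intro mult_left_mono) auto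
      also have "\<dots> = (1/2) powr (q * real k)" by (simp add: d_def flip: powr_mult)
      also have "\<dots> \<le> (1/2) powr (real k)"
        using q by (intro powr_mono') (auto simp: mult_le_cancel_right1)
      finally show "(LINT x|?M. h k x) \<le> (1/2) ^ k" by (simp add: powr_realpow)
    qed
    also have "\<dots> = ennreal (\<Sum>k. (1/2) ^ k)"
      by (rule suminf_ennreal2) (auto simp: summable_geometric)
    finally have "(\<integral>\<^sup>+x. (\<Sum>k. ennreal (h k x)) \<partial>?M) < \<infinity>" by (simp add: le_less_trans)
    then show "AE x in ?M. (\<Sum>k. ennreal (h k x)) \<noteq> \<infinity>"
      by (intro nn_integral_PInf_AE) (auto simp: h_def)
    show "(\<Sum>k. ennreal (h k x)) \<noteq> \<infinity> \<longrightarrow> summable (\<lambda>k. norm (h k x))" for x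
      by (auto simp: h_def intro!: summable_suminf_not_top)
  qed
  then have conv: "AE x in ?M. convergent (\<lambda>k. f (s k) x)"
  proof eventually_elim
    case (elim x)
    have "(\<lambda>k. norm (h k x)) \<longlonglongrightarrow> 0" using elim summable_LIMSEQ_zero by blast
    then have "\<forall>\<^sub>F k in sequentially. norm (h k x) < 1" by (rule order_tendstoD) simp
    then have "\<forall>\<^sub>F k in sequentially. norm (f (s (Suc k)) x - f (s k) x) \<le> (1/2) ^ k"
    proof eventually_elim
      case (elim k)
      have "(2 ^ k * norm (f (s (Suc k)) x - f (s k) x)) powr q = h k x"
        by (simp add: h_def powr_mult powr_powr mult.commute flip: powr_realpow)
      then have "(2 ^ k * norm (f (s (Suc k)) x - f (s k) x)) powr q < 1 powr q" using elim by simp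
      then have "2 ^ k * norm (f (s (Suc k)) x - f (s k) x) < 1"
        using q0 by (meson not_less powr_mono2 less_imp_le zero_le_one)
      then show ?case by (simp add: power_divide field_simps)
    qed
    then have "summable (\<lambda>k. f (s (Suc k)) x - f (s k) x)"
      by (intro summable_comparison_test_ev[OF _ summable_geometric]) auto
    then have "convergent (\<lambda>n. \<Sum>k<n. f (s (Suc k)) x - f (s k) x)"
      by (simp add: summable_iff_convergent)
    then have "convergent (\<lambda>n. f (s n) x - f (s 0) x)"
      using sum_lessThan_telescope[of "\<lambda>n. f (s n) x"] by simp
    then have "convergent (\<lambda>n. (f (s n) x - f (s 0) x) + f (s 0) x)"
      by (intro convergent_add convergent_const)
    then show ?case by simp
  qed
  define v where "v x = lim (\<lambda>k. f (s k) x)" for x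
  have vm[measurable]: "v \<in> borel_measurable ?M" unfolding v_def[abs_def] by measurable
  have fatou: "(\<integral>\<^sup>+x. norm (f m x - v x) powr q \<partial>?M) \<le> ennreal (d k)" if "m \<ge> s k" for m k
  proof -
    have "AE x in ?M. ennreal (norm (f m x - v x) powr q) \<le> liminf (\<lambda>j. ennreal (norm (f m x - f (s j) x) powr q))"
      using conv
    proof eventually_elim
      case (elim x)
      then have "(\<lambda>j. f (s j) x) \<longlonglongrightarrow> v x" by (simp add: v_def convergent_LIMSEQ_iff)
      then have "(\<lambda>j. ennreal (norm (f m x - f (s j) x) powr q)) \<longlonglongrightarrow> ennreal (norm (f m x - v x) powr q)"
        using q0 by (intro tendsto_ennrealI tendsto_powr' tendsto_intros) auto
      from lim_imp_Liminf[OF sequentially_bot this] show ?case by (simp only: order_refl)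
    qed
    then have "(\<integral>\<^sup>+x. norm (f m x - v x) powr q \<partial>?M) \<le> (\<integral>\<^sup>+x. liminf (\<lambda>j. ennreal (norm (f m x - f (s j) x) powr q)) \<partial>?M)"
      by (rule nn_integral_mono_AE)
    also have "\<dots> \<le> liminf (\<lambda>j. \<integral>\<^sup>+x. ennreal (norm (f m x - f (s j) x) powr q) \<partial>?M)"
      by (rule nn_integral_liminf) measurable
    also have "\<dots> \<le> ennreal (d k)"
    proof (rule Liminf_le)
      have "\<forall>\<^sub>F j in sequentially. j \<ge> k" by (rule eventually_ge_at_top)
      then show "\<forall>\<^sub>F j in sequentially. (\<integral>\<^sup>+x. ennreal (norm (f m x - f (s j) x) powr q) \<partial>?M) \<le> ennreal (d k)"
      proof eventually_elim
        case (elim j)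
        have "(\<integral>\<^sup>+x. ennreal (norm (f m x - f (s j) x) powr q) \<partial>?M) = ennreal (\<Theta> m (s j))"
          unfolding \<Theta>_def by (rule nn_integral_eq_integral[OF fi]) simp
        then show ?case
          using s(2)[OF that, of "s j"] strict_mono_leD[OF s(1) elim] by (simp add: ennreal_leI)
      qed
    qed simp
    finally show ?thesis .
  qed
  have int: "integrable ?M (\<lambda>x. norm (f m x - v x) powr q)" "(LINT x|?M. norm (f m x - v x) powr q) \<le> d k"
    if "m \<ge> s k" for m k
  proof -
    show *: "integrable ?M (\<lambda>x. norm (f m x - v x) powr q)"
      using fatou[OF that] by (intro integrableI_bounded) (auto simp: le_less_trans)
    show "(LINT x|?M. norm (f m x - v x) powr q) \<le> d k"
      using fatou[OF that] nn_integral_eq_integral[OF *] by (simp add: d_def)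
  qed
  have "(\<lambda>x. f (s 0) x - v x) \<in> L_space q U"
    using int(1)[of 0 "s 0"] unfolding L_space_def by auto
  from L_space_diff[OF q0 f[of "s 0"] this] have "v \<in> L_space q U" by simp
  moreover have "(\<lambda>n. LINT x|?M. norm (f n x - v x) powr q) \<longlonglongrightarrow> 0"
  proof (rule LIMSEQ_I)
    fix e :: real assume "e > 0"
    have "(\<lambda>k. ((1/4) powr q) ^ k) \<longlonglongrightarrow> 0"
      using powr_less_mono2[OF q0, of "1/4" 1] by (intro LIMSEQ_realpow_zero) auto
    moreover have "d = (^) ((1/4) powr q)" by (auto simp: d_def powr_powr simp flip: powr_realpow)
    ultimately have "d \<longlonglongrightarrow> 0" by simp
    then have "\<forall>\<^sub>F k in sequentially. d k < e" using \<open>e > 0\<close> by (rule order_tendstoD)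
    then obtain k where "d k < e" by (auto simp: eventually_sequentially)
    then show "\<exists>N. \<forall>n\<ge>N. norm ((LINT x|?M. norm (f n x - v x) powr q) - 0) < e"
      using int(2)[of k] by (intro exI[of _ "s k"]) (auto intro: le_less_trans)
  qed
  ultimately show ?thesis by blast
qed

lemma L_space_uniformly_convex:
  assumes "q \<ge> 2"
  shows "uniformly_convex_space (L_space q U :: (real ^ 'n \<Rightarrow> real) set)
    (\<lambda>f. LINT x|lebesgue_on U. norm (f x) powr q) q"
proof
  show "(\<lambda>x. c * f x) \<in> L_space q U" if "f \<in> L_space q U" for f :: "real ^ 'n \<Rightarrow> real" and c
    using L_space_scaleR[OF that, of c] by simp
  show "(LINT x|lebesgue_on U. norm ((f x + g x) / 2) powr q) + (LINT x|lebesgue_on U. norm ((f x - g x) / 2) powr q)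
     \<le> ((LINT x|lebesgue_on U. norm (f x) powr q) + (LINT x|lebesgue_on U. norm (g x) powr q)) / 2"
    if "f \<in> L_space q U" "g \<in> L_space q U" for f g :: "real ^ 'n \<Rightarrow> real"
    using clarkson_integral[OF assms that]
    by (simp only: real_scaleR_def divide_inverse mult.commute[of "inverse 2"])
  show "\<exists>v\<in>L_space q U. (\<lambda>n. LINT x|lebesgue_on U. norm (f n x - v x) powr q) \<longlonglongrightarrow> 0"
    if "\<And>n. f n \<in> L_space q U"
      "\<And>e. e > 0 \<Longrightarrow> \<exists>M. \<forall>m\<ge>M. \<forall>n\<ge>M. (LINT x|lebesgue_on U. norm (f m x - f n x) powr q) < e"
    for f :: "nat \<Rightarrow> real ^ 'n \<Rightarrow> real"
    by (rule L_space_complete) (use that assms in auto)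
qed (use assms in \<open>auto simp: L_space_add powr_mult abs_mult\<close>)

text \<open>
  Young's inequality for \<open>f\<close> divided by its norm. This gives Hoelder's inequality with the
  constant \<open>1 + \<integral> \<bar>g\<bar>\<^bsup>q'\<^esup>\<close> in place of the norm of \<open>g\<close>, which is all that boundedness of the
  pairing requires.
\<close>

lemma L_space_pairing:
  fixes f g :: "real ^ 'n \<Rightarrow> real"
  assumes q: "q > 1" and f: "f \<in> L_space q U" and g: "g \<in> L_space (q / (q - 1)) U"
  shows "integrable (lebesgue_on U) (\<lambda>x. g x * f x)"
    "\<bar>LINT x|lebesgue_on U. g x * f x\<bar> \<le> (1 + (LINT x|lebesgue_on U. norm (g x) powr (q / (q - 1)))) * L_norm q U f"
proof -
  let ?M = "lebesgue_on U" and ?q' = "q / (q - 1)"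
  have [measurable]: "f \<in> borel_measurable ?M" "g \<in> borel_measurable ?M"
    using f g by (auto simp: L_space_def)
  have fi: "integrable ?M (\<lambda>x. norm (f x) powr q)" and gi: "integrable ?M (\<lambda>x. norm (g x) powr ?q')"
    using f g by (auto simp: L_space_def)
  have q': "?q' > 1" using q by (simp add: field_simps)
  have young: "\<bar>a * b\<bar> \<le> \<bar>a\<bar> powr ?q' + \<bar>b\<bar> powr q" for a b :: real
  proof -
    have "1 / ?q' + 1 / q = 1" using q by (simp add: field_simps)
    then have "\<bar>a\<bar> * \<bar>b\<bar> \<le> \<bar>a\<bar> powr ?q' / ?q' + \<bar>b\<bar> powr q / q"
      using q q' by (intro Youngs_inequality) auto
    also have "\<dots> \<le> \<bar>a\<bar> powr ?q' + \<bar>b\<bar> powr q"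
    proof -
      have "X / c \<le> X" if "X \<ge> 0" "c \<ge> 1" for X c :: real
        using that by (simp add: divide_le_eq mult_le_cancel_left1)
      then show ?thesis using q q' by (intro add_mono) (simp_all only: powr_ge_zero less_imp_le)
    qed
    finally show ?thesis by (simp add: abs_mult)
  qed
  have bound: "integrable ?M (\<lambda>x. g x * h x)"
    "\<bar>LINT x|?M. g x * h x\<bar> \<le> (LINT x|?M. norm (g x) powr ?q') + (LINT x|?M. norm (h x) powr q)"
    if [measurable]: "h \<in> borel_measurable ?M" and hi: "integrable ?M (\<lambda>x. norm (h x) powr q)" for h
  proof -
    show i: "integrable ?M (\<lambda>x. g x * h x)"
      by (rule Bochner_Integration.integrable_bound[OF Bochner_Integration.integrable_add[OF gi hi]])
        (use young in auto)
    have "\<bar>LINT x|?M. g x * h x\<bar> \<le> (LINT x|?M. \<bar>g x * h x\<bar>)" by (rule integral_abs_bound)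
    also have "\<dots> \<le> (LINT x|?M. norm (g x) powr ?q' + norm (h x) powr q)"
      using i gi hi young by (intro integral_mono) auto
    finally show "\<bar>LINT x|?M. g x * h x\<bar> \<le> (LINT x|?M. norm (g x) powr ?q') + (LINT x|?M. norm (h x) powr q)"
      using gi hi by simp
  qed
  show "integrable ?M (\<lambda>x. g x * f x)" using bound(1) fi by simp
  define N where "N = L_norm q U f"
  show "\<bar>LINT x|?M. g x * f x\<bar> \<le> (1 + (LINT x|?M. norm (g x) powr ?q')) * L_norm q U f"
  proof (cases "(LINT x|?M. norm (f x) powr q) = 0")
    case True
    then have "AE x in ?M. norm (f x) powr q = 0"
      using integral_nonneg_eq_0_iff_AE[OF fi] by simp
    then have "AE x in ?M. g x * f x = 0" by eventually_elim (use q in simp)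
    then have "(LINT x|?M. g x * f x) = 0" by (rule integral_eq_zero_AE)
    then show ?thesis by (simp add: L_norm_def True)
  next
    case False
    have "0 \<le> (LINT x|?M. norm (f x) powr q)" by (rule Bochner_Integration.integral_nonneg) simp
    with False have pos: "(LINT x|?M. norm (f x) powr q) > 0" by (metis less_le)
    then have N: "N > 0" "N powr q = (LINT x|?M. norm (f x) powr q)"
      using q by (auto simp: N_def L_norm_def powr_powr)
    define h where "h x = f x / N" for x
    have hn: "norm (h x) powr q = norm (f x) powr q / N powr q" for x
      using N by (simp add: h_def powr_divide)
    have hm[measurable]: "h \<in> borel_measurable ?M" unfolding h_def by measurable
    have "(LINT x|?M. norm (h x) powr q) = 1" unfolding hn using N pos by simp
    moreover have "integrable ?M (\<lambda>x. norm (h x) powr q)" unfolding hn using fi by simp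
    ultimately have "\<bar>LINT x|?M. g x * h x\<bar> \<le> (LINT x|?M. norm (g x) powr ?q') + 1"
      using bound(2)[OF hm] by simp
    moreover have "(LINT x|?M. g x * h x) = (LINT x|?M. g x * f x) / N"
      by (simp add: h_def)
    ultimately show ?thesis using N(1) by (simp add: N_def field_simps)
  qed
qed

lemma L_space_pairing_functional:
  fixes g :: "real ^ 'n \<Rightarrow> real"
  assumes q: "q > 1" and g: "g \<in> L_space (q / (q - 1)) U"
  shows "bounded_functional (L_space q U) (L_norm q U) (\<lambda>f. LINT x|lebesgue_on U. g x * f x)"
  unfolding bounded_functional_def
  using L_space_pairing[OF q _ g] by (auto simp: distrib_left mult.left_commute intro!: exI)

lemma indicator_L_space:
  fixes U :: "(real ^ 'n) set"
  assumes "U \<in> lmeasurable" "B \<in> sets lebesgue"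
  shows "indicat_real B \<in> L_space q U"
proof -
  interpret finite_measure "lebesgue_on U" by (rule finite_measure_lebesgue_on[OF assms(1)])
  have [measurable]: "indicat_real B \<in> borel_measurable (lebesgue_on U)"
    using assms(2) by (intro measurable_restrict_space1) auto
  have "integrable (lebesgue_on U) (\<lambda>x. norm (indicat_real B x) powr q)"
  proof (rule integrable_const_bound[of _ 1])
    show "(\<lambda>x. norm (indicat_real B x) powr q) \<in> borel_measurable (lebesgue_on U)" by measurable
  qed (auto simp: indicator_def)
  then show ?thesis
    unfolding L_space_def mem_Collect_eq
    using \<open>indicat_real B \<in> borel_measurable (lebesgue_on U)\<close> by (intro conjI)
qed

lemma borel_measurable_lebesgue_on_AE:
  fixes f g :: "real ^ 'n \<Rightarrow> 'b::euclidean_space"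
  assumes "f \<in> borel_measurable (lebesgue_on U)" "U \<in> sets lebesgue" "AE x in lebesgue_on U. f x = g x"
  shows "g \<in> borel_measurable (lebesgue_on U)"
proof -
  have "AE x in lebesgue. (if x \<in> U then f x else 0) = (if x \<in> U then g x else 0)"
    using assms(2,3) by (auto simp: AE_restrict_space_iff elim: eventually_mono)
  then have "(\<lambda>x. if x \<in> U then g x else 0) \<in> borel_measurable lebesgue"
    using borel_measurable_if_I[OF assms(1,2)] by (rule borel_measurable_AE[rotated])
  then show ?thesis by (rule borel_measurable_if_D)
qed

lemma L_space_cong_AE:
  fixes f g :: "real ^ 'n \<Rightarrow> 'b::euclidean_space"
  assumes f: "f \<in> L_space q U" and U: "U \<in> sets lebesgue" and ae: "AE x in lebesgue_on U. f x = g x"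
  shows "g \<in> L_space q U"
proof -
  have fm[measurable]: "f \<in> borel_measurable (lebesgue_on U)" using f by (simp add: L_space_def)
  have gm[measurable]: "g \<in> borel_measurable (lebesgue_on U)"
    by (rule borel_measurable_lebesgue_on_AE[OF fm U ae])
  have "integrable (lebesgue_on U) (\<lambda>x. norm (g x) powr q) \<longleftrightarrow> integrable (lebesgue_on U) (\<lambda>x. norm (f x) powr q)"
    using ae by (intro integrable_cong_AE) (measurable, auto)
  then show ?thesis using f by (simp add: L_space_def)
qed

section \<open>Test functions and the fundamental lemma\<close>

lemma test_function_props:
  assumes "\<phi> \<in> test_functions U"
  shows "smooth_on UNIV \<phi>" "continuous_on UNIV \<phi>"
    "\<exists>K. compact K \<and> K \<subseteq> U \<and> (\<forall>x. x \<notin> K \<longrightarrow> \<phi> x = 0)"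
  using assms closure_subset[of "{x. \<phi> x \<noteq> 0}"]
  by (auto simp: test_functions_def smooth_on_continuous intro!: exI[of _ "closure {x. \<phi> x \<noteq> 0}"])

lemma test_functionI:
  assumes "smooth_on UNIV \<phi>" "compact K" "K \<subseteq> U" "\<And>x. x \<notin> K \<Longrightarrow> \<phi> x = 0"
  shows "\<phi> \<in> test_functions U"
proof -
  have *: "closure {x. \<phi> x \<noteq> 0} \<subseteq> K"
    using assms(2,4) by (intro closure_minimal compact_imp_closed) auto
  then have "compact (closure {x. \<phi> x \<noteq> 0})"
    by (metis assms(2) closed_closure compact_Int_closed inf.absorb_iff2)
  with * assms show ?thesis by (auto simp: test_functions_def)
qed

lemma partial_deriv_test_function:
  assumes "\<phi> \<in> test_functions U"
  shows "partial_deriv i \<phi> \<in> test_functions U"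
proof -
  obtain K where K: "compact K" "K \<subseteq> U" "\<forall>x. x \<notin> K \<longrightarrow> \<phi> x = 0"
    using test_function_props(3)[OF assms] by blast
  show ?thesis
  proof (rule test_functionI[OF _ K(1,2)])
    show "smooth_on UNIV (partial_deriv i \<phi>)"
      using test_function_props(1)[OF assms] by (rule smooth_on_UNIV_partial)
    fix x assume "x \<notin> K"
    have "(\<phi> has_derivative (\<lambda>_. 0)) (at x)"
    proof (rule has_derivative_transform_within_open[of "\<lambda>_. 0"])
      show "open (- K)" using K(1) compact_imp_closed by auto
    qed (use K \<open>x \<notin> K\<close> in auto)
    then show "partial_deriv i \<phi> x = 0" by (simp add: partial_deriv_has_derivative)
  qed
qed

lemma test_function_bounded:
  assumes "\<phi> \<in> test_functions U"
  obtains C where "C > 0" "\<And>x. norm (\<phi> x) \<le> C"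
proof -
  obtain K where K: "compact K" "K \<subseteq> U" "\<forall>x. x \<notin> K \<longrightarrow> \<phi> x = 0"
    using test_function_props(3)[OF assms] by blast
  have "compact (\<phi> ` K)" using K(1) test_function_props(2)[OF assms]
    by (meson compact_continuous_image continuous_on_subset subset_UNIV)
  then obtain C where "C > 0" "\<And>y. y \<in> \<phi> ` K \<Longrightarrow> norm y \<le> C"
    using compact_imp_bounded bounded_pos by metis
  then have "norm (\<phi> x) \<le> C" for x using K(3) by (cases "x \<in> K") auto
  with \<open>C > 0\<close> that show ?thesis by blast
qed

lemma continuous_measurable_lebesgue_on:
  fixes f :: "real ^ 'n \<Rightarrow> 'b::topological_space"
  assumes "continuous_on UNIV f" shows "f \<in> borel_measurable (lebesgue_on U)"
  using borel_measurable_continuous_onI[OF assms]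
  by (intro measurable_restrict_space1 measurable_completion) simp

lemma test_function_measurable:
  "\<phi> \<in> test_functions U \<Longrightarrow> \<phi> \<in> borel_measurable (lebesgue_on V)"
  by (intro continuous_measurable_lebesgue_on test_function_props)

lemma L_loc_test_integrable:
  fixes f :: "real ^ 'n \<Rightarrow> real"
  assumes f: "f \<in> L_loc 1 U" and \<phi>: "\<phi> \<in> test_functions U" and U: "U \<in> sets lebesgue"
  shows "integrable (lebesgue_on U) (\<lambda>x. f x * \<phi> x)"
proof -
  obtain K where K: "compact K" "K \<subseteq> U" "\<forall>x. x \<notin> K \<longrightarrow> \<phi> x = 0"
    using test_function_props(3)[OF \<phi>] by blast
  have Kl: "K \<in> sets lebesgue" using borel_compact[OF K(1)] by simp
  obtain C where C: "C > 0" "\<And>x. norm (\<phi> x) \<le> C" using test_function_bounded[OF \<phi>] by blast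
  have fm[measurable]: "f \<in> borel_measurable (lebesgue_on K)"
    and fi: "integrable (lebesgue_on K) (\<lambda>x. norm (f x))"
    using f K by (auto simp: L_loc_def L_space_def)
  have [measurable]: "\<phi> \<in> borel_measurable (lebesgue_on K)"
    by (rule test_function_measurable[OF \<phi>])
  have "integrable (lebesgue_on K) (\<lambda>x. f x * \<phi> x)"
  proof (rule Bochner_Integration.integrable_bound)
    show "integrable (lebesgue_on K) (\<lambda>x. C * norm (f x))" using fi by simp
    show "AE x in lebesgue_on K. norm (f x * \<phi> x) \<le> norm (C * norm (f x))"
      using C by (auto simp: abs_mult mult.commute[of C] intro!: mult_left_mono)
  qed measurable
  then have "integrable lebesgue (\<lambda>x. if x \<in> K then f x * \<phi> x else 0)"
    by (simp add: Lebesgue_Measure.integrable_restrict_UNIV[OF Kl])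
  also have "(\<lambda>x. if x \<in> K then f x * \<phi> x else 0) = (\<lambda>x. if x \<in> U then f x * \<phi> x else 0)"
    by (intro ext) (use K in auto)
  finally show ?thesis by (simp add: Lebesgue_Measure.integrable_restrict_UNIV[OF U])
qed

lemma flat_scaled_tendsto:
  "(\<lambda>k. flat 0 (real k * t)) \<longlonglongrightarrow> (if t > 0 then 1 else 0)"
proof (cases "t > 0")
  case True
  have "(\<lambda>k. exp (- (1 / t) * (1 / real k))) \<longlonglongrightarrow> exp (- (1 / t) * 0)"
    by (intro tendsto_intros lim_1_over_n)
  then have "(\<lambda>k. exp (- (1 / t) * (1 / real k))) \<longlonglongrightarrow> 1" by simp
  then have "(\<lambda>k. flat 0 (real k * t)) \<longlonglongrightarrow> 1"
  proof (rule Lim_transform_eventually)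
    show "\<forall>\<^sub>F k in sequentially. exp (- (1 / t) * (1 / real k)) = flat 0 (real k * t)"
      using eventually_gt_at_top[of 0]
      by eventually_elim (use True in \<open>simp add: flat_0 field_simps\<close>)
  qed
  then show ?thesis using True by simp
next
  case False
  then have "flat 0 (real k * t) = 0" for k by (simp add: flat_nonpos mult_nonneg_nonpos)
  then show ?thesis using False by simp
qed

text \<open>
  For growing \<open>k\<close> each factor tends to one on the inner side of its face and is zero on the
  outer side: a smooth approximation from below to the indicator of the open box.
\<close>

definition box_bump :: "nat \<Rightarrow> real ^ 'n \<Rightarrow> real ^ 'n \<Rightarrow> real ^ 'n \<Rightarrow> real" where
  "box_bump k a b x = (\<Prod>i\<in>UNIV. flat 0 (real k * (x $ i - a $ i)) * flat 0 (real k * (b $ i - x $ i)))"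

lemma box_bump_tendsto: "(\<lambda>k. box_bump k a b x) \<longlonglongrightarrow> indicator (box a b) x"
proof -
  have "(\<lambda>k. box_bump k a b x) \<longlonglongrightarrow>
    (\<Prod>i\<in>UNIV. (if x $ i - a $ i > 0 then 1 else 0) * (if b $ i - x $ i > 0 then 1 else 0))"
    unfolding box_bump_def by (intro tendsto_intros flat_scaled_tendsto)
  also have "(\<Prod>i\<in>UNIV. (if x $ i - a $ i > 0 then 1 else 0) * (if b $ i - x $ i > 0 then 1 else (0::real)))
    = indicator (box a b) x"
    by (auto simp: indicator_def mem_box_cart prod_eq_1_iff intro!: prod_zero prod.neutral)
  finally show ?thesis .
qed

lemma box_bump_bounds: "0 \<le> box_bump k a b x" "box_bump k a b x \<le> 1"
  unfolding box_bump_def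
  by (auto intro!: prod_nonneg prod_le_1 mult_nonneg_nonneg mult_le_one flat_0_nonneg flat_0_le_1)

lemma box_bump_zero:
  assumes "x \<notin> cbox a b" shows "box_bump k a b x = 0"
proof -
  have "\<exists>i. x $ i < a $ i \<or> b $ i < x $ i"
    using assms by (auto simp: mem_box_cart not_le)
  then obtain i where "x $ i < a $ i \<or> b $ i < x $ i" by blast
  then have "flat 0 (real k * (x $ i - a $ i)) * flat 0 (real k * (b $ i - x $ i)) = 0"
    by (auto simp: flat_nonpos mult_nonneg_nonpos)
  then show ?thesis unfolding box_bump_def by (intro prod_zero) auto
qed

lemma smooth_on_component: "smooth_on UNIV (\<lambda>x :: real ^ 'n. x $ i)"
  by (intro smooth_on_bounded_linear bounded_linear_vec_nth)

lemma smooth_on_flat: "smooth_on UNIV q \<Longrightarrow> smooth_on UNIV (\<lambda>x. flat j (q x))"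
  by (rule smooth_on_compose[where h = flat, OF DERIV_flat])

lemma smooth_on_box_bump:
  fixes a b :: "real ^ 'n" shows "smooth_on UNIV (box_bump k a b)"
proof -
  have "smooth_on UNIV (\<lambda>x :: real ^ 'n. real k * (x $ i + (- a $ i)))"
    "smooth_on UNIV (\<lambda>x :: real ^ 'n. real k * (b $ i + (-1) * x $ i))" for i
    by (intro smooth_on_mult smooth_on_add smooth_on_const smooth_on_component)+
  then have "smooth_on UNIV (\<lambda>x :: real ^ 'n. flat 0 (real k * (x $ i - a $ i)) * flat 0 (real k * (b $ i - x $ i)))" for i
    by (intro smooth_on_mult[OF smooth_on_flat smooth_on_flat]) simp_all
  then show ?thesis unfolding box_bump_def[abs_def] by (rule smooth_on_prod)
qed

lemma box_bump_test_function: "cbox a b \<subseteq> U \<Longrightarrow> box_bump k a b \<in> test_functions U"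
  by (rule test_functionI[OF smooth_on_box_bump compact_cbox]) (auto simp: box_bump_zero)

lemma test_integrals_zero_imp_box_integral_zero:
  fixes f :: "real ^ 'n \<Rightarrow> real"
  assumes f: "f \<in> L_loc 1 U" and U: "U \<in> sets lebesgue"
    and 0: "\<And>\<phi>. \<phi> \<in> test_functions U \<Longrightarrow> (LINT x|lebesgue_on U. f x * \<phi> x) = 0"
    and ab: "cbox a b \<subseteq> U"
  shows "(LINT x|lebesgue_on (cbox a b). f x * indicator (box a b) x) = 0"
proof -
  let ?M = "lebesgue_on (cbox a b)"
  have fm[measurable]: "f \<in> borel_measurable ?M" and fi: "integrable ?M (\<lambda>x. norm (f x))"
    using f ab compact_cbox by (auto simp: L_loc_def L_space_def)
  have "(\<lambda>k. LINT x|?M. f x * box_bump k a b x) \<longlonglongrightarrow> (LINT x|?M. f x * indicator (box a b) x)"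
  proof (rule integral_dominated_convergence[OF _ _ fi])
    show "(\<lambda>x. f x * box_bump k a b x) \<in> borel_measurable ?M" for k
      by (intro borel_measurable_times fm test_function_measurable[OF box_bump_test_function[OF ab]])
    have [measurable]: "indicat_real (box a b) \<in> borel_measurable ?M"
      by (intro measurable_restrict_space1 borel_measurable_indicator) simp
    show "(\<lambda>x. f x * indicator (box a b) x) \<in> borel_measurable ?M" by measurable
    show "AE x in ?M. (\<lambda>k. f x * box_bump k a b x) \<longlonglongrightarrow> f x * indicator (box a b) x"
      by (intro AE_I2 tendsto_intros box_bump_tendsto)
    show "AE x in ?M. norm (f x * box_bump k a b x) \<le> norm (f x)" for k
      using box_bump_bounds[of k a b] by (auto simp: abs_mult mult_left_le)
  qed
  moreover have "(LINT x|?M. f x * box_bump k a b x) = 0" for k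
  proof -
    have "(LINT x|?M. f x * box_bump k a b x) = (LINT x|lebesgue. (if x \<in> cbox a b then f x * box_bump k a b x else 0))"
      by (rule Lebesgue_Measure.integral_restrict_UNIV[symmetric]) simp
    also have "\<dots> = (LINT x|lebesgue. (if x \<in> U then f x * box_bump k a b x else 0))"
      using ab by (intro Bochner_Integration.integral_cong) (auto simp: box_bump_zero)
    also have "\<dots> = (LINT x|lebesgue_on U. f x * box_bump k a b x)"
      by (rule Lebesgue_Measure.integral_restrict_UNIV[OF U])
    also have "\<dots> = 0" by (intro 0 box_bump_test_function ab)
    finally show ?thesis .
  qed
  ultimately have "(\<lambda>k. 0 :: real) \<longlonglongrightarrow> (LINT x|?M. f x * indicator (box a b) x)" by simp
  from LIMSEQ_unique[OF this tendsto_const] show ?thesis .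
qed

text \<open>
  On a box whose closure lies in \<open>U\<close> the test functions \<open>box_bump\<close> approximate indicators of
  smaller boxes, so the integrals of \<open>f\<close> over these vanish and \<open>f\<close> is zero almost everywhere on
  the box. Countably many such boxes cover \<open>U\<close>.
\<close>

theorem fundamental_lemma:
  fixes f :: "real ^ 'n \<Rightarrow> real"
  assumes f: "f \<in> L_loc 1 U" and U: "open U"
    and 0: "\<And>\<phi>. \<phi> \<in> test_functions U \<Longrightarrow> (LINT x|lebesgue_on U. f x * \<phi> x) = 0"
  shows "AE x in lebesgue_on U. f x = 0"
proof -
  have Ul: "U \<in> sets lebesgue" using borel_open[OF U] by simp
  have ae: "AE x in lebesgue. x \<in> box c d \<longrightarrow> f x = 0" if cd: "cbox c d \<subseteq> U" for c d
  proof -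
    let ?M = "lebesgue_on (cbox c d)"
    have fm[measurable]: "f \<in> borel_measurable ?M" and fi: "integrable ?M (\<lambda>x. norm (f x))"
      using f cd compact_cbox by (auto simp: L_loc_def L_space_def)
    have [measurable]: "indicat_real (box c d) \<in> borel_measurable ?M"
      by (intro measurable_restrict_space1 borel_measurable_indicator) simp
    define h where "h x = (if x \<in> cbox c d then f x * indicator (box c d) x else 0)" for x
    have "integrable ?M (\<lambda>x. f x * indicator (box c d) x)"
      by (rule Bochner_Integration.integrable_bound[OF fi], measurable) (auto simp: indicator_def)
    then have hi: "integrable lebesgue h"
      unfolding h_def by (subst Lebesgue_Measure.integrable_restrict_UNIV) auto
    have "AE x in lebesgue. h x = 0"
    proof (rule AE_zero_if_box_integrals_zero[OF hi])
      fix B :: "(real ^ 'n) set" assume "B \<in> rational_boxes"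
      then obtain a b where B: "B = box a b" by (auto simp: rational_boxes_def)
      obtain e g where eg: "box a b \<inter> box c d = box e g" using box_Int_box by blast
      show "(\<integral>x. indicator B x * h x \<partial>lebesgue) = 0"
      proof (cases "box e g = {}")
        case True
        then have "indicator B x * h x = 0" for x using eg B by (auto simp: h_def indicator_def)
        then show ?thesis by (intro integral_eq_zero_AE AE_I2)
      next
        case False
        have "cbox e g \<subseteq> cbox c d"
          using closure_mono[of "box e g" "cbox c d"] eg box_subset_cbox[of c d] closure_box[OF False]
          by auto
        then have sub: "cbox e g \<subseteq> U" using cd by auto
        have "(\<integral>x. indicator B x * h x \<partial>lebesgue) = (LINT x|lebesgue. (if x \<in> cbox e g then f x * indicator (box e g) x else 0))"
          using eg B box_subset_cbox[of e g] box_subset_cbox[of c d]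
          by (intro Bochner_Integration.integral_cong) (auto simp: h_def indicator_def)
        also have "\<dots> = (LINT x|lebesgue_on (cbox e g). f x * indicator (box e g) x)"
          by (rule Lebesgue_Measure.integral_restrict_UNIV) simp
        also have "\<dots> = 0"
          by (rule test_integrals_zero_imp_box_integral_zero[OF f Ul 0 sub])
        finally show ?thesis .
      qed
    qed
    then show ?thesis
      by eventually_elim (use box_subset_cbox[of c d] in \<open>auto simp: h_def\<close>)
  qed
  define \<B> where "\<B> = {B \<in> rational_boxes. closure B \<subseteq> U}"
  have "countable \<B>" unfolding \<B>_def by (rule countable_subset[OF _ countable_rational_boxes]) auto
  have "\<forall>B\<in>\<B>. AE x in lebesgue. x \<in> B \<longrightarrow> f x = 0"
  proof
    fix B assume "B \<in> \<B>"
    then obtain c d where B: "B = box c d" "closure B \<subseteq> U" by (auto simp: \<B>_def rational_boxes_def)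
    show "AE x in lebesgue. x \<in> B \<longrightarrow> f x = 0"
      using ae[of c d] B closure_box[of c d] by (cases "box c d = {}") auto
  qed
  then have "AE x in lebesgue. \<forall>B\<in>\<B>. x \<in> B \<longrightarrow> f x = 0"
    by (rule AE_ball_countable[OF \<open>countable \<B>\<close>, THEN iffD2])
  moreover have "\<exists>B\<in>\<B>. x \<in> B" if "x \<in> U" for x
  proof -
    obtain e where e: "e > 0" "cball x e \<subseteq> U" using U \<open>x \<in> U\<close> open_contains_cball by blast
    obtain B where B: "B \<in> rational_boxes" "B \<subseteq> ball x e" "x \<in> B"
      using open_Union_rational_boxes[of "ball x e"] e by (metis (no_types, lifting) Union_iff centre_in_ball mem_Collect_eq open_ball)
    have "closure B \<subseteq> cball x e" using closure_mono[OF B(2)] e by simp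
    then show ?thesis using B e by (auto simp: \<B>_def)
  qed
  ultimately have "AE x in lebesgue. x \<in> U \<longrightarrow> f x = 0"
    by (auto elim!: eventually_mono)
  then show ?thesis using Ul by (simp add: AE_restrict_space_iff)
qed

section \<open>Weak gradients and the space \<open>H\<^sup>1\<close>\<close>

lemma L_space_subset:
  fixes f :: "real ^ 'n \<Rightarrow> 'b::euclidean_space"
  assumes f: "f \<in> L_space q U" and VU: "V \<subseteq> U" "V \<in> sets lebesgue" "U \<in> sets lebesgue"
  shows "f \<in> L_space q V"
proof -
  have fm: "f \<in> borel_measurable (lebesgue_on U)" and fi: "integrable (lebesgue_on U) (\<lambda>x. norm (f x) powr q)"
    using f by (auto simp: L_space_def)
  have fV[measurable]: "f \<in> borel_measurable (lebesgue_on V)"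
    using measurable_restrict_mono[OF fm VU(1)] .
  have "integrable lebesgue (\<lambda>x. if x \<in> U then norm (f x) powr q else 0)"
    using fi by (simp add: Lebesgue_Measure.integrable_restrict_UNIV[OF VU(3)])
  then have "integrable lebesgue (\<lambda>x. if x \<in> V then norm (f x) powr q else 0)"
  proof (rule Bochner_Integration.integrable_bound)
    show "(\<lambda>x. if x \<in> V then norm (f x) powr q else 0) \<in> borel_measurable lebesgue"
      by (rule borel_measurable_if_I[OF _ VU(2)]) measurable
  qed (use VU in auto)
  then have "integrable (lebesgue_on V) (\<lambda>x. norm (f x) powr q)"
    by (simp add: Lebesgue_Measure.integrable_restrict_UNIV[OF VU(2)])
  with fV show ?thesis by (simp add: L_space_def)
qed

lemma L_space_exponent_le:
  fixes f :: "real ^ 'n \<Rightarrow> 'b::euclidean_space"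
  assumes f: "f \<in> L_space q U" and U: "U \<in> lmeasurable" and s: "0 < s" "s \<le> q"
  shows "f \<in> L_space s U"
proof -
  interpret finite_measure "lebesgue_on U" by (rule finite_measure_lebesgue_on[OF U])
  have [measurable]: "f \<in> borel_measurable (lebesgue_on U)"
    and fi: "integrable (lebesgue_on U) (\<lambda>x. norm (f x) powr q)"
    using f by (auto simp: L_space_def)
  have "integrable (lebesgue_on U) (\<lambda>x. norm (f x) powr s)"
  proof (rule Bochner_Integration.integrable_bound)
    show "integrable (lebesgue_on U) (\<lambda>x. 1 + norm (f x) powr q)" using fi by simp
    have "t powr s \<le> 1 + t powr q" if "t \<ge> 0" for t :: real
    proof (cases "t \<le> 1")
      case True
      then have "t powr s \<le> 1" using that s by (intro powr_le1) auto
      then show ?thesis using powr_ge_zero[of t q] by linarith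
    next
      case False
      then have "t powr s \<le> t powr q" using s by (intro powr_mono) auto
      then show ?thesis by simp
    qed
    then show "AE x in lebesgue_on U. norm (norm (f x) powr s) \<le> norm (1 + norm (f x) powr q)"
      by (intro AE_I2) (simp add: abs_of_nonneg)
  qed measurable
  then show ?thesis by (simp add: L_space_def)
qed

lemma L_space_imp_L_loc:
  fixes f :: "real ^ 'n \<Rightarrow> 'b::euclidean_space"
  assumes "f \<in> L_space q U" "U \<in> sets lebesgue" "0 < s" "s \<le> q"
  shows "f \<in> L_loc s U"
  unfolding L_loc_def
proof safe
  fix K assume K: "compact K" "K \<subseteq> U"
  have "f \<in> L_space q K"
    using L_space_subset[OF assms(1) K(2) _ assms(2)] borel_compact[OF K(1)] by simp
  then show "f \<in> L_space s K"
    by (rule L_space_exponent_le[OF _ lmeasurable_compact[OF K(1)] assms(3,4)])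
qed

lemma L_space_component:
  fixes G :: "real ^ 'n \<Rightarrow> real ^ 'm"
  assumes q: "q > 0" and G: "G \<in> L_space q U" shows "(\<lambda>x. G x $ i) \<in> L_space q U"
proof -
  have [measurable]: "G \<in> borel_measurable (lebesgue_on U)"
    and gi: "integrable (lebesgue_on U) (\<lambda>x. norm (G x) powr q)"
    using G by (auto simp: L_space_def)
  have m[measurable]: "(\<lambda>x. G x $ i) \<in> borel_measurable (lebesgue_on U)"
    using borel_measurable_inner[of G "lebesgue_on U" "\<lambda>_. axis i 1"] by (simp add: inner_axis)
  have "integrable (lebesgue_on U) (\<lambda>x. norm (G x $ i) powr q)"
    by (rule Bochner_Integration.integrable_bound[OF gi])
      (use q component_le_norm_cart in \<open>auto intro!: powr_mono2 AE_I2\<close>)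
  with m show ?thesis by (simp add: L_space_def)
qed

lemma L_loc_component:
  fixes G :: "real ^ 'n \<Rightarrow> real ^ 'm"
  shows "G \<in> L_loc 1 U \<Longrightarrow> (\<lambda>x. G x $ i) \<in> L_loc 1 U"
  using L_space_component[of 1] by (auto simp: L_loc_def)

lemma L_loc_add: "f \<in> L_loc 1 U \<Longrightarrow> g \<in> L_loc 1 U \<Longrightarrow> (\<lambda>x. f x + g x) \<in> L_loc 1 U"
  by (simp add: L_loc_def L_space_add)

lemma L_loc_scaleR: "f \<in> L_loc 1 U \<Longrightarrow> (\<lambda>x. c *\<^sub>R f x) \<in> L_loc 1 U"
  by (simp add: L_loc_def L_space_scaleR)

lemma L_loc_diff:
  assumes "f \<in> L_loc 1 U" "g \<in> L_loc 1 U" shows "(\<lambda>x. f x - g x) \<in> L_loc 1 U"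
  using L_loc_add[OF assms(1) L_loc_scaleR[OF assms(2), of "-1"]] by simp

lemma has_weak_gradient_lincomb:
  fixes u v :: "real ^ 'n \<Rightarrow> real"
  assumes U: "U \<in> sets lebesgue" and u: "has_weak_gradient U u G" and v: "has_weak_gradient U v H"
  shows "has_weak_gradient U (\<lambda>x. a * u x + b * v x) (\<lambda>x. a *\<^sub>R G x + b *\<^sub>R H x)"
  unfolding has_weak_gradient_def
proof (intro conjI ballI allI)
  have loc: "u \<in> L_loc 1 U" "v \<in> L_loc 1 U" "G \<in> L_loc 1 U" "H \<in> L_loc 1 U"
    using u v by (auto simp: has_weak_gradient_def)
  show "(\<lambda>x. a * u x + b * v x) \<in> L_loc 1 U"
    using L_loc_add[OF L_loc_scaleR[OF loc(1), of a] L_loc_scaleR[OF loc(2), of b]] by simp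
  show "(\<lambda>x. a *\<^sub>R G x + b *\<^sub>R H x) \<in> L_loc 1 U"
    by (intro L_loc_add L_loc_scaleR loc)
  fix \<phi> :: "real ^ 'n \<Rightarrow> real" and i assume \<phi>: "\<phi> \<in> test_functions U"
  note I = L_loc_test_integrable[OF _ _ U]
  have "(LINT x|lebesgue_on U. (a * u x + b * v x) * partial_deriv i \<phi> x)
     = a * (LINT x|lebesgue_on U. u x * partial_deriv i \<phi> x) + b * (LINT x|lebesgue_on U. v x * partial_deriv i \<phi> x)"
    using I[OF loc(1) partial_deriv_test_function[OF \<phi>, of i]] I[OF loc(2) partial_deriv_test_function[OF \<phi>, of i]]
    by (simp add: distrib_right mult.assoc)
  also have "\<dots> = - (a * (LINT x|lebesgue_on U. G x $ i * \<phi> x) + b * (LINT x|lebesgue_on U. H x $ i * \<phi> x))"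
    using u v \<phi> by (simp add: has_weak_gradient_def)
  also have "\<dots> = - (LINT x|lebesgue_on U. (a *\<^sub>R G x + b *\<^sub>R H x) $ i * \<phi> x)"
    using I[OF L_loc_component[OF loc(3)] \<phi>, of i] I[OF L_loc_component[OF loc(4)] \<phi>, of i]
    by (simp add: distrib_right mult.assoc)
  finally show "(LINT x|lebesgue_on U. (a * u x + b * v x) * partial_deriv i \<phi> x)
    = - (LINT x|lebesgue_on U. (a *\<^sub>R G x + b *\<^sub>R H x) $ i * \<phi> x)" .
qed

text \<open>
  The difference of the two gradients integrates to zero against all test functions. The two
  functions are allowed to differ on a null set, since \<open>H1\<close> and the functionals on it are used
  modulo null sets.
\<close>

lemma weak_gradient_unique:
  fixes u v :: "real ^ 'n \<Rightarrow> real"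
  assumes U: "open U" and u: "has_weak_gradient U u G" and v: "has_weak_gradient U v H"
    and uv: "AE x in lebesgue_on U. u x = v x"
  shows "AE x in lebesgue_on U. G x = H x"
proof -
  have Ul: "U \<in> sets lebesgue" using borel_open[OF U] by simp
  have loc: "u \<in> L_loc 1 U" "v \<in> L_loc 1 U" "G \<in> L_loc 1 U" "H \<in> L_loc 1 U"
    using u v by (auto simp: has_weak_gradient_def)
  note I = L_loc_test_integrable[OF _ _ Ul]
  have "AE x in lebesgue_on U. G x $ i - H x $ i = 0" for i
  proof (rule fundamental_lemma[OF _ U])
    show "(\<lambda>x. G x $ i - H x $ i) \<in> L_loc 1 U"
      by (intro L_loc_diff L_loc_component loc)
    fix \<phi> :: "real ^ 'n \<Rightarrow> real" assume \<phi>: "\<phi> \<in> test_functions U"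
    have "(LINT x|lebesgue_on U. (G x $ i - H x $ i) * \<phi> x)
      = (LINT x|lebesgue_on U. G x $ i * \<phi> x) - (LINT x|lebesgue_on U. H x $ i * \<phi> x)"
      using I[OF L_loc_component[OF loc(3)] \<phi>, of i] I[OF L_loc_component[OF loc(4)] \<phi>, of i]
      by (simp add: left_diff_distrib)
    also have "\<dots> = (LINT x|lebesgue_on U. v x * partial_deriv i \<phi> x) - (LINT x|lebesgue_on U. u x * partial_deriv i \<phi> x)"
      using u v \<phi> by (simp add: has_weak_gradient_def)
    also have "(LINT x|lebesgue_on U. v x * partial_deriv i \<phi> x) = (LINT x|lebesgue_on U. u x * partial_deriv i \<phi> x)"
      using I[OF loc(1) partial_deriv_test_function[OF \<phi>, of i]] I[OF loc(2) partial_deriv_test_function[OF \<phi>, of i]]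
      by (intro integral_cong_AE) (use uv in auto)
    finally show "(LINT x|lebesgue_on U. (G x $ i - H x $ i) * \<phi> x) = 0" by simp
  qed
  then have "AE x in lebesgue_on U. \<forall>i. G x $ i - H x $ i = 0"
    by (subst AE_all_countable) auto
  then show ?thesis by eventually_elim (simp add: vec_eq_iff)
qed

lemma H1_weak_gradient:
  assumes U: "open U" and u: "u \<in> H1 U"
  shows "has_weak_gradient U u (weak_gradient U u)" "weak_gradient U u \<in> L_space 2 U"
proof -
  obtain G where G: "G \<in> L_space 2 U" "has_weak_gradient U u G" using u by (auto simp: H1_def)
  show *: "has_weak_gradient U u (weak_gradient U u)"
    unfolding weak_gradient_def by (rule someI[of "has_weak_gradient U u", OF G(2)])
  show "weak_gradient U u \<in> L_space 2 U"
    by (rule L_space_cong_AE[OF G(1) _ weak_gradient_unique[OF U G(2) *]])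
      (use borel_open[OF U] in auto)
qed

lemma H1_I: "u \<in> L_space 2 U \<Longrightarrow> G \<in> L_space 2 U \<Longrightarrow> has_weak_gradient U u G \<Longrightarrow> u \<in> H1 U"
  by (auto simp: H1_def)

lemma weak_gradient_AE_eq:
  assumes U: "open U" and G: "has_weak_gradient U u G"
  shows "AE x in lebesgue_on U. weak_gradient U u x = G x"
proof -
  have "has_weak_gradient U u (weak_gradient U u)"
    unfolding weak_gradient_def by (rule someI[of "has_weak_gradient U u", OF G])
  from weak_gradient_unique[OF U this G] show ?thesis by simp
qed

lemma has_weak_gradient_cong_AE:
  fixes u v :: "real ^ 'n \<Rightarrow> real"
  assumes U: "open U" and u: "has_weak_gradient U u G" and uv: "AE x in lebesgue_on U. u x = v x"
    and v: "v \<in> L_loc 1 U"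
  shows "has_weak_gradient U v G"
  unfolding has_weak_gradient_def
proof (intro conjI ballI allI)
  show "G \<in> L_loc 1 U" using u by (simp add: has_weak_gradient_def)
  fix \<phi> :: "real ^ 'n \<Rightarrow> real" and i assume \<phi>: "\<phi> \<in> test_functions U"
  have Ul: "U \<in> sets lebesgue" using borel_open[OF U] by simp
  note I = L_loc_test_integrable[OF _ partial_deriv_test_function[OF \<phi>, of i] Ul]
  have "(LINT x|lebesgue_on U. v x * partial_deriv i \<phi> x) = (LINT x|lebesgue_on U. u x * partial_deriv i \<phi> x)"
    using I[of u] I[OF v] u uv
    by (intro integral_cong_AE) (auto simp: has_weak_gradient_def)
  then show "(LINT x|lebesgue_on U. v x * partial_deriv i \<phi> x) = - (LINT x|lebesgue_on U. G x $ i * \<phi> x)"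
    using u \<phi> by (simp add: has_weak_gradient_def)
qed (rule v)

lemma H1_cong_AE:
  assumes U: "open U" and u: "u \<in> H1 U" and uv: "AE x in lebesgue_on U. u x = v x"
  shows "v \<in> H1 U"
proof -
  have Ul: "U \<in> sets lebesgue" using borel_open[OF U] by simp
  obtain G where G: "u \<in> L_space 2 U" "G \<in> L_space 2 U" "has_weak_gradient U u G" using u by (auto simp: H1_def)
  have v: "v \<in> L_space 2 U" by (rule L_space_cong_AE[OF G(1) Ul uv])
  show ?thesis
    by (rule H1_I[OF v G(2) has_weak_gradient_cong_AE[OF U G(3) uv L_space_imp_L_loc[OF v Ul]]]) auto
qed

text \<open>
  The square of \<open>H1_norm\<close>, with the integrands written as in \<open>L_space\<close> for the exponent 2.
\<close>

definition H1_energy :: "(real ^ 'n) set \<Rightarrow> (real ^ 'n \<Rightarrow> real) \<Rightarrow> real" where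
  "H1_energy U u = (LINT x|lebesgue_on U. norm (u x) powr 2) + (LINT x|lebesgue_on U. norm (weak_gradient U u x) powr 2)"

lemma H1_norm_eq: "H1_norm U = (\<lambda>u. H1_energy U u powr (1 / 2))"
  by (auto simp: H1_norm_def H1_energy_def powr_half_sqrt Bochner_Integration.integral_nonneg)

lemma H1_energy_cong:
  fixes u :: "real ^ 'n \<Rightarrow> real"
  assumes U: "open U" and u: "u \<in> H1 U" and G: "has_weak_gradient U u G"
  shows "H1_energy U u = (LINT x|lebesgue_on U. norm (u x) powr 2) + (LINT x|lebesgue_on U. norm (G x) powr 2)"
proof -
  have ae: "AE x in lebesgue_on U. weak_gradient U u x = G x" by (rule weak_gradient_AE_eq[OF U G])
  have m[measurable]: "weak_gradient U u \<in> borel_measurable (lebesgue_on U)"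
    using H1_weak_gradient(2)[OF U u] by (simp add: L_space_def)
  have [measurable]: "G \<in> borel_measurable (lebesgue_on U)"
    using borel_measurable_lebesgue_on_AE[OF m _ ae] borel_open[OF U] by simp
  have "(LINT x|lebesgue_on U. norm (weak_gradient U u x) powr 2) = (LINT x|lebesgue_on U. norm (G x) powr 2)"
    by (rule integral_cong_AE, measurable) (use ae in \<open>auto elim: eventually_mono\<close>)
  then show ?thesis by (simp add: H1_energy_def)
qed

lemma H1_lincomb:
  assumes U: "open U" and f: "f \<in> H1 U" and g: "g \<in> H1 U"
  shows "(\<lambda>x. a * f x + b * g x) \<in> H1 U"
    "has_weak_gradient U (\<lambda>x. a * f x + b * g x) (\<lambda>x. a *\<^sub>R weak_gradient U f x + b *\<^sub>R weak_gradient U g x)"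
proof -
  have Ul: "U \<in> sets lebesgue" using borel_open[OF U] by simp
  show *: "has_weak_gradient U (\<lambda>x. a * f x + b * g x) (\<lambda>x. a *\<^sub>R weak_gradient U f x + b *\<^sub>R weak_gradient U g x)"
    by (intro has_weak_gradient_lincomb Ul H1_weak_gradient U f g)
  have "(\<lambda>x. a * f x + b * g x) \<in> L_space 2 U"
    using L_space_add[of 2, OF _ L_space_scaleR[of f 2 U a] L_space_scaleR[of g 2 U b]] f g by (simp add: H1_def)
  then show "(\<lambda>x. a * f x + b * g x) \<in> H1 U"
    by (rule H1_I[OF _ _ *]) (intro L_space_add L_space_scaleR H1_weak_gradient U f g zero_less_numeral)
qed

lemma test_function_L_space:
  fixes \<phi> :: "real ^ 'n \<Rightarrow> real"
  assumes \<phi>: "\<phi> \<in> test_functions V" and q: "q > 0" and U: "U \<in> sets lebesgue"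
  shows "\<phi> \<in> L_space q U"
proof -
  obtain K where K: "compact K" "K \<subseteq> V" "\<forall>x. x \<notin> K \<longrightarrow> \<phi> x = 0"
    using test_function_props(3)[OF \<phi>] by blast
  obtain C where C: "C > 0" "\<And>x. norm (\<phi> x) \<le> C" using test_function_bounded[OF \<phi>] by blast
  have Kl: "K \<in> lmeasurable" "K \<in> sets lebesgue" using lmeasurable_compact[OF K(1)] by auto
  have m[measurable]: "\<phi> \<in> borel_measurable (lebesgue_on A)" for A
    by (rule test_function_measurable[OF \<phi>])
  interpret K: finite_measure "lebesgue_on K" by (rule finite_measure_lebesgue_on[OF Kl(1)])
  have "integrable (lebesgue_on K) (\<lambda>x. norm (\<phi> x) powr q)"
    by (rule K.integrable_const_bound[of _ "C powr q"]) (use C q in \<open>auto intro!: powr_mono2\<close>)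
  then have "integrable lebesgue (\<lambda>x. if x \<in> K then norm (\<phi> x) powr q else 0)"
    by (simp add: Lebesgue_Measure.integrable_restrict_UNIV[OF Kl(2)])
  also have "(\<lambda>x. if x \<in> K then norm (\<phi> x) powr q else 0) = (\<lambda>x. norm (\<phi> x) powr q)"
    using K(3) by auto
  finally have "\<phi> \<in> L_space q UNIV" using m[of UNIV] by (simp add: L_space_def lebesgue_on_UNIV_eq)
  then show ?thesis by (rule L_space_subset) (use U in auto)
qed

text \<open>
  Pairing with a fixed test function is a bounded functional on \<open>L\<^sup>2\<close>, so both sides of the
  integration-by-parts identity pass to the limit.
\<close>

lemma has_weak_gradient_limit:
  fixes f :: "nat \<Rightarrow> real ^ 'n \<Rightarrow> real"
  assumes U: "U \<in> sets lebesgue"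
    and f: "\<And>n. has_weak_gradient U (f n) (F n)" "\<And>n. f n \<in> L_space 2 U" "\<And>n. F n \<in> L_space 2 U"
    and v: "v \<in> L_space 2 U" "(\<lambda>n. LINT x|lebesgue_on U. norm (f n x - v x) powr 2) \<longlonglongrightarrow> 0"
    and V: "V \<in> L_space 2 U" "(\<lambda>n. LINT x|lebesgue_on U. norm (F n x - V x) powr 2) \<longlonglongrightarrow> 0"
  shows "has_weak_gradient U v V"
  unfolding has_weak_gradient_def
proof (intro conjI ballI allI)
  show "v \<in> L_loc 1 U" "V \<in> L_loc 1 U" using v V U by (auto intro: L_space_imp_L_loc)
  fix \<phi> :: "real ^ 'n \<Rightarrow> real" and i assume \<phi>: "\<phi> \<in> test_functions U"
  interpret L: uniformly_convex_space "L_space 2 U :: (real ^ 'n \<Rightarrow> real) set"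
    "\<lambda>f. LINT x|lebesgue_on U. norm (f x) powr 2" 2
    by (rule L_space_uniformly_convex) simp
  have L2: "bounded_functional (L_space 2 U) (\<lambda>f. (LINT x|lebesgue_on U. norm (f x) powr 2) powr (1 / 2))
      (\<lambda>f. LINT x|lebesgue_on U. \<psi> x * f x)" if "\<psi> \<in> test_functions U" for \<psi> :: "real ^ 'n \<Rightarrow> real"
    using L_space_pairing_functional[of 2 \<psi> U] test_function_L_space[OF that _ U, of 2]
    unfolding L_norm_def[abs_def] by simp
  have lim1: "(\<lambda>n. LINT x|lebesgue_on U. partial_deriv i \<phi> x * f n x) \<longlonglongrightarrow> (LINT x|lebesgue_on U. partial_deriv i \<phi> x * v x)"
    using L.functional_tendsto[OF L2[OF partial_deriv_test_function[OF \<phi>]] _ v(1), of f] f(2) v(2) by simp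
  have Fi: "(\<lambda>n. LINT x|lebesgue_on U. norm (F n x $ i - V x $ i) powr 2) \<longlonglongrightarrow> 0"
  proof (rule tendsto_sandwich[OF _ _ tendsto_const V(2)])
    have d: "(\<lambda>x. F n x - V x) \<in> L_space 2 U" for n by (intro L_space_diff f V) simp
    have "(LINT x|lebesgue_on U. norm (F n x $ i - V x $ i) powr 2) \<le> (LINT x|lebesgue_on U. norm (F n x - V x) powr 2)" for n
    proof (rule integral_mono)
      show "integrable (lebesgue_on U) (\<lambda>x. norm (F n x $ i - V x $ i) powr 2)"
        using L_space_component[OF _ d, of n i] by (simp add: L_space_def)
      show "integrable (lebesgue_on U) (\<lambda>x. norm (F n x - V x) powr 2)"
        using d by (simp add: L_space_def)
      show "norm (F n x $ i - V x $ i) powr 2 \<le> norm (F n x - V x) powr 2" for x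
        using component_le_norm_cart[of "F n x - V x" i] by (intro powr_mono2) auto
    qed
    then show "\<forall>\<^sub>F n in sequentially. (LINT x|lebesgue_on U. norm (F n x $ i - V x $ i) powr 2)
      \<le> (LINT x|lebesgue_on U. norm (F n x - V x) powr 2)" by (rule always_eventually[OF allI])
  qed (simp add: Bochner_Integration.integral_nonneg)
  have lim2: "(\<lambda>n. LINT x|lebesgue_on U. \<phi> x * F n x $ i) \<longlonglongrightarrow> (LINT x|lebesgue_on U. \<phi> x * V x $ i)"
  proof -
    have "\<forall>\<^sub>F n in sequentially. (\<lambda>x. F n x $ i) \<in> L_space 2 U"
      using L_space_component[OF _ f(3)] by simp
    from L.functional_tendsto[OF L2[OF \<phi>] this L_space_component[OF _ V(1)] Fi] show ?thesis by simp
  qed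
  have "(LINT x|lebesgue_on U. partial_deriv i \<phi> x * f n x) = - (LINT x|lebesgue_on U. \<phi> x * F n x $ i)" for n
    using f(1)[of n] \<phi> by (simp add: has_weak_gradient_def mult.commute)
  then have "(LINT x|lebesgue_on U. partial_deriv i \<phi> x * v x) = - (LINT x|lebesgue_on U. \<phi> x * V x $ i)"
    using LIMSEQ_unique[OF lim1] tendsto_minus[OF lim2] by simp
  then show "(LINT x|lebesgue_on U. v x * partial_deriv i \<phi> x) = - (LINT x|lebesgue_on U. V x $ i * \<phi> x)"
    by (simp add: mult.commute)
qed

text \<open>
  Clarkson's inequality holds for the functions and for their gradients separately. For
  completeness, functions and gradients have limits in \<open>L\<^sup>2\<close>, and the second limit is the weak
  gradient of the first.
\<close>

theorem H1_uniformly_convex: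
  fixes U :: "(real ^ 'n) set"
  assumes U: "open U"
  shows "uniformly_convex_space (H1 U) (H1_energy U) 2"
proof
  have Ul: "U \<in> sets lebesgue" using borel_open[OF U] by simp
  fix f g :: "real ^ 'n \<Rightarrow> real" and c :: real
  show "0 \<le> H1_energy U f" unfolding H1_energy_def by (simp add: Bochner_Integration.integral_nonneg)
  assume f: "f \<in> H1 U"
  show "(\<lambda>x. c * f x) \<in> H1 U" using H1_lincomb(1)[OF U f f, of c 0] by simp
  have "has_weak_gradient U (\<lambda>x. c * f x) (\<lambda>x. c *\<^sub>R weak_gradient U f x)"
    using H1_lincomb(2)[OF U f f, of c 0] by simp
  from H1_energy_cong[OF U \<open>(\<lambda>x. c * f x) \<in> H1 U\<close> this]
  show "H1_energy U (\<lambda>x. c * f x) = \<bar>c\<bar> powr 2 * H1_energy U f"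
    by (simp add: norm_scaleR_powr abs_mult powr_mult H1_energy_def[of U f] distrib_left del: norm_scaleR)
  assume g: "g \<in> H1 U"
  show "(\<lambda>x. f x + g x) \<in> H1 U" using H1_lincomb(1)[OF U f g, of 1 1] by simp
  have L: "f \<in> L_space 2 U" "g \<in> L_space 2 U" using f g by (auto simp: H1_def)
  have p: "(\<lambda>x. (f x + g x) / 2) \<in> H1 U"
    "has_weak_gradient U (\<lambda>x. (f x + g x) / 2) (\<lambda>x. (weak_gradient U f x + weak_gradient U g x) /\<^sub>R 2)"
    using H1_lincomb[OF U f g, of "1/2" "1/2"] by (simp_all add: scaleR_add_right add_divide_distrib)
  have m: "(\<lambda>x. (f x - g x) / 2) \<in> H1 U"
    "has_weak_gradient U (\<lambda>x. (f x - g x) / 2) (\<lambda>x. (weak_gradient U f x - weak_gradient U g x) /\<^sub>R 2)"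
    using H1_lincomb[OF U f g, of "1/2" "-1/2"] by (simp_all add: scaleR_diff_right diff_divide_distrib)
  have "(LINT x|lebesgue_on U. norm ((f x + g x) / 2) powr 2) + (LINT x|lebesgue_on U. norm ((f x - g x) / 2) powr 2)
     \<le> ((LINT x|lebesgue_on U. norm (f x) powr 2) + (LINT x|lebesgue_on U. norm (g x) powr 2)) / 2"
    using clarkson_integral[OF _ L]
    by (simp only: real_scaleR_def divide_inverse mult.commute[of "inverse 2"] order_refl)
  with clarkson_integral[OF _ H1_weak_gradient(2)[OF U f] H1_weak_gradient(2)[OF U g]]
  show "H1_energy U (\<lambda>x. (f x + g x) / 2) + H1_energy U (\<lambda>x. (f x - g x) / 2) \<le> (H1_energy U f + H1_energy U g) / 2"
    unfolding H1_energy_cong[OF U p] H1_energy_cong[OF U m] unfolding H1_energy_def by argo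
next
  have Ul: "U \<in> sets lebesgue" using borel_open[OF U] by simp
  fix f :: "nat \<Rightarrow> real ^ 'n \<Rightarrow> real"
  assume f: "\<And>n. f n \<in> H1 U"
    and cauchy: "\<And>e. e > 0 \<Longrightarrow> \<exists>M. \<forall>m\<ge>M. \<forall>n\<ge>M. H1_energy U (\<lambda>x. f m x - f n x) < e"
  define F where "F n = weak_gradient U (f n)" for n
  have L: "f n \<in> L_space 2 U" "F n \<in> L_space 2 U" "has_weak_gradient U (f n) (F n)" for n
    using f H1_weak_gradient[OF U f] by (auto simp: H1_def F_def)
  have diff: "(\<lambda>x. f n x - v x) \<in> H1 U"
    "H1_energy U (\<lambda>x. f n x - v x) =
    (LINT x|lebesgue_on U. norm (f n x - v x) powr 2) + (LINT x|lebesgue_on U. norm (F n x - V x) powr 2)"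
    if v: "v \<in> H1 U" "has_weak_gradient U v V" for n v V
  proof -
    show *: "(\<lambda>x. f n x - v x) \<in> H1 U" using H1_lincomb(1)[OF U f[of n] v(1), of 1 "-1"] by simp
    have "has_weak_gradient U (\<lambda>x. f n x - v x) (\<lambda>x. F n x - V x)"
      using has_weak_gradient_lincomb[OF Ul L(3) v(2), of 1 n "-1"] by simp
    from H1_energy_cong[OF U * this] show "H1_energy U (\<lambda>x. f n x - v x) =
    (LINT x|lebesgue_on U. norm (f n x - v x) powr 2) + (LINT x|lebesgue_on U. norm (F n x - V x) powr 2)" .
  qed
  have nn: "0 \<le> (LINT x|lebesgue_on U. norm (h x) powr 2)" for h :: "real ^ 'n \<Rightarrow> 'c::euclidean_space"
    by (simp add: Bochner_Integration.integral_nonneg)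
  have c1: "\<exists>M. \<forall>m\<ge>M. \<forall>n\<ge>M. (LINT x|lebesgue_on U. norm (f m x - f n x) powr 2) < e"
    and c2: "\<exists>M. \<forall>m\<ge>M. \<forall>n\<ge>M. (LINT x|lebesgue_on U. norm (F m x - F n x) powr 2) < e" if e: "e > 0" for e
  proof -
    obtain M where M: "\<And>m n. m \<ge> M \<Longrightarrow> n \<ge> M \<Longrightarrow> H1_energy U (\<lambda>x. f m x - f n x) < e" using cauchy[OF e] by blast
    have "(LINT x|lebesgue_on U. norm (f m x - f n x) powr 2) < e \<and> (LINT x|lebesgue_on U. norm (F m x - F n x) powr 2) < e"
      if "m \<ge> M" "n \<ge> M" for m n
      using M[OF that] diff(2)[OF f L(3), of m n] nn[of "\<lambda>x. f m x - f n x"] nn[of "\<lambda>x. F m x - F n x"] by linarith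
    then show "\<exists>M. \<forall>m\<ge>M. \<forall>n\<ge>M. (LINT x|lebesgue_on U. norm (f m x - f n x) powr 2) < e"
      "\<exists>M. \<forall>m\<ge>M. \<forall>n\<ge>M. (LINT x|lebesgue_on U. norm (F m x - F n x) powr 2) < e" by blast+
  qed
  obtain v where v: "v \<in> L_space 2 U" "(\<lambda>n. LINT x|lebesgue_on U. norm (f n x - v x) powr 2) \<longlonglongrightarrow> 0"
    using L_space_complete[of 2 f U, OF _ L(1) c1] by auto
  obtain V where V: "V \<in> L_space 2 U" "(\<lambda>n. LINT x|lebesgue_on U. norm (F n x - V x) powr 2) \<longlonglongrightarrow> 0"
    using L_space_complete[of 2 F U, OF _ L(2) c2] by auto
  have gr: "has_weak_gradient U v V" by (rule has_weak_gradient_limit[OF Ul L(3,1,2) v V])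
  have vH: "v \<in> H1 U" by (rule H1_I[OF v(1) V(1) gr])
  show "\<exists>v\<in>H1 U. (\<lambda>n. H1_energy U (\<lambda>x. f n x - v x)) \<longlonglongrightarrow> 0"
    by (intro bexI[OF _ vH]) (use tendsto_add[OF v(2) V(2)] in \<open>simp only: diff(2)[OF vH gr] add_0\<close>)
qed simp

lemma H1_energy_zero:
  fixes v :: "real ^ 'n \<Rightarrow> real"
  assumes U: "open U" and v: "AE x in lebesgue_on U. v x = 0"
  shows "v \<in> H1 U" "H1_energy U v = 0"
proof -
  have Ul: "U \<in> sets lebesgue" using borel_open[OF U] by simp
  have z: "(\<lambda>x. 0) \<in> L_space 2 U" by (simp add: L_space_def)
  have "(\<lambda>x :: real ^ 'n. 0 :: real) \<in> L_loc 1 U" "(\<lambda>x :: real ^ 'n. 0 :: real ^ 'n) \<in> L_loc 1 U"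
    by (auto simp: L_loc_def L_space_def)
  then have 0: "has_weak_gradient U (\<lambda>x. 0) (\<lambda>x. 0)" by (simp add: has_weak_gradient_def)
  have v': "AE x in lebesgue_on U. 0 = v x" using v by (auto elim: eventually_mono)
  show vH: "v \<in> H1 U" by (rule H1_cong_AE[OF U H1_I[OF z _ 0] v']) (simp add: L_space_def)
  have "v \<in> L_space 2 U" using vH by (simp add: H1_def)
  then have "has_weak_gradient U v (\<lambda>x. 0)"
    by (intro has_weak_gradient_cong_AE[OF U 0 v'] L_space_imp_L_loc[OF _ Ul]) auto
  from H1_energy_cong[OF U vH this] have "H1_energy U v = (LINT x|lebesgue_on U. norm (v x) powr 2)" by simp
  also have "\<dots> = 0" by (rule integral_eq_zero_AE) (use v in \<open>auto elim: eventually_mono\<close>)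
  finally show "H1_energy U v = 0" .
qed

section \<open>Weak limits in Lebesgue spaces\<close>

lemma box_functional:
  fixes U :: "(real ^ 'n) set"
  assumes U: "U \<in> lmeasurable" and q: "q > 1" and B: "B \<in> rational_boxes"
  shows "bounded_functional (L_space q U) (L_norm q U) (\<lambda>f. LINT x|lebesgue_on U. indicator B x * f x)"
proof (rule L_space_pairing_functional[OF q])
  have "B \<in> sets borel" using B by (auto simp: rational_boxes_def)
  then show "indicat_real B \<in> L_space (q / (q - 1)) U" by (intro indicator_L_space U) simp
qed

text \<open>
  Together with \<open>box_functional\<close> this makes the integrals over rational boxes a countable
  separating family of functionals, as \<open>weak_compactness\<close> demands.
\<close>

lemma box_integrals_separate:
  fixes f :: "real ^ 'n \<Rightarrow> real"
  assumes U: "U \<in> lmeasurable" and f: "f \<in> L_space q U" and q: "q \<ge> 1"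
    and 0: "\<And>B. B \<in> rational_boxes \<Longrightarrow> (LINT x|lebesgue_on U. indicator B x * f x) = 0"
  shows "AE x in lebesgue_on U. f x = 0"
proof -
  have Ul: "U \<in> sets lebesgue" using U by auto
  have "f \<in> L_space 1 U" using L_space_exponent_le[OF f U] q by simp
  then have "integrable (lebesgue_on U) f"
    using integrable_norm_iff[of f "lebesgue_on U"] by (simp add: L_space_def)
  then have "integrable lebesgue (\<lambda>x. if x \<in> U then f x else 0)"
    by (simp add: Lebesgue_Measure.integrable_restrict_UNIV[OF Ul])
  moreover have "(\<integral>x. indicator B x * (if x \<in> U then f x else 0) \<partial>lebesgue) = 0" if "B \<in> rational_boxes" for B
  proof -
    have "(\<integral>x. indicator B x * (if x \<in> U then f x else 0) \<partial>lebesgue)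
       = (\<integral>x. (if x \<in> U then indicator B x * f x else 0) \<partial>lebesgue)"
      by (intro Bochner_Integration.integral_cong) auto
    also have "\<dots> = 0" unfolding Lebesgue_Measure.integral_restrict_UNIV[OF Ul] by (rule 0[OF that])
    finally show ?thesis .
  qed
  ultimately have "AE x in lebesgue. (if x \<in> U then f x else 0) = 0"
    by (rule AE_zero_if_box_integrals_zero)
  then show ?thesis using Ul by (auto simp: AE_restrict_space_iff elim: eventually_mono)
qed

lemma AE_zero_imp_integral_powr_zero:
  "AE x in M. f x = 0 \<Longrightarrow> (LINT x|M. norm (f x) powr q) = (0 :: real)"
  by (rule integral_eq_zero_AE) (auto elim: eventually_mono)

definition nth_box :: "nat \<Rightarrow> (real ^ 'n) set" where
  "nth_box = from_nat_into rational_boxes"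

lemma range_nth_box: "range (nth_box :: nat \<Rightarrow> (real ^ 'n) set) = rational_boxes"
  unfolding nth_box_def
  by (rule range_from_nat_into[OF _ countable_rational_boxes])
    (use open_Union_rational_boxes[of "UNIV :: (real ^ 'n) set"] in force)

lemma nth_box: "nth_box k \<in> rational_boxes"
  using range_nth_box by blast

theorem L_space_weak_limit:
  fixes f :: "nat \<Rightarrow> real ^ 'n \<Rightarrow> real"
  assumes U: "U \<in> lmeasurable" and q: "q \<ge> 2" and f: "\<And>n. f n \<in> L_space q U"
    and B: "\<And>n. (LINT x|lebesgue_on U. norm (f n x) powr q) \<le> B"
    and conv: "\<And>k. convergent (\<lambda>n. LINT x|lebesgue_on U. indicator (nth_box k) x * f n x)"
  shows "\<exists>v\<in>L_space q U. \<forall>l. bounded_functional (L_space q U) (L_norm q U) l \<longrightarrow> (\<lambda>n. l (f n)) \<longlonglongrightarrow> l v"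
proof -
  interpret L: uniformly_convex_space "L_space q U :: (real ^ 'n \<Rightarrow> real) set"
    "\<lambda>f. LINT x|lebesgue_on U. norm (f x) powr q" q
    by (rule L_space_uniformly_convex[OF q])
  have N: "L_norm q U = (\<lambda>f :: real ^ 'n \<Rightarrow> real. (LINT x|lebesgue_on U. norm (f x) powr q) powr (1 / q))"
    by (simp add: L_norm_def fun_eq_iff)
  show ?thesis
    unfolding N
  proof (rule L.weak_compactness[where T = "\<lambda>k f. LINT x|lebesgue_on U. indicator (nth_box k) x * f x", OF f B _ _ conv])
    show "L.functional (\<lambda>f. LINT x|lebesgue_on U. indicator (nth_box k) x * f x)" for k
      using box_functional[OF U _ nth_box, of q k] q unfolding N by simp
    fix v :: "real ^ 'n \<Rightarrow> real"
    assume v: "v \<in> L_space q U" "\<And>k. (LINT x|lebesgue_on U. indicator (nth_box k) x * v x) = 0"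
    show "(LINT x|lebesgue_on U. norm (v x) powr q) = 0"
    proof (rule AE_zero_imp_integral_powr_zero, rule box_integrals_separate[OF U v(1)])
      fix B :: "(real ^ 'n) set" assume "B \<in> rational_boxes"
      then obtain k where "B = nth_box k" using range_nth_box by blast
      then show "(LINT x|lebesgue_on U. indicator B x * v x) = 0" using v(2) by simp
    qed (use q in simp)
  qed
qed

text \<open>
  The weak limit of a bounded sequence is determined by its box integrals, so it must be \<open>w\<close>
  when these converge to those of \<open>w\<close>.
\<close>

corollary L_space_weak_convergence:
  fixes f :: "nat \<Rightarrow> real ^ 'n \<Rightarrow> real"
  assumes U: "U \<in> lmeasurable" and q: "q \<ge> 2" and f: "\<And>n. f n \<in> L_space q U"
    and B: "\<And>n. (LINT x|lebesgue_on U. norm (f n x) powr q) \<le> B" and w: "w \<in> L_space q U"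
    and conv: "\<And>B. B \<in> rational_boxes \<Longrightarrow> (\<lambda>n. LINT x|lebesgue_on U. indicator B x * f n x)
       \<longlonglongrightarrow> (LINT x|lebesgue_on U. indicator B x * w x)"
    and g: "g \<in> L_space (q / (q - 1)) U"
  shows "(\<lambda>n. LINT x|lebesgue_on U. g x * f n x) \<longlonglongrightarrow> (LINT x|lebesgue_on U. g x * w x)"
proof -
  have q1: "q > 1" using q by simp
  have "convergent (\<lambda>n. LINT x|lebesgue_on U. indicator (nth_box k) x * f n x)" for k
    using conv[OF nth_box] by (auto simp: convergent_def)
  from L_space_weak_limit[of U q f B, OF U q f B this] obtain v where v: "v \<in> L_space q U"
    "\<And>l. bounded_functional (L_space q U) (L_norm q U) l \<Longrightarrow> (\<lambda>n. l (f n)) \<longlonglongrightarrow> l v" by blast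
  have "AE x in lebesgue_on U. v x - w x = 0"
  proof (rule box_integrals_separate[OF U])
    show "(\<lambda>x. v x - w x) \<in> L_space q U" using v w q by (intro L_space_diff) auto
    fix B :: "(real ^ 'n) set" assume B: "B \<in> rational_boxes"
    then have "B \<in> sets borel" by (auto simp: rational_boxes_def)
    then have ind: "indicat_real B \<in> L_space (q / (q - 1)) U" by (intro indicator_L_space U) simp
    have "(LINT x|lebesgue_on U. indicator B x * v x) = (LINT x|lebesgue_on U. indicator B x * w x)"
      by (rule LIMSEQ_unique[OF v(2)[OF box_functional[OF U q1 B]] conv[OF B]])
    then show "(LINT x|lebesgue_on U. indicator B x * (v x - w x)) = 0"
      using L_space_pairing(1)[OF q1 v(1) ind] L_space_pairing(1)[OF q1 w ind]
      by (simp add: right_diff_distrib)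
  qed (use q in simp)
  then have ae: "AE x in lebesgue_on U. g x * v x = g x * w x" by (auto elim: eventually_mono)
  have "(LINT x|lebesgue_on U. g x * v x) = (LINT x|lebesgue_on U. g x * w x)"
    using L_space_pairing(1)[OF q1 v(1) g] L_space_pairing(1)[OF q1 w g]
    by (intro integral_cong_AE ae) auto
  then show ?thesis using v(2)[OF L_space_pairing_functional[OF q1 g]] by simp
qed

section \<open>Mollification\<close>

lemma frechet_derivative_partials:
  fixes f :: "real ^ 'n \<Rightarrow> 'b::real_normed_vector"
  assumes "f differentiable (at x)"
  shows "frechet_derivative f (at x) h = (\<Sum>i\<in>UNIV. h $ i *\<^sub>R partial_deriv i f x)"
proof -
  interpret linear "frechet_derivative f (at x)" using assms by (rule linear_frechet_derivative)
  have "frechet_derivative f (at x) h = frechet_derivative f (at x) (\<Sum>i\<in>UNIV. h $ i *\<^sub>R axis i 1)"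
    by (metis basis_expansion scalar_mult_eq_scaleR)
  then show ?thesis by (simp add: sum scale partial_deriv_def)
qed

lemma partial_deriv_affine:
  fixes f :: "real ^ 'n \<Rightarrow> 'b::real_normed_vector"
  assumes "f differentiable (at (a + c *\<^sub>R x))"
  shows "(\<lambda>x. f (a + c *\<^sub>R x)) differentiable (at x)"
    "partial_deriv i (\<lambda>x. f (a + c *\<^sub>R x)) x = c *\<^sub>R partial_deriv i f (a + c *\<^sub>R x)"
proof -
  obtain D where D: "(f has_derivative D) (at (a + c *\<^sub>R x))" using assms by (auto simp: differentiable_def)
  have *: "((\<lambda>x. f (a + c *\<^sub>R x)) has_derivative (\<lambda>h. D (c *\<^sub>R h))) (at x)"
    by (rule has_derivative_compose[of "\<lambda>x. a + c *\<^sub>R x" "\<lambda>h. c *\<^sub>R h" x UNIV, OF _ D])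
      (auto intro!: derivative_eq_intros)
  then show "(\<lambda>x. f (a + c *\<^sub>R x)) differentiable (at x)" by (auto simp: differentiable_def)
  have "D (c *\<^sub>R axis i 1) = c *\<^sub>R D (axis i 1)"
    using D has_derivative_linear linear_cmul by blast
  then show "partial_deriv i (\<lambda>x. f (a + c *\<^sub>R x)) x = c *\<^sub>R partial_deriv i f (a + c *\<^sub>R x)"
    by (simp add: partial_deriv_has_derivative[OF *] partial_deriv_has_derivative[OF D])
qed

lemma smooth_on_affine:
  fixes f :: "real ^ 'n \<Rightarrow> 'b::real_normed_vector"
  assumes "smooth_on UNIV f" shows "smooth_on UNIV (\<lambda>x. f (a + c *\<^sub>R x))"
proof -
  have "C_on k UNIV f \<Longrightarrow> C_on k UNIV (\<lambda>x. f (a + c *\<^sub>R x))" for k and f :: "real ^ 'n \<Rightarrow> 'b"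
  proof (induction k arbitrary: f)
    case 0
    then show ?case by (auto intro!: continuous_on_compose2[of UNIV f] continuous_intros)
  next
    case (Suc k)
    have "partial_deriv i (\<lambda>x. f (a + c *\<^sub>R x)) = (\<lambda>x. c *\<^sub>R partial_deriv i f (a + c *\<^sub>R x))" for i
      using Suc.prems by (intro ext partial_deriv_affine(2)) simp
    moreover have "C_on k UNIV (\<lambda>x. c *\<^sub>R partial_deriv i f (a + c *\<^sub>R x))" for i
      using Suc.IH[of "partial_deriv i f"] Suc.prems smooth_on_const[of c]
      by (intro C_on_scaleR) (auto simp: smooth_on_def)
    moreover have "(\<lambda>x. f (a + c *\<^sub>R x)) differentiable (at x)" for x
      using Suc.prems by (intro partial_deriv_affine(1)) simp
    ultimately show ?case by simp
  qed
  then show ?thesis using assms by (simp add: smooth_on_def)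
qed

lemma test_function_lipschitz:
  fixes \<rho> :: "real ^ 'n \<Rightarrow> real"
  assumes \<rho>: "\<rho> \<in> test_functions U"
  obtains L where "L > 0" "\<And>x y. \<bar>\<rho> x - \<rho> y\<bar> \<le> L * norm (x - y)"
    "\<And>x h. \<bar>frechet_derivative \<rho> (at x) h\<bar> \<le> L * norm h"
proof -
  have "\<forall>i. \<exists>C>0. \<forall>x. norm (partial_deriv i \<rho> x) \<le> C"
    using test_function_bounded[OF partial_deriv_test_function[OF \<rho>]] by metis
  then obtain C where C: "\<And>i. C i > 0" "\<And>i x. norm (partial_deriv i \<rho> x) \<le> C i" by metis
  define L where "L = (\<Sum>i\<in>UNIV. C i)"
  have L: "L > 0" unfolding L_def using C(1) by (intro sum_pos) auto
  have diff: "\<rho> differentiable (at x)" for x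
    by (rule smooth_on_UNIV_differentiable[OF test_function_props(1)[OF \<rho>]])
  have D: "\<bar>frechet_derivative \<rho> (at x) h\<bar> \<le> L * norm h" for x h
  proof -
    have "\<bar>frechet_derivative \<rho> (at x) h\<bar> \<le> (\<Sum>i\<in>UNIV. \<bar>h $ i *\<^sub>R partial_deriv i \<rho> x\<bar>)"
      unfolding frechet_derivative_partials[OF diff] by (rule sum_abs)
    also have "\<dots> \<le> (\<Sum>i\<in>UNIV. C i * norm h)"
    proof (rule sum_mono)
      fix i
      show "\<bar>h $ i *\<^sub>R partial_deriv i \<rho> x\<bar> \<le> C i * norm h"
        using mult_mono[OF C(2)[of i x] component_le_norm_cart[of h i]] C(1)[of i]
        by (simp add: abs_mult mult.commute)
    qed
    finally show ?thesis by (simp add: L_def sum_distrib_right)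
  qed
  have "norm (\<rho> x - \<rho> y) \<le> L * norm (x - y)" for x y
  proof (rule differentiable_bound[of UNIV \<rho> "\<lambda>x. frechet_derivative \<rho> (at x)"])
    show "(\<rho> has_derivative frechet_derivative \<rho> (at x)) (at x within UNIV)" for x
      using diff frechet_derivative_works by auto
    show "onorm (frechet_derivative \<rho> (at x)) \<le> L" for x
      using D L by (intro onorm_bound) auto
  qed auto
  with L D that show ?thesis by auto
qed

definition conv :: "(real ^ 'n \<Rightarrow> real) \<Rightarrow> (real ^ 'n \<Rightarrow> real) \<Rightarrow> real ^ 'n \<Rightarrow> real" where
  "conv w \<rho> x = (\<integral>y. w y * \<rho> (x - y) \<partial>lborel)"

lemma test_function_borel: "\<phi> \<in> test_functions U \<Longrightarrow> \<phi> \<in> borel_measurable borel"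
  by (intro borel_measurable_continuous_onI test_function_props)

lemma conv_integrable:
  fixes w :: "real ^ 'n \<Rightarrow> real"
  assumes w: "integrable lborel w" and \<rho>: "\<rho> \<in> test_functions U"
  shows "integrable lborel (\<lambda>y. w y * \<rho> (x - y))"
proof -
  obtain C where C: "C > 0" "\<And>x. norm (\<rho> x) \<le> C" using test_function_bounded[OF \<rho>] by blast
  have [measurable]: "\<rho> \<in> borel_measurable borel" by (rule test_function_borel[OF \<rho>])
  have [measurable]: "w \<in> borel_measurable borel" using w by auto
  have "integrable lborel (\<lambda>y. C * norm (w y))" using w by simp
  then show ?thesis
  proof (rule Bochner_Integration.integrable_bound)
    show "AE y in lborel. norm (w y * \<rho> (x - y)) \<le> norm (C * norm (w y))"
      using C by (auto simp: abs_mult mult.commute[of C] intro!: mult_left_mono)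
  qed simp
qed

text \<open>
  Differentiation under the integral sign. The remainder of the first-order expansion of \<open>\<rho>\<close>,
  divided by the norm of the increment, tends to zero pointwise and is bounded by twice the
  Lipschitz constant of \<open>\<rho>\<close>.
\<close>

lemma conv_has_derivative:
  fixes w :: "real ^ 'n \<Rightarrow> real"
  assumes w: "integrable lborel w" and \<rho>: "\<rho> \<in> test_functions U"
  shows "(conv w \<rho> has_derivative (\<lambda>h. \<Sum>i\<in>UNIV. h $ i * conv w (partial_deriv i \<rho>) x)) (at x)"
  unfolding has_derivative_at
proof
  let ?D = "\<lambda>h. \<Sum>i\<in>UNIV. h $ i * conv w (partial_deriv i \<rho>) x"
  show "bounded_linear ?D"
    by (intro bounded_linear_sum bounded_linear_mult_const bounded_linear_vec_nth)
  obtain L where L: "L > 0" "\<And>x y. \<bar>\<rho> x - \<rho> y\<bar> \<le> L * norm (x - y)"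
    "\<And>x h. \<bar>frechet_derivative \<rho> (at x) h\<bar> \<le> L * norm h"
    using test_function_lipschitz[OF \<rho>] by blast
  have [measurable]: "\<rho> \<in> borel_measurable borel" by (rule test_function_borel[OF \<rho>])
  have [measurable]: "partial_deriv i \<rho> \<in> borel_measurable borel" for i
    by (rule test_function_borel[OF partial_deriv_test_function[OF \<rho>]])
  have [measurable]: "w \<in> borel_measurable borel" using w by auto
  have diff: "\<rho> differentiable (at x)" for x
    by (rule smooth_on_UNIV_differentiable[OF test_function_props(1)[OF \<rho>]])
  define e where "e h y = (\<rho> (x + h - y) - \<rho> (x - y) - (\<Sum>i\<in>UNIV. h $ i * partial_deriv i \<rho> (x - y)))" for h y
  have e: "e h y = \<rho> ((x - y) + h) - \<rho> (x - y) - frechet_derivative \<rho> (at (x - y)) h" for h y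
    by (simp add: e_def frechet_derivative_partials[OF diff] algebra_simps)
  have eq: "conv w \<rho> (x + h) - conv w \<rho> x - ?D h = (\<integral>y. w y * e h y \<partial>lborel)" for h
  proof -
    have i: "integrable lborel (\<lambda>y. h $ i * (w y * partial_deriv i \<rho> (x - y)))" for i
      using conv_integrable[OF w partial_deriv_test_function[OF \<rho>]] by simp
    have "(\<integral>y. w y * e h y \<partial>lborel) = (\<integral>y. w y * \<rho> (x + h - y) - w y * \<rho> (x - y)
      - (\<Sum>i\<in>UNIV. h $ i * (w y * partial_deriv i \<rho> (x - y))) \<partial>lborel)"
      by (simp add: e_def right_diff_distrib sum_distrib_left mult.left_commute)
    also have "\<dots> = (\<integral>y. w y * \<rho> (x + h - y) \<partial>lborel) - (\<integral>y. w y * \<rho> (x - y) \<partial>lborel)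
      - (\<Sum>i\<in>UNIV. \<integral>y. h $ i * (w y * partial_deriv i \<rho> (x - y)) \<partial>lborel)"
      using i conv_integrable[OF w \<rho>]
      by (subst Bochner_Integration.integral_diff Bochner_Integration.integral_sum; simp)+
    finally show ?thesis by (simp add: conv_def)
  qed
  show "(\<lambda>h. norm (conv w \<rho> (x + h) - conv w \<rho> x - ?D h) / norm h) \<midarrow>0\<rightarrow> 0"
    unfolding tendsto_at_iff_sequentially
  proof (intro allI impI)
    fix h :: "nat \<Rightarrow> real ^ 'n" assume h: "\<forall>n. h n \<in> UNIV - {0}" "h \<longlonglongrightarrow> 0"
    have "(\<lambda>n. \<integral>y. w y * (e (h n) y / norm (h n)) \<partial>lborel) \<longlonglongrightarrow> (\<integral>y. w y * 0 \<partial>lborel)"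
    proof (rule integral_dominated_convergence)
      show "integrable lborel (\<lambda>y. (2 * L) * norm (w y))" using w by simp
      show "AE y in lborel. (\<lambda>n. w y * (e (h n) y / norm (h n))) \<longlonglongrightarrow> w y * 0"
      proof (intro AE_I2 tendsto_mult tendsto_const)
        fix y
        have "(\<rho> has_derivative frechet_derivative \<rho> (at (x - y))) (at (x - y))"
          using diff frechet_derivative_works by blast
        then have "(\<lambda>h. norm (e h y) / norm h) \<midarrow>0\<rightarrow> 0" unfolding has_derivative_at e by blast
        then have "(\<lambda>n. norm (e (h n) y) / norm (h n)) \<longlonglongrightarrow> 0"
          using h unfolding tendsto_at_iff_sequentially by (auto simp: o_def)
        then have "(\<lambda>n. norm (e (h n) y / norm (h n))) \<longlonglongrightarrow> 0" by simp
        then show "(\<lambda>n. e (h n) y / norm (h n)) \<longlonglongrightarrow> 0" by (rule tendsto_norm_zero_cancel)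
      qed
      show "AE y in lborel. norm (w y * (e (h n) y / norm (h n))) \<le> (2 * L) * norm (w y)" for n
      proof (rule AE_I2)
        fix y
        have "\<bar>e (h n) y\<bar> \<le> 2 * L * norm (h n)"
          unfolding e using L(2)[of "x - y + h n" "x - y"] L(3)[of "x - y" "h n"] by simp
        then have "\<bar>e (h n) y / norm (h n)\<bar> \<le> 2 * L"
          using h(1) by (simp add: divide_le_eq)
        from mult_left_mono[OF this, of "\<bar>w y\<bar>"]
        show "norm (w y * (e (h n) y / norm (h n))) \<le> (2 * L) * norm (w y)"
          by (simp add: abs_mult mult.commute)
      qed
    qed (unfold e_def, measurable)
    then have "(\<lambda>n. norm ((\<integral>y. w y * e (h n) y \<partial>lborel) / norm (h n))) \<longlonglongrightarrow> 0"
      by (intro tendsto_norm_zero) simp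
    then show "((\<lambda>h. norm (conv w \<rho> (x + h) - conv w \<rho> x - ?D h) / norm h) \<circ> h) \<longlonglongrightarrow> 0"
      unfolding eq by (simp add: o_def)
  qed
qed

lemma partial_deriv_conv:
  fixes w :: "real ^ 'n \<Rightarrow> real"
  assumes w: "integrable lborel w" and \<rho>: "\<rho> \<in> test_functions U"
  shows "partial_deriv i (conv w \<rho>) = conv w (partial_deriv i \<rho>)"
proof
  fix x
  have "(\<Sum>j\<in>UNIV. axis i 1 $ j * conv w (partial_deriv j \<rho>) x)
    = (\<Sum>j\<in>UNIV. if j = i then conv w (partial_deriv j \<rho>) x else 0)"
    by (intro sum.cong) (auto simp: axis_def)
  then show "partial_deriv i (conv w \<rho>) x = conv w (partial_deriv i \<rho>) x"
    by (simp add: partial_deriv_has_derivative[OF conv_has_derivative[OF w \<rho>]])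
qed

lemma smooth_on_conv:
  fixes w :: "real ^ 'n \<Rightarrow> real"
  assumes w: "integrable lborel w" and \<rho>: "\<rho> \<in> test_functions U"
  shows "smooth_on UNIV (conv w \<rho>)"
proof -
  have d: "conv w \<rho> differentiable (at x)" if "\<rho> \<in> test_functions U" for \<rho> x
    using conv_has_derivative[OF w that] by (auto simp: differentiable_def)
  have "C_on k UNIV (conv w \<rho>)" if "\<rho> \<in> test_functions U" for k \<rho>
    using that
  proof (induction k arbitrary: \<rho>)
    case 0
    then show ?case using d by (auto intro!: continuous_at_imp_continuous_on differentiable_imp_continuous_within)
  next
    case (Suc k)
    then show ?case using d by (simp add: partial_deriv_conv[OF w Suc.prems] partial_deriv_test_function)
  qed
  then show ?thesis using \<rho> by (simp add: smooth_on_def)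
qed

lemma lborel_affine_integral:
  fixes f :: "'a::euclidean_space \<Rightarrow> real" and t :: 'a
  assumes [measurable]: "f \<in> borel_measurable borel" and c: "c \<noteq> 0"
  shows "integrable lborel (\<lambda>x. f (t + c *\<^sub>R x)) \<longleftrightarrow> integrable lborel f"
    "(\<integral>x. f x \<partial>lborel) = \<bar>c\<bar> ^ DIM('a) * (\<integral>x. f (t + c *\<^sub>R x) \<partial>lborel)"
proof -
  have [measurable]: "(\<lambda>x::'a. t + c *\<^sub>R x) \<in> borel_measurable borel" by measurable
  have "integrable lborel f \<longleftrightarrow> integrable (density (distr lborel borel (\<lambda>x. t + c *\<^sub>R x)) (\<lambda>_. \<bar>c\<bar>^DIM('a))) f"
    by (subst lborel_affine[OF c, of t]) simp
  also have "\<dots> \<longleftrightarrow> integrable lborel (\<lambda>x. f (t + c *\<^sub>R x))"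
    using c by (simp add: integrable_density integrable_distr_eq)
  finally show "integrable lborel (\<lambda>x. f (t + c *\<^sub>R x)) \<longleftrightarrow> integrable lborel f" by simp
  have "(\<integral>x. f x \<partial>lborel) = (\<integral>x. f x \<partial>density (distr lborel borel (\<lambda>x. t + c *\<^sub>R x)) (\<lambda>_. \<bar>c\<bar>^DIM('a)))"
    by (subst lborel_affine[OF c, of t]) simp
  also have "\<dots> = \<bar>c\<bar> ^ DIM('a) * (\<integral>x. f (t + c *\<^sub>R x) \<partial>lborel)"
    using c by (simp add: integral_density integral_distr)
  finally show "(\<integral>x. f x \<partial>lborel) = \<bar>c\<bar> ^ DIM('a) * (\<integral>x. f (t + c *\<^sub>R x) \<partial>lborel)" .
qed

lemma lborel_reflection:
  fixes f :: "'a::euclidean_space \<Rightarrow> real" and t :: 'a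
  assumes "f \<in> borel_measurable borel"
  shows "integrable lborel (\<lambda>x. f (t - x)) \<longleftrightarrow> integrable lborel f" "(\<integral>x. f (t - x) \<partial>lborel) = (\<integral>x. f x \<partial>lborel)"
  using lborel_affine_integral[OF assms, of "-1" t] by auto

lemma lborel_translation:
  fixes f :: "'a::euclidean_space \<Rightarrow> real" and t :: 'a
  assumes "f \<in> borel_measurable borel"
  shows "integrable lborel (\<lambda>x. f (x - t)) \<longleftrightarrow> integrable lborel f" "(\<integral>x. f (x - t) \<partial>lborel) = (\<integral>x. f x \<partial>lborel)"
  using lborel_affine_integral[OF assms, of 1 "-t"] by auto

lemma test_function_integrable:
  fixes \<phi> :: "real ^ 'n \<Rightarrow> real"
  assumes "\<phi> \<in> test_functions U" shows "integrable lborel \<phi>"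
proof -
  have "\<phi> \<in> L_space 1 UNIV" by (rule test_function_L_space[OF assms]) auto
  then have "integrable lebesgue (\<lambda>x. norm (\<phi> x))" by (simp add: L_space_def lebesgue_on_UNIV_eq)
  then have "integrable lborel (\<lambda>x. norm (\<phi> x))"
    using test_function_borel[OF assms] by (subst (asm) integrable_completion) auto
  then show ?thesis using test_function_borel[OF assms] by (subst (asm) integrable_norm_iff) auto
qed

text \<open>
  For \<open>j = 0\<close> and \<open>t > 0\<close> this is a smooth cut-off supported in the ball of radius \<open>1 / sqrt t\<close>
  around \<open>c\<close>. Being a function of \<open>t \<bar>y - c\<bar>\<^sup>2\<close>, it leads from \<open>j\<close> to \<open>Suc j\<close> under
  differentiation in \<open>y\<close> as well as in \<open>t\<close>.
\<close>

definition radial :: "nat \<Rightarrow> real \<Rightarrow> real ^ 'n \<Rightarrow> real ^ 'n \<Rightarrow> real" where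
  "radial j t c y = flat j (1 - t * (norm (y - c))\<^sup>2)"

lemma has_derivative_norm_square:
  fixes c :: "'a::real_inner"
  shows "((\<lambda>y. (norm (y - c))\<^sup>2) has_derivative (\<lambda>h. 2 * ((y - c) \<bullet> h))) (at y)"
  unfolding power2_norm_eq_inner by (auto intro!: derivative_eq_intros simp: inner_commute)

lemma smooth_on_norm_square: "smooth_on UNIV (\<lambda>y :: real ^ 'n. 1 - t * (norm (y - c))\<^sup>2)"
proof -
  have "smooth_on UNIV (\<lambda>y :: real ^ 'n. 1 + (- t) * (\<Sum>i\<in>UNIV. (y $ i + (- c $ i)) * (y $ i + (- c $ i))))"
    by (intro smooth_on_add smooth_on_mult smooth_on_sum smooth_on_const smooth_on_component)
  moreover have "(norm (y - c))\<^sup>2 = (\<Sum>i\<in>UNIV. (y $ i + (- c $ i)) * (y $ i + (- c $ i)))" for y :: "real ^ 'n"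
    by (simp add: power2_norm_eq_inner inner_vec_def)
  ultimately show ?thesis by simp
qed

lemma smooth_on_radial: "smooth_on UNIV (radial j t c)"
  unfolding radial_def[abs_def] by (intro smooth_on_flat smooth_on_norm_square)

lemma partial_deriv_radial:
  "partial_deriv i (radial j t c) y = radial (Suc j) t c y * (- 2 * t * (y $ i - c $ i))"
proof -
  have d: "((\<lambda>y. 1 - t * (norm (y - c))\<^sup>2) has_derivative (\<lambda>h. - (t * (2 * ((y - c) \<bullet> h))))) (at y)"
    using has_derivative_diff[OF has_derivative_const[of 1] has_derivative_mult_right[OF has_derivative_norm_square[of c y], of t]]
    by simp
  then have "partial_deriv i (\<lambda>y. 1 - t * (norm (y - c))\<^sup>2) y = - 2 * t * (y $ i - c $ i)"
    by (simp add: partial_deriv_has_derivative inner_axis)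
  then show ?thesis
    unfolding radial_def using partial_deriv_compose(2)[of "flat j" "flat (Suc j) (1 - t * (norm (y - c))\<^sup>2)"
        "\<lambda>y. 1 - t * (norm (y - c))\<^sup>2" y i, OF DERIV_flat] d
    by (auto simp: differentiable_def)
qed

lemma radial_zero:
  assumes "t > 0" "norm (y - c) \<ge> 1 / sqrt t"
  shows "radial j t c y = 0"
proof -
  have "(1 / sqrt t)\<^sup>2 \<le> (norm (y - c))\<^sup>2" using assms by (intro power_mono) auto
  then have "1 \<le> t * (norm (y - c))\<^sup>2" using assms(1) by (simp add: power_divide field_simps)
  then show ?thesis by (simp add: radial_def flat_nonpos)
qed

lemma radial_test_function:
  assumes t: "t > 0" and sub: "cball c (1 / sqrt t) \<subseteq> U"
  shows "radial j t c \<in> test_functions U"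
  by (rule test_functionI[OF smooth_on_radial compact_cball sub])
    (use t in \<open>auto simp: dist_norm norm_minus_commute intro!: radial_zero\<close>)

text \<open>
  The scale \<open>(k + 1)\<^sup>2\<close> makes the support the ball of radius \<open>1 / (k + 1)\<close>.
\<close>

definition mollifier :: "nat \<Rightarrow> real ^ 'n \<Rightarrow> real" where
  "mollifier k z = radial 0 ((real (Suc k))\<^sup>2) 0 z / (\<integral>z. radial 0 ((real (Suc k))\<^sup>2) 0 z \<partial>(lborel :: (real ^ 'n) measure))"

lemma radial_integral_pos:
  assumes t: "t > 0"
  shows "0 < (\<integral>z. radial 0 t c z \<partial>(lborel :: (real ^ 'n) measure))"
proof -
  have i: "integrable lborel (radial 0 t c :: real ^ 'n \<Rightarrow> real)"
    using radial_test_function[OF t, of c UNIV 0] by (intro test_function_integrable[of _ UNIV]) simp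
  have nn: "0 \<le> radial 0 t c z" for z by (simp add: radial_def flat_0_nonneg)
  have "(\<integral>z. radial 0 t c z \<partial>lborel) \<noteq> 0"
  proof
    assume "(\<integral>z. radial 0 t c z \<partial>lborel) = 0"
    then have "AE z in lborel. radial 0 t c z = 0"
      using integral_nonneg_eq_0_iff_AE[OF i] nn by simp
    then have "AE z in lborel. z \<notin> ball c (1 / sqrt t)"
    proof eventually_elim
      case (elim z)
      show ?case
      proof
        assume "z \<in> ball c (1 / sqrt t)"
        then have "(norm (z - c))\<^sup>2 < (1 / sqrt t)\<^sup>2"
          by (intro power_strict_mono) (auto simp: dist_norm norm_minus_commute)
        then have "t * (norm (z - c))\<^sup>2 < 1" using t by (simp add: power_divide field_simps)
        then show False using elim by (simp add: radial_def flat_0)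
      qed
    qed
    then have "emeasure lborel (ball c (1 / sqrt t)) = 0"
      by (subst (asm) AE_iff_measurable[OF _ refl]) (auto simp: ball_def)
    then have "ball c (1 / sqrt t) \<in> null_sets lborel" by (auto simp: null_sets_def)
    then have "negligible (ball c (1 / sqrt t))" by (simp add: negligible_iff_null_sets null_sets_completionI)
    then show False using open_not_negligible[of "ball c (1 / sqrt t)"] t by simp
  qed
  then show ?thesis using Bochner_Integration.integral_nonneg[of lborel "radial 0 t c"] nn by (simp add: less_le)
qed

lemma mollifier_props:
  shows "mollifier k \<in> test_functions (UNIV :: (real ^ 'n) set)" "0 \<le> mollifier k (z :: real ^ 'n)"
    "(\<integral>z. mollifier k z \<partial>(lborel :: (real ^ 'n) measure)) = 1"
    "norm z \<ge> 1 / real (Suc k) \<Longrightarrow> mollifier k z = 0"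
proof -
  let ?t = "(real (Suc k))\<^sup>2"
  define c where "c = (\<integral>z. radial 0 ?t 0 z \<partial>(lborel :: (real ^ 'n) measure))"
  have c: "c > 0" unfolding c_def by (rule radial_integral_pos) simp
  have m: "mollifier k = (\<lambda>z :: real ^ 'n. (1 / c) * radial 0 ?t 0 z)"
    by (auto simp: mollifier_def c_def)
  have sq: "sqrt ?t = real (Suc k)" by simp
  show z: "mollifier k z = 0" if "norm z \<ge> 1 / real (Suc k)" for z :: "real ^ 'n"
    using radial_zero[of ?t z 0 0] that unfolding m sq by simp
  show "mollifier k \<in> test_functions (UNIV :: (real ^ 'n) set)"
  proof (rule test_functionI[of _ "cball 0 (1 / real (Suc k))"])
    show "smooth_on UNIV (mollifier k :: real ^ 'n \<Rightarrow> real)"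
      unfolding m by (intro smooth_on_mult smooth_on_const smooth_on_radial)
  qed (use z in auto)
  show "0 \<le> mollifier k z" using c by (simp add: m radial_def flat_0_nonneg)
  show "(\<integral>z. mollifier k z \<partial>(lborel :: (real ^ 'n) measure)) = 1"
    unfolding m using c by (simp add: c_def)
qed

text \<open>
  Jensen's inequality for the probability density \<open>y \<mapsto> \<rho> (x - y)\<close>. With \<open>m = \<bar>conv w \<rho> x\<bar>\<close>,
  Young's inequality bounds \<open>\<bar>w y\<bar> m\<^bsup>q-1\<^esup>\<close> by \<open>\<bar>w y\<bar>\<^bsup>q\<^esup> / q + m\<^bsup>q\<^esup> / q'\<close>; integrating against
  the density leaves \<open>m\<^bsup>q\<^esup>\<close> on both sides.
\<close>

lemma conv_powr_le:
  fixes w :: "real ^ 'n \<Rightarrow> real"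
  assumes q: "q > 1" and w: "integrable lborel w" and wq: "integrable lborel (\<lambda>y. \<bar>w y\<bar> powr q)"
    and \<rho>: "\<rho> \<in> test_functions U" "\<And>z. 0 \<le> \<rho> z" "(\<integral>z. \<rho> z \<partial>lborel) = 1"
  shows "\<bar>conv w \<rho> x\<bar> powr q \<le> conv (\<lambda>y. \<bar>w y\<bar> powr q) \<rho> x"
proof -
  define m where "m = \<bar>conv w \<rho> x\<bar>"
  have m0: "m \<ge> 0" by (simp add: m_def)
  define q' where "q' = q / (q - 1)"
  have q': "q' > 1" "1 / q + 1 / q' = 1" using q by (auto simp: q'_def field_simps)
  have i0: "integrable lborel (\<lambda>y. \<rho> (x - y))" "(\<integral>y. \<rho> (x - y) \<partial>lborel) = 1"
    using lborel_reflection[OF test_function_borel[OF \<rho>(1)]] test_function_integrable[OF \<rho>(1)] \<rho>(3) by auto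
  have i1: "integrable lborel (\<lambda>y. \<bar>w y\<bar> * \<rho> (x - y))"
    using conv_integrable[OF integrable_abs[OF w] \<rho>(1)] .
  have i2: "integrable lborel (\<lambda>y. \<bar>w y\<bar> powr q * \<rho> (x - y))"
    using conv_integrable[OF wq \<rho>(1)] .
  have mq: "m powr (q - 1) * m = m powr q"
    using m0 by (cases "m = 0") (auto simp: powr_mult_base mult.commute[of _ m])
  have mq': "(m powr (q - 1)) powr q' = m powr q"
    using q by (simp add: powr_powr q'_def)
  have "m \<le> (\<integral>y. \<bar>w y * \<rho> (x - y)\<bar> \<partial>lborel)" unfolding m_def conv_def by (rule integral_abs_bound)
  also have "\<dots> = (\<integral>y. \<bar>w y\<bar> * \<rho> (x - y) \<partial>lborel)" using \<rho>(2) by (simp add: abs_mult)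
  finally have "m powr (q - 1) * m \<le> m powr (q - 1) * (\<integral>y. \<bar>w y\<bar> * \<rho> (x - y) \<partial>lborel)"
    by (intro mult_left_mono) auto
  also have "\<dots> = (\<integral>y. (\<bar>w y\<bar> * m powr (q - 1)) * \<rho> (x - y) \<partial>lborel)"
    by (simp add: mult.assoc mult.left_commute flip: Bochner_Integration.integral_mult_right_zero)
  also have "\<dots> \<le> (\<integral>y. (1 / q) * (\<bar>w y\<bar> powr q * \<rho> (x - y)) + (m powr q / q') * \<rho> (x - y) \<partial>lborel)"
  proof (rule integral_mono)
    show "integrable lborel (\<lambda>y. (\<bar>w y\<bar> * m powr (q - 1)) * \<rho> (x - y))"
      using integrable_mult_left[OF i1, of "m powr (q - 1)"] by (simp add: mult_ac)
    show "integrable lborel (\<lambda>y. (1 / q) * (\<bar>w y\<bar> powr q * \<rho> (x - y)) + (m powr q / q') * \<rho> (x - y))"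
      by (intro Bochner_Integration.integrable_add integrable_mult_right i0 i2)
    fix y
    have "\<bar>w y\<bar> * m powr (q - 1) \<le> \<bar>w y\<bar> powr q / q + (m powr (q - 1)) powr q' / q'"
      using q q' by (intro Youngs_inequality) auto
    then have "(\<bar>w y\<bar> * m powr (q - 1)) * \<rho> (x - y) \<le> (\<bar>w y\<bar> powr q / q + m powr q / q') * \<rho> (x - y)"
      unfolding mq' by (intro mult_right_mono \<rho>(2))
    then show "(\<bar>w y\<bar> * m powr (q - 1)) * \<rho> (x - y) \<le> (1 / q) * (\<bar>w y\<bar> powr q * \<rho> (x - y)) + (m powr q / q') * \<rho> (x - y)"
      by (simp add: distrib_right)
  qed
  also have "\<dots> = (1 / q) * conv (\<lambda>y. \<bar>w y\<bar> powr q) \<rho> x + m powr q / q'"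
    by (subst Bochner_Integration.integral_add) (use i0 i2 in \<open>auto simp: conv_def\<close>)
  finally have "m powr q \<le> (1 / q) * conv (\<lambda>y. \<bar>w y\<bar> powr q) \<rho> x + m powr q * (1 / q')"
    unfolding mq by simp
  then have "m powr q * (1 - 1 / q') \<le> (1 / q) * conv (\<lambda>y. \<bar>w y\<bar> powr q) \<rho> x"
    by (simp add: right_diff_distrib)
  also have "1 - 1 / q' = 1 / q" using q'(2) by simp
  finally show ?thesis using q by (simp add: m_def divide_right_mono field_simps)
qed

lemma conv_Fubini:
  fixes w :: "real ^ 'n \<Rightarrow> real"
  assumes w: "integrable lborel w" and \<rho>: "\<rho> \<in> test_functions U" and [measurable]: "B \<in> sets borel"
  shows "integrable lborel (\<lambda>x. indicator B x * conv w \<rho> x)"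
    "(\<integral>x. indicator B x * conv w \<rho> x \<partial>lborel) = (\<integral>y. w y * (\<integral>x. indicator B x * \<rho> (x - y) \<partial>lborel) \<partial>lborel)"
proof -
  have [measurable]: "\<rho> \<in> borel_measurable borel" by (rule test_function_borel[OF \<rho>])
  have [measurable]: "w \<in> borel_measurable borel" using w by auto
  have r: "integrable lborel \<rho>" by (rule test_function_integrable[OF \<rho>])
  have i: "integrable lborel (\<lambda>x. \<rho> (x - y))" "(\<integral>x. \<bar>\<rho> (x - y)\<bar> \<partial>lborel) = (\<integral>x. \<bar>\<rho> x\<bar> \<partial>lborel)" for y
    using lborel_translation(1)[of \<rho> y] lborel_translation(2)[of "\<lambda>x. \<bar>\<rho> x\<bar>" y] r by auto
  have iB: "integrable lborel (\<lambda>x. indicator B x * \<rho> (x - y))" for y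
    by (rule Bochner_Integration.integrable_bound[OF i(1)[of y]]) (auto simp: indicator_def)
  define F where "F = (\<lambda>(y, x). w y * (indicator B x * \<rho> (x - y)))"
  have F[measurable]: "F \<in> borel_measurable (lborel \<Otimes>\<^sub>M lborel)" unfolding F_def by measurable
  have "integrable (lborel \<Otimes>\<^sub>M lborel) F"
  proof (rule lborel_pair.Fubini_integrable[OF F])
    show "integrable lborel (\<lambda>y. \<integral>x. norm (F (y, x)) \<partial>lborel)"
    proof (rule Bochner_Integration.integrable_bound)
      show "integrable lborel (\<lambda>y. (\<integral>x. \<bar>\<rho> x\<bar> \<partial>lborel) * w y)" using w by simp
      show "AE y in lborel. norm (\<integral>x. norm (F (y, x)) \<partial>lborel) \<le> norm ((\<integral>x. \<bar>\<rho> x\<bar> \<partial>lborel) * w y)"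
      proof (rule AE_I2)
        fix y
        have "(\<integral>x. norm (F (y, x)) \<partial>lborel) = \<bar>w y\<bar> * (\<integral>x. \<bar>indicator B x * \<rho> (x - y)\<bar> \<partial>lborel)"
          by (simp add: F_def abs_mult)
        also have "\<dots> \<le> \<bar>w y\<bar> * (\<integral>x. \<bar>\<rho> (x - y)\<bar> \<partial>lborel)"
          using iB[of y] i(1)[of y] by (intro mult_left_mono integral_mono) (auto simp: indicator_def)
        finally show "norm (\<integral>x. norm (F (y, x)) \<partial>lborel) \<le> norm ((\<integral>x. \<bar>\<rho> x\<bar> \<partial>lborel) * w y)"
          by (simp add: i(2) abs_mult mult.commute Bochner_Integration.integral_nonneg)
      qed
    qed simp
    show "AE y in lborel. integrable lborel (\<lambda>x. F (y, x))" using iB by (simp add: F_def)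
  qed
  then have int: "integrable (lborel \<Otimes>\<^sub>M lborel) (case_prod (\<lambda>y x. w y * (indicator B x * \<rho> (x - y))))"
    by (simp add: F_def)
  have eq: "(\<integral>y. w y * (indicator B x * \<rho> (x - y)) \<partial>lborel) = indicator B x * conv w \<rho> x" for x
    by (cases "x \<in> B") (auto simp: conv_def)
  show "integrable lborel (\<lambda>x. indicator B x * conv w \<rho> x)"
    using lborel_pair.integrable_snd[OF int] unfolding eq .
  show "(\<integral>x. indicator B x * conv w \<rho> x \<partial>lborel) = (\<integral>y. w y * (\<integral>x. indicator B x * \<rho> (x - y) \<partial>lborel) \<partial>lborel)"
    using lborel_pair.Fubini_integral[OF int] unfolding eq by simp
qed

lemma mollifier_box_average:
  fixes y :: "real ^ 'n"
  assumes B: "B \<in> sets borel"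
  shows "0 \<le> (\<integral>x. indicator B x * mollifier k (x - y) \<partial>lborel)"
    "(\<integral>x. indicator B x * mollifier k (x - y) \<partial>lborel) \<le> 1"
    "ball y (1 / real (Suc k)) \<subseteq> B \<Longrightarrow> (\<integral>x. indicator B x * mollifier k (x - y) \<partial>lborel) = 1" "ball y (1 / real (Suc k)) \<inter> B = {} \<Longrightarrow> (\<integral>x. indicator B x * mollifier k (x - y) \<partial>lborel) = 0"
proof -
  have [measurable]: "B \<in> sets borel" by (rule B)
  note m = mollifier_props[where 'n = 'n]
  have bm[measurable]: "mollifier k \<in> borel_measurable (borel :: (real ^ 'n) measure)"
    by (rule test_function_borel[OF m(1)])
  have i: "integrable lborel (\<lambda>x. mollifier k (x - y))" "(\<integral>x. mollifier k (x - y) \<partial>lborel) = 1"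
    using lborel_translation[OF bm, of y] test_function_integrable[OF m(1)] m(3) by auto
  have iB: "integrable lborel (\<lambda>x. indicator B x * mollifier k (x - y))"
    by (rule Bochner_Integration.integrable_bound[OF i(1)]) (auto simp: indicator_def)
  show "0 \<le> (\<integral>x. indicator B x * mollifier k (x - y) \<partial>lborel)" using m(2) by (intro Bochner_Integration.integral_nonneg) auto
  have "(\<integral>x. indicator B x * mollifier k (x - y) \<partial>lborel) \<le> (\<integral>x. mollifier k (x - y) \<partial>lborel)"
    using iB i m(2) by (intro integral_mono) (auto simp: indicator_def)
  then show "(\<integral>x. indicator B x * mollifier k (x - y) \<partial>lborel) \<le> 1" using i by simp
  show "(\<integral>x. indicator B x * mollifier k (x - y) \<partial>lborel) = 1" if "ball y (1 / real (Suc k)) \<subseteq> B"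
  proof -
    have *: "indicator B x * mollifier k (x - y) = mollifier k (x - y)" for x
    proof (cases "x \<in> B")
      case False
      then have "norm (x - y) \<ge> 1 / real (Suc k)" using that by (auto simp: dist_norm norm_minus_commute not_less subset_eq)
      then show ?thesis using m(4) by simp
    qed simp
    show ?thesis unfolding * by (rule i(2))
  qed
  show "(\<integral>x. indicator B x * mollifier k (x - y) \<partial>lborel) = 0" if "ball y (1 / real (Suc k)) \<inter> B = {}"
  proof -
    have *: "indicator B x * mollifier k (x - y) = 0" for x
    proof (cases "x \<in> B")
      case True
      then have "norm (x - y) \<ge> 1 / real (Suc k)" using that by (auto simp: dist_norm norm_minus_commute disjoint_iff intro: leI)
      then show ?thesis using m(4) by simp
    qed simp
    show ?thesis unfolding * by simp
  qed
qed

text \<open>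
  By Fubini's theorem the mollifier may be moved to the indicator of the box, and the averages
  of the indicator converge to it off the boundary of the box, a null set.
\<close>

lemma conv_mollifier_box_tendsto:
  fixes w :: "real ^ 'n \<Rightarrow> real"
  assumes w: "integrable lborel w"
  shows "(\<lambda>k. \<integral>x. indicator (box a b) x * conv w (mollifier k) x \<partial>lborel) \<longlonglongrightarrow> (\<integral>x. indicator (box a b) x * w x \<partial>lborel)"
proof -
  have [measurable]: "w \<in> borel_measurable borel" using w by auto
  have [measurable]: "mollifier k \<in> borel_measurable (borel :: (real ^ 'n) measure)" for k
    by (rule test_function_borel[OF mollifier_props(1)])
  define A where "A k y = (\<integral>x. indicator (box a b) x * mollifier k (x - y) \<partial>lborel)" for k y
  have A: "0 \<le> A k y" "A k y \<le> 1" for k y unfolding A_def by (intro mollifier_box_average; simp)+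
  have lim: "(\<lambda>k. A k y) \<longlonglongrightarrow> indicator (box a b) y" if y: "y \<notin> cbox a b - box a b" for y
  proof (cases "y \<in> box a b")
    case True
    then obtain e where e: "e > 0" "ball y e \<subseteq> box a b" using open_box openE by blast
    obtain N where N: "1 / real (Suc N) < e" using nat_approx_posE[OF e(1)] by blast
    have "A k y = 1" if "k \<ge> N" for k
    proof -
      have "1 / real (Suc k) \<le> 1 / real (Suc N)" using that by (simp add: frac_le)
      then have "ball y (1 / real (Suc k)) \<subseteq> ball y e" using N by (intro subset_ball) simp
      then show ?thesis unfolding A_def using e(2) by (intro mollifier_box_average(3)) auto
    qed
    then have "\<forall>\<^sub>F k in sequentially. A k y = 1" unfolding eventually_sequentially by blast
    then show ?thesis using True by (simp add: tendsto_eventually)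
  next
    case False
    then have "y \<in> - cbox a b" using y by auto
    then obtain e where e: "e > 0" "ball y e \<subseteq> - cbox a b" using closed_cbox open_Compl openE by blast
    obtain N where N: "1 / real (Suc N) < e" using nat_approx_posE[OF e(1)] by blast
    have "A k y = 0" if "k \<ge> N" for k
    proof -
      have "1 / real (Suc k) \<le> 1 / real (Suc N)" using that by (simp add: frac_le)
      then have "ball y (1 / real (Suc k)) \<subseteq> ball y e" using N by (intro subset_ball) simp
      then show ?thesis unfolding A_def using e(2) box_subset_cbox[of a b]
        by (intro mollifier_box_average(4)) auto
    qed
    then have "\<forall>\<^sub>F k in sequentially. A k y = 0" unfolding eventually_sequentially by blast
    then show ?thesis using False by (simp add: tendsto_eventually)
  qed
  have null: "AE y in lborel. y \<notin> cbox a b - box a b"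
  proof (rule AE_not_in)
    have "cbox a b - box a b \<in> null_sets lebesgue"
      using negligible_frontier_interval negligible_iff_null_sets by blast
    then show "cbox a b - box a b \<in> null_sets lborel" by (subst (asm) null_sets_completion_iff) auto
  qed
  have [measurable]: "A k \<in> borel_measurable borel" for k unfolding A_def[abs_def] by measurable
  have "(\<lambda>k. \<integral>y. w y * A k y \<partial>lborel) \<longlonglongrightarrow> (\<integral>y. w y * indicator (box a b) y \<partial>lborel)"
  proof (rule integral_dominated_convergence)
    show "integrable lborel (\<lambda>y. norm (w y))" using w by simp
    show "AE y in lborel. (\<lambda>k. w y * A k y) \<longlonglongrightarrow> w y * indicator (box a b) y"
      using null by eventually_elim (intro tendsto_intros lim)
    show "AE y in lborel. norm (w y * A k y) \<le> norm (w y)" for k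
      using A by (auto simp: abs_mult mult_left_le)
  qed measurable
  then show ?thesis
    by (simp add: conv_Fubini(2)[OF w mollifier_props(1)] A_def mult.commute)
qed

lemma lebesgue_on_eq_lborel:
  fixes h :: "'a::euclidean_space \<Rightarrow> real"
  assumes [measurable]: "h \<in> borel_measurable borel" "U \<in> sets borel"
  shows "integrable (lebesgue_on U) h \<longleftrightarrow> integrable lborel (\<lambda>x. indicator U x * h x)"
    "(LINT x|lebesgue_on U. h x) = (\<integral>x. indicator U x * h x \<partial>lborel)"
proof -
  have U: "U \<in> sets lebesgue" by simp
  have eq: "(\<lambda>x. if x \<in> U then h x else 0) = (\<lambda>x. indicator U x * h x)" by (auto simp: indicator_def)
  have m: "(\<lambda>x. indicator U x * h x) \<in> borel_measurable lborel" by simp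
  show "integrable (lebesgue_on U) h \<longleftrightarrow> integrable lborel (\<lambda>x. indicator U x * h x)"
    using integrable_completion[OF m] Lebesgue_Measure.integrable_restrict_UNIV[OF U, of h] unfolding eq by simp
  show "(LINT x|lebesgue_on U. h x) = (\<integral>x. indicator U x * h x \<partial>lborel)"
    using integral_completion[OF m] Lebesgue_Measure.integral_restrict_UNIV[OF U, of h] unfolding eq by simp
qed

lemma compact_neighbourhood:
  fixes K :: "'a::euclidean_space set"
  assumes K: "compact K" and U: "open U" "K \<subseteq> U"
  obtains e where "e > 0" "compact {x + z |x z. x \<in> K \<and> z \<in> cball 0 e}" "{x + z |x z. x \<in> K \<and> z \<in> cball 0 e} \<subseteq> U"
proof -
  obtain d where d: "d > 0" "(\<Union>x\<in>K. ball x d) \<subseteq> U"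
    using compact_subset_open_imp_ball_epsilon_subset[OF K U] by blast
  have "compact {x + z |x z. x \<in> K \<and> z \<in> cball 0 (d/2)}"
    by (rule compact_sums[OF K compact_cball])
  moreover have "{x + z |x z. x \<in> K \<and> z \<in> cball 0 (d/2)} \<subseteq> U"
  proof safe
    fix x z :: 'a assume "x \<in> K" "z \<in> cball 0 (d/2)"
    then have "x + z \<in> ball x d" using d(1) by (simp add: dist_norm)
    then show "x + z \<in> U" using d(2) \<open>x \<in> K\<close> by blast
  qed
  ultimately show ?thesis using that[of "d/2"] d(1) by auto
qed

lemma conv_mollifier_test_function:
  fixes w :: "real ^ 'n \<Rightarrow> real"
  assumes w: "integrable lborel w" and K: "compact K" "\<And>x. x \<notin> K \<Longrightarrow> w x = 0" and U: "open U" "K \<subseteq> U"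
  shows "\<forall>\<^sub>F k in sequentially. conv w (mollifier k) \<in> test_functions U"
proof -
  obtain e where e: "e > 0" and C: "compact {x + z |x z. x \<in> K \<and> z \<in> cball 0 e}" "{x + z |x z. x \<in> K \<and> z \<in> cball 0 e} \<subseteq> U"
    using compact_neighbourhood[OF K(1) U] by blast
  have "\<forall>\<^sub>F k in sequentially. 1 / real (Suc k) < e"
    using lim_inverse_n'[THEN LIMSEQ_Suc] e by (rule order_tendstoD(2))
  then show ?thesis
  proof eventually_elim
    case (elim k)
    show ?case
    proof (rule test_functionI[OF smooth_on_conv[OF w mollifier_props(1)] C])
      fix x assume x: "x \<notin> {x + z |x z. x \<in> K \<and> z \<in> cball 0 e}"
      have *: "w y * mollifier k (x - y) = 0" for y
      proof (cases "y \<in> K")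
        case True
        have "x - y \<notin> cball 0 e"
        proof
          assume "x - y \<in> cball 0 e"
          with True have "y + (x - y) \<in> {x + z |x z. x \<in> K \<and> z \<in> cball 0 e}" by blast
          then have "x \<in> {x + z |x z. x \<in> K \<and> z \<in> cball 0 e}"
            by (simp only: add.commute[of y] diff_add_cancel)
          with x show False by contradiction
        qed
        then show ?thesis using elim mollifier_props(4)[of k "x - y"] by simp
      qed (simp add: K(2))
      show "conv w (mollifier k) x = 0" unfolding conv_def * by simp
    qed
  qed
qed

text \<open>
  Mollifications stay bounded in \<open>L\<^bsup>q\<^esup>\<close> by Jensen's inequality, and their integrals over boxes
  converge. Boundedness and convergence of the box integrals amount to weak convergence.
\<close>

theorem mollification_weak_limit:
  fixes w :: "real ^ 'n \<Rightarrow> real"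
  assumes w: "integrable lborel w" and K: "compact K" "\<And>x. x \<notin> K \<Longrightarrow> w x = 0" and U: "open U" "bounded U" "K \<subseteq> U"
    and q: "q \<ge> 2" and wq: "w \<in> L_space q U" and g: "g \<in> L_space (q / (q - 1)) U"
  shows "(\<lambda>k. LINT x|lebesgue_on U. g x * conv w (mollifier k) x) \<longlonglongrightarrow> (LINT x|lebesgue_on U. g x * w x)"
proof -
  have Ul: "U \<in> lmeasurable" using U by (simp add: lmeasurable_open)
  have Ub[measurable]: "U \<in> sets borel" using U by simp
  have q1: "q > 1" using q by simp
  have wU: "w x = 0" if "x \<notin> U" for x using K(2) U(3) that by blast
  have wm[measurable]: "w \<in> borel_measurable borel" using w by auto
  define c where "c k = conv w (mollifier k)" for k
  have cm[measurable]: "c k \<in> borel_measurable borel" for k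
    unfolding c_def by (intro borel_measurable_continuous_onI smooth_on_continuous smooth_on_conv[OF w mollifier_props(1)])
  have "integrable lborel (\<lambda>x. indicator U x * (\<bar>w x\<bar> powr q))"
    using wq by (subst lebesgue_on_eq_lborel(1)[symmetric]) (auto simp: L_space_def)
  also have "(\<lambda>x. indicator U x * (\<bar>w x\<bar> powr q)) = (\<lambda>x. \<bar>w x\<bar> powr q)"
  proof
    fix x show "indicator U x * (\<bar>w x\<bar> powr q) = \<bar>w x\<bar> powr q"
      using K(2)[of x] U(3) by (cases "x \<in> U") auto
  qed
  finally have wi: "integrable lborel (\<lambda>x. \<bar>w x\<bar> powr q)" .
  define B where "B = (\<integral>x. \<bar>w x\<bar> powr q \<partial>lborel)"
  note m = mollifier_props[where 'n = 'n]
  have bound: "integrable lborel (\<lambda>x. \<bar>c k x\<bar> powr q)" "(\<integral>x. \<bar>c k x\<bar> powr q \<partial>lborel) \<le> B" for k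
  proof -
    have F: "integrable lborel (conv (\<lambda>y. \<bar>w y\<bar> powr q) (mollifier k))"
      "(\<integral>x. conv (\<lambda>y. \<bar>w y\<bar> powr q) (mollifier k) x \<partial>lborel) = B"
    proof -
      note F = conv_Fubini[OF wi m(1), of UNIV k]
      show "integrable lborel (conv (\<lambda>y. \<bar>w y\<bar> powr q) (mollifier k))" using F(1) by simp
      have "(\<integral>x. mollifier k (x - y) \<partial>lborel) = 1" for y :: "real ^ 'n"
        using lborel_translation(2)[OF test_function_borel[OF m(1)], of k y] m(3) by simp
      then show "(\<integral>x. conv (\<lambda>y. \<bar>w y\<bar> powr q) (mollifier k) x \<partial>lborel) = B" using F(2) by (simp add: B_def)
    qed
    have le: "\<bar>c k x\<bar> powr q \<le> conv (\<lambda>y. \<bar>w y\<bar> powr q) (mollifier k) x" for x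
      unfolding c_def by (rule conv_powr_le[OF q1 w wi m(1) m(2) m(3)])
    show i: "integrable lborel (\<lambda>x. \<bar>c k x\<bar> powr q)"
      by (rule Bochner_Integration.integrable_bound[OF F(1)]) (auto intro!: AE_I2 order_trans[OF le])
    show "(\<integral>x. \<bar>c k x\<bar> powr q \<partial>lborel) \<le> B"
      using integral_mono[OF i F(1) le] F(2) by simp
  qed
  have cU: "integrable (lebesgue_on U) (\<lambda>x. norm (c k x) powr q)" "(LINT x|lebesgue_on U. norm (c k x) powr q) \<le> B" for k
  proof -
    have iU: "integrable lborel (\<lambda>x. indicator U x * \<bar>c k x\<bar> powr q)"
      by (rule Bochner_Integration.integrable_bound[OF bound(1)[of k]]) (auto simp: indicator_def)
    then show "integrable (lebesgue_on U) (\<lambda>x. norm (c k x) powr q)"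
      by (subst lebesgue_on_eq_lborel(1)) auto
    have "(LINT x|lebesgue_on U. norm (c k x) powr q) = (\<integral>x. indicator U x * \<bar>c k x\<bar> powr q \<partial>lborel)"
      by (subst lebesgue_on_eq_lborel(2)) auto
    also have "\<dots> \<le> (\<integral>x. \<bar>c k x\<bar> powr q \<partial>lborel)"
      using iU bound(1)[of k] by (intro integral_mono) (auto simp: indicator_def)
    finally show "(LINT x|lebesgue_on U. norm (c k x) powr q) \<le> B" using bound(2)[of k] by simp
  qed
  have cL: "c k \<in> L_space q U" for k
    using cU(1)[of k] measurable_restrict_space1[OF measurable_completion, of "c k" lborel borel U]
    by (simp add: L_space_def)
  show ?thesis
    unfolding c_def[symmetric]
  proof (rule L_space_weak_convergence[OF Ul q cL cU(2) wq _ g])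
    fix S :: "(real ^ 'n) set" assume "S \<in> rational_boxes"
    then obtain a b where S: "S = box a b" by (auto simp: rational_boxes_def)
    have [measurable]: "S \<in> sets borel" by (simp add: S)
    have "\<forall>\<^sub>F k in sequentially. conv w (mollifier k) \<in> test_functions U"
      by (rule conv_mollifier_test_function[OF w K(1) _ U(1,3)]) (rule K(2))
    then have "\<forall>\<^sub>F k in sequentially. (\<integral>x. indicator S x * c k x \<partial>lborel) = (LINT x|lebesgue_on U. indicator S x * c k x)"
    proof eventually_elim
      case (elim k)
      have "c k x = 0" if "x \<notin> U" for x
        using test_function_props(3)[OF elim] that by (auto simp: c_def)
      then show ?case
        by (subst lebesgue_on_eq_lborel(2)) (auto simp: indicator_def intro!: Bochner_Integration.integral_cong)
    qed
    moreover have "(\<lambda>k. \<integral>x. indicator S x * c k x \<partial>lborel) \<longlonglongrightarrow> (\<integral>x. indicator S x * w x \<partial>lborel)"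
      unfolding c_def S by (rule conv_mollifier_box_tendsto[OF w])
    moreover have "(\<integral>x. indicator S x * w x \<partial>lborel) = (LINT x|lebesgue_on U. indicator S x * w x)"
      by (subst lebesgue_on_eq_lborel(2)) (use wU in \<open>auto simp: indicator_def intro!: Bochner_Integration.integral_cong\<close>)
    ultimately show "(\<lambda>k. LINT x|lebesgue_on U. indicator S x * c k x) \<longlonglongrightarrow> (LINT x|lebesgue_on U. indicator S x * w x)"
      using Lim_transform_eventually by force
  qed
qed

text \<open>
  Mollification commutes with weak derivatives because \<open>y \<mapsto> \<rho> (x - y)\<close> is itself a test
  function. The sign of the reflection cancels the sign of the integration by parts.
\<close>

lemma partial_deriv_conv_weak:
  fixes w h :: "real ^ 'n \<Rightarrow> real"
  assumes w: "integrable lborel w" and \<rho>: "\<rho> \<in> test_functions UNIV"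
    and wh: "\<And>\<psi>. \<psi> \<in> test_functions UNIV \<Longrightarrow> (\<integral>x. w x * partial_deriv i \<psi> x \<partial>lborel) = - (\<integral>x. h x * \<psi> x \<partial>lborel)"
  shows "partial_deriv i (conv w \<rho>) = conv h \<rho>"
proof
  fix x
  define \<psi> where "\<psi> y = \<rho> (x + (-1) *\<^sub>R y)" for y
  obtain K where K: "compact K" "\<forall>z. z \<notin> K \<longrightarrow> \<rho> z = 0" using test_function_props(3)[OF \<rho>] by blast
  have \<psi>: "\<psi> \<in> test_functions UNIV"
  proof (rule test_functionI)
    show "smooth_on UNIV \<psi>" unfolding \<psi>_def[abs_def] by (rule smooth_on_affine[OF test_function_props(1)[OF \<rho>]])
    show "compact ((\<lambda>z. x + (-1) *\<^sub>R z) ` K)" by (intro compact_continuous_image continuous_intros K)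
    fix y assume "y \<notin> (\<lambda>z. x + (-1) *\<^sub>R z) ` K"
    then have "x + (-1) *\<^sub>R y \<notin> K" by (auto simp: image_iff)
    then show "\<psi> y = 0" using K by (simp add: \<psi>_def)
  qed simp
  have d: "partial_deriv i \<psi> y = - partial_deriv i \<rho> (x - y)" for y
    unfolding \<psi>_def[abs_def]
    by (subst partial_deriv_affine(2)) (use smooth_on_UNIV_differentiable[OF test_function_props(1)[OF \<rho>]] in auto)
  have "partial_deriv i (conv w \<rho>) x = (\<integral>y. w y * partial_deriv i \<rho> (x - y) \<partial>lborel)"
    by (simp add: partial_deriv_conv[OF w \<rho>] conv_def)
  also have "\<dots> = - (\<integral>y. w y * partial_deriv i \<psi> y \<partial>lborel)" by (simp add: d)
  also have "\<dots> = (\<integral>y. h y * \<psi> y \<partial>lborel)" using wh[OF \<psi>] by simp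
  finally show "partial_deriv i (conv w \<rho>) x = conv h \<rho> x" by (simp add: conv_def \<psi>_def)
qed

text \<open>
  Convolutions are formed over Borel functions, to have Fubini's theorem on the product of Borel
  measures; the representative keeps the support of the original.
\<close>

lemma borel_representative:
  fixes f :: "real ^ 'n \<Rightarrow> real"
  assumes f: "f \<in> borel_measurable (lebesgue_on U)" and U: "U \<in> sets borel" and K: "K \<in> sets borel" "K \<subseteq> U"
    "\<And>x. x \<in> U \<Longrightarrow> x \<notin> K \<Longrightarrow> f x = 0"
  obtains g where "g \<in> borel_measurable borel" "\<And>x. x \<notin> K \<Longrightarrow> g x = 0" "AE x in lebesgue_on U. f x = g x"
proof -
  have Ul: "U \<in> sets lebesgue" using U by simp
  obtain g where g: "g \<in> borel_measurable lborel" "AE x in lborel. (if x \<in> U then f x else 0) = g x"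
    using completion_ex_borel_measurable_real[OF borel_measurable_if_I[OF f Ul]] by blast
  have [measurable]: "g \<in> borel_measurable borel" "K \<in> sets borel" using g K by auto
  have ae: "AE x in lebesgue. (if x \<in> U then f x else 0) = g x" by (rule AE_completion[OF g(2)])
  show ?thesis
  proof
    show "(\<lambda>x. indicator K x * g x) \<in> borel_measurable borel" by measurable
    have "AE x in lebesgue. x \<in> U \<longrightarrow> f x = indicator K x * g x"
      using ae by eventually_elim (use K in \<open>auto simp: indicator_def\<close>)
    then show "AE x in lebesgue_on U. f x = indicator K x * g x"
      using Ul by (simp add: AE_restrict_space_iff)
  qed (simp add: indicator_def)
qed

lemma test_function_mult:
  fixes \<phi> \<psi> :: "real ^ 'n \<Rightarrow> real"
  assumes \<phi>: "\<phi> \<in> test_functions U" and \<psi>: "smooth_on UNIV \<psi>"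
  shows "(\<lambda>x. \<phi> x * \<psi> x) \<in> test_functions U"
proof -
  obtain K where K: "compact K" "K \<subseteq> U" "\<forall>z. z \<notin> K \<longrightarrow> \<phi> z = 0" using test_function_props(3)[OF \<phi>] by blast
  show ?thesis
    by (rule test_functionI[OF smooth_on_mult[OF test_function_props(1)[OF \<phi>] \<psi>] K(1,2)]) (simp add: K(3))
qed

lemma L_space_mult_test:
  fixes f \<phi> :: "real ^ 'n \<Rightarrow> real"
  assumes f: "f \<in> L_space q U" and \<phi>: "\<phi> \<in> test_functions V" and q: "q > 0"
  shows "(\<lambda>x. f x * \<phi> x) \<in> L_space q U"
proof -
  obtain C where C: "C > 0" "\<And>x. norm (\<phi> x) \<le> C" using test_function_bounded[OF \<phi>] by blast
  have [measurable]: "f \<in> borel_measurable (lebesgue_on U)" and fi: "integrable (lebesgue_on U) (\<lambda>x. norm (f x) powr q)"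
    using f by (auto simp: L_space_def)
  have [measurable]: "\<phi> \<in> borel_measurable (lebesgue_on U)" by (rule test_function_measurable[OF \<phi>])
  have "integrable (lebesgue_on U) (\<lambda>x. norm (f x * \<phi> x) powr q)"
  proof (rule Bochner_Integration.integrable_bound)
    show "integrable (lebesgue_on U) (\<lambda>x. C powr q * norm (f x) powr q)" using fi by simp
    have "norm (f x * \<phi> x) powr q \<le> (C * norm (f x)) powr q" for x
      using C q by (intro powr_mono2) (auto simp: abs_mult mult.commute[of C] intro!: mult_left_mono)
    then show "AE x in lebesgue_on U. norm (norm (f x * \<phi> x) powr q) \<le> norm (C powr q * norm (f x) powr q)"
      using C by (auto simp: powr_mult)
  qed measurable
  then show ?thesis by (simp add: L_space_def)
qed

text \<open>
  The product rule for \<open>u \<eta>\<close>, from testing the weak gradient of \<open>u\<close> with \<open>\<eta> \<psi>\<close>, whose support is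
  compact for every smooth \<open>\<psi>\<close>.
\<close>

lemma weak_gradient_product:
  fixes u \<eta> \<psi> :: "real ^ 'n \<Rightarrow> real"
  assumes U: "U \<in> sets lebesgue" and u: "has_weak_gradient U u G"
    and \<eta>: "\<eta> \<in> test_functions U" and \<psi>: "smooth_on UNIV \<psi>"
  shows "(LINT x|lebesgue_on U. (u x * \<eta> x) * partial_deriv i \<psi> x)
    = - (LINT x|lebesgue_on U. (\<eta> x * G x $ i + u x * partial_deriv i \<eta> x) * \<psi> x)"
proof -
  have loc: "u \<in> L_loc 1 U" "G \<in> L_loc 1 U" using u by (auto simp: has_weak_gradient_def)
  note I = L_loc_test_integrable[OF _ _ U]
  have t: "(\<lambda>x. \<eta> x * \<psi> x) \<in> test_functions U" by (rule test_function_mult[OF \<eta> \<psi>])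
  have d: "partial_deriv i (\<lambda>x. \<eta> x * \<psi> x) x = \<eta> x * partial_deriv i \<psi> x + partial_deriv i \<eta> x * \<psi> x" for x
    using partial_deriv_scaleR[of \<eta> x \<psi> i] smooth_on_UNIV_differentiable[OF \<psi>]
      smooth_on_UNIV_differentiable[OF test_function_props(1)[OF \<eta>]] by simp
  have i1: "integrable (lebesgue_on U) (\<lambda>x. u x * (\<eta> x * partial_deriv i \<psi> x))"
    by (intro I loc test_function_mult[OF \<eta>] smooth_on_UNIV_partial \<psi>)
  have i2: "integrable (lebesgue_on U) (\<lambda>x. u x * (partial_deriv i \<eta> x * \<psi> x))"
    by (intro I loc test_function_mult[OF partial_deriv_test_function[OF \<eta>]] \<psi>)
  have i3: "integrable (lebesgue_on U) (\<lambda>x. G x $ i * (\<eta> x * \<psi> x))"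
    by (intro I L_loc_component loc t)
  have "(LINT x|lebesgue_on U. u x * (\<eta> x * partial_deriv i \<psi> x)) + (LINT x|lebesgue_on U. u x * (partial_deriv i \<eta> x * \<psi> x))
    = (LINT x|lebesgue_on U. u x * partial_deriv i (\<lambda>x. \<eta> x * \<psi> x) x)"
    unfolding d using i1 i2 by (simp add: distrib_left)
  also have "\<dots> = - (LINT x|lebesgue_on U. G x $ i * (\<eta> x * \<psi> x))"
    using u t by (simp add: has_weak_gradient_def)
  finally have "(LINT x|lebesgue_on U. u x * (\<eta> x * partial_deriv i \<psi> x))
    = - ((LINT x|lebesgue_on U. G x $ i * (\<eta> x * \<psi> x)) + (LINT x|lebesgue_on U. u x * (partial_deriv i \<eta> x * \<psi> x)))" by simp
  also have "\<dots> = - (LINT x|lebesgue_on U. G x $ i * (\<eta> x * \<psi> x) + u x * (partial_deriv i \<eta> x * \<psi> x))"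
    using i2 i3 by simp
  finally show ?thesis by (simp add: distrib_right distrib_left mult_ac)
qed

text \<open>
  The mollifications of \<open>u \<eta>\<close> are test functions that converge to \<open>u \<eta>\<close> weakly in \<open>L\<^sup>2\<close> and in
  \<open>L\<^bsup>s\<^esup>\<close>, and so do their gradients in \<open>L\<^sup>2\<close>. Hence an identity that holds for all test
  functions, and whose terms are integrals of the function or its gradient against functions
  from the dual spaces, holds for \<open>u \<eta>\<close>.
\<close>

theorem H1_product_density:
  fixes u \<eta> :: "real ^ 'n \<Rightarrow> real"
  assumes U: "open U" "bounded U" and u: "u \<in> H1 U" "u \<in> L_space s U" and s: "s \<ge> 2" and \<eta>: "\<eta> \<in> test_functions U"
  obtains \<phi> :: "nat \<Rightarrow> real ^ 'n \<Rightarrow> real" where "\<And>k. \<phi> k \<in> test_functions U"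
    "\<And>g. g \<in> L_space 2 U \<Longrightarrow> (\<lambda>k. LINT x|lebesgue_on U. g x * \<phi> k x) \<longlonglongrightarrow> (LINT x|lebesgue_on U. g x * (u x * \<eta> x))"
    "\<And>g. g \<in> L_space (s / (s - 1)) U \<Longrightarrow> (\<lambda>k. LINT x|lebesgue_on U. g x * \<phi> k x) \<longlonglongrightarrow> (LINT x|lebesgue_on U. g x * (u x * \<eta> x))"
    "\<And>h i. h \<in> L_space 2 U \<Longrightarrow> (\<lambda>k. LINT x|lebesgue_on U. h x * partial_deriv i (\<phi> k) x)
       \<longlonglongrightarrow> (LINT x|lebesgue_on U. h x * (\<eta> x * weak_gradient U u x $ i + u x * partial_deriv i \<eta> x))"
proof -
  have Ub: "U \<in> sets borel" and Ul: "U \<in> sets lebesgue" and Um: "U \<in> lmeasurable"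
    using U by (auto simp: lmeasurable_open)
  define G where "G = weak_gradient U u"
  have G: "has_weak_gradient U u G" "G \<in> L_space 2 U" using H1_weak_gradient[OF U(1) u(1)] by (auto simp: G_def)
  obtain K where K: "compact K" "K \<subseteq> U" "\<forall>x. x \<notin> K \<longrightarrow> \<eta> x = 0" using test_function_props(3)[OF \<eta>] by blast
  have Kb: "K \<in> sets borel" using K(1) borel_compact by blast
  have d0: "partial_deriv i \<eta> x = 0" if "x \<notin> K" for i x
  proof -
    have "(\<eta> has_derivative (\<lambda>_. 0)) (at x)"
    proof (rule has_derivative_transform_within_open[of "\<lambda>_. 0"])
      show "open (- K)" using K(1) compact_imp_closed by auto
    qed (use K that in auto)
    then show ?thesis by (simp add: partial_deriv_has_derivative)
  qed
  (* lets the dual exponent 2 / (2 - 1) be simplified to 2 *)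
  note [simp] = divide_numeral_1
  have rep: "\<exists>w. w \<in> borel_measurable borel \<and> (\<forall>x. x \<notin> K \<longrightarrow> w x = 0) \<and> (AE x in lebesgue_on U. f x = w x) \<and>
      integrable lborel w \<and> w \<in> L_space q U"
    if f: "f \<in> L_space q U" "\<And>x. x \<notin> K \<Longrightarrow> f x = 0" and q: "q \<ge> 1" for f :: "real ^ 'n \<Rightarrow> real" and q
  proof -
    have "f \<in> borel_measurable (lebesgue_on U)" using f by (simp add: L_space_def)
    from borel_representative[OF this Ub Kb K(2)] f(2) obtain w where
      w: "w \<in> borel_measurable borel" "\<And>x. x \<notin> K \<Longrightarrow> w x = 0" "AE x in lebesgue_on U. f x = w x" by metis
    have wL: "w \<in> L_space q U" by (rule L_space_cong_AE[OF f(1) Ul w(3)])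
    have "w \<in> L_space 1 U" using L_space_exponent_le[OF wL Um] q by simp
    then have "integrable (lebesgue_on U) w"
      using integrable_norm_iff[of w "lebesgue_on U"] by (simp add: L_space_def)
    then have "integrable lborel (\<lambda>x. indicator U x * w x)" using lebesgue_on_eq_lborel(1)[OF w(1) Ub] by simp
    also have "(\<lambda>x. indicator U x * w x) = w"
    proof
      fix x show "indicator U x * w x = w x" using w(2)[of x] K(2) by (cases "x \<in> U") auto
    qed
    finally show ?thesis using w wL by blast
  qed
  have uL: "u \<in> L_space 2 U" using u(1) by (simp add: H1_def)
  have "(\<lambda>x. u x * \<eta> x) \<in> L_space s U" using L_space_mult_test[OF u(2) \<eta>] s by simp
  from rep[OF this] K(3) s obtain w where w: "w \<in> borel_measurable borel" "\<And>x. x \<notin> K \<Longrightarrow> w x = 0"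
    "AE x in lebesgue_on U. u x * \<eta> x = w x" "integrable lborel w" "w \<in> L_space s U" by auto
  have w2: "w \<in> L_space 2 U" using L_space_exponent_le[OF w(5) Um] s by simp
  have hL: "(\<lambda>x. \<eta> x * G x $ i + u x * partial_deriv i \<eta> x) \<in> L_space 2 U" for i
    using L_space_mult_test[OF L_space_component[OF _ G(2)] \<eta>] L_space_mult_test[OF uL partial_deriv_test_function[OF \<eta>]]
    by (intro L_space_add) (auto simp: mult.commute)
  have "\<forall>i. \<exists>h. h \<in> borel_measurable borel \<and> (\<forall>x. x \<notin> K \<longrightarrow> h x = 0) \<and>
    (AE x in lebesgue_on U. \<eta> x * G x $ i + u x * partial_deriv i \<eta> x = h x) \<and> integrable lborel h \<and> h \<in> L_space 2 U"
    by (rule allI, rule rep[OF hL]) (use K(3) d0 in auto)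
  from choice[OF this] obtain h where h: "\<And>i. h i \<in> borel_measurable borel" "\<And>i x. x \<notin> K \<Longrightarrow> h i x = 0"
    "\<And>i. AE x in lebesgue_on U. \<eta> x * G x $ i + u x * partial_deriv i \<eta> x = h i x"
    "\<And>i. integrable lborel (h i)" "\<And>i. h i \<in> L_space 2 U" by auto
  have to_U: "(\<integral>x. f x * \<psi> x \<partial>lborel) = (LINT x|lebesgue_on U. f' x * \<psi> x)"
    if f: "f \<in> borel_measurable borel" "\<And>x. x \<notin> K \<Longrightarrow> f x = 0" "AE x in lebesgue_on U. f' x = f x"
      and f'[measurable]: "f' \<in> borel_measurable (lebesgue_on U)" and \<psi>: "\<psi> \<in> test_functions UNIV"
    for f f' \<psi> :: "real ^ 'n \<Rightarrow> real"
  proof -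
    have [measurable]: "\<psi> \<in> borel_measurable borel" "f \<in> borel_measurable borel"
      using test_function_borel[OF \<psi>] f by auto
    have [measurable]: "\<psi> \<in> borel_measurable (lebesgue_on U)" by (rule test_function_measurable[OF \<psi>])
    have [measurable]: "f \<in> borel_measurable (lebesgue_on U)"
      using f(1) by (intro measurable_restrict_space1 measurable_completion) simp
    have *: "indicator U x * (f x * \<psi> x) = f x * \<psi> x" for x using f(2)[of x] K(2) by (cases "x \<in> U") auto
    have "(LINT x|lebesgue_on U. f x * \<psi> x) = (\<integral>x. indicator U x * (f x * \<psi> x) \<partial>lborel)"
      by (rule lebesgue_on_eq_lborel(2)) (auto simp: Ub)
    then have "(\<integral>x. f x * \<psi> x \<partial>lborel) = (LINT x|lebesgue_on U. f x * \<psi> x)"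
      by (simp only: *)
    also have "\<dots> = (LINT x|lebesgue_on U. f' x * \<psi> x)"
      by (rule integral_cong_AE) (measurable, use f(3) in \<open>auto elim: eventually_mono\<close>)
    finally show ?thesis .
  qed
  have um: "(\<lambda>x. u x * \<eta> x) \<in> borel_measurable (lebesgue_on U)"
    "\<And>i. (\<lambda>x. \<eta> x * G x $ i + u x * partial_deriv i \<eta> x) \<in> borel_measurable (lebesgue_on U)"
    using L_space_mult_test[OF u(2) \<eta>] hL s by (auto simp: L_space_def)
  have weak: "(\<integral>x. w x * partial_deriv i \<psi> x \<partial>lborel) = - (\<integral>x. h i x * \<psi> x \<partial>lborel)"
    if \<psi>: "\<psi> \<in> test_functions UNIV" for \<psi> i
    using weak_gradient_product[OF Ul G(1) \<eta> test_function_props(1)[OF \<psi>], of i]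
      to_U[OF w(1,2,3) um(1) partial_deriv_test_function[OF \<psi>], of i] to_U[OF h(1,2,3) um(2) \<psi>, of i] by simp
  (* mollifications have their support inside U only from some index on; the sequence is shifted
     accordingly *)
  obtain N where N: "\<And>k. k \<ge> N \<Longrightarrow> conv w (mollifier k) \<in> test_functions U"
    using conv_mollifier_test_function[OF w(4) K(1) w(2) U(1) K(2)] unfolding eventually_sequentially by blast
  define \<phi> where "\<phi> k = conv w (mollifier (k + N))" for k
  have lim: "(\<lambda>k. LINT x|lebesgue_on U. g x * conv f (mollifier (k + N)) x) \<longlonglongrightarrow> (LINT x|lebesgue_on U. g x * f' x)"
    if f: "integrable lborel f" "\<And>x. x \<notin> K \<Longrightarrow> f x = 0" "f \<in> L_space q U" "AE x in lebesgue_on U. f' x = f x"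
      and f': "f' \<in> borel_measurable (lebesgue_on U)" and q: "q \<ge> 2" and g: "g \<in> L_space (q / (q - 1)) U"
    for f f' g :: "real ^ 'n \<Rightarrow> real" and q
  proof -
    have [measurable]: "g \<in> borel_measurable (lebesgue_on U)" "f \<in> borel_measurable (lebesgue_on U)"
      "f' \<in> borel_measurable (lebesgue_on U)"
      using f f' g by (auto simp: L_space_def)
    have "(LINT x|lebesgue_on U. g x * f x) = (LINT x|lebesgue_on U. g x * f' x)"
      by (rule integral_cong_AE) (measurable, use f(4) in \<open>auto elim: eventually_mono\<close>)
    then show ?thesis
      using LIMSEQ_ignore_initial_segment[OF mollification_weak_limit[OF f(1) K(1) f(2) U K(2) q f(3) g], of N] by simp
  qed
  show ?thesis
  proof (rule that[of \<phi>])
    show "\<phi> k \<in> test_functions U" for k unfolding \<phi>_def by (rule N) simp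
    show "(\<lambda>k. LINT x|lebesgue_on U. g x * \<phi> k x) \<longlonglongrightarrow> (LINT x|lebesgue_on U. g x * (u x * \<eta> x))"
      if "g \<in> L_space 2 U" for g
      unfolding \<phi>_def by (rule lim[OF w(4,2) w2 w(3) um(1)]) (use that in auto)
    show "(\<lambda>k. LINT x|lebesgue_on U. g x * \<phi> k x) \<longlonglongrightarrow> (LINT x|lebesgue_on U. g x * (u x * \<eta> x))"
      if "g \<in> L_space (s / (s - 1)) U" for g
      unfolding \<phi>_def by (rule lim[OF w(4,2) w(5,3) um(1) s that])
    show "(\<lambda>k. LINT x|lebesgue_on U. g x * partial_deriv i (\<phi> k) x)
       \<longlonglongrightarrow> (LINT x|lebesgue_on U. g x * (\<eta> x * weak_gradient U u x $ i + u x * partial_deriv i \<eta> x))"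
      if g: "g \<in> L_space 2 U" for g i
    proof -
      have "partial_deriv i (\<phi> k) = conv (h i) (mollifier (k + N))" for k
        unfolding \<phi>_def by (rule partial_deriv_conv_weak[OF w(4) mollifier_props(1) weak])
      then show ?thesis
        unfolding G_def[symmetric] by (simp only:) (rule lim[OF h(4,2,5,3) um(2)], use g in auto)
    qed
  qed
qed

section \<open>Integrals against radial cut-offs\<close>

lemma radial_measurable: "radial j t c \<in> borel_measurable (lebesgue_on U)"
  by (intro continuous_measurable_lebesgue_on smooth_on_continuous smooth_on_radial)

lemma radial_bounded:
  obtains C where "C > 0" "\<And>t c y. t \<ge> 0 \<Longrightarrow> \<bar>radial j t c y\<bar> \<le> C"
proof -
  obtain C where C: "C > 0" "\<And>s. s \<le> 1 \<Longrightarrow> \<bar>flat j s\<bar> \<le> C" using flat_bounded[of 1 j] by blast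
  have "\<bar>radial j t c y\<bar> \<le> C" if "t \<ge> 0" for t c y
    unfolding radial_def using that by (intro C(2)) simp
  with C(1) that show ?thesis by blast
qed

lemma radial_integrable:
  fixes a :: "real ^ 'n \<Rightarrow> real"
  assumes a: "integrable (lebesgue_on U) a" and t: "t \<ge> 0"
  shows "integrable (lebesgue_on U) (\<lambda>y. radial j t c y * a y)"
proof -
  obtain C where C: "C > 0" "\<And>t c y. t \<ge> 0 \<Longrightarrow> \<bar>radial j t (c :: real ^ 'n) y\<bar> \<le> C"
    using radial_bounded[where j = j] by metis
  have [measurable]: "a \<in> borel_measurable (lebesgue_on U)" using a by auto
  note radial_measurable[measurable]
  show ?thesis
  proof (rule Bochner_Integration.integrable_bound)
    show "integrable (lebesgue_on U) (\<lambda>y. C * a y)" using a by simp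
    show "AE y in lebesgue_on U. norm (radial j t c y * a y) \<le> norm (C * a y)"
      using C t by (auto simp: abs_mult intro!: mult_right_mono AE_I2)
  qed measurable
qed

text \<open>
  Differentiation under the integral sign in the scale \<open>t\<close>; the difference quotients of the
  cut-off are dominated by a multiple of \<open>\<bar>y - c\<bar>\<^sup>2\<close>.
\<close>

lemma radial_integral_DERIV:
  fixes a :: "real ^ 'n \<Rightarrow> real"
  assumes a: "integrable (lebesgue_on U) a" and ka: "integrable (lebesgue_on U) (\<lambda>y. (norm (y - c))\<^sup>2 * a y)" and t: "t > 0"
  shows "((\<lambda>t. LINT y|lebesgue_on U. radial j t c y * a y) has_real_derivative
     - (LINT y|lebesgue_on U. radial (Suc j) t c y * ((norm (y - c))\<^sup>2 * a y))) (at t)"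
proof -
  let ?M = "lebesgue_on U"
  obtain C where C: "C > 0" "\<And>t c y. t \<ge> 0 \<Longrightarrow> \<bar>radial (Suc j) t (c :: real ^ 'n) y\<bar> \<le> C"
    using radial_bounded[where j = "Suc j"] by metis
  have [measurable]: "a \<in> borel_measurable ?M" using a by auto
  note radial_measurable[measurable]
  have d: "((\<lambda>t. radial j t c y) has_real_derivative - (norm (y - c))\<^sup>2 * radial (Suc j) t c y) (at t)" for t y
    unfolding radial_def
    by (rule DERIV_cong[OF DERIV_chain2[OF DERIV_flat]]) (auto intro!: derivative_eq_intros)
  have lip: "\<bar>radial j s c y - radial j t c y\<bar> \<le> C * (norm (y - c))\<^sup>2 * \<bar>s - t\<bar>" if "s > 0" for s y
  proof -
    have "norm (radial j s c y - radial j t c y) \<le> ((norm (y - c))\<^sup>2 * C) * norm (s - t)"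
    proof (rule field_differentiable_bound[of "{0<..}"])
      show "((\<lambda>t. radial j t c y) has_field_derivative - (norm (y - c))\<^sup>2 * radial (Suc j) z c y) (at z within {0<..})"
        if "z \<in> {0<..}" for z
        using d DERIV_subset by blast
      show "norm (- (norm (y - c))\<^sup>2 * radial (Suc j) z c y) \<le> (norm (y - c))\<^sup>2 * C" if "z \<in> {0<..}" for z
        using C(2)[of z c y] that by (auto simp: abs_mult intro!: mult_left_mono)
    qed (use that t in auto)
    then show ?thesis by (simp add: mult.commute)
  qed
  (* the bounds on the cut-off concern positive parameters, and all parameters close to t are
     positive *)
  have "((\<lambda>s. ((LINT y|?M. radial j s c y * a y) - (LINT y|?M. radial j t c y * a y)) / (s - t))
     \<longlongrightarrow> - (LINT y|?M. radial (Suc j) t c y * ((norm (y - c))\<^sup>2 * a y))) (at t within {0<..})"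
    unfolding tendsto_at_iff_sequentially
  proof (intro allI impI)
    fix s :: "nat \<Rightarrow> real" assume s: "\<forall>i. s i \<in> {0<..} - {t}" "s \<longlonglongrightarrow> t"
    have lim: "(\<lambda>i. LINT y|?M. (radial j (s i) c y - radial j t c y) / (s i - t) * a y)
       \<longlonglongrightarrow> (LINT y|?M. (- (norm (y - c))\<^sup>2 * radial (Suc j) t c y) * a y)"
    proof (rule integral_dominated_convergence)
      show "integrable ?M (\<lambda>y. C * \<bar>(norm (y - c))\<^sup>2 * a y\<bar>)" using ka by simp
      show "AE y in ?M. (\<lambda>i. (radial j (s i) c y - radial j t c y) / (s i - t) * a y)
         \<longlonglongrightarrow> (- (norm (y - c))\<^sup>2 * radial (Suc j) t c y) * a y"
      proof (intro AE_I2 tendsto_mult tendsto_const)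
        fix y
        have "((\<lambda>s. (radial j s c y - radial j t c y) / (s - t)) \<longlongrightarrow> - (norm (y - c))\<^sup>2 * radial (Suc j) t c y) (at t)"
          using d unfolding has_field_derivative_iff .
        then show "(\<lambda>i. (radial j (s i) c y - radial j t c y) / (s i - t)) \<longlonglongrightarrow> - (norm (y - c))\<^sup>2 * radial (Suc j) t c y"
          using s unfolding tendsto_at_iff_sequentially by (auto simp: o_def)
      qed
      show "AE y in ?M. norm ((radial j (s i) c y - radial j t c y) / (s i - t) * a y) \<le> C * \<bar>(norm (y - c))\<^sup>2 * a y\<bar>" for i
      proof (rule AE_I2)
        fix y
        have "\<bar>radial j (s i) c y - radial j t c y\<bar> / \<bar>s i - t\<bar> \<le> C * (norm (y - c))\<^sup>2"
          using lip[of "s i" y] s(1) by (simp add: divide_le_eq)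
        from mult_right_mono[OF this, of "\<bar>a y\<bar>"]
        show "norm ((radial j (s i) c y - radial j t c y) / (s i - t) * a y) \<le> C * \<bar>(norm (y - c))\<^sup>2 * a y\<bar>"
          by (simp add: abs_mult mult.assoc)
      qed
    next
      have [measurable]: "(\<lambda>y. (norm (y - c))\<^sup>2) \<in> borel_measurable ?M"
        by (intro continuous_measurable_lebesgue_on continuous_intros)
      show "(\<lambda>y. - (norm (y - c))\<^sup>2 * radial (Suc j) t c y * a y) \<in> borel_measurable ?M" by measurable
    qed measurable
    have eq: "(LINT y|?M. (radial j (s i) c y - radial j t c y) / (s i - t) * a y)
      = ((LINT y|?M. radial j (s i) c y * a y) - (LINT y|?M. radial j t c y * a y)) / (s i - t)" for i
    proof -
      have i: "integrable ?M (\<lambda>y. radial j (s i) c y * a y)" "integrable ?M (\<lambda>y. radial j t c y * a y)"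
        using s(1) t by (auto intro!: radial_integrable[OF a] less_imp_le)
      have "(LINT y|?M. (radial j (s i) c y - radial j t c y) / (s i - t) * a y)
        = (LINT y|?M. (radial j (s i) c y * a y - radial j t c y * a y) / (s i - t))"
        by (intro Bochner_Integration.integral_cong) (auto simp: left_diff_distrib)
      then show ?thesis using i by simp
    qed
    have eq': "(LINT y|?M. (- (norm (y - c))\<^sup>2 * radial (Suc j) t c y) * a y)
      = - (LINT y|?M. radial (Suc j) t c y * ((norm (y - c))\<^sup>2 * a y))" by (simp add: mult_ac)
    show "((\<lambda>s. ((LINT y|?M. radial j s c y * a y) - (LINT y|?M. radial j t c y * a y)) / (s - t)) \<circ> s)
       \<longlonglongrightarrow> - (LINT y|?M. radial (Suc j) t c y * ((norm (y - c))\<^sup>2 * a y))"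
      using lim unfolding eq eq' o_def .
  qed
  then have "((\<lambda>t. LINT y|?M. radial j t c y * a y) has_real_derivative
     - (LINT y|?M. radial (Suc j) t c y * ((norm (y - c))\<^sup>2 * a y))) (at t within {0<..})"
    unfolding has_field_derivative_iff .
  then show ?thesis using t by (simp add: at_within_open[of t "{0<..}"])
qed

section \<open>The monotonicity formula as a differential inequality\<close>

text \<open>
  The part of the proof that is about functions of the scale \<open>t\<close> only. In the application, with
  \<open>h\<close> the profile of the cut-off and \<open>X = y - x\<close>, the functions are \<open>I = \<integral> h \<bar>\<nabla>u\<bar>\<^sup>2\<close>,
  \<open>J = \<integral> h \<bar>u\<bar>\<^bsup>p+1\<^esup>\<close>, \<open>P = \<integral> h' u\<^sup>2\<close>, \<open>Q = \<integral> h' u (X \<bullet> \<nabla>u)\<close> and \<open>S = \<integral> h' (X \<bullet> \<nabla>u)\<^sup>2\<close>.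

  The three identities combine to \<open>t M' = - t\<^bsup>\<gamma>+1\<^esup> (S + 2 \<beta> Q + \<beta>\<^sup>2 P)\<close> for
  \<open>M = t\<^bsup>\<gamma>\<^esup> (I / 2 - J / (p + 1) + \<beta> t P)\<close>, so \<open>M\<close> does not increase. With \<open>G = 2 t\<^bsup>\<gamma>+1\<^esup> P\<close> they
  also give \<open>M = t\<^bsup>\<gamma>\<^esup> J / \<alpha> - t G' / 2\<close>: an upper bound on \<open>M\<close> bounds the energy up to a
  derivative. The assumption \<open>holder\<close> turns the bound on \<open>M\<close> into \<open>t G' \<ge> (\<gamma> + 2) (G - K)\<close> for a
  constant \<open>K\<close>. If \<open>G\<close> ever exceeded \<open>K\<close>, it would grow like \<open>t\<^bsup>\<gamma>+2\<^esup>\<close>, faster than the bound on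
  \<open>P\<close> permits. So \<open>G\<close> is bounded, its derivative is of order \<open>1 / t\<close> at some point of every
  interval \<open>[t, 2 t]\<close>, and at such a point \<open>I\<close> and \<open>J\<close> are bounded as claimed. Since they
  decrease, the bound holds at \<open>2 t\<close> too. The constant \<open>\<gamma> + 2\<close> in \<open>holder\<close> is there to exceed
  \<open>\<gamma> + 1\<close>, the power of \<open>t\<close> that bounds \<open>G\<close>.
\<close>

lemma monotonicity_bound:
  fixes I J P Q S dI dJ dP :: "real \<Rightarrow> real" and p n t0 :: real
  defines "\<alpha> \<equiv> 2 * (p + 1) / (p - 1)" and "\<beta> \<equiv> 2 / (p - 1)"
  defines "\<gamma> \<equiv> (n - \<alpha>) / 2"
  assumes p: "p > 1" and \<gamma>: "\<gamma> > 0" and t0: "t0 > 0"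
    and dI: "\<And>t. t \<ge> t0 \<Longrightarrow> (I has_real_derivative dI t) (at t)"
    and dJ: "\<And>t. t \<ge> t0 \<Longrightarrow> (J has_real_derivative dJ t) (at t)"
    and dP: "\<And>t. t \<ge> t0 \<Longrightarrow> (P has_real_derivative dP t) (at t)"
    and U: "\<And>t. t \<ge> t0 \<Longrightarrow> I t - J t = 2 * t * Q t"
    and Po: "\<And>t. t \<ge> t0 \<Longrightarrow> n * (I t / 2 - J t / (p + 1)) - I t + 2 * t * (dI t / 2 - dJ t / (p + 1)) + 2 * t * S t = 0"
    and Di: "\<And>t. t \<ge> t0 \<Longrightarrow> n * P t + 2 * t * dP t + 2 * Q t = 0"
    and sq: "\<And>t. t \<ge> t0 \<Longrightarrow> 0 \<le> S t + 2 * \<beta> * Q t + \<beta>\<^sup>2 * P t"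
    and nonneg: "\<And>t. t \<ge> t0 \<Longrightarrow> 0 \<le> J t" "\<And>t. t \<ge> t0 \<Longrightarrow> 0 \<le> P t"
    and mono: "\<And>s t. t0 \<le> s \<Longrightarrow> s \<le> t \<Longrightarrow> I t \<le> I s" "\<And>s t. t0 \<le> s \<Longrightarrow> s \<le> t \<Longrightarrow> J t \<le> J s"
    and Pb: "\<And>t. t \<ge> t0 \<Longrightarrow> P t \<le> C1"
    and holder: "\<And>t. t \<ge> t0 \<Longrightarrow> \<alpha> * (\<gamma> + 2) * (t powr (\<gamma> + 1) * P t) \<le> t powr \<gamma> * J t + C2"
  shows "\<exists>C. \<forall>t\<ge>2 * t0. t powr \<gamma> * (I t + J t) \<le> C"
proof -
  have \<alpha>: "\<alpha> > 0" "1 / \<alpha> = 1 / 2 - 1 / (p + 1)" "\<alpha> = 2 + 2 * \<beta>" using p by (auto simp: \<alpha>_def \<beta>_def field_simps)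
  have ab: "\<alpha> / (p + 1) = \<beta>"
  proof -
    have "\<alpha> = \<beta> * (p + 1)" by (simp add: \<alpha>_def \<beta>_def)
    then show ?thesis using p by simp
  qed
  have \<beta>: "\<beta> > 0" using p by (simp add: \<beta>_def)
  have n: "n = 2 * \<gamma> + 2 + 2 * \<beta>" using \<alpha>(3) by (simp add: \<gamma>_def field_simps)
  define M where "M t = t powr \<gamma> * (I t / 2 - J t / (p + 1) + \<beta> * t * P t)" for t
  define G where "G t = 2 * t powr (\<gamma> + 1) * P t" for t
  have pw: "t powr (\<gamma> + 1) = t * t powr \<gamma>" "t powr (\<gamma> - 1) * t = t powr \<gamma>" if "t > 0" for t
    using that by (simp_all add: powr_add powr_diff)
  have dpw: "((\<lambda>t. t powr a) has_real_derivative a * t powr (a - 1)) (at t)" if "t > 0" for t a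
    using that by (auto intro!: derivative_eq_intros)
  define dM where "dM t = \<gamma> * t powr (\<gamma> - 1) * (I t / 2 - J t / (p + 1) + \<beta> * t * P t)
    + t powr \<gamma> * (dI t / 2 - dJ t / (p + 1) + (\<beta> * P t + \<beta> * t * dP t))" for t
  have M': "(M has_real_derivative dM t) (at t)" if "t \<ge> t0" for t
  proof -
    have "t > 0" using that t0 by simp
    have "((\<lambda>t. I t / 2 - J t / (p + 1) + \<beta> * t * P t) has_real_derivative
      dI t / 2 - dJ t / (p + 1) + (\<beta> * P t + \<beta> * t * dP t)) (at t)"
      by (rule DERIV_cong[OF DERIV_add[OF DERIV_diff[OF DERIV_cdivide[OF dI[OF that]] DERIV_cdivide[OF dJ[OF that]]]
          DERIV_mult[OF DERIV_cmult[OF DERIV_ident] dP[OF that]]]]) simp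
    from DERIV_mult[OF dpw[OF \<open>t > 0\<close>, of \<gamma>] this]
    show ?thesis unfolding M_def[abs_def] dM_def by (simp add: algebra_simps)
  qed
  have "dM t \<le> 0" if "t \<ge> t0" for t
  proof -
    have t: "t > 0" using that t0 by simp
    define E where "E = I t / 2 - J t / (p + 1)"
    define dE where "dE = dI t / 2 - dJ t / (p + 1)"
    have IE: "I t = \<alpha> * E - \<beta> * (2 * t * Q t)"
    proof -
      have "E = I t / 2 - (I t - 2 * t * Q t) / (p + 1)" using U[OF that] by (simp add: E_def)
      also have "\<dots> = I t * (1 / 2 - 1 / (p + 1)) + 2 * t * Q t / (p + 1)"
        by (simp add: diff_divide_distrib right_diff_distrib)
      also have "\<dots> = I t / \<alpha> + 2 * t * Q t / (p + 1)" by (simp flip: \<alpha>(2))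
      finally have "\<alpha> * E = I t + \<alpha> * (2 * t * Q t / (p + 1))" using \<alpha>(1) by (simp add: distrib_left)
      also have "\<alpha> * (2 * t * Q t / (p + 1)) = \<beta> * (2 * t * Q t)" by (simp flip: ab)
      finally show ?thesis by simp
    qed
    have "n * E - I t + 2 * t * dE + 2 * t * S t = 0" using Po[OF that] by (simp add: E_def dE_def)
    then have tdE: "t * dE = - \<gamma> * E - \<beta> * (t * Q t) - t * S t"
      unfolding IE n \<alpha>(3) by (simp add: algebra_simps)
    have tdP: "t * dP t = - (\<gamma> + 1 + \<beta>) * P t - Q t"
      using Di[OF that] unfolding n by (simp add: algebra_simps)
    have tdM: "t * dM t = t powr \<gamma> * (\<gamma> * (E + \<beta> * t * P t) + t * dE + \<beta> * t * P t + \<beta> * t * (t * dP t))"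
      unfolding dM_def E_def[symmetric] dE_def[symmetric] pw(2)[OF t, symmetric] by (simp add: algebra_simps)
    (* all terms but those of the square cancel; this fixes the coefficient beta of P in M *)
    have "t * dM t = - (t powr \<gamma> * t * (S t + 2 * \<beta> * Q t + \<beta>\<^sup>2 * P t))"
      unfolding tdM tdE tdP by (simp add: algebra_simps power2_eq_square)
    also have "\<dots> \<le> 0" using sq[OF that] t by simp
    finally show ?thesis using t by (simp add: mult_le_0_iff)
  qed
  then have Mmono: "M t \<le> M t0" if "t \<ge> t0" for t
    using DERIV_nonpos_imp_nonincreasing[OF that, of M] M' by (meson order_trans)
  define dG where "dG t = 2 * ((\<gamma> + 1) * t powr \<gamma> * P t + t powr (\<gamma> + 1) * dP t)" for t
  have G': "(G has_real_derivative dG t) (at t)" if "t \<ge> t0" for t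
  proof -
    have "t > 0" using that t0 by simp
    from DERIV_cmult[OF DERIV_mult[OF dpw[OF this, of "\<gamma> + 1"] dP[OF that]], of 2]
    show ?thesis unfolding G_def[abs_def] dG_def by (simp add: algebra_simps)
  qed
  have tdG: "t * dG t = - 2 * t powr \<gamma> * t * (\<beta> * P t + Q t)" if "t \<ge> t0" for t
  proof -
    have t: "t > 0" using that t0 by simp
    have d: "t * dP t = - (\<gamma> + 1 + \<beta>) * P t - Q t"
      using Di[OF that] unfolding n by (simp add: algebra_simps)
    have "t * dG t = 2 * t powr \<gamma> * t * ((\<gamma> + 1) * P t + t * dP t)"
      unfolding dG_def pw(1)[OF t] by (simp add: algebra_simps)
    then show ?thesis unfolding d by (simp add: algebra_simps)
  qed
  have MJ: "M t = t powr \<gamma> * J t / \<alpha> - t * dG t / 2" if "t \<ge> t0" for t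
  proof -
    have "M t - t powr \<gamma> * J t / \<alpha> = t powr \<gamma> * (I t / 2 - J t / (p + 1) + \<beta> * t * P t - J t * (1 / \<alpha>))"
      by (simp add: M_def algebra_simps)
    also have "\<dots> = t powr \<gamma> * ((I t - J t) / 2 + \<beta> * t * P t)"
      unfolding \<alpha>(2) by (simp add: field_simps)
    also have "\<dots> = - (t * dG t / 2)" unfolding U[OF that] tdG[OF that] by (simp add: field_simps)
    finally show ?thesis by simp
  qed
  (* K is nonnegative, so that G - K is at most G *)
  define K where "K = max 0 ((2 * C2 + 2 * \<alpha> * M t0) / (\<alpha> * (\<gamma> + 2)))"
  have growth: "t * dG t \<ge> (\<gamma> + 2) * (G t - K)" if "t \<ge> t0" for t
  proof -
    have t: "t > 0" using that t0 by simp
    have "\<alpha> * (\<gamma> + 2) * (G t / 2) \<le> t powr \<gamma> * J t + C2" using holder[OF that] by (simp add: G_def mult.assoc)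
    then have "\<alpha> * (\<gamma> + 2) * G t \<le> 2 * (t powr \<gamma> * J t) + 2 * C2" by simp
    also have "t powr \<gamma> * J t = \<alpha> * (M t + t * dG t / 2)" using MJ[OF that] \<alpha>(1) by (simp add: field_simps)
    also have "2 * (\<alpha> * (M t + t * dG t / 2)) + 2 * C2 \<le> \<alpha> * (t * dG t) + (2 * C2 + 2 * \<alpha> * M t0)"
      using Mmono[OF that] \<alpha>(1) by (simp add: algebra_simps)
    also have "2 * C2 + 2 * \<alpha> * M t0 \<le> \<alpha> * (\<gamma> + 2) * K"
    proof -
      have "(2 * C2 + 2 * \<alpha> * M t0) / (\<alpha> * (\<gamma> + 2)) \<le> K" by (simp add: K_def)
      then show ?thesis using \<alpha>(1) \<gamma> by (simp add: pos_divide_le_eq mult.commute)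
    qed
    finally have "\<alpha> * ((\<gamma> + 2) * G t) \<le> \<alpha> * (t * dG t + (\<gamma> + 2) * K)" by (simp add: algebra_simps)
    then have "(\<gamma> + 2) * G t \<le> t * dG t + (\<gamma> + 2) * K"
      using \<alpha>(1) by (simp only: mult_le_cancel_left_pos)
    then show ?thesis by (simp add: right_diff_distrib)
  qed
  have GK: "G t1 \<le> K" if t1: "t1 \<ge> t0" for t1
  proof (rule ccontr)
    assume "\<not> G t1 \<le> K"
    then have e: "G t1 - K > 0" by simp
    (* the integrating factor: the differential inequality says that H does not decrease *)
    define H where "H t = (G t - K) * t powr (- (\<gamma> + 2))" for t
    have H': "(H has_real_derivative dG t * t powr (- (\<gamma> + 2)) + (G t - K) * (- (\<gamma> + 2) * t powr (- (\<gamma> + 2) - 1))) (at t)"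
      if "t \<ge> t0" for t
    proof -
      have "t > 0" using that t0 by simp
      from DERIV_mult[OF DERIV_diff[OF G'[OF that] DERIV_const[of K]] dpw[OF this, of "- (\<gamma> + 2)"]]
      show ?thesis unfolding H_def[abs_def] by (simp add: algebra_simps)
    qed
    have H0: "0 \<le> dG t * t powr (- (\<gamma> + 2)) + (G t - K) * (- (\<gamma> + 2) * t powr (- (\<gamma> + 2) - 1))" if "t \<ge> t0" for t
    proof -
      have t: "t > 0" using that t0 by simp
      have "t * t powr (- (\<gamma> + 2) - 1) = t powr (1 + (- (\<gamma> + 2) - 1))"
        by (rule powr_mult_base) (use t in simp)
      also have "1 + (- (\<gamma> + 2) - 1) = - (\<gamma> + 2)" by simp
      finally have tp: "t powr (- (\<gamma> + 2)) = t * t powr (- (\<gamma> + 2) - 1)" by (rule sym)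
      have "dG t * t powr (- (\<gamma> + 2)) + (G t - K) * (- (\<gamma> + 2) * t powr (- (\<gamma> + 2) - 1))
        = t powr (- (\<gamma> + 2) - 1) * (t * dG t - (\<gamma> + 2) * (G t - K))"
        unfolding tp by (simp add: algebra_simps del: minus_add_distrib)
      also have "\<dots> \<ge> 0" using growth[OF that] by simp
      finally show ?thesis .
    qed
    define h where "h = H t1"
    have "t1 > 0" using t1 t0 by simp
    then have h: "h > 0" using e by (simp add: h_def H_def)
    have Hh: "h \<le> H t" if "t \<ge> t1" for t
      unfolding h_def using DERIV_nonneg_imp_nondecreasing[OF that, of H] H' H0 t1 by (meson order_trans)
    (* at this scale h t^(gamma + 2), a lower bound for G - K, exceeds the upper bound 2 C1
       t^(gamma + 1) for G *)
    define t where "t = max t1 (2 * \<bar>C1\<bar> / h + 1)"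
    have t: "t \<ge> t1" "t > 0" "t > 2 * \<bar>C1\<bar> / h" using \<open>t1 > 0\<close> by (auto simp: t_def)
    have tt: "t powr (\<gamma> + 2) = t * t powr (\<gamma> + 1)" using t by (simp add: powr_add power2_eq_square)
    have "h * t powr (\<gamma> + 2) \<le> H t * t powr (\<gamma> + 2)" using Hh[OF t(1)] by (intro mult_right_mono) auto
    also have "\<dots> = G t - K"
    proof -
      have one: "t powr (- (\<gamma> + 2)) * t powr (\<gamma> + 2) = 1" using t(2) by (simp flip: powr_add)
      show ?thesis unfolding H_def mult.assoc one by simp
    qed
    also have "\<dots> \<le> G t" by (simp add: K_def)
    also have "\<dots> \<le> 2 * t powr (\<gamma> + 1) * \<bar>C1\<bar>"
      unfolding G_def using Pb[of t] t t1 by (intro mult_left_mono) auto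
    finally have "(h * t) * t powr (\<gamma> + 1) \<le> (2 * \<bar>C1\<bar>) * t powr (\<gamma> + 1)" unfolding tt by (simp add: mult_ac)
    then have "h * t \<le> 2 * \<bar>C1\<bar>" using t(2) by (simp add: mult_le_cancel_right)
    then show False using t(3) h by (simp add: pos_divide_less_eq mult.commute)
  qed
  have K0: "K \<ge> 0" by (simp add: K_def)
  have G0: "G t \<ge> 0" if "t \<ge> t0" for t using nonneg(2)[OF that] by (simp add: G_def)
  define D where "D = \<bar>M t0\<bar> + K"
  have main: "(2 * t) powr \<gamma> * (I (2 * t) + J (2 * t)) \<le> 2 powr \<gamma> * (2 * (\<alpha> * D) + 2 * K)" if t: "t \<ge> t0" for t
  proof -
    have tp: "t > 0" using t t0 by simp
    (* G varies by at most K between t and 2 t *)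
    obtain \<xi> where \<xi>: "t < \<xi>" "\<xi> < 2 * t" "G (2 * t) - G t = (2 * t - t) * dG \<xi>"
      using MVT2[of t "2 * t" G dG] G' t tp by force
    have \<xi>0: "\<xi> \<ge> t0" "\<xi> > 0" using \<xi> t tp by auto
    have "\<bar>t * dG \<xi>\<bar> \<le> K"
      using \<xi>(3) GK[of "2 * t"] GK[OF t] G0[of "2 * t"] G0[OF t] t tp t0 by auto
    then have "\<bar>dG \<xi>\<bar> * t \<le> K" using tp by (simp add: abs_mult mult.commute)
    then have "\<bar>dG \<xi>\<bar> * \<xi> \<le> 2 * K"
      using mult_left_mono[of \<xi> "2 * t" "\<bar>dG \<xi>\<bar>"] \<xi> by linarith
    then have g: "\<bar>\<xi> * dG \<xi>\<bar> \<le> 2 * K" using \<xi>0 by (simp add: abs_mult mult.commute)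
    have "\<xi> powr \<gamma> * J \<xi> / \<alpha> \<le> D" using MJ[OF \<xi>0(1)] Mmono[OF \<xi>0(1)] g by (simp add: D_def)
    then have bJ: "\<xi> powr \<gamma> * J \<xi> \<le> \<alpha> * D" using \<alpha>(1) by (simp add: divide_le_eq mult.commute)
    have "\<xi> powr \<gamma> * I \<xi> = \<xi> powr \<gamma> * J \<xi> + \<xi> powr \<gamma> * (2 * \<xi> * Q \<xi>)"
      using U[OF \<xi>0(1)] by (simp flip: distrib_left)
    also have "\<xi> powr \<gamma> * (2 * \<xi> * Q \<xi>) = - (\<xi> * dG \<xi>) - 2 * \<xi> powr \<gamma> * \<xi> * (\<beta> * P \<xi>)"
      unfolding tdG[OF \<xi>0(1)] by (simp add: algebra_simps)
    also have "\<dots> \<le> 2 * K"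
    proof -
      have "0 \<le> 2 * \<xi> powr \<gamma> * \<xi> * (\<beta> * P \<xi>)"
        using nonneg(2)[OF \<xi>0(1)] \<beta> \<xi>0(2) by (intro mult_nonneg_nonneg) auto
      then show ?thesis using g by linarith
    qed
    finally have bI: "\<xi> powr \<gamma> * I \<xi> \<le> \<alpha> * D + 2 * K" using bJ by simp
    have "I (2 * t) + J (2 * t) \<le> I \<xi> + J \<xi>" using mono[of \<xi> "2 * t"] \<xi> \<xi>0 by simp
    then have "(2 * t) powr \<gamma> * (I (2 * t) + J (2 * t)) \<le> (2 * t) powr \<gamma> * (I \<xi> + J \<xi>)" by (intro mult_left_mono) auto
    also have "\<dots> = 2 powr \<gamma> * t powr \<gamma> * (I \<xi> + J \<xi>)" using tp by (simp add: powr_mult)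
    finally have A: "(2 * t) powr \<gamma> * (I (2 * t) + J (2 * t)) \<le> 2 powr \<gamma> * (t powr \<gamma> * (I \<xi> + J \<xi>))" by (simp add: mult.assoc)
    have "t powr \<gamma> * (I \<xi> + J \<xi>) \<le> 2 * (\<alpha> * D) + 2 * K"
    proof (cases "I \<xi> + J \<xi> \<ge> 0")
      case True
      have "t powr \<gamma> * (I \<xi> + J \<xi>) \<le> \<xi> powr \<gamma> * (I \<xi> + J \<xi>)"
        using True \<xi> tp \<gamma> by (intro mult_right_mono powr_mono2) auto
      then show ?thesis using bI bJ by (simp add: distrib_left)
    next
      case False
      then have "t powr \<gamma> * (I \<xi> + J \<xi>) \<le> 0" by (simp add: mult_nonneg_nonpos)
      also have "0 \<le> 2 * (\<alpha> * D) + 2 * K" using \<alpha>(1) K0 by (simp add: D_def)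
      finally show ?thesis .
    qed
    then have "2 powr \<gamma> * (t powr \<gamma> * (I \<xi> + J \<xi>)) \<le> 2 powr \<gamma> * (2 * (\<alpha> * D) + 2 * K)" by (intro mult_left_mono) auto
    with A show ?thesis by linarith
  qed
  have "t powr \<gamma> * (I t + J t) \<le> 2 powr \<gamma> * (2 * (\<alpha> * D) + 2 * K)" if "t \<ge> 2 * t0" for t
    using main[of "t / 2"] that by simp
  then show ?thesis by blast
qed

section \<open>Stationary solutions\<close>

lemma L_space_one_iff:
  fixes f :: "real ^ 'n \<Rightarrow> real"
  shows "f \<in> L_space 1 U \<longleftrightarrow> integrable (lebesgue_on U) f"
  using integrable_norm_iff[of f "lebesgue_on U"] by (auto simp: L_space_def)

lemma L_space_two_mult_integrable:
  fixes f g :: "real ^ 'n \<Rightarrow> real"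
  assumes "f \<in> L_space 2 U" "g \<in> L_space 2 U"
  shows "integrable (lebesgue_on U) (\<lambda>x. f x * g x)"
  using L_space_pairing(1)[of 2 g U f] assms by simp

locale stationary =
  fixes p :: real and \<Omega> :: "(real ^ 'n) set" and u :: "real ^ 'n \<Rightarrow> real"
  assumes p: "p > 1" and open_\<Omega>: "open \<Omega>" and bounded_\<Omega>: "bounded \<Omega>" and stat: "stationary_solution p \<Omega> u"
begin

abbreviation "M \<equiv> lebesgue_on \<Omega>"
abbreviation "G \<equiv> weak_gradient \<Omega> u"

lemma \<Omega>_sets: "\<Omega> \<in> sets lebesgue" "\<Omega> \<in> lmeasurable" "\<Omega> \<in> sets borel"
  using open_\<Omega> bounded_\<Omega> by (auto simp: lmeasurable_open)

lemma u_H1: "u \<in> H1 \<Omega>" and u_Lp: "u \<in> L_space (p + 1) \<Omega>" and u_L2: "u \<in> L_space 2 \<Omega>"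
  using stat by (auto simp: stationary_solution_def H1_def)

lemma G_L2: "G \<in> L_space 2 \<Omega>" and G_grad: "has_weak_gradient \<Omega> u G"
  using H1_weak_gradient[OF open_\<Omega> u_H1] by auto

lemma G_comp: "(\<lambda>y. G y $ i) \<in> L_space 2 \<Omega>"
  by (rule L_space_component[OF _ G_L2]) simp

lemma meas[measurable]: "u \<in> borel_measurable M" "(\<lambda>y. G y $ i) \<in> borel_measurable M"
  using u_L2 G_comp by (auto simp: L_space_def)

lemma norm_G: "(norm (G y))\<^sup>2 = (\<Sum>i\<in>UNIV. G y $ i * G y $ i)"
  by (simp add: power2_norm_eq_inner inner_vec_def)

lemma int_grad_sq: "integrable M (\<lambda>y. (norm (G y))\<^sup>2)"
  unfolding norm_G by (intro Bochner_Integration.integrable_sum L_space_two_mult_integrable G_comp)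

lemma int_power: "integrable M (\<lambda>y. \<bar>u y\<bar> powr (p + 1))"
  using u_Lp by (simp add: L_space_def)

lemma int_u2: "integrable M (\<lambda>y. (u y)\<^sup>2)"
  using L_space_two_mult_integrable[OF u_L2 u_L2] by (simp add: power2_eq_square)

lemma int_uG: "integrable M (\<lambda>y. u y * G y $ i)"
  by (rule L_space_two_mult_integrable[OF u_L2 G_comp])

lemma power_L: "(\<lambda>y. \<bar>u y\<bar> powr (p - 1) * u y) \<in> L_space ((p + 1) / (p + 1 - 1)) \<Omega>"
proof -
  have "(\<bar>\<bar>s\<bar> powr (p - 1) * s\<bar>) powr ((p + 1) / (p + 1 - 1)) = \<bar>s\<bar> powr (p + 1)" for s :: real
  proof -
    have "\<bar>\<bar>s\<bar> powr (p - 1) * s\<bar> = \<bar>s\<bar> powr p"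
      using p by (cases "s = 0") (auto simp: abs_mult powr_diff)
    then show ?thesis using p by (simp add: powr_powr)
  qed
  then show ?thesis using int_power unfolding L_space_def by (auto intro!: borel_measurable_times)
qed

lemma weak_equation:
  "\<phi> \<in> test_functions \<Omega> \<Longrightarrow>
     (\<Sum>i\<in>UNIV. LINT y|M. G y $ i * partial_deriv i \<phi> y) = (LINT y|M. (\<bar>u y\<bar> powr (p - 1) * u y) * \<phi> y)"
proof -
  assume \<phi>: "\<phi> \<in> test_functions \<Omega>"
  have i: "integrable M (\<lambda>y. G y $ i * partial_deriv i \<phi> y)" for i
    by (intro L_space_two_mult_integrable G_comp test_function_L_space[OF partial_deriv_test_function[OF \<phi>]] \<Omega>_sets) simp
  have j: "integrable M (\<lambda>y. (\<bar>u y\<bar> powr (p - 1) * u y) * \<phi> y)"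
    using p by (intro L_space_pairing(1)[OF _ _ power_L] test_function_L_space[OF \<phi>] \<Omega>_sets) auto
  have "(LINT y|M. (\<Sum>i\<in>UNIV. G y $ i * partial_deriv i \<phi> y) - \<bar>u y\<bar> powr (p - 1) * u y * \<phi> y) = 0"
    using stat \<phi> by (simp add: stationary_solution_def)
  then show ?thesis using i j by simp
qed

text \<open>
  Both identities are those for test functions carried over to \<open>u \<eta>\<close> by \<open>H1_product_density\<close>:
  the first is the equation, the second the definition of the weak gradient, which says that
  \<open>u\<^sup>2\<close> has the gradient \<open>2 u \<nabla>u\<close>.
\<close>

lemma test_with_solution:
  assumes \<eta>: "\<eta> \<in> test_functions \<Omega>"
  shows "(\<Sum>i\<in>UNIV. LINT y|M. G y $ i * (\<eta> y * G y $ i + u y * partial_deriv i \<eta> y)) = (LINT y|M. \<bar>u y\<bar> powr (p + 1) * \<eta> y)"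
    "(LINT y|M. (u y)\<^sup>2 * partial_deriv i \<eta> y) = - 2 * (LINT y|M. u y * G y $ i * \<eta> y)"
proof -
  have p2: "p + 1 \<ge> 2" using p by simp
  obtain \<phi> where \<phi>: "\<And>k. \<phi> k \<in> test_functions \<Omega>"
    "\<And>g. g \<in> L_space 2 \<Omega> \<Longrightarrow> (\<lambda>k. LINT x|M. g x * \<phi> k x) \<longlonglongrightarrow> (LINT x|M. g x * (u x * \<eta> x))"
    "\<And>g. g \<in> L_space ((p + 1) / (p + 1 - 1)) \<Omega> \<Longrightarrow> (\<lambda>k. LINT x|M. g x * \<phi> k x) \<longlonglongrightarrow> (LINT x|M. g x * (u x * \<eta> x))"
    "\<And>h i. h \<in> L_space 2 \<Omega> \<Longrightarrow> (\<lambda>k. LINT x|M. h x * partial_deriv i (\<phi> k) x)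
       \<longlonglongrightarrow> (LINT x|M. h x * (\<eta> x * G x $ i + u x * partial_deriv i \<eta> x))"
    using H1_product_density[OF open_\<Omega> bounded_\<Omega> u_H1 u_Lp p2 \<eta>] by blast
  have "(\<lambda>k. \<Sum>i\<in>UNIV. LINT y|M. G y $ i * partial_deriv i (\<phi> k) y)
    \<longlonglongrightarrow> (\<Sum>i\<in>UNIV. LINT y|M. G y $ i * (\<eta> y * G y $ i + u y * partial_deriv i \<eta> y))"
    by (intro tendsto_sum \<phi>(4) G_comp)
  moreover have "(\<lambda>k. \<Sum>i\<in>UNIV. LINT y|M. G y $ i * partial_deriv i (\<phi> k) y)
    \<longlonglongrightarrow> (LINT y|M. (\<bar>u y\<bar> powr (p - 1) * u y) * (u y * \<eta> y))"
    unfolding weak_equation[OF \<phi>(1)] by (rule \<phi>(3)[OF power_L])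
  ultimately have "(\<Sum>i\<in>UNIV. LINT y|M. G y $ i * (\<eta> y * G y $ i + u y * partial_deriv i \<eta> y))
    = (LINT y|M. (\<bar>u y\<bar> powr (p - 1) * u y) * (u y * \<eta> y))" by (rule LIMSEQ_unique)
  also have "(\<lambda>y. (\<bar>u y\<bar> powr (p - 1) * u y) * (u y * \<eta> y)) = (\<lambda>y. \<bar>u y\<bar> powr (p + 1) * \<eta> y)"
  proof
    fix y
    have "\<bar>s\<bar> powr (p + 1) = \<bar>s\<bar> powr (p - 1) * s * s" for s :: real
    proof -
      have "\<bar>s\<bar> powr (p + 1) = \<bar>s\<bar> powr (p - 1) * s\<^sup>2" using powr_add[of "\<bar>s\<bar>" "p - 1" 2] by (simp add: add.commute)
      then show ?thesis by (simp add: power2_eq_square)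
    qed
    then show "(\<bar>u y\<bar> powr (p - 1) * u y) * (u y * \<eta> y) = \<bar>u y\<bar> powr (p + 1) * \<eta> y" by simp
  qed
  finally show "(\<Sum>i\<in>UNIV. LINT y|M. G y $ i * (\<eta> y * G y $ i + u y * partial_deriv i \<eta> y))
    = (LINT y|M. \<bar>u y\<bar> powr (p + 1) * \<eta> y)" .
  have "(\<lambda>k. LINT x|M. u x * partial_deriv i (\<phi> k) x) \<longlonglongrightarrow> - (LINT x|M. G x $ i * (u x * \<eta> x))"
    using tendsto_minus[OF \<phi>(2)[OF G_comp[of i]]] G_grad \<phi>(1) by (simp add: has_weak_gradient_def)
  with \<phi>(4)[OF u_L2, of i] have "(LINT x|M. u x * (\<eta> x * G x $ i + u x * partial_deriv i \<eta> x)) = - (LINT x|M. G x $ i * (u x * \<eta> x))"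
    by (rule LIMSEQ_unique)
  moreover have "(LINT x|M. u x * (\<eta> x * G x $ i + u x * partial_deriv i \<eta> x))
    = (LINT x|M. u x * G x $ i * \<eta> x) + (LINT x|M. (u x)\<^sup>2 * partial_deriv i \<eta> x)"
  proof -
    have "integrable M (\<lambda>x. u x * G x $ i * \<eta> x)"
      using L_space_two_mult_integrable[OF u_L2 L_space_mult_test[OF G_comp \<eta>, of i]] by (simp add: mult.assoc)
    moreover have "integrable M (\<lambda>x. (u x)\<^sup>2 * partial_deriv i \<eta> x)"
      using L_space_two_mult_integrable[OF u_L2 L_space_mult_test[OF u_L2 partial_deriv_test_function[OF \<eta>], of i]]
      by (simp add: power2_eq_square mult.assoc)
    ultimately have "(LINT x|M. u x * G x $ i * \<eta> x + (u x)\<^sup>2 * partial_deriv i \<eta> x)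
     = (LINT x|M. u x * G x $ i * \<eta> x) + (LINT x|M. (u x)\<^sup>2 * partial_deriv i \<eta> x)" by simp
    then show ?thesis by (simp add: distrib_left power2_eq_square mult_ac)
  qed
  moreover have "(LINT x|M. G x $ i * (u x * \<eta> x)) = (LINT x|M. u x * G x $ i * \<eta> x)" by (simp add: mult_ac)
  ultimately show "(LINT y|M. (u y)\<^sup>2 * partial_deriv i \<eta> y) = - 2 * (LINT y|M. u y * G y $ i * \<eta> y)" by simp
qed

end

locale stationary_at = stationary p \<Omega> u
  for p :: real and \<Omega> :: "(real ^ 'n) set" and u :: "real ^ 'n \<Rightarrow> real" +
  fixes x :: "real ^ 'n"
  assumes x: "x \<in> \<Omega>"
begin

definition radial_grad :: "real ^ 'n \<Rightarrow> real" where "radial_grad y = (y - x) \<bullet> G y"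
definition sqdist :: "real ^ 'n \<Rightarrow> real" where "sqdist y = (norm (y - x))\<^sup>2"

lemma radial_grad_sum: "radial_grad y = (\<Sum>i\<in>UNIV. (y $ i - x $ i) * G y $ i)"
  by (simp add: radial_grad_def inner_vec_def)

lemma sqdist_sum: "sqdist y = (\<Sum>i\<in>UNIV. (y $ i - x $ i) * (y $ i - x $ i))"
  by (simp add: sqdist_def power2_norm_eq_inner inner_vec_def)

lemma coord_bounded:
  obtains D where "D > 0" "\<And>y. y \<in> \<Omega> \<Longrightarrow> norm (y - x) \<le> D" "\<And>y i. y \<in> \<Omega> \<Longrightarrow> \<bar>y $ i - x $ i\<bar> \<le> D"
proof -
  obtain D where D: "D > 0" "\<And>y. y \<in> \<Omega> \<Longrightarrow> norm (y - x) \<le> D"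
    using bounded_\<Omega> bounded_translation_minus[of \<Omega> x] unfolding bounded_pos by auto
  then have "\<bar>y $ i - x $ i\<bar> \<le> D" if "y \<in> \<Omega>" for y i
    using component_le_norm_cart[of "y - x" i] D(2)[OF that] by simp
  with D that show ?thesis by blast
qed

lemma coord_meas[measurable]: "(\<lambda>y. y $ i - x $ i) \<in> borel_measurable M" "sqdist \<in> borel_measurable M"
  unfolding sqdist_def[abs_def] by (intro continuous_measurable_lebesgue_on continuous_intros)+

lemma int_coord:
  assumes a: "integrable M a" shows "integrable M (\<lambda>y. (y $ i - x $ i) * a y)"
proof -
  obtain D where D: "D > 0" "\<And>y i. y \<in> \<Omega> \<Longrightarrow> \<bar>y $ i - x $ i\<bar> \<le> D" using coord_bounded by metis
  have [measurable]: "a \<in> borel_measurable M" using a by auto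
  show ?thesis
    by (rule Bochner_Integration.integrable_bound[of M "\<lambda>y. D * a y"])
      (use a D in \<open>auto simp: abs_mult intro!: AE_I2 mult_right_mono\<close>)
qed

lemma int_sqdist: "integrable M a \<Longrightarrow> integrable M (\<lambda>y. sqdist y * a y)"
  unfolding sqdist_sum sum_distrib_right mult.assoc by (intro Bochner_Integration.integrable_sum int_coord)

lemma int_u_radial_grad: "integrable M (\<lambda>y. u y * radial_grad y)"
proof -
  have "integrable M (\<lambda>y. \<Sum>i\<in>UNIV. (y $ i - x $ i) * (u y * G y $ i))"
    by (intro Bochner_Integration.integrable_sum int_coord int_uG)
  then show ?thesis by (simp add: radial_grad_sum sum_distrib_left mult_ac)
qed

lemma int_radial_grad_sq: "integrable M (\<lambda>y. (radial_grad y)\<^sup>2)"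
proof (rule Bochner_Integration.integrable_bound)
  show "integrable M (\<lambda>y. sqdist y * (norm (G y))\<^sup>2)" by (intro int_sqdist int_grad_sq)
  have [measurable]: "radial_grad \<in> borel_measurable M" unfolding radial_grad_sum[abs_def] by measurable
  show "(\<lambda>y. (radial_grad y)\<^sup>2) \<in> borel_measurable M" by measurable
  have "(radial_grad y)\<^sup>2 \<le> sqdist y * (norm (G y))\<^sup>2" for y
    using Cauchy_Schwarz_ineq[of "y - x" "G y"] by (simp add: radial_grad_def sqdist_def power2_norm_eq_inner)
  then show "AE y in M. norm ((radial_grad y)\<^sup>2) \<le> norm (sqdist y * (norm (G y))\<^sup>2)"
    by (auto simp: sqdist_def)
qed

abbreviation rad :: "nat \<Rightarrow> real \<Rightarrow> real ^ 'n \<Rightarrow> real" where "rad j t \<equiv> radial j t x"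
abbreviation "rint j t a \<equiv> (LINT y|M. rad j t y * a y)"

lemma rint_int: "integrable M a \<Longrightarrow> t > 0 \<Longrightarrow> integrable M (\<lambda>y. rad j t y * a y)"
  by (rule radial_integrable) auto

lemma rint_DERIV:
  assumes a: "integrable M a" and t: "t > 0"
  shows "((\<lambda>t. rint j t a) has_real_derivative - rint (Suc j) t (\<lambda>y. sqdist y * a y)) (at t)"
  using radial_integral_DERIV[OF a _ t, of x j] int_sqdist[OF a] by (simp add: sqdist_def)

text \<open>
  The weight is the cut-off where it appears undifferentiated, and the derivative of its profile
  where a derivative has fallen on it; the latter comes with a factor \<open>t (y - x)\<close>.
\<close>

definition I where "I t = rint 0 t (\<lambda>y. (norm (G y))\<^sup>2)"
definition J where "J t = rint 0 t (\<lambda>y. \<bar>u y\<bar> powr (p + 1))"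
definition P where "P t = rint 1 t (\<lambda>y. (u y)\<^sup>2)"
definition Q where "Q t = rint 1 t (\<lambda>y. u y * radial_grad y)"
definition S where "S t = rint 1 t (\<lambda>y. (radial_grad y)\<^sup>2)"

context
  fixes t :: real assumes t: "t > 0" and sub: "cball x (1 / sqrt t) \<subseteq> \<Omega>"
begin

lemma rad_test: "rad j t \<in> test_functions \<Omega>"
  by (rule radial_test_function[OF t sub])

lemma rad_partial: "partial_deriv i (rad j t) y = - 2 * t * (rad (Suc j) t y * (y $ i - x $ i))"
  by (simp add: partial_deriv_radial mult_ac)

text \<open>
  The equation tested with \<open>u\<close> times the cut-off.
\<close>

lemma energy_identity: "I t - J t = 2 * t * Q t"
proof -
  have e: "G y $ i * (rad 0 t y * G y $ i + u y * partial_deriv i (rad 0 t) y)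
      = rad 0 t y * (G y $ i * G y $ i) - 2 * t * (rad 1 t y * ((y $ i - x $ i) * (u y * G y $ i)))" for y i
    by (simp add: rad_partial algebra_simps)
  have i1: "integrable M (\<lambda>y. rad 0 t y * (G y $ i * G y $ i))" for i
    by (intro rint_int t L_space_two_mult_integrable G_comp)
  have i2: "integrable M (\<lambda>y. 2 * t * (rad 1 t y * ((y $ i - x $ i) * (u y * G y $ i))))" for i
    by (intro integrable_mult_right rint_int t int_coord int_uG)
  have "(\<Sum>i\<in>UNIV. LINT y|M. rad 0 t y * (G y $ i * G y $ i) - 2 * t * (rad 1 t y * ((y $ i - x $ i) * (u y * G y $ i))))
    = (LINT y|M. (\<Sum>i\<in>UNIV. rad 0 t y * (G y $ i * G y $ i)) - (\<Sum>i\<in>UNIV. 2 * t * (rad 1 t y * ((y $ i - x $ i) * (u y * G y $ i)))))"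
    using i1 i2 by (subst Bochner_Integration.integral_sum[symmetric]) (auto simp: sum_subtractf)
  also have "\<dots> = I t - 2 * t * Q t"
    using i1 i2 unfolding I_def Q_def norm_G radial_grad_sum
    by (subst Bochner_Integration.integral_diff)
      (auto simp: sum_distrib_left mult_ac simp flip: Bochner_Integration.integral_mult_right_zero)
  finally show ?thesis
    using test_with_solution(1)[OF rad_test, of 0] unfolding e by (simp add: J_def mult.commute)
qed

text \<open>
  Integration by parts of \<open>u\<^sup>2\<close> against the components of the field \<open>h' (y - x)\<close>. The integral
  with index 2 is \<open>- P'\<close>.
\<close>

lemma divergence_identity: "real CARD('n) * P t + 2 * t * (- rint 2 t (\<lambda>y. sqdist y * (u y)\<^sup>2)) + 2 * Q t = 0"
proof -
  define \<psi> where "\<psi> i y = rad 1 t y * (y $ i - x $ i)" for i y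
  have lin: "smooth_on UNIV (\<lambda>y :: real ^ 'n. y $ i - x $ i)" for i
    using smooth_on_add[OF smooth_on_component smooth_on_const, of i "- x $ i"] by simp
  have \<psi>: "\<psi> i \<in> test_functions \<Omega>" for i
    unfolding \<psi>_def[abs_def] by (rule test_function_mult[OF rad_test lin])
  have d1: "partial_deriv i (\<lambda>y :: real ^ 'n. y $ i - x $ i) y = 1" for i y
    by (subst partial_deriv_has_derivative[of _ "\<lambda>h. h $ i"])
      (auto intro!: derivative_eq_intros bounded_linear_imp_has_derivative bounded_linear_vec_nth simp: axis_def)
  have dr: "rad 1 t differentiable (at y)" and dl: "(\<lambda>y :: real ^ 'n. y $ i - x $ i) differentiable (at y)" for i y
    by (rule smooth_on_UNIV_differentiable[OF smooth_on_radial] smooth_on_UNIV_differentiable[OF lin])+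
  have d: "partial_deriv i (\<psi> i) y = rad 1 t y - 2 * t * (rad 2 t y * ((y $ i - x $ i) * (y $ i - x $ i)))" for i y
    unfolding \<psi>_def[abs_def]
    using partial_deriv_scaleR[of "rad 1 t" y "\<lambda>y. y $ i - x $ i" i, OF dr dl]
    by (simp add: d1 rad_partial eval_nat_numeral mult_ac)
  have i1: "integrable M (\<lambda>y. rad 1 t y * (u y)\<^sup>2)" by (intro rint_int t int_u2)
  have i2: "integrable M (\<lambda>y. rad 2 t y * ((y $ i - x $ i) * ((y $ i - x $ i) * (u y)\<^sup>2)))" for i
    by (intro rint_int t int_coord int_u2)
  have i3: "integrable M (\<lambda>y. rad 1 t y * ((y $ i - x $ i) * (u y * G y $ i)))" for i
    by (intro rint_int t int_coord int_uG)
  have "(LINT y|M. (u y)\<^sup>2 * partial_deriv i (\<psi> i) y)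
    = P t - 2 * t * (LINT y|M. rad 2 t y * ((y $ i - x $ i) * ((y $ i - x $ i) * (u y)\<^sup>2)))" for i
  proof -
    have "(LINT y|M. (u y)\<^sup>2 * partial_deriv i (\<psi> i) y)
      = (LINT y|M. rad 1 t y * (u y)\<^sup>2 - 2 * t * (rad 2 t y * ((y $ i - x $ i) * ((y $ i - x $ i) * (u y)\<^sup>2))))"
      unfolding d by (intro Bochner_Integration.integral_cong) (auto simp: algebra_simps)
    also have "\<dots> = P t - 2 * t * (LINT y|M. rad 2 t y * ((y $ i - x $ i) * ((y $ i - x $ i) * (u y)\<^sup>2)))"
      using i1 i2[of i] unfolding P_def by (subst Bochner_Integration.integral_diff) auto
    finally show ?thesis .
  qed
  moreover have "(LINT y|M. u y * G y $ i * \<psi> i y) = (LINT y|M. rad 1 t y * ((y $ i - x $ i) * (u y * G y $ i)))" for i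
    by (simp add: \<psi>_def mult_ac)
  ultimately have "P t - 2 * t * (LINT y|M. rad 2 t y * ((y $ i - x $ i) * ((y $ i - x $ i) * (u y)\<^sup>2)))
    + 2 * (LINT y|M. rad 1 t y * ((y $ i - x $ i) * (u y * G y $ i))) = 0" for i
    using test_with_solution(2)[OF \<psi>[of i], of i] by simp
  then have "0 = (\<Sum>i\<in>UNIV. P t - 2 * t * (LINT y|M. rad 2 t y * ((y $ i - x $ i) * ((y $ i - x $ i) * (u y)\<^sup>2)))
    + 2 * (LINT y|M. rad 1 t y * ((y $ i - x $ i) * (u y * G y $ i))))" by simp
  also have "\<dots> = real CARD('n) * P t - 2 * t * (\<Sum>i\<in>UNIV. LINT y|M. rad 2 t y * ((y $ i - x $ i) * ((y $ i - x $ i) * (u y)\<^sup>2)))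
    + 2 * (\<Sum>i\<in>UNIV. LINT y|M. rad 1 t y * ((y $ i - x $ i) * (u y * G y $ i)))"
    by (simp add: sum.distrib sum_subtractf flip: sum_distrib_left)
  also have "(\<Sum>i\<in>UNIV. LINT y|M. rad 2 t y * ((y $ i - x $ i) * ((y $ i - x $ i) * (u y)\<^sup>2))) = rint 2 t (\<lambda>y. sqdist y * (u y)\<^sup>2)"
    using i2 by (subst Bochner_Integration.integral_sum[symmetric]) (auto simp: sqdist_sum sum_distrib_left sum_distrib_right mult.assoc)
  also have "(\<Sum>i\<in>UNIV. LINT y|M. rad 1 t y * ((y $ i - x $ i) * (u y * G y $ i))) = Q t"
    unfolding Q_def using i3 by (subst Bochner_Integration.integral_sum[symmetric]) (auto simp: radial_grad_sum sum_distrib_left mult_ac)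
  finally show ?thesis by simp
qed

text \<open>
  Pohozaev's identity: stationarity for the field \<open>h (y - x)\<close>. The terms with \<open>h'\<close> are the
  derivatives of \<open>I\<close> and \<open>J\<close> in \<open>t\<close>, and \<open>S\<close>.
\<close>

lemma pohozaev_identity:
  "real CARD('n) * (I t / 2 - J t / (p + 1)) - I t
   + 2 * t * (- rint 1 t (\<lambda>y. sqdist y * (norm (G y))\<^sup>2) / 2 - (- rint 1 t (\<lambda>y. sqdist y * \<bar>u y\<bar> powr (p + 1))) / (p + 1)) + 2 * t * S t = 0"
proof -
  define Y :: "real ^ 'n \<Rightarrow> real ^ 'n" where "Y y = rad 0 t y *\<^sub>R (y - x)" for y
  have lin: "smooth_on UNIV (\<lambda>y :: real ^ 'n. y - x)"
    using smooth_on_add[OF smooth_on_bounded_linear[OF bounded_linear_ident] smooth_on_const, of "- x"] by simp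
  have Y: "Y \<in> test_functions \<Omega>"
  proof (rule test_functionI)
    show "smooth_on UNIV Y" unfolding Y_def[abs_def] by (rule smooth_on_scaleR[OF smooth_on_radial lin])
    show "Y y = 0" if "y \<notin> cball x (1 / sqrt t)" for y
      using radial_zero[OF t, of y x 0] that by (simp add: Y_def dist_norm norm_minus_commute)
  qed (use sub in auto)
  have d1: "partial_deriv i (\<lambda>y :: real ^ 'n. y - x) y = axis i 1" for i y
    by (subst partial_deriv_has_derivative[of _ "\<lambda>h. h"]) (auto intro!: derivative_eq_intros)
  have d: "partial_deriv i Y y $ j = - 2 * t * (rad 1 t y * (y $ i - x $ i)) * (y $ j - x $ j) + (if i = j then rad 0 t y else 0)" for i j y
    unfolding Y_def[abs_def]
    by (subst partial_deriv_scaleR)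
      (use smooth_on_UNIV_differentiable[OF lin] smooth_on_UNIV_differentiable[OF smooth_on_radial]
        in \<open>auto simp: d1 rad_partial axis_def\<close>)
  have div: "divergence Y y = real CARD('n) * rad 0 t y - 2 * t * (rad 1 t y * sqdist y)" for y
    unfolding divergence_def d by (simp add: sum.distrib sum_subtractf sqdist_sum sum_distrib_left mult.assoc)
  have quad: "(\<Sum>i\<in>UNIV. \<Sum>j\<in>UNIV. partial_deriv i Y y $ j * G y $ i * G y $ j)
    = rad 0 t y * (norm (G y))\<^sup>2 - 2 * t * (rad 1 t y * (radial_grad y)\<^sup>2)" for y
  proof -
    have "(\<Sum>i\<in>UNIV. \<Sum>j\<in>UNIV. partial_deriv i Y y $ j * G y $ i * G y $ j)
      = (\<Sum>i\<in>UNIV. \<Sum>j\<in>UNIV. - 2 * t * rad 1 t y * (((y $ i - x $ i) * G y $ i) * ((y $ j - x $ j) * G y $ j))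
         + (if i = j then rad 0 t y * (G y $ i * G y $ i) else 0))"
      unfolding d by (intro sum.cong refl) (auto simp: algebra_simps)
    also have "\<dots> = - 2 * t * rad 1 t y * ((\<Sum>i\<in>UNIV. (y $ i - x $ i) * G y $ i) * (\<Sum>j\<in>UNIV. (y $ j - x $ j) * G y $ j))
       + rad 0 t y * (\<Sum>i\<in>UNIV. G y $ i * G y $ i)"
      unfolding sum_product by (simp add: sum.distrib sum_subtractf sum_negf sum_distrib_left)
    finally show ?thesis unfolding norm_G radial_grad_sum[symmetric] by (simp add: power2_eq_square)
  qed
  have e: "((norm (G y))\<^sup>2 / 2 - \<bar>u y\<bar> powr (p + 1) / (p + 1)) * divergence Y y
    - (\<Sum>i\<in>UNIV. \<Sum>j\<in>UNIV. partial_deriv i Y y $ j * G y $ i * G y $ j)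
    = (real CARD('n) / 2 - 1) * (rad 0 t y * (norm (G y))\<^sup>2) - (real CARD('n) / (p + 1)) * (rad 0 t y * \<bar>u y\<bar> powr (p + 1))
     - t * (rad 1 t y * (sqdist y * (norm (G y))\<^sup>2)) + (2 * t / (p + 1)) * (rad 1 t y * (sqdist y * \<bar>u y\<bar> powr (p + 1)))
     + 2 * t * (rad 1 t y * (radial_grad y)\<^sup>2)" for y
    unfolding quad div by (simp add: algebra_simps)
  have "0 = (LINT y|M. ((norm (G y))\<^sup>2 / 2 - \<bar>u y\<bar> powr (p + 1) / (p + 1)) * divergence Y y
    - (\<Sum>i\<in>UNIV. \<Sum>j\<in>UNIV. partial_deriv i Y y $ j * G y $ i * G y $ j))"
    using stat Y by (simp add: stationary_solution_def)
  also have "\<dots> = (real CARD('n) / 2 - 1) * I t - (real CARD('n) / (p + 1)) * J t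
     - t * rint 1 t (\<lambda>y. sqdist y * (norm (G y))\<^sup>2) + (2 * t / (p + 1)) * rint 1 t (\<lambda>y. sqdist y * \<bar>u y\<bar> powr (p + 1))
     + 2 * t * S t"
    unfolding e I_def J_def S_def
    using rint_int[OF int_grad_sq t, of 0] rint_int[OF int_power t, of 0] rint_int[OF int_sqdist[OF int_grad_sq] t, of 1]
      rint_int[OF int_sqdist[OF int_power] t, of 1] rint_int[OF int_radial_grad_sq t, of 1]
    by simp
  finally show ?thesis by (simp add: algebra_simps diff_divide_distrib)
qed

end

end

section \<open>Energy on small balls\<close>

lemma flat_0_mono: "s \<le> t \<Longrightarrow> flat 0 s \<le> flat 0 t"
  by (rule DERIV_nonneg_imp_nondecreasing) (use DERIV_flat flat_1_nonneg in blast)+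

lemma radial_0_antimono: "s \<le> t \<Longrightarrow> radial 0 t c y \<le> radial 0 s c y"
  unfolding radial_def by (intro flat_0_mono) (simp add: mult_right_mono)

lemma radial_nonneg: "0 \<le> radial 0 t c y" "0 \<le> radial 1 t c y"
  by (simp_all add: radial_def flat_0_nonneg flat_1_nonneg)

context stationary_at begin

definition energy :: "real \<Rightarrow> real" where
  "energy r = (LINT y|M. indicator (ball x r) y * ((norm (G y))\<^sup>2 + \<bar>u y\<bar> powr (p + 1)))"

lemma int_energy: "integrable M (\<lambda>y. indicator (ball x r) y * ((norm (G y))\<^sup>2 + \<bar>u y\<bar> powr (p + 1)))"
proof (rule Bochner_Integration.integrable_bound)
  show "integrable M (\<lambda>y. (norm (G y))\<^sup>2 + \<bar>u y\<bar> powr (p + 1))" using int_grad_sq int_power by simp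
  have [measurable]: "indicat_real (ball x r) \<in> borel_measurable M"
    by (intro measurable_restrict_space1 borel_measurable_indicator) simp
  have [measurable]: "(\<lambda>y. (norm (G y))\<^sup>2) \<in> borel_measurable M" using int_grad_sq by auto
  show "(\<lambda>y. indicator (ball x r) y * ((norm (G y))\<^sup>2 + \<bar>u y\<bar> powr (p + 1))) \<in> borel_measurable M" by measurable
qed (auto simp: indicator_def)

lemma radius_threshold:
  assumes "e > 0" obtains t0 where "t0 \<ge> 1" "\<And>t. t \<ge> t0 \<Longrightarrow> cball x (1 / sqrt t) \<subseteq> \<Omega>" "\<And>t. t \<ge> t0 \<Longrightarrow> 1 / sqrt t < e"
proof -
  obtain d where d: "d > 0" "cball x d \<subseteq> \<Omega>" using x open_\<Omega> open_contains_cball by blast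
  define m where "m = min d (e / 2)"
  have m: "m > 0" using d assms by (simp add: m_def)
  have le: "1 / sqrt t \<le> m" if "t \<ge> max 1 (1 / m\<^sup>2)" for t
  proof -
    have "sqrt (1 / m\<^sup>2) \<le> sqrt t" using that by (intro real_sqrt_le_mono) simp
    then have "1 / m \<le> sqrt t" using m by (simp add: real_sqrt_divide)
    moreover have "sqrt t > 0" using that by simp
    ultimately show ?thesis using m by (simp add: field_simps)
  qed
  show ?thesis
  proof (rule that[of "max 1 (1 / m\<^sup>2)"])
    fix t assume t: "t \<ge> max 1 (1 / m\<^sup>2)"
    show "cball x (1 / sqrt t) \<subseteq> \<Omega>" using le[OF t] d(2) by (auto simp: m_def intro!: order_trans[OF subset_cball d(2)])
    show "1 / sqrt t < e" using le[OF t] assms by (auto simp: m_def)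
  qed simp
qed

lemma I_DERIV: "t > 0 \<Longrightarrow> (I has_real_derivative - rint 1 t (\<lambda>y. sqdist y * (norm (G y))\<^sup>2)) (at t)"
  and J_DERIV: "t > 0 \<Longrightarrow> (J has_real_derivative - rint 1 t (\<lambda>y. sqdist y * \<bar>u y\<bar> powr (p + 1))) (at t)"
  and P_DERIV: "t > 0 \<Longrightarrow> (P has_real_derivative - rint 2 t (\<lambda>y. sqdist y * (u y)\<^sup>2)) (at t)"
  unfolding I_def[abs_def] J_def[abs_def] P_def[abs_def]
  using rint_DERIV[OF int_grad_sq, of t 0] rint_DERIV[OF int_power, of t 0] rint_DERIV[OF int_u2, of t 1]
  by (simp_all add: eval_nat_numeral)

lemma I_J_mono:
  assumes "0 < s" "s \<le> t" shows "I t \<le> I s" "J t \<le> J s"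
  using assms unfolding I_def J_def
  by (intro integral_mono rint_int int_grad_sq int_power mult_right_mono radial_0_antimono; simp)+

lemma J_P_nonneg: "0 \<le> I t" "0 \<le> J t" "0 \<le> P t"
  unfolding I_def J_def P_def
  by (intro Bochner_Integration.integral_nonneg mult_nonneg_nonneg radial_nonneg; simp)+

text \<open>
  The integral of \<open>h' ((y - x) \<bullet> \<nabla>u + b u)\<^sup>2\<close>, expanded.
\<close>

lemma square_nonneg:
  assumes "t > 0" shows "0 \<le> S t + 2 * b * Q t + b\<^sup>2 * P t"
proof -
  have "0 \<le> (LINT y|M. rad 1 t y * (radial_grad y + b * u y)\<^sup>2)"
    by (intro Bochner_Integration.integral_nonneg mult_nonneg_nonneg radial_nonneg) simp
  also have "\<dots> = (LINT y|M. rad 1 t y * (radial_grad y)\<^sup>2 + 2 * b * (rad 1 t y * (u y * radial_grad y)) + b\<^sup>2 * (rad 1 t y * (u y)\<^sup>2))"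
    by (intro Bochner_Integration.integral_cong) (auto simp: power2_eq_square algebra_simps)
  also have "\<dots> = S t + 2 * b * Q t + b\<^sup>2 * P t"
    unfolding S_def Q_def P_def
    using rint_int[OF int_radial_grad_sq assms, of 1] rint_int[OF int_u_radial_grad assms, of 1] rint_int[OF int_u2 assms, of 1] by simp
  finally show ?thesis .
qed

lemma indicator_ball_integral:
  "integrable M (indicat_real (ball x r))"
  "r \<ge> 0 \<Longrightarrow> (LINT y|M. indicat_real (ball x r) y) \<le> unit_ball_vol (real CARD('n)) * r ^ CARD('n)"
proof -
  interpret finite_measure M by (rule finite_measure_lebesgue_on[OF \<Omega>_sets(2)])
  have m: "indicat_real (ball x r) \<in> borel_measurable M"
    by (intro measurable_restrict_space1 borel_measurable_indicator) simp
  show i: "integrable M (indicat_real (ball x r))"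
    by (rule integrable_const_bound[of _ 1]) (use m in auto)
  assume r: "r \<ge> 0"
  have "(LINT y|M. indicat_real (ball x r) y) \<le> (LINT y|lebesgue. indicat_real (ball x r) y)"
  proof -
    have "integrable lebesgue (indicat_real (ball x r))" by (simp flip: lmeasurable_iff_integrable)
    then show ?thesis
      using integral_mono_lebesgue_on_AE[where f = "indicat_real (ball x r)" and g = "indicat_real (ball x r)" and S = \<Omega> and T = UNIV] \<Omega>_sets
      by (simp add: lebesgue_on_UNIV_eq)
  qed
  also have "\<dots> = unit_ball_vol (real CARD('n)) * r ^ CARD('n)"
    using r by (simp add: content_ball)
  finally show "(LINT y|M. indicat_real (ball x r) y) \<le> unit_ball_vol (real CARD('n)) * r ^ CARD('n)" .
qed

lemma ball_volume_t:
  assumes "t > 0"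
  shows "(LINT y|M. indicat_real (ball x (1 / sqrt t)) y) \<le> unit_ball_vol (real CARD('n)) * t powr (- (real CARD('n) / 2))"
proof -
  have "(1 / sqrt t) ^ CARD('n) = t powr (- (real CARD('n) / 2))"
  proof -
    have "1 / sqrt t = t powr (- (1/2))" using assms by (simp add: powr_minus_divide powr_half_sqrt)
    moreover have "(t powr (- (1/2))) ^ CARD('n) = (t powr (- (1/2))) powr real CARD('n)"
      using assms by (simp add: powr_realpow)
    ultimately show ?thesis by (simp add: powr_powr)
  qed
  then show ?thesis using indicator_ball_integral(2)[of "1 / sqrt t"] assms by simp
qed

text \<open>
  Pointwise, \<open>h' u\<^sup>2\<close> is at most a constant times \<open>h\<^bsup>1/q\<^esup> u\<^sup>2\<close> with \<open>q = (p + 1) / 2\<close>, and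
  Young's inequality splits this into \<open>h \<bar>u\<bar>\<^bsup>p+1\<^esup>\<close> and a constant. The constant is integrated
  over a ball of volume of order \<open>t\<^bsup>-n/2\<^esup>\<close>, and by the choice of \<open>\<gamma>\<close> the powers of \<open>t\<close> in front
  of it cancel.
\<close>

lemma P_holder:
  assumes \<gamma>: "\<gamma> = (real CARD('n) - 2 * (p + 1) / (p - 1)) / 2" and l: "l \<ge> 0"
  shows "\<exists>C2. \<forall>t>0. l * (t powr (\<gamma> + 1) * P t) \<le> t powr \<gamma> * J t + C2"
proof -
  define q where "q = (p + 1) / 2"
  define q' where "q' = (p + 1) / (p - 1)"
  have q: "q > 1" "q' > 1" using p by (auto simp: q_def q'_def)
  have qq: "1 / q + 1 / q' = 1" using p by (simp add: q_def q'_def add_divide_distrib[symmetric])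
  obtain C where C: "C > 0" "\<And>t. flat (Suc 0) t \<le> C * flat 0 t powr (1 / q)"
    using flat_1_le_powr[of "1 / q"] q by auto
  define \<omega> where "\<omega> = unit_ball_vol (real CARD('n))"
  have "l * (t powr (\<gamma> + 1) * P t) \<le> t powr \<gamma> * J t + (l * C) powr q' * \<omega>" if t: "t > 0" for t
  proof -
    have pt: "l * t * (rad 1 t y * (u y)\<^sup>2) \<le> rad 0 t y * \<bar>u y\<bar> powr (p + 1) + (l * C * t) powr q' * indicat_real (ball x (1 / sqrt t)) y" for y
    proof (cases "y \<in> ball x (1 / sqrt t)")
      case False
      then have "rad 1 t y = 0" using t by (intro radial_zero) (auto simp: dist_norm norm_minus_commute)
      then show ?thesis by (simp add: radial_nonneg)
    next
      case True
      define a where "a = rad 0 t y powr (1 / q) * (u y)\<^sup>2"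
      have "(u y)\<^sup>2 powr q = \<bar>u y\<bar> powr (p + 1)"
      proof -
        have "(u y)\<^sup>2 = \<bar>u y\<bar> powr 2" by simp
        then have "(u y)\<^sup>2 powr q = (\<bar>u y\<bar> powr 2) powr q" by (rule arg_cong)
        also have "\<dots> = \<bar>u y\<bar> powr (2 * q)" by (rule powr_powr)
        also have "2 * q = p + 1" by (simp add: q_def)
        finally show ?thesis .
      qed
      then have aq: "a powr q = rad 0 t y * \<bar>u y\<bar> powr (p + 1)"
        using q(1) radial_nonneg(1)[of t x y] by (simp add: a_def powr_mult powr_powr)
      have "l * t * (rad 1 t y * (u y)\<^sup>2) \<le> l * t * (C * rad 0 t y powr (1 / q) * (u y)\<^sup>2)"
        using C(2)[of "1 - t * (norm (y - x))\<^sup>2"] l t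
        by (intro mult_left_mono mult_right_mono) (auto simp: radial_def)
      also have "\<dots> = a * (l * C * t)" by (simp add: a_def mult_ac)
      also have "\<dots> \<le> a powr q / q + (l * C * t) powr q' / q'"
        using q qq l t C(1) by (intro Youngs_inequality) (auto simp: a_def)
      also have "\<dots> \<le> a powr q + (l * C * t) powr q'"
      proof -
        have "X / c \<le> X" if "X \<ge> 0" "c \<ge> 1" for X c :: real
          using that by (simp add: divide_le_eq mult_le_cancel_left1)
        then show ?thesis using q by (intro add_mono) (simp_all only: powr_ge_zero less_imp_le)
      qed
      finally show ?thesis using True by (simp add: aq)
    qed
    have "l * t * P t = (LINT y|M. l * t * (rad 1 t y * (u y)\<^sup>2))" by (simp add: P_def)
    also have "\<dots> \<le> (LINT y|M. rad 0 t y * \<bar>u y\<bar> powr (p + 1) + (l * C * t) powr q' * indicat_real (ball x (1 / sqrt t)) y)"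
      using pt by (intro integral_mono integrable_mult_right Bochner_Integration.integrable_add
          rint_int int_u2 int_power t indicator_ball_integral(1))
    also have "\<dots> = J t + (l * C * t) powr q' * (LINT y|M. indicat_real (ball x (1 / sqrt t)) y)"
      using rint_int[OF int_power t, of 0] indicator_ball_integral(1) by (simp add: J_def)
    also have "\<dots> \<le> J t + (l * C * t) powr q' * (\<omega> * t powr (- (real CARD('n) / 2)))"
      using ball_volume_t[OF t] by (intro add_left_mono mult_left_mono) (auto simp: \<omega>_def)
    finally have "t powr \<gamma> * (l * t * P t) \<le> t powr \<gamma> * (J t + (l * C * t) powr q' * (\<omega> * t powr (- (real CARD('n) / 2))))"
      by (intro mult_left_mono) auto
    also have "\<dots> = t powr \<gamma> * J t + (l * C) powr q' * \<omega> * (t powr \<gamma> * t powr q' * t powr (- (real CARD('n) / 2)))"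
      using l C(1) t by (simp add: powr_mult algebra_simps)
    also have "t powr \<gamma> * t powr q' * t powr (- (real CARD('n) / 2)) = t powr (\<gamma> + q' + (- (real CARD('n) / 2)))"
      by (simp only: powr_add)
    also have "\<gamma> + q' + (- (real CARD('n) / 2)) = 0"
    proof -
      have "2 * (p + 1) / (p - 1) = 2 * q'" by (simp add: q'_def)
      then show ?thesis unfolding \<gamma> by (simp only: diff_divide_distrib)
    qed
    finally show ?thesis using t by (simp add: powr_add mult_ac)
  qed
  then show ?thesis by blast
qed

text \<open>
  At this scale the argument of the cut-off profile is at least \<open>3 / 4\<close> on the ball of radius
  \<open>r\<close>.
\<close>

lemma energy_le_I_J:
  assumes r: "r > 0" and t: "t = 1 / (4 * r\<^sup>2)"
  shows "energy r \<le> exp (4 / 3) * (I t + J t)"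
proof -
  have tp: "t > 0" using r t by simp
  have "energy r \<le> (LINT y|M. exp (4 / 3) * (rad 0 t y * (norm (G y))\<^sup>2 + rad 0 t y * \<bar>u y\<bar> powr (p + 1)))"
    unfolding energy_def
  proof (rule integral_mono[OF int_energy])
    show "integrable M (\<lambda>y. exp (4 / 3) * (rad 0 t y * (norm (G y))\<^sup>2 + rad 0 t y * \<bar>u y\<bar> powr (p + 1)))"
      by (intro integrable_mult_right Bochner_Integration.integrable_add rint_int int_grad_sq int_power tp)
    fix y
    show "indicat_real (ball x r) y * ((norm (G y))\<^sup>2 + \<bar>u y\<bar> powr (p + 1))
      \<le> exp (4 / 3) * (rad 0 t y * (norm (G y))\<^sup>2 + rad 0 t y * \<bar>u y\<bar> powr (p + 1))"
    proof (cases "y \<in> ball x r")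
      case True
      then have "norm (y - x) < r" by (simp add: dist_norm norm_minus_commute)
      then have "(norm (y - x))\<^sup>2 \<le> r\<^sup>2" by (intro power_mono) auto
      then have "t * (norm (y - x))\<^sup>2 \<le> t * r\<^sup>2" using tp by (intro mult_left_mono) auto
      also have "t * r\<^sup>2 = 1 / 4" using r by (simp add: t)
      finally have "flat 0 (3 / 4) \<le> rad 0 t y" unfolding radial_def by (intro flat_0_mono) simp
      then have "exp (- (4 / 3)) \<le> rad 0 t y" by (simp add: flat_0)
      then have "exp (4 / 3) * exp (- (4 / 3)) \<le> exp (4 / 3) * rad 0 t y" by (intro mult_left_mono) auto
      then have one: "1 \<le> exp (4 / 3) * rad 0 t y" by (simp flip: exp_add)
      have "1 * ((norm (G y))\<^sup>2 + \<bar>u y\<bar> powr (p + 1)) \<le> (exp (4 / 3) * rad 0 t y) * ((norm (G y))\<^sup>2 + \<bar>u y\<bar> powr (p + 1))"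
        by (intro mult_right_mono one) simp
      then show ?thesis using True by (simp add: distrib_left mult.assoc)
    qed (simp add: radial_nonneg)
  qed
  also have "\<dots> = exp (4 / 3) * (I t + J t)"
    using rint_int[OF int_grad_sq tp, of 0] rint_int[OF int_power tp, of 0] by (simp add: I_def J_def)
  finally show ?thesis .
qed

text \<open>
  For small radii this is \<open>monotonicity_bound\<close> at \<open>t = 1 / (4 r\<^sup>2)\<close>; at larger radii the total
  energy of \<open>u\<close> is below the right-hand side once \<open>C\<close> is large.
\<close>

theorem energy_bound:
  assumes n: "alpha p < real CARD('n)"
  shows "\<exists>C\<ge>0. \<forall>r>0. energy r \<le> C * r powr (real CARD('n) - alpha p)"
proof -
  define \<gamma> where "\<gamma> = (real CARD('n) - 2 * (p + 1) / (p - 1)) / 2"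
  have \<gamma>: "\<gamma> > 0" "2 * \<gamma> = real CARD('n) - alpha p" using n by (auto simp: \<gamma>_def alpha_def)
  obtain t0 where t0: "t0 \<ge> 1" "\<And>t. t \<ge> t0 \<Longrightarrow> cball x (1 / sqrt t) \<subseteq> \<Omega>"
    "\<And>t. t \<ge> t0 \<Longrightarrow> 1 / sqrt t < 1"
    by (rule radius_threshold[OF zero_less_one]) (rule that; blast)
  have tp: "t > 0" if "t \<ge> t0" for t using that t0(1) by simp
  obtain C1 where C1: "\<And>t. t \<ge> t0 \<Longrightarrow> P t \<le> C1"
  proof -
    obtain B where B: "B > 0" "\<And>t c y. t \<ge> 0 \<Longrightarrow> \<bar>radial 1 t (c :: real ^ 'n) y\<bar> \<le> B"
      using radial_bounded[where j = 1] by metis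
    have "P t \<le> (LINT y|M. B * (u y)\<^sup>2)" if "t \<ge> t0" for t
      unfolding P_def using B(2)[of t x] tp[OF that]
      by (intro integral_mono rint_int integrable_mult_right int_u2 mult_right_mono) (auto simp: abs_le_iff)
    then show ?thesis using that by blast
  qed
  have p': "2 * (p + 1) / (p - 1) * (\<gamma> + 2) \<ge> 0" using p \<gamma>(1) by simp
  obtain C2 where C2: "\<And>t. t > 0 \<Longrightarrow> 2 * (p + 1) / (p - 1) * (\<gamma> + 2) * (t powr (\<gamma> + 1) * P t) \<le> t powr \<gamma> * J t + C2"
    using P_holder[OF \<gamma>_def p'] by auto
  have "\<exists>C. \<forall>t\<ge>2 * t0. t powr \<gamma> * (I t + J t) \<le> C"
    unfolding \<gamma>_def
  proof (rule monotonicity_bound[OF p, where S = S and Q = Q and P = P])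
    show "0 < (real CARD('n) - 2 * (p + 1) / (p - 1)) / 2" using \<gamma>(1) by (simp add: \<gamma>_def)
    show "0 < t0" using t0 by simp
    fix t assume t: "t0 \<le> t"
    note tp = tp[OF t] and sub = t0(2)[OF t]
    show "(I has_real_derivative - rint 1 t (\<lambda>y. sqdist y * (norm (G y))\<^sup>2)) (at t)" by (rule I_DERIV[OF tp])
    show "(J has_real_derivative - rint 1 t (\<lambda>y. sqdist y * \<bar>u y\<bar> powr (p + 1))) (at t)" by (rule J_DERIV[OF tp])
    show "(P has_real_derivative - rint 2 t (\<lambda>y. sqdist y * (u y)\<^sup>2)) (at t)" by (rule P_DERIV[OF tp])
    show "I t - J t = 2 * t * Q t" by (rule energy_identity[OF tp sub])
    show "real CARD('n) * (I t / 2 - J t / (p + 1)) - I t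
      + 2 * t * (- rint 1 t (\<lambda>y. sqdist y * (norm (G y))\<^sup>2) / 2 - (- rint 1 t (\<lambda>y. sqdist y * \<bar>u y\<bar> powr (p + 1))) / (p + 1)) + 2 * t * S t = 0"
      by (rule pohozaev_identity[OF tp sub])
    show "real CARD('n) * P t + 2 * t * (- rint 2 t (\<lambda>y. sqdist y * (u y)\<^sup>2)) + 2 * Q t = 0" by (rule divergence_identity[OF tp sub])
    show "0 \<le> S t + 2 * (2 / (p - 1)) * Q t + (2 / (p - 1))\<^sup>2 * P t" by (rule square_nonneg[OF tp])
    show "0 \<le> J t" "0 \<le> P t" by (rule J_P_nonneg)+
    show "P t \<le> C1" by (rule C1[OF t])
    show "2 * (p + 1) / (p - 1) * ((real CARD('n) - 2 * (p + 1) / (p - 1)) / 2 + 2) *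
         (t powr ((real CARD('n) - 2 * (p + 1) / (p - 1)) / 2 + 1) * P t)
         \<le> t powr ((real CARD('n) - 2 * (p + 1) / (p - 1)) / 2) * J t + C2"
      using C2[OF tp] unfolding \<gamma>_def .
  next
    fix s t assume "t0 \<le> s" "s \<le> t"
    then show "I t \<le> I s" "J t \<le> J s" using I_J_mono tp by blast+
  qed
  then obtain C where C: "\<And>t. t \<ge> 2 * t0 \<Longrightarrow> t powr \<gamma> * (I t + J t) \<le> C" by blast
  have C0: "C \<ge> 0"
    using C[of "2 * t0"] J_P_nonneg(1,2)[of "2 * t0"] order_trans[of 0 "(2 * t0) powr \<gamma> * (I (2 * t0) + J (2 * t0))" C] by simp
  define r1 where "r1 = 1 / (2 * sqrt (2 * t0))"
  have r1: "r1 > 0" using t0 by (simp add: r1_def)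
  define T where "T = (LINT y|M. (norm (G y))\<^sup>2 + \<bar>u y\<bar> powr (p + 1))"
  have T: "energy r \<le> T" for r
    unfolding energy_def T_def using int_grad_sq int_power by (intro integral_mono int_energy) (auto simp: indicator_def)
  have T0: "T \<ge> 0" unfolding T_def by (intro Bochner_Integration.integral_nonneg) simp
  define K where "K = exp (4 / 3) * C * 4 powr \<gamma> + T * (1 / r1) powr (2 * \<gamma>)"
  have "energy r \<le> K * r powr (2 * \<gamma>)" if r: "r > 0" for r
  proof (cases "r \<le> r1")
    case True
    define t where "t = 1 / (4 * r\<^sup>2)"
    have tp: "t > 0" using r by (simp add: t_def)
    have "r\<^sup>2 \<le> r1\<^sup>2" using True r by (intro power_mono) auto
    also have "r1\<^sup>2 = 1 / (8 * t0)" using t0 by (simp add: r1_def power_divide power_mult_distrib)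
    finally have "2 * t0 \<le> t" using r t0 by (simp add: t_def field_simps)
    then have "t powr \<gamma> * (I t + J t) \<le> C" by (rule C)
    then have "I t + J t \<le> C * t powr (- \<gamma>)" using tp by (simp add: powr_minus field_simps)
    also have "t powr (- \<gamma>) = (4 * r\<^sup>2) powr \<gamma>"
      using r by (simp add: t_def powr_minus powr_divide)
    also have "\<dots> = 4 powr \<gamma> * r powr (2 * \<gamma>)"
    proof -
      have "(r\<^sup>2) powr \<gamma> = (r powr 2) powr \<gamma>" using r by simp
      also have "\<dots> = r powr (2 * \<gamma>)" by (rule powr_powr)
      finally show ?thesis using r by (simp add: powr_mult)
    qed
    finally have "exp (4 / 3) * (I t + J t) \<le> exp (4 / 3) * (C * (4 powr \<gamma> * r powr (2 * \<gamma>)))" by (intro mult_left_mono) auto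
    with energy_le_I_J[OF r t_def] have "energy r \<le> exp (4 / 3) * (C * (4 powr \<gamma> * r powr (2 * \<gamma>)))" by linarith
    also have "\<dots> \<le> K * r powr (2 * \<gamma>)" using T0 by (simp add: K_def distrib_right mult.assoc)
    finally show ?thesis .
  next
    case False
    have "1 \<le> (r / r1) powr (2 * \<gamma>)" using False r1 \<gamma>(1) by (intro ge_one_powr_ge_zero) auto
    then have "T * 1 \<le> T * (r / r1) powr (2 * \<gamma>)" using T0 by (intro mult_left_mono)
    also have "\<dots> = T * (1 / r1) powr (2 * \<gamma>) * r powr (2 * \<gamma>)"
      using r r1 by (simp add: powr_divide)
    also have "\<dots> \<le> K * r powr (2 * \<gamma>)" using C0 by (intro mult_right_mono) (auto simp: K_def)
    finally show ?thesis using T[of r] by simp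
  qed
  moreover have "K \<ge> 0" using C0 T0 by (simp add: K_def)
  ultimately show ?thesis unfolding \<gamma>(2) by blast
qed

text \<open>
  A Caccioppoli estimate. Boundedness of \<open>u\<close> makes \<open>J\<close> and \<open>P\<close> of the order of the volume
  \<open>t\<^bsup>-n/2\<^esup>\<close>. By \<open>energy_identity\<close> and \<open>divergence_identity\<close>, \<open>I\<close> is bounded by \<open>J\<close> and
  \<open>- t\<^sup>2 P'\<close>, and the mean value theorem makes \<open>- P'\<close> at most of order \<open>P / t\<close> somewhere between
  \<open>t\<close> and \<open>2 t\<close>. So \<open>I\<close> is of order \<open>t\<^bsup>1-n/2\<^esup>\<close>, that is \<open>r\<^bsup>n-2\<^esup>\<close>.
\<close>

theorem energy_decay_bounded:
  assumes \<rho>: "\<rho> > 0" "ball x \<rho> \<subseteq> \<Omega>" and m: "AE y in lebesgue_on (ball x \<rho>). \<bar>u y\<bar> \<le> m"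
  shows "\<exists>C r1. r1 > 0 \<and> (\<forall>r. 0 < r \<and> r \<le> r1 \<longrightarrow> energy r \<le> C * r powr (real CARD('n) - 2))"
proof -
  obtain t0 where t0: "t0 \<ge> 1" "\<And>t. t \<ge> t0 \<Longrightarrow> cball x (1 / sqrt t) \<subseteq> \<Omega>" "\<And>t. t \<ge> t0 \<Longrightarrow> 1 / sqrt t < \<rho>"
    by (rule radius_threshold[OF \<rho>(1)]) (rule that; blast)
  define \<omega> where "\<omega> = unit_ball_vol (real CARD('n))"
  have "AE y in lebesgue. y \<in> ball x \<rho> \<longrightarrow> \<bar>u y\<bar> \<le> m" using m by (simp add: AE_restrict_space_iff)
  then have mM: "AE y in M. y \<in> ball x \<rho> \<longrightarrow> \<bar>u y\<bar> \<le> m"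
    using \<Omega>_sets by (simp add: AE_restrict_space_iff) (auto elim: eventually_mono)
  have rbound: "rint j t a \<le> B * b * (\<omega> * t powr (- (real CARD('n) / 2)))"
    if t: "t \<ge> t0" and a: "integrable M a" "AE y in M. y \<in> ball x \<rho> \<longrightarrow> 0 \<le> a y \<and> a y \<le> b"
      and B: "\<And>y. \<bar>rad j t y\<bar> \<le> B" and "0 \<le> b" for j t a b B
  proof -
    have tp: "t > 0" using t t0 by simp
    have Bb: "0 \<le> B" using B[of x] by linarith
    have "rint j t a \<le> (LINT y|M. B * b * indicat_real (ball x (1 / sqrt t)) y)"
    proof (rule integral_mono_AE)
      show "AE y in M. rad j t y * a y \<le> B * b * indicat_real (ball x (1 / sqrt t)) y"
        using a(2)
      proof eventually_elim
        case (elim y)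
        show ?case
        proof (cases "y \<in> ball x (1 / sqrt t)")
          case True
          then have y: "0 \<le> a y" "a y \<le> b" using elim t0(3)[OF t] by auto
          have "rad j t y * a y \<le> B * a y" using B[of y] y by (intro mult_right_mono) auto
          also have "\<dots> \<le> B * b" using y Bb by (intro mult_left_mono)
          finally show ?thesis using True by simp
        next
          case False
          then have "rad j t y = 0" using tp by (intro radial_zero) (auto simp: dist_norm norm_minus_commute)
          then show ?thesis using Bb \<open>0 \<le> b\<close> by simp
        qed
      qed
    qed (intro rint_int a tp integrable_mult_right indicator_ball_integral(1))+
    also have "\<dots> = B * b * (LINT y|M. indicat_real (ball x (1 / sqrt t)) y)" by simp
    also have "\<dots> \<le> B * b * (\<omega> * t powr (- (real CARD('n) / 2)))"
      using ball_volume_t[OF tp] Bb \<open>0 \<le> b\<close> by (intro mult_left_mono) (auto simp: \<omega>_def)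
    finally show ?thesis .
  qed
  obtain B where B: "B > 0" "\<And>t c y. t \<ge> 0 \<Longrightarrow> \<bar>radial 1 t (c :: real ^ 'n) y\<bar> \<le> B"
    using radial_bounded[where j = 1] by metis
  define m1 where "m1 = \<bar>m\<bar> powr (p + 1)"
  define m2 where "m2 = m\<^sup>2"
  have Jb: "J t \<le> m1 * (\<omega> * t powr (- (real CARD('n) / 2)))" if t: "t \<ge> t0" for t
  proof -
    have "\<bar>rad 0 t y\<bar> \<le> 1" for y by (simp add: radial_def flat_0_nonneg flat_0_le_1)
    moreover have "AE y in M. y \<in> ball x \<rho> \<longrightarrow> 0 \<le> \<bar>u y\<bar> powr (p + 1) \<and> \<bar>u y\<bar> powr (p + 1) \<le> m1"
      using mM by eventually_elim (use p in \<open>auto simp: m1_def intro!: powr_mono2\<close>)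
    ultimately show ?thesis using rbound[OF t int_power, of m1 0 1] by (simp add: J_def m1_def)
  qed
  have Pb: "P t \<le> B * m2 * (\<omega> * t powr (- (real CARD('n) / 2)))" if t: "t \<ge> t0" for t
  proof -
    have "AE y in M. y \<in> ball x \<rho> \<longrightarrow> 0 \<le> (u y)\<^sup>2 \<and> (u y)\<^sup>2 \<le> m2"
      using mM by eventually_elim (auto simp: m2_def abs_le_square_iff[symmetric])
    then show ?thesis unfolding P_def using t t0 by (intro rbound int_u2 B(2)) (auto simp: m2_def)
  qed
  define h where "h t = \<omega> * t powr (- (real CARD('n) / 2))" for t
  have \<omega>0: "\<omega> \<ge> 0" by (simp add: \<omega>_def)
  have h: "0 \<le> h t" "h (2 * t) \<le> h t" if "t > 0" for t
    using that \<omega>0 unfolding h_def by (auto intro!: mult_left_mono powr_mono2')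
  have main: "I (2 * t) + J (2 * t) \<le> (2 * m1 + 16 * B * m2) * (t * h t)" if t: "t \<ge> t0" for t
  proof -
    have tp: "t > 0" "t \<ge> 1" using t t0 by auto
    obtain \<xi> where \<xi>: "t < \<xi>" "\<xi> < 2 * t" "P (2 * t) - P t = (2 * t - t) * - rint 2 \<xi> (\<lambda>y. sqdist y * (u y)\<^sup>2)"
      using MVT2[of t "2 * t" P "\<lambda>t. - rint 2 t (\<lambda>y. sqdist y * (u y)\<^sup>2)"] P_DERIV tp by force
    (* the value of - P' at the intermediate point *)
    define d where "d = rint 2 \<xi> (\<lambda>y. sqdist y * (u y)\<^sup>2)"
    have \<xi>0: "\<xi> > 0" "\<xi> \<ge> t0" using \<xi> t tp by auto
    note sub = t0(2)[OF \<xi>0(2)]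
    have td: "t * d = P t - P (2 * t)" using \<xi>(3) by (simp add: d_def)
    also have "\<dots> \<le> P t" using J_P_nonneg(3) by simp
    also have "\<dots> \<le> B * m2 * h t" using Pb[OF t] by (simp add: h_def)
    finally have td: "t * d \<le> B * m2 * h t" .
    have "I \<xi> = J \<xi> + \<xi> * (2 * Q \<xi>)" using energy_identity[OF \<xi>0(1) sub] by simp
    also have "2 * Q \<xi> = 2 * \<xi> * d - real CARD('n) * P \<xi>" using divergence_identity[OF \<xi>0(1) sub] by (simp add: d_def)
    also have "J \<xi> + \<xi> * (2 * \<xi> * d - real CARD('n) * P \<xi>) \<le> J \<xi> + 2 * \<xi>\<^sup>2 * d"
      using J_P_nonneg(3)[of \<xi>] \<xi>0(1) by (simp add: right_diff_distrib power2_eq_square)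
    also have "2 * \<xi>\<^sup>2 * d \<le> 8 * t * (B * m2 * h t)"
    proof (cases "d \<ge> 0")
      case True
      have "\<xi>\<^sup>2 \<le> (2 * t)\<^sup>2" using \<xi> \<xi>0 by (intro power_mono) auto
      then have "2 * \<xi>\<^sup>2 * d \<le> 2 * (2 * t)\<^sup>2 * d" using True by (intro mult_right_mono) auto
      also have "\<dots> = 8 * t * (t * d)" by (simp add: power2_eq_square)
      also have "\<dots> \<le> 8 * t * (B * m2 * h t)" using td tp by (intro mult_left_mono) auto
      finally show ?thesis .
    next
      case False
      then have "2 * \<xi>\<^sup>2 * d \<le> 0" by (simp add: mult_nonneg_nonpos)
      also have "0 \<le> 8 * t * (B * m2 * h t)" using tp B(1) h(1)[OF tp(1)] by (simp add: m2_def)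
      finally show ?thesis .
    qed
    finally have "I \<xi> \<le> J \<xi> + 8 * t * (B * m2 * h t)" by simp
    moreover have "I (2 * t) \<le> I \<xi>" "J (2 * t) \<le> J t" "J \<xi> \<le> J t" using I_J_mono \<xi> \<xi>0 tp by auto
    ultimately have "I (2 * t) + J (2 * t) \<le> 2 * J t + 8 * t * (B * m2 * h t)" by linarith
    also have "J t \<le> m1 * h t" using Jb[OF t] by (simp add: h_def)
    also have "m1 * h t \<le> m1 * (t * h t)"
      using tp h(1)[OF tp(1)] by (intro mult_left_mono) (auto simp: m1_def mult_le_cancel_right1)
    also have "2 * (m1 * (t * h t)) + 8 * t * (B * m2 * h t) \<le> (2 * m1 + 16 * B * m2) * (t * h t)"
    proof -
      have "0 \<le> B * m2 * (t * h t)" using tp B(1) h(1)[OF tp(1)] by (simp add: m2_def)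
      then show ?thesis by (simp add: algebra_simps)
    qed
    finally show ?thesis by simp
  qed
  define r1 where "r1 = 1 / (2 * sqrt (2 * t0))"
  have r1: "r1 > 0" using t0 by (simp add: r1_def)
  define K where "K = exp (4 / 3) * ((2 * m1 + 16 * B * m2) * (\<omega> * 8 powr (real CARD('n) / 2 - 1)))"
  have "energy r \<le> K * r powr (real CARD('n) - 2)" if r: "0 < r" "r \<le> r1" for r
  proof -
    define t where "t = 1 / (8 * r\<^sup>2)"
    have tp: "t > 0" using r by (simp add: t_def)
    have "r\<^sup>2 \<le> r1\<^sup>2" using r by (intro power_mono) auto
    also have "r1\<^sup>2 = 1 / (8 * t0)" using t0 by (simp add: r1_def power_divide power_mult_distrib)
    finally have tt: "t0 \<le> t" using r t0 by (simp add: t_def field_simps)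
    have "2 * t = 1 / (4 * r\<^sup>2)" by (simp add: t_def)
    from energy_le_I_J[OF r(1) this] have "energy r \<le> exp (4 / 3) * (I (2 * t) + J (2 * t))" .
    also have "\<dots> \<le> exp (4 / 3) * ((2 * m1 + 16 * B * m2) * (t * h t))" by (intro mult_left_mono main tt) simp
    also have "t * h t = \<omega> * t powr (1 - real CARD('n) / 2)"
      using tp powr_mult_base[of t "- (real CARD('n) / 2)"] by (simp add: h_def mult.left_commute)
    also have "t powr (1 - real CARD('n) / 2) = (8 * r\<^sup>2) powr (real CARD('n) / 2 - 1)"
    proof -
      have "t powr (1 - real CARD('n) / 2) = inverse (t powr (real CARD('n) / 2 - 1))"
        using powr_minus[of t "real CARD('n) / 2 - 1"] by simp
      then show ?thesis using r by (simp add: t_def powr_divide)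
    qed
    also have "\<dots> = 8 powr (real CARD('n) / 2 - 1) * r powr (real CARD('n) - 2)"
    proof -
      have "(r\<^sup>2) powr (real CARD('n) / 2 - 1) = (r powr 2) powr (real CARD('n) / 2 - 1)" using r by simp
      also have "\<dots> = r powr (2 * (real CARD('n) / 2 - 1))" by (rule powr_powr)
      finally show ?thesis using r by (simp add: powr_mult right_diff_distrib)
    qed
    finally show ?thesis by (simp add: K_def mult_ac)
  qed
  with r1 show ?thesis by blast
qed

end

section \<open>Restriction to smaller domains\<close>

lemma lebesgue_on_restrict_integral:
  fixes f :: "real ^ 'n \<Rightarrow> real"
  assumes "V \<subseteq> U" "V \<in> sets lebesgue" "U \<in> sets lebesgue" "\<And>x. x \<in> U \<Longrightarrow> x \<notin> V \<Longrightarrow> f x = 0"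
  shows "(LINT x|lebesgue_on V. f x) = (LINT x|lebesgue_on U. f x)"
proof -
  have "(LINT x|lebesgue_on V. f x) = (LINT x|lebesgue. (if x \<in> V then f x else 0))"
    by (rule Lebesgue_Measure.integral_restrict_UNIV[OF assms(2), symmetric])
  also have "\<dots> = (LINT x|lebesgue. (if x \<in> U then f x else 0))"
    by (rule Bochner_Integration.integral_cong) (use assms in auto)
  also have "\<dots> = (LINT x|lebesgue_on U. f x)"
    by (rule Lebesgue_Measure.integral_restrict_UNIV[OF assms(3)])
  finally show ?thesis .
qed

lemma lebesgue_on_subset_integral_le:
  fixes f :: "real ^ 'n \<Rightarrow> real"
  assumes "V \<subseteq> U" "V \<in> sets lebesgue" "U \<in> sets lebesgue" "integrable (lebesgue_on U) f" "\<And>x. 0 \<le> f x"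
  shows "(LINT x|lebesgue_on V. f x) \<le> (LINT x|lebesgue_on U. f x)"
  using integral_mono_lebesgue_on_AE[where f = f and g = f and S = V and T = U] assms by simp

lemma lebesgue_on_subset_integrable:
  fixes f :: "real ^ 'n \<Rightarrow> real"
  assumes "V \<subseteq> U" "V \<in> sets lebesgue" "U \<in> sets lebesgue" "integrable (lebesgue_on U) f"
  shows "integrable (lebesgue_on V) f"
  using L_space_subset[of f 1 U V] assms by (simp add: L_space_one_iff)

lemma test_functions_mono: "V \<subseteq> U \<Longrightarrow> test_functions V \<subseteq> test_functions U"
  by (auto simp: test_functions_def)

lemma has_weak_gradient_subset:
  fixes u :: "real ^ 'n \<Rightarrow> real"
  assumes VU: "V \<subseteq> U" "V \<in> sets lebesgue" "U \<in> sets lebesgue" and u: "has_weak_gradient U u G"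
  shows "has_weak_gradient V u G"
  unfolding has_weak_gradient_def
proof (intro conjI ballI allI)
  show "u \<in> L_loc 1 V" "G \<in> L_loc 1 V" using u VU by (auto simp: has_weak_gradient_def L_loc_def)
  fix \<phi> :: "real ^ 'n \<Rightarrow> real" and i assume \<phi>: "\<phi> \<in> test_functions V"
  have \<phi>U: "\<phi> \<in> test_functions U" using test_functions_mono[OF VU(1)] \<phi> by blast
  have z: "\<phi> y = 0" "partial_deriv i \<phi> y = 0" if "y \<notin> V" for y
    using test_function_props(3)[OF \<phi>] test_function_props(3)[OF partial_deriv_test_function[OF \<phi>, of i]] that by auto
  have "(LINT x|lebesgue_on V. u x * partial_deriv i \<phi> x) = (LINT x|lebesgue_on U. u x * partial_deriv i \<phi> x)"
    by (rule lebesgue_on_restrict_integral[OF VU]) (simp add: z)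
  also have "\<dots> = - (LINT x|lebesgue_on U. G x $ i * \<phi> x)" using u \<phi>U by (simp add: has_weak_gradient_def)
  also have "(LINT x|lebesgue_on U. G x $ i * \<phi> x) = (LINT x|lebesgue_on V. G x $ i * \<phi> x)"
    by (rule lebesgue_on_restrict_integral[OF VU, symmetric]) (simp add: z)
  finally show "(LINT x|lebesgue_on V. u x * partial_deriv i \<phi> x) = - (LINT x|lebesgue_on V. G x $ i * \<phi> x)" .
qed

lemma H1_subset:
  fixes u :: "real ^ 'n \<Rightarrow> real"
  assumes V: "V \<subseteq> U" "open V" "open U" and u: "u \<in> H1 U"
  shows "u \<in> H1 V" "H1_energy V u \<le> H1_energy U u"
proof -
  have l: "V \<in> sets lebesgue" "U \<in> sets lebesgue" using V by auto
  note G = H1_weak_gradient[OF V(3) u]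
  have gV: "has_weak_gradient V u (weak_gradient U u)" by (rule has_weak_gradient_subset[OF V(1) l G(1)])
  have uL: "u \<in> L_space 2 U" using u by (simp add: H1_def)
  show uV: "u \<in> H1 V" by (rule H1_I[OF L_space_subset[OF uL V(1) l] L_space_subset[OF G(2) V(1) l] gV])
  show "H1_energy V u \<le> H1_energy U u"
    unfolding H1_energy_cong[OF V(2) uV gV] unfolding H1_energy_def
    by (intro add_mono lebesgue_on_subset_integral_le V l) (use uL G(2) in \<open>auto simp: L_space_def\<close>)
qed

text \<open>
  A functional that is bounded on the larger space is bounded on the smaller one, because
  \<open>N' \<le> N\<close> there.
\<close>

lemma weakly_converges_mono:
  assumes f: "weakly_converges X N f v" and X: "X \<subseteq> Y" "\<And>g. g \<in> X \<Longrightarrow> N' g \<le> N g" "\<And>g. 0 \<le> N' g"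
  shows "weakly_converges Y N' f v"
  unfolding weakly_converges_def
proof (intro conjI allI impI)
  show "\<forall>\<^sub>F i in sequentially. f i \<in> Y" using f X(1) by (auto simp: weakly_converges_def elim: eventually_mono)
  show "v \<in> Y" using f X(1) by (auto simp: weakly_converges_def)
  fix l assume l: "bounded_functional Y N' l"
  then obtain C where C: "\<And>g. g \<in> Y \<Longrightarrow> \<bar>l g\<bar> \<le> C * N' g" unfolding bounded_functional_def by blast
  have "\<bar>l g\<bar> \<le> \<bar>C\<bar> * N g" if "g \<in> X" for g
  proof -
    have "\<bar>l g\<bar> \<le> \<bar>C\<bar> * N' g" using C[of g] X(1,3) that mult_right_mono[of C "\<bar>C\<bar>" "N' g"] by force
    also have "\<dots> \<le> \<bar>C\<bar> * N g" using X(2)[OF that] by (intro mult_left_mono) auto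
    finally show ?thesis .
  qed
  then have "bounded_functional X N l" using l X(1) unfolding bounded_functional_def by blast
  then show "(\<lambda>i. l (f i)) \<longlonglongrightarrow> l v" using f by (simp add: weakly_converges_def)
qed

lemma weakly_converges_H1_mono:
  fixes f :: "nat \<Rightarrow> real ^ 'n \<Rightarrow> real"
  assumes "weakly_converges (H1 U) (H1_norm U) f v" "V \<subseteq> U" "open V" "open U"
  shows "weakly_converges (H1 V) (H1_norm V) f v"
proof (rule weakly_converges_mono[OF assms(1)])
  show "H1 U \<subseteq> H1 V" using H1_subset(1)[OF assms(2-4)] by blast
  interpret u: uniformly_convex_space "H1 V" "H1_energy V" 2 by (rule H1_uniformly_convex[OF assms(3)])
  show "H1_norm V g \<le> H1_norm U g" if "g \<in> H1 U" for g
    unfolding H1_norm_eq using H1_subset(2)[OF assms(2-4) that] by (intro powr_mono2) (auto simp: u.nonneg)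
  show "0 \<le> H1_norm V g" for g unfolding H1_norm_eq by simp
qed

lemma weakly_converges_L_mono:
  fixes f :: "nat \<Rightarrow> real ^ 'n \<Rightarrow> real"
  assumes "weakly_converges (L_space q U) (L_norm q U) f v" "V \<subseteq> U" "open V" "open U" "q > 0"
  shows "weakly_converges (L_space q V) (L_norm q V) f v"
proof (rule weakly_converges_mono[OF assms(1)])
  have l: "V \<in> sets lebesgue" "U \<in> sets lebesgue" using assms by auto
  show "L_space q U \<subseteq> (L_space q V :: (real ^ 'n \<Rightarrow> real) set)" using L_space_subset[OF _ assms(2) l] by blast
  show "L_norm q V g \<le> L_norm q U g" if "g \<in> L_space q U" for g :: "real ^ 'n \<Rightarrow> real"
    unfolding L_norm_def using that assms(5)
    by (intro powr_mono2 lebesgue_on_subset_integral_le assms l Bochner_Integration.integral_nonneg) (auto simp: L_space_def)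
  show "0 \<le> L_norm q V g" for g :: "real ^ 'n \<Rightarrow> real" unfolding L_norm_def by simp
qed

lemma (in uniformly_convex_space) functional_cong:
  assumes "functional l" "f \<in> X" "g \<in> X" "\<Theta> (\<lambda>x. f x - g x) = 0"
  shows "l f = l g"
  using functional_zero[OF assms(1) diff_closed[OF assms(2,3)] assms(4)] functional_diff[OF assms(1-3)] by simp

lemma L_functional_cong_AE:
  fixes f g :: "real ^ 'n \<Rightarrow> real"
  assumes l: "bounded_functional (L_space q U) (L_norm q U) l" and q: "q \<ge> 2" and fg: "f \<in> L_space q U" "g \<in> L_space q U"
    and ae: "AE x in lebesgue_on U. f x = g x"
  shows "l f = l g"
proof -
  interpret L: uniformly_convex_space "L_space q U :: (real ^ 'n \<Rightarrow> real) set"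
    "\<lambda>f. LINT x|lebesgue_on U. norm (f x) powr q" q by (rule L_space_uniformly_convex[OF q])
  have N: "L_norm q U = (\<lambda>f :: real ^ 'n \<Rightarrow> real. (LINT x|lebesgue_on U. norm (f x) powr q) powr (1 / q))"
    by (simp add: L_norm_def fun_eq_iff)
  show ?thesis
    by (rule L.functional_cong[OF l[unfolded N] fg], rule AE_zero_imp_integral_powr_zero) (use ae in \<open>auto elim: eventually_mono\<close>)
qed

lemma H1_functional_cong_AE:
  fixes f g :: "real ^ 'n \<Rightarrow> real"
  assumes l: "bounded_functional (H1 U) (H1_norm U) l" and U: "open U" and fg: "f \<in> H1 U" "g \<in> H1 U"
    and ae: "AE x in lebesgue_on U. f x = g x"
  shows "l f = l g"
proof -
  interpret L: uniformly_convex_space "H1 U" "H1_energy U" 2 by (rule H1_uniformly_convex[OF U])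
  have "AE x in lebesgue_on U. f x - g x = 0" using ae by (auto elim: eventually_mono)
  from H1_energy_zero(2)[OF U this] show ?thesis
    by (intro L.functional_cong[OF _ fg]) (use l H1_norm_eq[of U] in auto)
qed

lemma box_functional_H1:
  fixes U :: "(real ^ 'n) set"
  assumes U: "open U" "U \<in> lmeasurable" and B: "B \<in> rational_boxes"
  shows "bounded_functional (H1 U) (H1_norm U) (\<lambda>f. LINT x|lebesgue_on U. indicator B x * f x)"
proof -
  have l: "bounded_functional (L_space 2 U) (L_norm 2 U) (\<lambda>f. LINT x|lebesgue_on U. indicator B x * f x)"
    by (rule box_functional[OF U(2) _ B]) simp
  have sub: "f \<in> H1 U \<Longrightarrow> f \<in> L_space 2 U" for f by (simp add: H1_def)
  obtain C where C: "\<And>f. f \<in> L_space 2 U \<Longrightarrow> \<bar>LINT x|lebesgue_on U. indicator B x * f x\<bar> \<le> C * L_norm 2 U f"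
    using l unfolding bounded_functional_def by blast
  have "\<bar>LINT x|lebesgue_on U. indicator B x * f x\<bar> \<le> \<bar>C\<bar> * H1_norm U f" if f: "f \<in> H1 U" for f
  proof -
    have n: "0 \<le> L_norm 2 U f" by (simp add: L_norm_def)
    have "L_norm 2 U f \<le> H1_norm U f"
      unfolding L_norm_def H1_norm_eq H1_energy_def by (intro powr_mono2) (auto intro!: Bochner_Integration.integral_nonneg)
    then have "\<bar>C\<bar> * L_norm 2 U f \<le> \<bar>C\<bar> * H1_norm U f" by (intro mult_left_mono) auto
    moreover have "C * L_norm 2 U f \<le> \<bar>C\<bar> * L_norm 2 U f" using n by (intro mult_right_mono) auto
    ultimately show ?thesis using C[OF sub[OF f]] by linarith
  qed
  then show ?thesis using l sub unfolding bounded_functional_def by blast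
qed

section \<open>Blow-ups\<close>

lemma lebesgue_affine:
  fixes f :: "real ^ 'n \<Rightarrow> real" and x :: "real ^ 'n"
  assumes f: "f \<in> borel_measurable lebesgue" and r: "r > 0"
  shows "(\<lambda>y. f (x + r *\<^sub>R y)) \<in> borel_measurable lebesgue"
    "integrable lebesgue (\<lambda>y. f (x + r *\<^sub>R y)) \<longleftrightarrow> integrable lebesgue f"
    "(\<integral>y. f (x + r *\<^sub>R y) \<partial>lebesgue) = r powr (- real CARD('n)) * (\<integral>z. f z \<partial>lebesgue)"
proof -
  have T: "(\<lambda>y. x + (\<Sum>j\<in>Basis. (r * (y \<bullet> j)) *\<^sub>R j)) = (\<lambda>y :: real ^ 'n. x + r *\<^sub>R y)"
    unfolding scaleR_scaleR[symmetric] scaleR_sum_right[symmetric] euclidean_representation ..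
  have m: "(\<lambda>y. x + r *\<^sub>R y) \<in> lebesgue \<rightarrow>\<^sub>M lebesgue"
    using lebesgue_affine_measurable[of "\<lambda>_. r" x] r unfolding T by simp
  have d: "lebesgue = density (distr lebesgue lebesgue (\<lambda>y. x + r *\<^sub>R y)) (\<lambda>_. ennreal (r ^ CARD('n)))"
    using lebesgue_affine_euclidean[of "\<lambda>_. r" x] r unfolding T by simp
  show "(\<lambda>y. f (x + r *\<^sub>R y)) \<in> borel_measurable lebesgue" using measurable_compose[OF m f] .
  have fd: "f \<in> borel_measurable (distr lebesgue lebesgue (\<lambda>y. x + r *\<^sub>R y))" using f by simp
  have "integrable lebesgue f \<longleftrightarrow> integrable (density (distr lebesgue lebesgue (\<lambda>y. x + r *\<^sub>R y)) (\<lambda>_. ennreal (r ^ CARD('n)))) f"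
    by (subst d) simp
  also have "\<dots> \<longleftrightarrow> integrable (distr lebesgue lebesgue (\<lambda>y. x + r *\<^sub>R y)) (\<lambda>z. r ^ CARD('n) *\<^sub>R f z)"
    by (rule integrable_density[OF fd]) (use r in auto)
  also have "\<dots> \<longleftrightarrow> integrable (distr lebesgue lebesgue (\<lambda>y. x + r *\<^sub>R y)) f" using r by simp
  also have "\<dots> \<longleftrightarrow> integrable lebesgue (\<lambda>y. f (x + r *\<^sub>R y))" by (rule integrable_distr_eq[OF m f])
  finally show "integrable lebesgue (\<lambda>y. f (x + r *\<^sub>R y)) \<longleftrightarrow> integrable lebesgue f" by simp
  have "(\<integral>z. f z \<partial>lebesgue) = (\<integral>z. f z \<partial>density (distr lebesgue lebesgue (\<lambda>y. x + r *\<^sub>R y)) (\<lambda>_. ennreal (r ^ CARD('n))))"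
    by (subst d) simp
  also have "\<dots> = (\<integral>z. r ^ CARD('n) *\<^sub>R f z \<partial>distr lebesgue lebesgue (\<lambda>y. x + r *\<^sub>R y))"
    by (rule integral_density[OF fd]) (use r in auto)
  also have "\<dots> = r ^ CARD('n) * (\<integral>y. f (x + r *\<^sub>R y) \<partial>lebesgue)"
    using integral_distr[OF m f] by simp
  finally show "(\<integral>y. f (x + r *\<^sub>R y) \<partial>lebesgue) = r powr (- real CARD('n)) * (\<integral>z. f z \<partial>lebesgue)"
    using r by (simp add: powr_minus powr_realpow)
qed

lemma lebesgue_on_ball_affine:
  fixes f :: "real ^ 'n \<Rightarrow> real" and x :: "real ^ 'n"
  assumes f: "f \<in> borel_measurable (lebesgue_on (ball x (r * R)))" and r: "r > 0"
  shows "(\<lambda>y. f (x + r *\<^sub>R y)) \<in> borel_measurable (lebesgue_on (ball 0 R))"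
    "integrable (lebesgue_on (ball 0 R)) (\<lambda>y. f (x + r *\<^sub>R y)) \<longleftrightarrow> integrable (lebesgue_on (ball x (r * R))) f"
    "(LINT y|lebesgue_on (ball 0 R). f (x + r *\<^sub>R y)) = r powr (- real CARD('n)) * (LINT z|lebesgue_on (ball x (r * R)). f z)"
proof -
  have l: "ball x (r * R) \<in> sets lebesgue" "ball (0 :: real ^ 'n) R \<in> sets lebesgue" by auto
  have e: "(\<lambda>y. if y \<in> ball 0 R then f (x + r *\<^sub>R y) else 0) = (\<lambda>y. (\<lambda>z. if z \<in> ball x (r * R) then f z else 0) (x + r *\<^sub>R y))"
  proof
    fix y :: "real ^ 'n"
    have "dist x (x + r *\<^sub>R y) = r * norm y" using r by (simp add: dist_norm)
    then have "x + r *\<^sub>R y \<in> ball x (r * R) \<longleftrightarrow> y \<in> ball 0 R" using r by simp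
    then show "(if y \<in> ball 0 R then f (x + r *\<^sub>R y) else 0) = (\<lambda>z. if z \<in> ball x (r * R) then f z else 0) (x + r *\<^sub>R y)"
      by (simp del: mem_ball)
  qed
  note A = lebesgue_affine[OF borel_measurable_if_I[OF f l(1)] r, of x, folded e]
  show "(\<lambda>y. f (x + r *\<^sub>R y)) \<in> borel_measurable (lebesgue_on (ball 0 R))" using A(1) by (rule borel_measurable_if_D)
  show "integrable (lebesgue_on (ball 0 R)) (\<lambda>y. f (x + r *\<^sub>R y)) \<longleftrightarrow> integrable (lebesgue_on (ball x (r * R))) f"
    using A(2) Lebesgue_Measure.integrable_restrict_UNIV[OF l(1), of f] Lebesgue_Measure.integrable_restrict_UNIV[OF l(2), of "\<lambda>y. f (x + r *\<^sub>R y)"]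
    by simp
  show "(LINT y|lebesgue_on (ball 0 R). f (x + r *\<^sub>R y)) = r powr (- real CARD('n)) * (LINT z|lebesgue_on (ball x (r * R)). f z)"
    using A(3) Lebesgue_Measure.integral_restrict_UNIV[OF l(1), of f] Lebesgue_Measure.integral_restrict_UNIV[OF l(2), of "\<lambda>y. f (x + r *\<^sub>R y)"]
    by simp
qed

context stationary_at begin

abbreviation "\<beta> \<equiv> 2 / (p - 1)"
abbreviation "bl r \<equiv> blow_up p x r u"

lemma alpha_beta: "alpha p = \<beta> * (p + 1)" "alpha p = 2 * (\<beta> + 1)"
  using p by (auto simp: alpha_def field_simps)

lemma energy_restrict:
  assumes s: "ball x s \<subseteq> \<Omega>"
  shows "(LINT z|lebesgue_on (ball x s). (norm (G z))\<^sup>2) \<le> energy s" "(LINT z|lebesgue_on (ball x s). \<bar>u z\<bar> powr (p + 1)) \<le> energy s"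
proof -
  have l: "ball x s \<in> sets lebesgue" by simp
  have eq: "(LINT z|lebesgue_on (ball x s). f z) = (LINT y|M. indicator (ball x s) y * f y)" for f :: "real ^ 'n \<Rightarrow> real"
  proof -
    have "(LINT z|lebesgue_on (ball x s). f z) = (LINT z|lebesgue_on (ball x s). indicator (ball x s) z * f z)"
      by (rule Bochner_Integration.integral_cong) auto
    also have "\<dots> = (LINT y|M. indicator (ball x s) y * f y)"
      by (rule lebesgue_on_restrict_integral[OF s l \<Omega>_sets(1)]) auto
    finally show ?thesis .
  qed
  have [measurable]: "indicat_real (ball x s) \<in> borel_measurable M"
    by (intro measurable_restrict_space1 borel_measurable_indicator) simp
  have i: "integrable M (\<lambda>y. indicator (ball x s) y * f y)" if [measurable]: "integrable M f" for f :: "real ^ 'n \<Rightarrow> real"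
  proof (rule Bochner_Integration.integrable_bound[OF that])
    have [measurable]: "f \<in> borel_measurable M" using that by auto
    show "(\<lambda>y. indicator (ball x s) y * f y) \<in> borel_measurable M" by measurable
  qed (auto simp: indicator_def)
  show "(LINT z|lebesgue_on (ball x s). (norm (G z))\<^sup>2) \<le> energy s" "(LINT z|lebesgue_on (ball x s). \<bar>u z\<bar> powr (p + 1)) \<le> energy s"
    unfolding eq energy_def by (intro integral_mono i int_grad_sq int_power int_energy; simp add: indicator_def)+
qed

text \<open>
  Powers of \<open>u\<close> and of \<open>\<nabla>u\<close> scale in the same way: \<open>\<beta> (p + 1) = 2 (\<beta> + 1) = \<alpha>\<close>, and the change
  of variables contributes \<open>r\<^bsup>-n\<^esup>\<close>.
\<close>

lemma blow_up_gradient: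
  assumes r: "r > 0" and sub: "ball x (r * R) \<subseteq> \<Omega>"
  shows "has_weak_gradient (ball 0 R) (bl r) (\<lambda>y. r powr (\<beta> + 1) *\<^sub>R G (x + r *\<^sub>R y))"
    "bl r \<in> L_space (p + 1) (ball 0 R)" "bl r \<in> H1 (ball 0 R)"
    "(LINT y|lebesgue_on (ball 0 R). norm (bl r y) powr (p + 1)) \<le> r powr (alpha p - real CARD('n)) * energy (r * R)"
    "(LINT y|lebesgue_on (ball 0 R). norm (r powr (\<beta> + 1) *\<^sub>R G (x + r *\<^sub>R y)) powr 2) \<le> r powr (alpha p - real CARD('n)) * energy (r * R)"
proof -
  let ?U = "ball (0 :: real ^ 'n) R" and ?U' = "ball x (r * R)"
  let ?n = "real CARD('n)"
  have l: "?U' \<in> sets lebesgue" "?U \<in> sets lebesgue" "?U \<in> lmeasurable" by auto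
  have p0: "p + 1 > 0" using p by simp
  have um: "u \<in> borel_measurable (lebesgue_on ?U')" using measurable_restrict_mono[OF meas(1) sub] .
  have Gim: "(\<lambda>z. G z $ i) \<in> borel_measurable (lebesgue_on ?U')" for i using measurable_restrict_mono[OF meas(2) sub] .
  have bm: "(\<lambda>y. u (x + r *\<^sub>R y)) \<in> borel_measurable (lebesgue_on ?U)" by (rule lebesgue_on_ball_affine(1)[OF um r])
  have Gm: "(\<lambda>y. G (x + r *\<^sub>R y)) \<in> borel_measurable (lebesgue_on ?U)"
  proof (subst borel_measurable_euclidean_space, intro ballI)
    fix b :: "real ^ 'n" assume "b \<in> Basis"
    then obtain i where "b = axis i 1" by (auto simp: Basis_vec_def)
    then show "(\<lambda>y. G (x + r *\<^sub>R y) \<bullet> b) \<in> borel_measurable (lebesgue_on ?U)"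
      using lebesgue_on_ball_affine(1)[OF Gim[of i] r] by (simp add: inner_axis)
  qed
  have B: "(\<lambda>z. \<bar>u z\<bar> powr (p + 1)) \<in> borel_measurable (lebesgue_on ?U')" "integrable (lebesgue_on ?U') (\<lambda>z. \<bar>u z\<bar> powr (p + 1))"
    using um lebesgue_on_subset_integrable[OF sub l(1) \<Omega>_sets(1) int_power] by auto
  have A: "(\<lambda>z. (norm (G z))\<^sup>2) \<in> borel_measurable (lebesgue_on ?U')" "integrable (lebesgue_on ?U') (\<lambda>z. (norm (G z))\<^sup>2)"
    using lebesgue_on_subset_integrable[OF sub l(1) \<Omega>_sets(1) int_grad_sq] by auto
  have e1: "norm (bl r y) powr (p + 1) = r powr alpha p * \<bar>u (x + r *\<^sub>R y)\<bar> powr (p + 1)" for y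
    using r by (simp add: blow_up_def abs_mult powr_mult powr_powr alpha_beta(1))
  have e2: "norm (r powr (\<beta> + 1) *\<^sub>R G (x + r *\<^sub>R y)) powr 2 = r powr alpha p * (norm (G (x + r *\<^sub>R y)))\<^sup>2" for y
  proof -
    have "(r powr (\<beta> + 1)) powr 2 = r powr alpha p" by (simp only: powr_powr alpha_beta(2) mult.commute)
    then show ?thesis using r by (simp add: powr_mult del: powr_numeral) simp
  qed
  have i1: "integrable (lebesgue_on ?U) (\<lambda>y. norm (bl r y) powr (p + 1))"
    unfolding e1 using lebesgue_on_ball_affine(2)[OF B(1) r] B(2) by simp
  have i2: "integrable (lebesgue_on ?U) (\<lambda>y. norm (r powr (\<beta> + 1) *\<^sub>R G (x + r *\<^sub>R y)) powr 2)"
    unfolding e2 using lebesgue_on_ball_affine(2)[OF A(1) r] A(2) by simp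
  have blm: "bl r \<in> borel_measurable (lebesgue_on ?U)"
    unfolding blow_up_def[abs_def] using bm by (intro borel_measurable_times) auto
  show Lp: "bl r \<in> L_space (p + 1) ?U" using i1 blm by (simp add: L_space_def)
  have L2: "bl r \<in> L_space 2 ?U" using L_space_exponent_le[OF Lp l(3), of 2] p by simp
  have VL2: "(\<lambda>y. r powr (\<beta> + 1) *\<^sub>R G (x + r *\<^sub>R y)) \<in> L_space 2 ?U"
    using i2 Gm by (simp add: L_space_def borel_measurable_scaleR)
  have pw: "r powr alpha p * (r powr (- ?n) * E) = r powr (alpha p - ?n) * E" for E
    by (simp add: powr_diff powr_minus field_simps)
  show "(LINT y|lebesgue_on ?U. norm (bl r y) powr (p + 1)) \<le> r powr (alpha p - ?n) * energy (r * R)"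
  proof -
    have "(LINT y|lebesgue_on ?U. norm (bl r y) powr (p + 1)) = r powr (alpha p - ?n) * (LINT z|lebesgue_on ?U'. \<bar>u z\<bar> powr (p + 1))"
      unfolding e1 using lebesgue_on_ball_affine(3)[OF B(1) r] pw by simp
    also have "\<dots> \<le> r powr (alpha p - ?n) * energy (r * R)" by (intro mult_left_mono energy_restrict[OF sub]) simp
    finally show ?thesis .
  qed
  show "(LINT y|lebesgue_on ?U. norm (r powr (\<beta> + 1) *\<^sub>R G (x + r *\<^sub>R y)) powr 2) \<le> r powr (alpha p - ?n) * energy (r * R)"
  proof -
    have "(LINT y|lebesgue_on ?U. norm (r powr (\<beta> + 1) *\<^sub>R G (x + r *\<^sub>R y)) powr 2) = r powr (alpha p - ?n) * (LINT z|lebesgue_on ?U'. (norm (G z))\<^sup>2)"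
      unfolding e2 using lebesgue_on_ball_affine(3)[OF A(1) r] pw by simp
    also have "\<dots> \<le> r powr (alpha p - ?n) * energy (r * R)" by (intro mult_left_mono energy_restrict[OF sub]) simp
    finally show ?thesis .
  qed
  show gr: "has_weak_gradient ?U (bl r) (\<lambda>y. r powr (\<beta> + 1) *\<^sub>R G (x + r *\<^sub>R y))"
    unfolding has_weak_gradient_def
  proof (intro conjI ballI allI)
    show "bl r \<in> L_loc 1 ?U" by (rule L_space_imp_L_loc[OF L2 l(2)]) auto
    show "(\<lambda>y. r powr (\<beta> + 1) *\<^sub>R G (x + r *\<^sub>R y)) \<in> L_loc 1 ?U" by (rule L_space_imp_L_loc[OF VL2 l(2)]) auto
    fix \<phi> :: "real ^ 'n \<Rightarrow> real" and i assume \<phi>: "\<phi> \<in> test_functions ?U"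
    define \<psi> where "\<psi> z = \<phi> ((- (1 / r)) *\<^sub>R x + (1 / r) *\<^sub>R z)" for z
    have arg: "(- (1 / r)) *\<^sub>R x + (1 / r) *\<^sub>R (x + r *\<^sub>R y) = y" for y using r by (simp add: scaleR_add_right)
    obtain K where K: "compact K" "K \<subseteq> ?U" "\<forall>y. y \<notin> K \<longrightarrow> \<phi> y = 0" using test_function_props(3)[OF \<phi>] by blast
    have \<psi>: "\<psi> \<in> test_functions ?U'"
    proof (rule test_functionI)
      show "smooth_on UNIV \<psi>" unfolding \<psi>_def[abs_def] by (rule smooth_on_affine[OF test_function_props(1)[OF \<phi>]])
      show "compact ((\<lambda>y. x + r *\<^sub>R y) ` K)" by (intro compact_continuous_image continuous_intros K)
      show "(\<lambda>y. x + r *\<^sub>R y) ` K \<subseteq> ?U'"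
      proof safe
        fix y assume "y \<in> K"
        then have "norm y < R" using K(2) by auto
        then have "r * norm y < r * R" using r by simp
        then show "x + r *\<^sub>R y \<in> ?U'" using r by (simp add: dist_norm)
      qed
      fix z assume "z \<notin> (\<lambda>y. x + r *\<^sub>R y) ` K"
      moreover have "z = x + r *\<^sub>R ((- (1 / r)) *\<^sub>R x + (1 / r) *\<^sub>R z)" using r by (simp add: scaleR_add_right scaleR_diff_right)
      ultimately have "(- (1 / r)) *\<^sub>R x + (1 / r) *\<^sub>R z \<notin> K" by blast
      then show "\<psi> z = 0" using K(3) by (simp add: \<psi>_def)
    qed
    have \<psi>\<Omega>: "\<psi> \<in> test_functions \<Omega>" using test_functions_mono[OF sub] \<psi> by blast
    have d: "partial_deriv i \<psi> z = (1 / r) * partial_deriv i \<phi> ((- (1 / r)) *\<^sub>R x + (1 / r) *\<^sub>R z)" for z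
      unfolding \<psi>_def[abs_def]
      by (subst partial_deriv_affine(2)) (use smooth_on_UNIV_differentiable[OF test_function_props(1)[OF \<phi>]] in auto)
    have d': "partial_deriv i \<psi> (x + r *\<^sub>R y) = (1 / r) * partial_deriv i \<phi> y" for y unfolding d arg ..
    have \<psi>': "\<psi> (x + r *\<^sub>R y) = \<phi> y" for y unfolding \<psi>_def arg ..
    have z0: "\<psi> z = 0" "partial_deriv i \<psi> z = 0" if "z \<notin> ?U'" for z
      using test_function_props(3)[OF \<psi>] test_function_props(3)[OF partial_deriv_test_function[OF \<psi>, of i]] that by auto
    have tm: "\<psi> \<in> borel_measurable (lebesgue_on ?U')" "partial_deriv i \<psi> \<in> borel_measurable (lebesgue_on ?U')"
      by (rule test_function_measurable[OF \<psi>] test_function_measurable[OF partial_deriv_test_function[OF \<psi>]])+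
    have "(LINT y|lebesgue_on ?U. bl r y * partial_deriv i \<phi> y)
      = (LINT y|lebesgue_on ?U. (r powr \<beta> * r) * ((\<lambda>z. u z * partial_deriv i \<psi> z) (x + r *\<^sub>R y)))"
      using r by (intro Bochner_Integration.integral_cong) (auto simp: blow_up_def d')
    also have "\<dots> = (r powr \<beta> * r) * (r powr (- ?n) * (LINT z|lebesgue_on ?U'. u z * partial_deriv i \<psi> z))"
      using lebesgue_on_ball_affine(3)[of "\<lambda>z. u z * partial_deriv i \<psi> z" x r R, OF borel_measurable_times[OF um tm(2)] r] by simp
    also have "(LINT z|lebesgue_on ?U'. u z * partial_deriv i \<psi> z) = (LINT z|M. u z * partial_deriv i \<psi> z)"
      by (rule lebesgue_on_restrict_integral[OF sub l(1) \<Omega>_sets(1)]) (simp add: z0 del: mem_ball)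
    also have "\<dots> = - (LINT z|M. G z $ i * \<psi> z)" using G_grad \<psi>\<Omega> by (simp add: has_weak_gradient_def)
    also have "(LINT z|M. G z $ i * \<psi> z) = (LINT z|lebesgue_on ?U'. G z $ i * \<psi> z)"
      by (rule lebesgue_on_restrict_integral[OF sub l(1) \<Omega>_sets(1), symmetric]) (simp add: z0 del: mem_ball)
    also have "(r powr \<beta> * r) * (r powr (- ?n) * - (LINT z|lebesgue_on ?U'. G z $ i * \<psi> z))
      = - ((r powr \<beta> * r) * (LINT y|lebesgue_on ?U. (\<lambda>z. G z $ i * \<psi> z) (x + r *\<^sub>R y)))"
      using lebesgue_on_ball_affine(3)[of "\<lambda>z. G z $ i * \<psi> z" x r R, OF borel_measurable_times[OF Gim tm(1)] r] by simp
    also have "(r powr \<beta> * r) * (LINT y|lebesgue_on ?U. (\<lambda>z. G z $ i * \<psi> z) (x + r *\<^sub>R y))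
      = (LINT y|lebesgue_on ?U. (r powr (\<beta> + 1) *\<^sub>R G (x + r *\<^sub>R y)) $ i * \<phi> y)"
      unfolding Bochner_Integration.integral_mult_right_zero[symmetric]
      by (intro Bochner_Integration.integral_cong) (use r in \<open>auto simp: \<psi>' powr_add\<close>)
    finally show "(LINT y|lebesgue_on ?U. bl r y * partial_deriv i \<phi> y)
      = - (LINT y|lebesgue_on ?U. (r powr (\<beta> + 1) *\<^sub>R G (x + r *\<^sub>R y)) $ i * \<phi> y)" .
  qed
  show "bl r \<in> H1 ?U" by (rule H1_I[OF L2 VL2 gr])
qed

lemma blow_up_norms:
  assumes r: "r > 0" and R: "R > 0" and sub: "ball x (r * R) \<subseteq> \<Omega>"
  shows "H1_energy (ball 0 R) (bl r) \<le> (LINT y|lebesgue_on (ball 0 R). norm (bl r y) powr 2) + r powr (alpha p - real CARD('n)) * energy (r * R)"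
    "(LINT y|lebesgue_on (ball 0 R). norm (bl r y) powr 2) \<le> measure lebesgue (ball (0 :: real ^ 'n) R) + r powr (alpha p - real CARD('n)) * energy (r * R)"
proof -
  note b = blow_up_gradient[OF r sub]
  have lm: "ball (0 :: real ^ 'n) R \<in> lmeasurable" by auto
  interpret finite_measure "lebesgue_on (ball (0 :: real ^ 'n) R)" by (rule finite_measure_lebesgue_on[OF lm])
  show "H1_energy (ball 0 R) (bl r) \<le> (LINT y|lebesgue_on (ball 0 R). norm (bl r y) powr 2) + r powr (alpha p - real CARD('n)) * energy (r * R)"
    unfolding H1_energy_cong[OF open_ball b(3,1)] using b(5) by simp
  have i: "integrable (lebesgue_on (ball 0 R)) (\<lambda>y. norm (bl r y) powr 2)" "integrable (lebesgue_on (ball 0 R)) (\<lambda>y. norm (bl r y) powr (p + 1))"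
    using b(2,3) by (auto simp: L_space_def H1_def)
  have pt: "t powr 2 \<le> 1 + t powr (p + 1)" if "t \<ge> 0" for t :: real
  proof (cases "t \<le> 1")
    case True
    then have "t powr 2 \<le> 1" using that by (intro powr_le1) auto
    then show ?thesis using powr_ge_zero[of t "p + 1"] by linarith
  next
    case False
    then have "t powr 2 \<le> t powr (p + 1)" using p by (intro powr_mono) auto
    then show ?thesis by simp
  qed
  have "(LINT y|lebesgue_on (ball 0 R). norm (bl r y) powr 2) \<le> (LINT y|lebesgue_on (ball 0 R). 1 + norm (bl r y) powr (p + 1))"
    by (intro integral_mono pt norm_ge_zero i Bochner_Integration.integrable_add) simp
  also have "\<dots> = measure lebesgue (ball (0 :: real ^ 'n) R) + (LINT y|lebesgue_on (ball 0 R). norm (bl r y) powr (p + 1))"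
    using i by (simp add: measure_restrict_space)
  also have "\<dots> \<le> measure lebesgue (ball (0 :: real ^ 'n) R) + r powr (alpha p - real CARD('n)) * energy (r * R)"
    using b(4) by simp
  finally show "(LINT y|lebesgue_on (ball 0 R). norm (bl r y) powr 2) \<le> measure lebesgue (ball (0 :: real ^ 'n) R) + r powr (alpha p - real CARD('n)) * energy (r * R)" .
qed

text \<open>
  Since \<open>(p - 1) / (p + 1) \<le> (p - 1) / 2\<close>, the density of the energy measure is at most
  \<open>(p - 1) / 2\<close> times the integrand of \<open>energy\<close>.
\<close>

lemma blow_up_measure_ball:
  assumes r: "r > 0"
  shows "emeasure (blow_up_measure p x r (energy_measure p \<Omega> u)) (ball 0 R)
    \<le> ennreal (r powr (alpha p - real CARD('n)) * ((p - 1) / 2 * energy (r * R)))"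
proof -
  let ?e = "\<lambda>y. (p - 1) / 2 * (norm (G y))\<^sup>2 + (p - 1) / (p + 1) * \<bar>u y\<bar> powr (p + 1)"
  have img: "(\<lambda>y. x + r *\<^sub>R y) ` ball 0 R \<inter> \<Omega> = ball x (r * R) \<inter> \<Omega>"
  proof -
    have "z \<in> (\<lambda>y. x + r *\<^sub>R y) ` ball 0 R" if "z \<in> ball x (r * R)" for z
    proof (rule image_eqI[of _ _ "(z - x) /\<^sub>R r"])
      show "z = x + r *\<^sub>R ((z - x) /\<^sub>R r)" using r by simp
      have "norm ((z - x) /\<^sub>R r) = norm (z - x) / r" using r by (simp add: divide_inverse mult.commute)
      also have "\<dots> < R" using that r by (simp add: dist_norm norm_minus_commute pos_divide_less_eq mult.commute)
      finally show "(z - x) /\<^sub>R r \<in> ball 0 R" by (simp only: mem_ball_0)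
    qed
    moreover have "x + r *\<^sub>R y \<in> ball x (r * R)" if "y \<in> ball 0 R" for y
      using that r by (simp add: dist_norm)
    ultimately show ?thesis by auto
  qed
  have em: "(\<lambda>y. ennreal (?e y)) \<in> borel_measurable M" using int_grad_sq by (auto intro!: measurable_compose[OF _ measurable_ennreal])
  have S: "ball x (r * R) \<inter> \<Omega> \<in> sets M"
    using sets.Int[of "ball x (r * R)" lebesgue \<Omega>] \<Omega>_sets(1) by (simp add: sets_restrict_space_iff)
  have "emeasure (energy_measure p \<Omega> u) (ball x (r * R) \<inter> \<Omega>) = (\<integral>\<^sup>+y. ennreal (?e y) * indicator (ball x (r * R) \<inter> \<Omega>) y \<partial>M)"
    unfolding energy_measure_def by (rule emeasure_density[OF em S])
  also have "\<dots> \<le> (\<integral>\<^sup>+y. ennreal ((p - 1) / 2 * (indicator (ball x (r * R)) y * ((norm (G y))\<^sup>2 + \<bar>u y\<bar> powr (p + 1)))) \<partial>M)"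
  proof (rule nn_integral_mono)
    fix y
    have "(p - 1) / (p + 1) * \<bar>u y\<bar> powr (p + 1) \<le> (p - 1) / 2 * \<bar>u y\<bar> powr (p + 1)"
      using p by (intro mult_right_mono divide_left_mono) auto
    then have "?e y \<le> (p - 1) / 2 * ((norm (G y))\<^sup>2 + \<bar>u y\<bar> powr (p + 1))" by (simp add: distrib_left)
    then show "ennreal (?e y) * indicator (ball x (r * R) \<inter> \<Omega>) y
      \<le> ennreal ((p - 1) / 2 * (indicator (ball x (r * R)) y * ((norm (G y))\<^sup>2 + \<bar>u y\<bar> powr (p + 1))))"
      by (cases "y \<in> ball x (r * R) \<inter> \<Omega>") (auto intro!: ennreal_leI)
  qed
  also have "\<dots> = ennreal (LINT y|M. (p - 1) / 2 * (indicator (ball x (r * R)) y * ((norm (G y))\<^sup>2 + \<bar>u y\<bar> powr (p + 1))))"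
    by (rule nn_integral_eq_integral) (use p int_energy in \<open>auto simp: indicator_def\<close>)
  also have "\<dots> = ennreal ((p - 1) / 2 * energy (r * R))" by (simp add: energy_def)
  finally have "ennreal (r powr (alpha p - real CARD('n))) * emeasure (energy_measure p \<Omega> u) (ball x (r * R) \<inter> \<Omega>)
    \<le> ennreal (r powr (alpha p - real CARD('n))) * ennreal ((p - 1) / 2 * energy (r * R))" by (intro mult_left_mono) auto
  also have "\<dots> = ennreal (r powr (alpha p - real CARD('n)) * ((p - 1) / 2 * energy (r * R)))"
    by (rule ennreal_mult'[symmetric]) simp
  finally show ?thesis
    using emeasure_blow_up_measure[OF r, of "ball 0 R" p x \<Omega> u] unfolding img by simp
qed

end

section \<open>A space-filling curve\<close>

text \<open>
  Schoenberg's function: continuous, of period 2, equal to 0 on \<open>[0, 1/3]\<close> and to 1 on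
  \<open>[2/3, 1]\<close>.
\<close>

definition step :: "real \<Rightarrow> real" where "step t = max 0 (min 1 (1 / 2 - cos (pi * t)))"

lemma step_bounds: "0 \<le> step t" "step t \<le> 1"
  by (auto simp: step_def)

lemma continuous_step: "continuous_on UNIV step"
  unfolding step_def[abs_def] by (intro continuous_intros)

lemma step_periodic: "step (t + 2 * of_int k) = step t"
proof -
  have "cos (pi * (t + 2 * of_int k)) = cos (pi * t + 2 * pi * of_int k)" by (simp add: algebra_simps)
  also have "\<dots> = cos (pi * t)"
    using cos_int_2pin[of k] sin_int_2pin[of k] by (simp add: cos_add)
  finally show ?thesis by (simp add: step_def)
qed

lemma step_low: "0 \<le> t \<Longrightarrow> t \<le> 1 / 3 \<Longrightarrow> step t = 0"
proof -
  assume t: "0 \<le> t" "t \<le> 1 / 3"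
  then have "cos (pi / 3) \<le> cos (pi * t)" by (intro cos_monotone_0_pi_le) (auto simp: field_simps)
  then show ?thesis by (simp add: step_def cos_60)
qed

lemma step_high: "2 / 3 \<le> t \<Longrightarrow> t \<le> 1 \<Longrightarrow> step t = 1"
proof -
  assume t: "2 / 3 \<le> t" "t \<le> 1"
  then have "cos (pi * t) \<le> cos (2 * pi / 3)" by (intro cos_monotone_0_pi_le) (auto simp: field_simps)
  also have "cos (2 * pi / 3) = - 1 / 2" using cos_120 by simp
  finally show ?thesis by (simp add: step_def)
qed

text \<open>
  The point of the Cantor set whose \<open>m\<close>-th ternary digit is 2 or 0 according to \<open>a m\<close>.
  Multiplication by \<open>3\<^sup>m\<close> moves digit \<open>m\<close> in front, up to an even integer, where \<open>step\<close> can read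
  it.
\<close>

definition ternary :: "(nat \<Rightarrow> bool) \<Rightarrow> real" where
  "ternary a = (\<Sum>m. 2 * of_bool (a m) / 3 ^ Suc m)"

lemma summable_ternary: "summable (\<lambda>m. 2 * of_bool (a m) / 3 ^ Suc m :: real)"
proof (rule summable_comparison_test[OF _ summable_mult[OF summable_geometric]])
  show "\<exists>N. \<forall>m\<ge>N. norm (2 * of_bool (a m) / 3 ^ Suc m :: real) \<le> (2 / 3) * (1 / 3) ^ m"
    by (intro exI[of _ 0]) (auto simp: power_divide)
qed simp

lemma ternary_bounds: "0 \<le> ternary a" "ternary a \<le> 1"
proof -
  show "0 \<le> ternary a" unfolding ternary_def by (intro suminf_nonneg summable_ternary) simp
  have s: "(\<lambda>m. (2 / 3) * (1 / 3) ^ m :: real) sums ((2 / 3) * (1 / (1 - 1 / 3)))"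
    by (intro sums_mult geometric_sums) simp
  have "ternary a \<le> (\<Sum>m. (2 / 3) * (1 / 3) ^ m :: real)"
    unfolding ternary_def
  proof (intro suminf_le summable_ternary sums_summable[OF s])
    show "2 * of_bool (a m) / 3 ^ Suc m \<le> (2 / 3) * (1 / 3 :: real) ^ m" for m
      by (simp add: power_divide)
  qed
  then show "ternary a \<le> 1" using sums_unique[OF s] by simp
qed

lemma ternary_shift: "3 * ternary a = 2 * of_bool (a 0) + ternary (\<lambda>m. a (Suc m))"
proof -
  have "ternary a = 2 * of_bool (a 0) / 3 + (\<Sum>m. 2 * of_bool (a (Suc m)) / 3 ^ Suc (Suc m))"
    unfolding ternary_def using suminf_split_initial_segment[OF summable_ternary[of a], of 1] by simp
  also have "(\<Sum>m. 2 * of_bool (a (Suc m)) / 3 ^ Suc (Suc m)) = (\<Sum>m. (1 / 3) * (2 * of_bool (a (Suc m)) / 3 ^ Suc m :: real))"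
    by (intro suminf_cong) simp
  also have "\<dots> = (1 / 3) * ternary (\<lambda>m. a (Suc m))"
    unfolding ternary_def by (rule suminf_mult[OF summable_ternary])
  finally show ?thesis by simp
qed

lemma step_ternary: "step (3 ^ m * ternary a) = of_bool (a m)"
proof (induction m arbitrary: a)
  case 0
  have "ternary a = 2 * of_bool (a 0) / 3 + ternary (\<lambda>m. a (Suc m)) / 3" using ternary_shift[of a] by simp
  then show ?case
    using ternary_bounds[of "\<lambda>m. a (Suc m)"] by (cases "a 0") (auto intro!: step_low step_high)
next
  case (Suc m)
  have "3 ^ Suc m * ternary a = 3 ^ m * (3 * ternary a)" by simp
  also have "\<dots> = 3 ^ m * ternary (\<lambda>m. a (Suc m)) + 2 * of_int (3 ^ m * of_bool (a 0))"
    unfolding ternary_shift by (simp add: algebra_simps)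
  finally show ?case using Suc.IH[of "\<lambda>m. a (Suc m)"] by (simp only: step_periodic)
qed

definition bit_of :: "real \<Rightarrow> nat \<Rightarrow> bool" where "bit_of x k = odd \<lfloor>2 ^ Suc k * x\<rfloor>"

lemma binary_partial_sum:
  assumes "0 \<le> x" "x < 1"
  shows "(\<Sum>k<N. of_bool (bit_of x k) / 2 ^ Suc k) = real_of_int \<lfloor>2 ^ N * x\<rfloor> / 2 ^ N"
proof (induction N)
  case 0
  have "\<lfloor>x\<rfloor> = 0" using assms by (simp add: floor_eq_iff)
  then show ?case by simp
next
  case (Suc N)
  have "\<lfloor>2 ^ Suc N * x\<rfloor> = 2 * \<lfloor>2 ^ N * x\<rfloor> + of_bool (bit_of x N)"
  proof -
    define y where "y = 2 ^ N * x"
    have "\<lfloor>2 * y\<rfloor> div 2 = \<lfloor>y\<rfloor>"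
      using floor_divide_real_eq_div[of 2 "2 * y"] by simp
    then have "\<lfloor>2 * y\<rfloor> = 2 * \<lfloor>y\<rfloor> + \<lfloor>2 * y\<rfloor> mod 2" using div_mult_mod_eq[of "\<lfloor>2 * y\<rfloor>" 2] by linarith
    moreover have "\<lfloor>2 * y\<rfloor> mod 2 = of_bool (odd \<lfloor>2 * y\<rfloor>)" by (simp add: mod_2_eq_odd)
    ultimately show ?thesis by (simp add: y_def bit_of_def mult.assoc)
  qed
  then show ?case using Suc.IH by (simp add: field_simps)
qed

lemma binary_expansion:
  assumes "0 \<le> x" "x < 1"
  shows "(\<lambda>k. of_bool (bit_of x k) / 2 ^ Suc k) sums x"
proof -
  have "(\<lambda>N. real_of_int \<lfloor>2 ^ N * x\<rfloor> / 2 ^ N) \<longlonglongrightarrow> x"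
  proof (rule tendsto_sandwich[of "\<lambda>N. x - (1 / 2) ^ N" _ _ "\<lambda>N. x"])
    have "(\<lambda>N. x - (1 / 2) ^ N) \<longlonglongrightarrow> x - 0" by (intro tendsto_intros LIMSEQ_power_zero) simp
    then show "(\<lambda>N. x - (1 / 2) ^ N) \<longlonglongrightarrow> x" by simp
    have "x - (1 / 2) ^ N \<le> real_of_int \<lfloor>2 ^ N * x\<rfloor> / 2 ^ N" for N
    proof -
      have "2 ^ N * x - 1 \<le> real_of_int \<lfloor>2 ^ N * x\<rfloor>" by linarith
      then have "(2 ^ N * x - 1) / 2 ^ N \<le> real_of_int \<lfloor>2 ^ N * x\<rfloor> / 2 ^ N" by (intro divide_right_mono) auto
      then show ?thesis by (simp add: diff_divide_distrib power_divide)
    qed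
    then show "\<forall>\<^sub>F N in sequentially. x - (1 / 2) ^ N \<le> real_of_int \<lfloor>2 ^ N * x\<rfloor> / 2 ^ N" by simp
    have "real_of_int \<lfloor>2 ^ N * x\<rfloor> / 2 ^ N \<le> x" for N
      by (simp add: divide_le_eq mult.commute)
    then show "\<forall>\<^sub>F N in sequentially. real_of_int \<lfloor>2 ^ N * x\<rfloor> / 2 ^ N \<le> x" by simp
  qed simp
  then show ?thesis unfolding sums_def binary_partial_sum[OF assms] .
qed

definition coord_index :: "'n::finite \<Rightarrow> nat" where
  "coord_index = (SOME f. bij_betw f UNIV {0..<CARD('n)})"

lemma coord_index: "bij_betw (coord_index :: 'n::finite \<Rightarrow> nat) UNIV {0..<CARD('n)}"
  unfolding coord_index_def using ex_bij_betw_finite_nat[OF finite, of UNIV] by (rule someI_ex)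

definition curve_term :: "nat \<Rightarrow> nat \<Rightarrow> real \<Rightarrow> nat \<Rightarrow> real" where
  "curve_term n i t k = step (3 ^ (n * k + i) * t) / 2 ^ Suc k"

text \<open>
  Schoenberg's space-filling curve: with \<open>n\<close> coordinates, the binary digits of coordinate \<open>i\<close>
  are read off from the ternary digits of \<open>t\<close> at the positions \<open>i\<close>, \<open>n + i\<close>, \<open>2 n + i\<close>, and so
  on.
\<close>

definition curve :: "real \<Rightarrow> real ^ 'n" where
  "curve t = (\<chi> j. \<Sum>k. curve_term CARD('n) (coord_index j) t k)"

lemma continuous_curve: "continuous_on UNIV (curve :: real \<Rightarrow> real ^ 'n)"
proof -
  have "continuous_on UNIV (\<lambda>t. \<Sum>k. curve_term n i t k)" for n i
  proof (rule uniform_limit_theorem[OF _ Weierstrass_m_test])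
    show "\<forall>\<^sub>F N in sequentially. continuous_on UNIV (\<lambda>t. \<Sum>k<N. curve_term n i t k)"
      unfolding curve_term_def
      by (intro always_eventually allI continuous_on_sum continuous_on_divide continuous_on_const
          continuous_on_compose2[OF continuous_step] continuous_intros) auto
    show "norm (curve_term n i t k) \<le> (1 / 2) ^ k" for k t
      using step_bounds[of "3 ^ (n * k + i) * t"] by (simp add: curve_term_def power_divide field_simps)
  qed (auto simp: summable_geometric)
  then show ?thesis unfolding curve_def[abs_def] by (rule continuous_on_vec_lambda)
qed

definition unit_cube :: "(real ^ 'n) set" where "unit_cube = {z. \<forall>j. 0 < z $ j \<and> z $ j < 1}"

text \<open>
  The binary digits of all coordinates, interleaved, are the ternary digits of a suitable \<open>t\<close>.
\<close>

lemma curve_onto: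
  fixes z :: "real ^ 'n"
  assumes z: "z \<in> unit_cube"
  obtains t where "0 \<le> t" "t \<le> 1" "curve t = z"
proof -
  define n where "n = CARD('n)"
  have n: "n > 0" by (simp add: n_def)
  define a where "a m = bit_of (z $ (inv coord_index (m mod n))) (m div n)" for m
  have inv: "inv coord_index (coord_index j) = j" for j :: 'n
    using coord_index by (intro inv_f_f) (auto simp: bij_betw_def)
  have idx: "coord_index j < n" for j :: 'n using coord_index unfolding bij_betw_def n_def by fastforce
  have "a (n * k + coord_index j) = bit_of (z $ j) k" for j k
    using idx[of j] n by (simp add: a_def inv)
  then have "curve_term n (coord_index j) (ternary a) k = of_bool (bit_of (z $ j) k) / 2 ^ Suc k" for j k
    by (simp add: curve_term_def step_ternary)
  moreover have "(\<Sum>k. of_bool (bit_of (z $ j) k) / 2 ^ Suc k) = z $ j" for j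
    using binary_expansion[of "z $ j"] z by (simp add: unit_cube_def sums_iff less_imp_le)
  ultimately have "curve (ternary a) = z" by (simp add: curve_def vec_eq_iff flip: n_def)
  with ternary_bounds[of a] that show ?thesis by blast
qed

lemma open_unit_cube: "open (unit_cube :: (real ^ 'n) set)"
proof -
  have "(unit_cube :: (real ^ 'n) set) = box 0 (vec 1)" by (auto simp: unit_cube_def mem_box_cart)
  then show ?thesis by (metis open_box)
qed

text \<open>
  The first time in the unit interval at which the curve passes through \<open>z\<close>. Off the cube the
  value is a number outside the unit interval, which keeps sublevel sets inside the cube.
\<close>

definition curve_section :: "real ^ 'n \<Rightarrow> real" where
  "curve_section z = (if z \<in> unit_cube then Inf {t \<in> {0..1}. curve t = z} else 2)"

lemma curve_section:
  fixes z :: "real ^ 'n"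
  assumes z: "z \<in> unit_cube"
  shows "curve_section z \<in> {0..1}" "curve (curve_section z) = z" "\<And>t. t \<in> {0..1} \<Longrightarrow> curve t = z \<Longrightarrow> curve_section z \<le> t"
proof -
  define A where "A = {t \<in> {0..1}. curve t = z}"
  have "closed (curve -` {z})" by (intro closed_vimage continuous_curve) simp
  then have "closed ({0..1} \<inter> curve -` {z})" by (intro closed_Int) auto
  also have "{0..1} \<inter> curve -` {z} = A" by (auto simp: A_def)
  finally have A: "closed A" .
  have ne: "A \<noteq> {}" using curve_onto[OF z] by (auto simp: A_def)
  have bdd: "bdd_below A" by (auto simp: A_def intro!: bdd_belowI[of _ 0])
  have s: "curve_section z = Inf A" using z by (simp add: curve_section_def A_def)
  have "Inf A \<in> A" by (rule closed_contains_Inf[OF ne bdd A])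
  then show "curve_section z \<in> {0..1}" "curve (curve_section z) = z" by (auto simp: s A_def)
  show "curve_section z \<le> t" if "t \<in> {0..1}" "curve t = z" for t
    unfolding s using that bdd by (intro cInf_lower) (auto simp: A_def)
qed

text \<open>
  By minimality, the section is at most \<open>c\<close> exactly at the points that the curve visits up to
  time \<open>c\<close>, and the curve maps compact intervals to compact sets.
\<close>

lemma curve_section_measurable: "curve_section \<in> borel_measurable (borel :: (real ^ 'n) measure)"
proof (rule borel_measurableI_le)
  fix c :: real
  have "{z :: real ^ 'n. curve_section z \<le> c} \<in> sets borel"
  proof (cases "c \<ge> 2")
    case True
    have "curve_section z \<le> 2" for z :: "real ^ 'n"
      using curve_section(1)[of z] by (cases "z \<in> unit_cube") (auto simp: curve_section_def)
    then have "{z :: real ^ 'n. curve_section z \<le> c} = UNIV" using True order_trans by blast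
    then show ?thesis by simp
  next
    case False
    have "{z :: real ^ 'n. curve_section z \<le> c} = curve ` ({0..1} \<inter> {..c}) \<inter> unit_cube"
    proof safe
      fix z :: "real ^ 'n" assume le: "curve_section z \<le> c"
      with False show z: "z \<in> unit_cube" by (auto simp: curve_section_def split: if_splits)
      show "z \<in> curve ` ({0..1} \<inter> {..c})"
        using curve_section[OF z] le by (intro image_eqI[of _ _ "curve_section z"]) auto
    next
      fix t assume "curve t \<in> (unit_cube :: (real ^ 'n) set)" "t \<in> {0..1}" "t \<le> c"
      then show "curve_section (curve t :: real ^ 'n) \<le> c"
        using curve_section(3)[of "curve t :: real ^ 'n" t] by simp
    qed
    moreover have c: "compact (curve ` ({0..1} \<inter> {..c}) :: (real ^ 'n) set)"
      by (intro compact_continuous_image continuous_on_subset[OF continuous_curve]) (auto intro: compact_Int_closed)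
    ultimately show ?thesis
      using sets.Int[OF borel_compact[OF c] borel_open[OF open_unit_cube]] by (simp only:)
  qed
  then show "{z \<in> space (borel :: (real ^ 'n) measure). curve_section z \<le> c} \<in> sets borel" by simp
qed

section \<open>Weak-* compactness of measures\<close>

text \<open>
  Helly's selection theorem for measures of bounded mass on the unit interval. Along a
  subsequence the masses converge; if the limit is positive, the normalised measures are a tight
  sequence of probability measures, and otherwise the limit measure is zero.
\<close>

lemma finite_measures_on_interval_compact:
  fixes L :: "nat \<Rightarrow> real measure" and W :: real
  assumes sets: "\<And>i. sets (L i) = sets borel" and W: "\<And>i. emeasure (L i) UNIV \<le> ennreal W"
    and supp: "\<And>i. emeasure (L i) (UNIV - {0..1}) = 0"
  obtains r K where "strict_mono (r :: nat \<Rightarrow> nat)" "finite_measure K" "sets K = sets borel"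
    "\<And>f B. continuous_on UNIV f \<Longrightarrow> (\<And>t. \<bar>f t\<bar> \<le> B) \<Longrightarrow> (\<lambda>i. LINT t|L (r i). f t) \<longlonglongrightarrow> (LINT t|K. f t :: real)"
proof -
  have fin: "finite_measure (L i)" for i
    by (rule finite_measureI) (use W[of i] sets_eq_imp_space_eq[OF sets] in \<open>auto simp: top_unique\<close>)
  have sp: "space (L i) = UNIV" for i using sets_eq_imp_space_eq[OF sets] by auto
  define m where "m i = measure (L i) UNIV" for i
  have em: "emeasure (L i) UNIV = ennreal (m i)" for i
    using finite_measure.emeasure_eq_measure[OF fin] by (simp add: m_def)
  have m: "0 \<le> m i" "m i \<le> \<bar>W\<bar>" for i
  proof -
    show "0 \<le> m i" by (simp add: m_def)
    have "ennreal (m i) \<le> ennreal \<bar>W\<bar>" using W[of i] unfolding em by (rule order_trans) (simp add: ennreal_leI)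
    then show "m i \<le> \<bar>W\<bar>" by simp
  qed
  then have "bounded (range m)" unfolding bounded_iff by (intro exI[of _ "\<bar>W\<bar>"]) auto
  then obtain m0 r1 where r1: "strict_mono (r1 :: nat \<Rightarrow> nat)" "(m \<circ> r1) \<longlonglongrightarrow> m0"
    using bounded_imp_convergent_subsequence by blast
  have bound: "\<bar>LINT t|L i. f t\<bar> \<le> B * m i" if f: "continuous_on UNIV f" "\<And>t. \<bar>f t\<bar> \<le> B" for f :: "real \<Rightarrow> real" and B i
  proof -
    interpret finite_measure "L i" by (rule fin)
    have [measurable_cong]: "sets (L i) = sets borel" by (rule sets)
    have [measurable]: "f \<in> borel_measurable borel" using f(1) by (rule borel_measurable_continuous_onI)
    have fi: "integrable (L i) f" by (rule integrable_const_bound[of _ B]) (use f in auto)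
    have "\<bar>LINT t|L i. f t\<bar> \<le> (LINT t|L i. \<bar>f t\<bar>)" by (rule integral_abs_bound)
    also have "\<dots> \<le> (LINT t|L i. B)" using fi f by (intro integral_mono) auto
    finally show ?thesis by (simp add: m_def sp mult.commute)
  qed
  show ?thesis
  proof (cases "m0 = 0")
    case True
    show ?thesis
    proof (rule that[of r1 "null_measure borel"])
      show "finite_measure (null_measure borel)" by (rule finite_measureI) simp
      show "(\<lambda>i. LINT t|L (r1 i). f t) \<longlonglongrightarrow> (LINT t|null_measure borel. f t)"
        if f: "continuous_on UNIV f" "\<And>t. \<bar>f t\<bar> \<le> B" for f :: "real \<Rightarrow> real" and B
      proof -
        have "(\<lambda>i. B * (m \<circ> r1) i) \<longlonglongrightarrow> 0"
          using r1(2) True by (intro tendsto_mult_right_zero) (simp add: o_def)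
        then have "(\<lambda>i. LINT t|L (r1 i). f t) \<longlonglongrightarrow> 0"
          by (rule Lim_null_comparison[rotated]) (use bound[OF f] in simp)
        then show ?thesis by (simp add: integral_null_measure)
      qed
    qed (use r1 in auto)
  next
    case False
    have "0 \<le> m0" by (rule LIMSEQ_le_const[OF r1(2)]) (use m in auto)
    with False have m0: "m0 > 0" by simp
    then obtain N where N: "\<And>i. i \<ge> N \<Longrightarrow> (m \<circ> r1) i > 0"
      using order_tendstoD(1)[OF r1(2) m0] unfolding eventually_sequentially by blast
    define r2 where "r2 i = r1 (i + N)" for i
    have r2: "strict_mono r2" using r1(1) by (simp add: r2_def strict_mono_def)
    have pos: "m (r2 i) > 0" for i using N[of "i + N"] by (simp add: r2_def)
    have lim2: "(\<lambda>i. m (r2 i)) \<longlonglongrightarrow> m0"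
      using LIMSEQ_ignore_initial_segment[OF r1(2), of N] by (simp add: r2_def o_def)
    define \<mu> where "\<mu> i = density (L (r2 i)) (\<lambda>_. ennreal (1 / m (r2 i)))" for i
    have rd: "real_distribution (\<mu> i)" for i
    proof -
      have "prob_space (\<mu> i)"
      proof (rule prob_spaceI)
        have "emeasure (\<mu> i) (space (\<mu> i)) = ennreal (1 / m (r2 i)) * ennreal (m (r2 i))"
          unfolding \<mu>_def by (subst emeasure_density) (auto simp: sp sets nn_integral_cmult_indicator em simp flip: em)
        also have "\<dots> = 1" using pos[of i] by (simp flip: ennreal_mult)
        finally show "emeasure (\<mu> i) (space (\<mu> i)) = 1" .
      qed
      then show ?thesis by (simp add: real_distribution_def real_distribution_axioms_def \<mu>_def sets)
    qed
    have one: "measure (\<mu> i) {-1<..1} = 1" for i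
    proof -
      interpret real_distribution "\<mu> i" by (rule rd)
      have "UNIV - {-1<..1} \<in> null_sets (L (r2 i))"
      proof (rule null_sets_subset[of "UNIV - {0..1}"])
        show "UNIV - {0..1} \<in> null_sets (L (r2 i))" using supp by (auto simp: null_sets_def sets)
      qed (auto simp: sets)
      then have "AE t in L (r2 i). t \<notin> UNIV - {-1<..1}" by (rule AE_not_in)
      then have "AE t in L (r2 i). t \<in> UNIV - {-1<..1} \<longrightarrow> ennreal (1 / m (r2 i)) = 0"
        by (rule eventually_mono) blast
      then have "UNIV - {-1<..1} \<in> null_sets (\<mu> i)"
        unfolding \<mu>_def by (intro iffD2[OF null_sets_density_iff] conjI) (simp_all only: sets borel_measurable_const, simp)
      then have "prob (UNIV - {-1<..1}) = 0" by (simp add: measure_def null_setsD1)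
      then show ?thesis using prob_compl[of "{-1<..1}"] by (simp add: Compl_eq_Diff_UNIV[symmetric] space_eq_univ)
    qed
    have "tight \<mu>"
      unfolding tight_def
    proof (intro conjI allI impI rd)
      fix e :: real assume "e > 0"
      then show "\<exists>a b. a < b \<and> (\<forall>n. 1 - e < measure (\<mu> n) {a<..b})"
        by (intro exI[of _ "-1"] exI[of _ 1]) (simp add: one)
    qed
    then obtain r3 K where r3: "strict_mono (r3 :: nat \<Rightarrow> nat)" "real_distribution K" "weak_conv_m (\<mu> \<circ> id \<circ> r3) K"
      using tight_imp_convergent_subsubsequence[of \<mu> id] by (auto simp: strict_mono_def)
    interpret K: real_distribution K by (rule r3(2))
    define K' where "K' = density K (\<lambda>_. ennreal m0)"
    show ?thesis
    proof (rule that[of "r2 \<circ> r3" K'])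
      show "strict_mono (r2 \<circ> r3)" using r2 r3(1) by (rule strict_mono_o)
      show "sets K' = sets borel" by (simp add: K'_def)
      show "finite_measure K'"
      proof (rule finite_measureI)
        have "emeasure K' (space K') = ennreal m0 * emeasure K (space K)"
          unfolding K'_def by (subst emeasure_density) (auto simp: nn_integral_cmult_indicator)
        then show "emeasure K' (space K') \<noteq> \<infinity>" by (simp only: K.emeasure_space_1) simp
      qed
      show "(\<lambda>i. LINT t|L ((r2 \<circ> r3) i). f t) \<longlonglongrightarrow> (LINT t|K'. f t)"
        if f: "continuous_on UNIV f" "\<And>t. \<bar>f t\<bar> \<le> B" for f :: "real \<Rightarrow> real" and B
      proof -
        have fm[measurable]: "f \<in> borel_measurable borel" using f(1) by (rule borel_measurable_continuous_onI)
        have "(\<lambda>i. LINT t|(\<mu> \<circ> id \<circ> r3) i. f t) \<longlonglongrightarrow> (LINT t|K. f t)"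
        proof (rule weak_conv_imp_integral_bdd_continuous_conv[OF _ _ r3(3)])
          show "isCont f t" for t using f(1) by (simp add: continuous_on_eq_continuous_at)
          show "norm (f t) \<le> B" for t using f(2) by simp
        qed (use rd r3(2) in auto)
        moreover have "(LINT t|\<mu> i. f t) = (LINT t|L (r2 i). f t) / m (r2 i)" for i
        proof -
          have "f \<in> borel_measurable (L (r2 i))" using fm sets measurable_cong_sets by blast
          then show ?thesis unfolding \<mu>_def using pos[of i]
            by (subst integral_density) auto
        qed
        ultimately have "(\<lambda>i. (LINT t|L (r2 (r3 i)). f t) / m (r2 (r3 i))) \<longlonglongrightarrow> (LINT t|K. f t)" by simp
        moreover have "(\<lambda>i. m (r2 (r3 i))) \<longlonglongrightarrow> m0" using LIMSEQ_subseq_LIMSEQ[OF lim2 r3(1)] by (simp add: o_def)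
        ultimately have "(\<lambda>i. m (r2 (r3 i)) * ((LINT t|L (r2 (r3 i)). f t) / m (r2 (r3 i)))) \<longlonglongrightarrow> m0 * (LINT t|K. f t)"
          by (intro tendsto_mult)
        moreover have "(LINT t|K'. f t) = m0 * (LINT t|K. f t)"
          unfolding K'_def using m0 by (subst integral_density) auto
        moreover have "m (r2 (r3 i)) * ((LINT t|L (r2 (r3 i)). f t) / m (r2 (r3 i))) = (LINT t|L (r2 (r3 i)). f t)" for i
          using pos[of "r3 i"] by simp
        ultimately show ?thesis by (simp add: o_def)
      qed
    qed
  qed
qed

text \<open>
  A homeomorphism of the line onto the interval between \<open>- 1\<close> and \<open>1\<close>, with inverse \<open>unsquash\<close>.
\<close>

definition squash :: "real \<Rightarrow> real" where "squash s = s / (1 + \<bar>s\<bar>)"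

definition unsquash :: "real \<Rightarrow> real" where "unsquash s = s / (1 - \<bar>s\<bar>)"

lemma squash_bound: "\<bar>squash s\<bar> < 1"
  by (simp add: squash_def abs_divide)

lemma unsquash_squash: "unsquash (squash s) = s"
proof -
  have p: "1 + \<bar>s\<bar> > 0" by simp
  have "1 - \<bar>s / (1 + \<bar>s\<bar>)\<bar> = 1 / (1 + \<bar>s\<bar>)" using p by (simp add: field_simps)
  then show ?thesis unfolding squash_def unsquash_def using p by simp
qed

lemma squash_unsquash:
  assumes "\<bar>s\<bar> < 1" shows "squash (unsquash s) = s"
proof -
  have p: "1 - \<bar>s\<bar> > 0" using assms by simp
  have "1 + \<bar>s / (1 - \<bar>s\<bar>)\<bar> = 1 / (1 - \<bar>s\<bar>)" using p by (simp add: field_simps)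
  then show ?thesis unfolding squash_def unsquash_def using p by simp
qed

definition to_cube :: "real ^ 'n \<Rightarrow> real ^ 'n" where
  "to_cube y = (\<chi> j. (1 + squash (y $ j)) / 2)"

definition of_cube :: "real ^ 'n \<Rightarrow> real ^ 'n" where
  "of_cube z = (\<chi> j. unsquash (2 * z $ j - 1))"

lemma to_cube: "to_cube y \<in> unit_cube"
proof -
  have "0 < (1 + squash s) / 2 \<and> (1 + squash s) / 2 < 1" for s
    using squash_bound[of s] by (auto simp: abs_less_iff)
  then show ?thesis unfolding unit_cube_def to_cube_def by simp
qed

lemma of_to_cube: "of_cube (to_cube y) = y"
  by (simp add: of_cube_def to_cube_def vec_eq_iff unsquash_squash add_divide_distrib)

lemma cube_coordinate: "z \<in> unit_cube \<Longrightarrow> \<bar>2 * z $ j - 1\<bar> < 1"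
  unfolding unit_cube_def by (auto simp: abs_less_iff)

lemma to_of_cube: "z \<in> unit_cube \<Longrightarrow> to_cube (of_cube z) = z"
  using cube_coordinate[of z] by (simp add: of_cube_def to_cube_def vec_eq_iff squash_unsquash)

lemma continuous_to_cube: "continuous_on A to_cube"
  unfolding to_cube_def[abs_def] squash_def by (intro continuous_on_vec_lambda continuous_intros) auto

lemma continuous_of_cube: "continuous_on unit_cube of_cube"
  unfolding of_cube_def[abs_def] unsquash_def
proof (intro continuous_on_vec_lambda continuous_intros ballI)
  fix z :: "real ^ 'n" and j assume "z \<in> unit_cube"
  then have "\<bar>2 * z $ j - 1\<bar> < 1" by (rule cube_coordinate)
  then show "1 - \<bar>2 * z $ j - 1\<bar> \<noteq> 0" by simp
qed

lemma of_cube_measurable: "of_cube \<in> borel_measurable (borel :: (real ^ 'n) measure)"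
proof -
  have "(\<lambda>z. unsquash (2 * z $ j - 1)) \<in> borel_measurable (borel :: (real ^ 'n) measure)" for j
    unfolding unsquash_def by (intro borel_measurable_divide borel_measurable_diff borel_measurable_abs borel_measurable_times borel_measurable_const
        borel_measurable_continuous_onI continuous_intros)
  then show ?thesis unfolding of_cube_def[abs_def]
    by (subst borel_measurable_euclidean_space) (auto simp: Basis_vec_def inner_axis)
qed

text \<open>
  The weight \<open>w\<close> decays by two powers more than the masses of balls may grow, so the weighted
  measures have bounded total mass. The Borel section of the curve carries them to measures on
  the unit interval, which converge along a subsequence to some \<open>K\<close>. Carrying \<open>K\<close> back by the
  curve and dividing by the weight gives the limit. For continuous \<open>f\<close> of compact support,
  \<open>f / w\<close> read off along the curve is a bounded continuous function on the line, so its
  integrals converge.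
\<close>

theorem weak_star_compactness:
  fixes \<nu> :: "nat \<Rightarrow> (real ^ 'n) measure" and C :: real and N :: nat
  assumes sets: "\<And>i. sets (\<nu> i) = sets borel"
    and bound: "\<And>i k. emeasure (\<nu> i) (ball 0 (real (Suc k))) \<le> ennreal (C * real (Suc k) ^ N)"
  obtains r \<mu> where "strict_mono (r :: nat \<Rightarrow> nat)" "\<mu> \<in> radon_measures" "weak_star_converges (\<lambda>i. \<nu> (r i)) \<mu>"
proof -
  define w where "w y = 1 / (1 + norm y) ^ (N + 2)" for y :: "real ^ 'n"
  have wpos: "w y > 0" for y unfolding w_def by (intro divide_pos_pos zero_less_power) (auto simp: add_pos_nonneg)
  have wcont: "continuous_on A w" for A
    unfolding w_def[abs_def] by (intro continuous_intros) (auto simp: add_nonneg_eq_0_iff)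
  have wm[measurable]: "w \<in> borel_measurable borel" by (intro borel_measurable_continuous_onI wcont)
  have cm: "(\<lambda>y. curve_section (to_cube y)) \<in> borel_measurable (borel :: (real ^ 'n) measure)"
    using measurable_compose[OF borel_measurable_continuous_onI[OF continuous_to_cube] curve_section_measurable] .
  have um: "(\<lambda>t. of_cube (curve t) :: real ^ 'n) \<in> borel_measurable borel"
    using measurable_compose[OF borel_measurable_continuous_onI[OF continuous_curve] of_cube_measurable] .
  have \<nu>m: "f \<in> borel_measurable (\<nu> i)" if "f \<in> borel_measurable borel" for f :: "real ^ 'n \<Rightarrow> 'c::topological_space" and i
    using that sets measurable_cong_sets by blast
  have sp: "space (\<nu> i) = UNIV" for i using sets_eq_imp_space_eq[OF sets] by auto
  define s where "s = (\<Sum>k. 1 / real (Suc k) ^ 2)"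
  have sum: "summable (\<lambda>k. 1 / real (Suc k) ^ 2)"
    using inverse_power_summable[of 2, where 'a = real] by (subst summable_Suc_iff) (simp add: inverse_eq_divide)
  define W where "W = \<bar>C\<bar> * s"
  have mass: "(\<integral>\<^sup>+y. ennreal (w y) \<partial>\<nu> i) \<le> ennreal W" for i
  proof -
    have "ennreal (w y) \<le> (\<Sum>k. ennreal (1 / real (Suc k) ^ (N + 2)) * indicator (ball 0 (real (Suc k))) y)" for y
    proof -
      define k where "k = nat \<lfloor>norm y\<rfloor>"
      have k: "real k \<le> norm y" "norm y < real (Suc k)" by (simp_all add: k_def) linarith
      have "w y \<le> 1 / real (Suc k) ^ (N + 2)" unfolding w_def using k by (intro divide_left_mono power_mono) auto
      then have "ennreal (w y) \<le> ennreal (1 / real (Suc k) ^ (N + 2)) * indicator (ball 0 (real (Suc k))) y"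
        using k by (simp add: ennreal_leI)
      also have "\<dots> \<le> (\<Sum>k. ennreal (1 / real (Suc k) ^ (N + 2)) * indicator (ball 0 (real (Suc k))) y)"
      proof -
        have "f k \<le> suminf f" for f :: "nat \<Rightarrow> ennreal"
          using sum_le_suminf[OF summableI, of "{k}" f] by simp
        then show ?thesis .
      qed
      finally show ?thesis .
    qed
    then have "(\<integral>\<^sup>+y. ennreal (w y) \<partial>\<nu> i) \<le> (\<integral>\<^sup>+y. (\<Sum>k. ennreal (1 / real (Suc k) ^ (N + 2)) * indicator (ball 0 (real (Suc k))) y) \<partial>\<nu> i)"
      by (intro nn_integral_mono)
    also have "\<dots> = (\<Sum>k. \<integral>\<^sup>+y. ennreal (1 / real (Suc k) ^ (N + 2)) * indicator (ball 0 (real (Suc k))) y \<partial>\<nu> i)"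
      by (rule nn_integral_suminf)
        (intro \<nu>m borel_measurable_times_ennreal borel_measurable_const borel_measurable_indicator, simp)
    also have "\<dots> = (\<Sum>k. ennreal (1 / real (Suc k) ^ (N + 2)) * emeasure (\<nu> i) (ball 0 (real (Suc k))))"
      by (intro suminf_cong nn_integral_cmult_indicator) (simp add: sets)
    also have "\<dots> \<le> (\<Sum>k. ennreal (\<bar>C\<bar> * (1 / real (Suc k) ^ 2)))"
    proof (intro suminf_le summableI)
      fix k
      have "ennreal (1 / real (Suc k) ^ (N + 2)) * emeasure (\<nu> i) (ball 0 (real (Suc k)))
        \<le> ennreal (1 / real (Suc k) ^ (N + 2)) * ennreal (\<bar>C\<bar> * real (Suc k) ^ N)"
        by (intro mult_left_mono order_trans[OF bound] ennreal_leI mult_right_mono) auto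
      also have "\<dots> = ennreal (1 / real (Suc k) ^ (N + 2) * (\<bar>C\<bar> * real (Suc k) ^ N))"
        by (rule ennreal_mult[symmetric]) auto
      also have "1 / real (Suc k) ^ (N + 2) * (\<bar>C\<bar> * real (Suc k) ^ N) = \<bar>C\<bar> * (1 / real (Suc k) ^ 2)"
        by (simp add: power_add power2_eq_square del: of_nat_Suc)
      finally show "ennreal (1 / real (Suc k) ^ (N + 2)) * emeasure (\<nu> i) (ball 0 (real (Suc k))) \<le> ennreal (\<bar>C\<bar> * (1 / real (Suc k) ^ 2))" .
    qed
    also have "\<dots> = ennreal (\<Sum>k. \<bar>C\<bar> * (1 / real (Suc k) ^ 2))"
      by (rule suminf_ennreal2[OF _ summable_mult[OF sum]]) simp
    also have "\<dots> = ennreal W" by (simp only: W_def s_def suminf_mult[OF sum])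
    finally show ?thesis .
  qed
  define L where "L i = distr (density (\<nu> i) (\<lambda>y. ennreal (w y))) borel (\<lambda>y. curve_section (to_cube y))" for i
  have dm: "(\<lambda>y. curve_section (to_cube y)) \<in> measurable (density (\<nu> i) (\<lambda>y. ennreal (w y))) borel" for i
    using \<nu>m[OF cm] by simp
  have wm': "(\<lambda>y. ennreal (w y)) \<in> borel_measurable (\<nu> i)" for i by (intro \<nu>m) simp
  have LW: "emeasure (L i) UNIV \<le> ennreal W" for i
  proof -
    have "emeasure (L i) UNIV = (\<integral>\<^sup>+y. ennreal (w y) \<partial>\<nu> i)"
      unfolding L_def by (subst emeasure_distr[OF dm]) (auto simp: emeasure_density[OF wm'] sp sets sets_eq_imp_space_eq)
    then show ?thesis using mass by simp
  qed
  have Ls: "emeasure (L i) (UNIV - {0..1}) = 0" for i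
  proof -
    have "(\<lambda>y. curve_section (to_cube y)) -` (UNIV - {0..1}) = ({} :: (real ^ 'n) set)"
    proof -
      have "curve_section (to_cube y) \<in> {0..1}" for y :: "real ^ 'n" by (rule curve_section(1)[OF to_cube])
      then show ?thesis by blast
    qed
    then show ?thesis unfolding L_def by (subst emeasure_distr[OF dm]) auto
  qed
  obtain r K where r: "strict_mono (r :: nat \<Rightarrow> nat)" "finite_measure K" "sets K = sets borel"
    "\<And>f B. continuous_on UNIV f \<Longrightarrow> (\<And>t. \<bar>f t\<bar> \<le> B) \<Longrightarrow> (\<lambda>i. LINT t|L (r i). f t) \<longlonglongrightarrow> (LINT t|K. f t :: real)"
    by (rule finite_measures_on_interval_compact[of L W]) (use LW Ls in \<open>auto simp: L_def\<close>)
  interpret K: finite_measure K by (rule r(2))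
  have Km: "f \<in> borel_measurable K" if "f \<in> borel_measurable borel" for f :: "real \<Rightarrow> 'c::topological_space"
    using that r(3) measurable_cong_sets by blast
  (* undoes the weight, and drops what K charges on the boundary of the cube, which is mass lost
     at infinity *)
  define d where "d t = indicator unit_cube (curve t :: real ^ 'n) / w (of_cube (curve t))" for t
  have d0: "d t \<ge> 0" for t unfolding d_def using wpos less_imp_le by (intro divide_nonneg_nonneg) auto
  have ind[measurable]: "(\<lambda>t. indicat_real unit_cube (curve t :: real ^ 'n)) \<in> borel_measurable borel"
    by (rule measurable_compose[OF borel_measurable_continuous_onI[OF continuous_curve]], rule borel_measurable_indicator,
        rule borel_open, rule open_unit_cube)
  have wu[measurable]: "(\<lambda>t. w (of_cube (curve t))) \<in> borel_measurable borel" using measurable_compose[OF um wm] .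
  have dmeas: "d \<in> borel_measurable borel" unfolding d_def by measurable
  define \<mu> where "\<mu> = distr (density K (\<lambda>t. ennreal (d t))) borel (\<lambda>t. of_cube (curve t) :: real ^ 'n)"
  have um': "(\<lambda>t. of_cube (curve t) :: real ^ 'n) \<in> measurable (density K (\<lambda>t. ennreal (d t))) borel"
    using Km[OF um] by simp
  have "\<mu> \<in> radon_measures"
    unfolding radon_measures_def
  proof (intro CollectI conjI allI impI)
    show "sets \<mu> = sets borel" by (simp add: \<mu>_def)
    fix A :: "(real ^ 'n) set" assume A: "compact A"
    have Ab[measurable]: "A \<in> sets borel" using A borel_compact by blast
    have "compact ((\<lambda>y. 1 / w y) ` A)"
      using A wpos by (intro compact_continuous_image continuous_intros wcont) (auto simp: less_imp_neq[symmetric])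
    then obtain B where "\<forall>v\<in>(\<lambda>y. 1 / w y) ` A. norm v \<le> B"
      using compact_imp_bounded[of "(\<lambda>y. 1 / w y) ` A"] unfolding bounded_iff by blast
    then have B: "\<And>y. y \<in> A \<Longrightarrow> 1 / w y \<le> B" by (auto intro: order_trans[OF abs_ge_self])
    have pre: "(\<lambda>t. of_cube (curve t)) -` A \<in> sets borel" using measurable_sets[OF um Ab] by simp
    have "emeasure \<mu> A = emeasure (density K (\<lambda>t. ennreal (d t))) ((\<lambda>t. of_cube (curve t)) -` A)"
      unfolding \<mu>_def by (subst emeasure_distr[OF um' Ab]) (simp add: sets_eq_imp_space_eq[OF r(3)])
    also have "\<dots> = (\<integral>\<^sup>+t. ennreal (d t) * indicator ((\<lambda>t. of_cube (curve t)) -` A) t \<partial>K)"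
      using pre r(3) by (intro emeasure_density Km) (auto intro: measurable_compose[OF dmeas])
    also have "\<dots> \<le> (\<integral>\<^sup>+t. ennreal \<bar>B\<bar> \<partial>K)"
    proof (intro nn_integral_mono)
      fix t
      show "ennreal (d t) * indicator ((\<lambda>t. of_cube (curve t)) -` A) t \<le> ennreal \<bar>B\<bar>"
      proof (cases "of_cube (curve t) \<in> A")
        case True
        have "d t \<le> 1 / w (of_cube (curve t))" unfolding d_def using wpos less_imp_le by (intro divide_right_mono) (auto simp: indicator_def)
        also have "\<dots> \<le> \<bar>B\<bar>" using B[OF True] by simp
        finally show ?thesis using True by (simp add: ennreal_leI)
      qed simp
    qed
    also have "\<dots> < \<infinity>" by (simp add: ennreal_mult_less_top less_top K.emeasure_finite[of "space K", simplified less_top])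
    finally show "emeasure \<mu> A < \<infinity>" .
  qed
  moreover have "weak_star_converges (\<lambda>i. \<nu> (r i)) \<mu>"
    unfolding weak_star_converges_def
  proof (intro allI impI)
    fix f :: "real ^ 'n \<Rightarrow> real"
    assume "continuous_on UNIV f \<and> compact (closure {x. f x \<noteq> 0})"
    then have f: "continuous_on UNIV f" "compact (closure {x. f x \<noteq> 0})" by auto
    define S where "S = closure {x. f x \<noteq> 0}"
    have S: "compact S" "\<And>y. y \<notin> S \<Longrightarrow> f y = 0" using f closure_subset[of "{x. f x \<noteq> 0}"] by (auto simp: S_def)
    have fm[measurable]: "f \<in> borel_measurable borel" using f(1) by (rule borel_measurable_continuous_onI)
    (* f / w on the cube; it vanishes near the boundary of the cube because the support of f is
       compact *)
    define H where "H z = indicator unit_cube z * (f (of_cube z) / w (of_cube z))" for z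
    have cS: "compact (to_cube ` S)" by (intro compact_continuous_image continuous_to_cube S)
    have H0: "H z = 0" if "z \<notin> to_cube ` S" for z
    proof (cases "z \<in> unit_cube")
      case True
      then have "of_cube z \<notin> S" using that to_of_cube[OF True] by (metis imageI)
      then show ?thesis by (simp add: H_def S)
    qed (simp add: H_def)
    have "continuous_on (unit_cube \<union> - (to_cube ` S)) H"
    proof (rule continuous_on_open_Un[OF open_unit_cube])
      show "open (- (to_cube ` S))" using cS compact_imp_closed by auto
      have "continuous_on unit_cube (\<lambda>z. f (of_cube z) / w (of_cube z))"
        by (intro continuous_on_divide continuous_on_compose2[OF f(1) continuous_of_cube]
            continuous_on_compose2[OF wcont[of UNIV] continuous_of_cube]) (auto simp: less_imp_neq[OF wpos, symmetric])
      then show "continuous_on unit_cube H" by (rule continuous_on_eq) (simp add: H_def)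
      show "continuous_on (- (to_cube ` S)) H"
        by (rule continuous_on_eq[OF continuous_on_const[of _ 0]]) (simp add: H0)
    qed
    moreover have "unit_cube \<union> - (to_cube ` S) = UNIV" using to_cube by auto
    ultimately have Hc: "continuous_on UNIV H" by simp
    have "compact (H ` (to_cube ` S))" by (rule compact_continuous_image[OF _ cS]) (rule continuous_on_subset[OF Hc], simp)
    then obtain B where B: "B > 0" "\<And>z. z \<in> to_cube ` S \<Longrightarrow> \<bar>H z\<bar> \<le> B"
      using compact_imp_bounded[of "H ` (to_cube ` S)"] unfolding bounded_pos by auto
    have Hb: "\<bar>H z\<bar> \<le> B" for z using B H0 by (cases "z \<in> to_cube ` S") auto
    define F where "F t = H (curve t)" for t
    have Fc: "continuous_on UNIV F" unfolding F_def by (intro continuous_on_compose2[OF Hc continuous_curve]) auto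
    have Fm[measurable]: "F \<in> borel_measurable borel" using Fc by (rule borel_measurable_continuous_onI)
    have lim: "(\<lambda>i. LINT t|L (r i). F t) \<longlonglongrightarrow> (LINT t|K. F t)"
      by (rule r(4)[OF Fc, of B]) (simp add: F_def Hb)
    have "(LINT t|L i. F t) = (LINT y|\<nu> i. f y)" for i
    proof -
      have "(LINT t|L i. F t) = (LINT y|density (\<nu> i) (\<lambda>y. ennreal (w y)). F (curve_section (to_cube y)))"
        unfolding L_def by (rule integral_distr[OF dm Fm])
      also have "\<dots> = (LINT y|\<nu> i. w y *\<^sub>R F (curve_section (to_cube y)))"
        by (rule integral_density) (use \<nu>m[OF measurable_compose[OF cm Fm]] \<nu>m[OF wm] in \<open>auto simp: less_imp_le[OF wpos]\<close>)
      also have "(\<lambda>y. w y *\<^sub>R F (curve_section (to_cube y))) = f"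
      proof
        fix y
        show "w y *\<^sub>R F (curve_section (to_cube y)) = f y"
          using wpos[of y] by (simp add: F_def curve_section(2)[OF to_cube] H_def to_cube of_to_cube)
      qed
      finally show ?thesis .
    qed
    moreover have "(LINT t|K. F t) = (LINT y|\<mu>. f y)"
    proof -
      have "(LINT y|\<mu>. f y) = (LINT t|density K (\<lambda>t. ennreal (d t)). f (of_cube (curve t)))"
        unfolding \<mu>_def by (rule integral_distr[OF um' fm])
      also have "\<dots> = (LINT t|K. d t *\<^sub>R f (of_cube (curve t)))"
        by (rule integral_density) (use Km[OF measurable_compose[OF um fm]] Km[OF dmeas] d0 in auto)
      also have "(\<lambda>t. d t *\<^sub>R f (of_cube (curve t))) = F" by (auto simp: F_def H_def d_def)
      finally show ?thesis by simp
    qed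
    ultimately show "(\<lambda>i. LINT y|\<nu> (r i). f y) \<longlonglongrightarrow> (LINT y|\<mu>. f y)" using lim by simp
  qed
  ultimately show ?thesis using that r(1) by blast
qed

section \<open>Gluing weak limits on balls\<close>

lemma weakly_converges_functional:
  "weakly_converges X N f v \<Longrightarrow> bounded_functional X N l \<Longrightarrow> (\<lambda>i. l (f i)) \<longlonglongrightarrow> l v"
  by (simp add: weakly_converges_def)

lemma weakly_converges_L_cong:
  fixes f :: "nat \<Rightarrow> real ^ 'n \<Rightarrow> real"
  assumes f: "weakly_converges (L_space q U) (L_norm q U) f v" and q: "q \<ge> 2" and U: "open U"
    and ae: "AE y in lebesgue_on U. v y = v' y"
  shows "weakly_converges (L_space q U) (L_norm q U) f v'"
proof -
  have v: "v \<in> L_space q U" using f by (simp add: weakly_converges_def)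
  have v': "v' \<in> L_space q U" by (rule L_space_cong_AE[OF v _ ae]) (use U in simp)
  have "l v = l v'" if "bounded_functional (L_space q U) (L_norm q U) l" for l
    by (rule L_functional_cong_AE[OF that q v v' ae])
  then show ?thesis using f v' unfolding weakly_converges_def by metis
qed

lemma weakly_converges_H1_cong:
  fixes f :: "nat \<Rightarrow> real ^ 'n \<Rightarrow> real"
  assumes f: "weakly_converges (H1 U) (H1_norm U) f v" and U: "open U"
    and ae: "AE y in lebesgue_on U. v y = v' y"
  shows "weakly_converges (H1 U) (H1_norm U) f v'"
proof -
  have v: "v \<in> H1 U" using f by (simp add: weakly_converges_def)
  have v': "v' \<in> H1 U" by (rule H1_cong_AE[OF U v ae])
  have "l v = l v'" if "bounded_functional (H1 U) (H1_norm U) l" for l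
    by (rule H1_functional_cong_AE[OF that U v v' ae])
  then show ?thesis using f v' unfolding weakly_converges_def by metis
qed

lemma box_integrals_eq_imp_AE_eq:
  fixes v w :: "real ^ 'n \<Rightarrow> real"
  assumes U: "U \<in> lmeasurable" and q: "q > 1" and vw: "v \<in> L_space q U" "w \<in> L_space q U"
    and eq: "\<And>B. B \<in> rational_boxes \<Longrightarrow> (LINT y|lebesgue_on U. indicator B y * v y) = (LINT y|lebesgue_on U. indicator B y * w y)"
  shows "AE y in lebesgue_on U. v y = w y"
proof -
  have "AE y in lebesgue_on U. v y - w y = 0"
  proof (rule box_integrals_separate[OF U])
    show "(\<lambda>y. v y - w y) \<in> L_space q U" using vw q by (intro L_space_diff) auto
    fix B :: "(real ^ 'n) set" assume B: "B \<in> rational_boxes"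
    then have "B \<in> sets borel" by (auto simp: rational_boxes_def)
    then have ind: "indicat_real B \<in> L_space (q / (q - 1)) U" by (intro indicator_L_space U) simp
    show "(LINT y|lebesgue_on U. indicator B y * (v y - w y)) = 0"
      using eq[OF B] L_space_pairing(1)[OF q vw(1) ind] L_space_pairing(1)[OF q vw(2) ind]
      by (simp add: right_diff_distrib)
  qed (use q in simp)
  then show ?thesis by (auto elim: eventually_mono)
qed

text \<open>
  Weak limits on two nested balls have the same box integrals on the smaller ball, hence agree
  almost everywhere there. The limits on countably many balls therefore patch together.
\<close>

theorem glue_weak_limits:
  fixes f :: "nat \<Rightarrow> real ^ 'n \<Rightarrow> real"
  assumes q: "q \<ge> 2"
    and loc: "\<And>m :: nat. \<exists>v. weakly_converges (H1 (ball 0 (real (Suc m)))) (H1_norm (ball 0 (real (Suc m)))) f v \<and>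
      weakly_converges (L_space q (ball 0 (real (Suc m)))) (L_norm q (ball 0 (real (Suc m)))) f v"
  shows "\<exists>v. \<forall>R>0. weakly_converges (H1 (ball 0 R)) (H1_norm (ball 0 R)) f v \<and>
      weakly_converges (L_space q (ball 0 R)) (L_norm q (ball 0 R)) f v"
proof -
  define B where "B m = ball (0 :: real ^ 'n) (real (Suc m))" for m :: nat
  have B: "open (B m)" "B m \<in> lmeasurable" "B m \<in> sets lebesgue" for m by (auto simp: B_def)
  have Bmono: "B j \<subseteq> B m" if "j \<le> m" for j m using that unfolding B_def by (intro subset_ball) simp
  obtain V where V: "\<And>m. weakly_converges (H1 (B m)) (H1_norm (B m)) f (V m)"
    "\<And>m. weakly_converges (L_space q (B m)) (L_norm q (B m)) f (V m)"
    using loc unfolding B_def by metis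
  have VL: "V m \<in> L_space q (B m)" for m using V(2) by (simp add: weakly_converges_def)
  have eq: "AE y in lebesgue_on (B j). V j y = V m y" if "j \<le> m" for j m
  proof (rule box_integrals_eq_imp_AE_eq[OF B(2) _ VL])
    show q1: "q > 1" using q by simp
    show "V m \<in> L_space q (B j)" by (rule L_space_subset[OF VL Bmono[OF that] B(3) B(3)])
    fix S :: "(real ^ 'n) set" assume "S \<in> rational_boxes"
    note l = box_functional[OF B(2) q1 this, of j]
    have "weakly_converges (L_space q (B j)) (L_norm q (B j)) f (V m)"
      by (rule weakly_converges_L_mono[OF V(2) Bmono[OF that] B(1) B(1)]) (use q in simp)
    from LIMSEQ_unique[OF weakly_converges_functional[OF V(2)[of j] l] weakly_converges_functional[OF this l]]
    show "(LINT y|lebesgue_on (B j). indicator S y * V j y) = (LINT y|lebesgue_on (B j). indicator S y * V m y)" .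
  qed
  (* the smallest of the balls B m that contains y has the index floor (norm y) *)
  define v where "v y = V (nat \<lfloor>norm y\<rfloor>) y" for y
  have ae: "AE y in lebesgue_on (B m). V m y = v y" for m
  proof -
    have "\<forall>j\<in>{..m}. AE y in lebesgue. y \<in> B j \<longrightarrow> V j y = V m y"
      using eq B(3) by (auto simp: AE_restrict_space_iff)
    then have "AE y in lebesgue. \<forall>j\<in>{..m}. y \<in> B j \<longrightarrow> V j y = V m y"
      by (intro AE_ball_countable[THEN iffD2]) auto
    then have "AE y in lebesgue. y \<in> B m \<longrightarrow> V m y = v y"
    proof eventually_elim
      case (elim y)
      show ?case
      proof
        assume "y \<in> B m"
        then have "norm y < real (Suc m)" by (simp add: B_def)
        then have "nat \<lfloor>norm y\<rfloor> \<le> m" by (simp add: nat_le_iff floor_le_iff)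
        moreover have "y \<in> B (nat \<lfloor>norm y\<rfloor>)" by (simp add: B_def) linarith
        ultimately show "V m y = v y" using elim by (simp add: v_def)
      qed
    qed
    then show ?thesis using B(3) by (simp add: AE_restrict_space_iff)
  qed
  have H: "weakly_converges (H1 (B m)) (H1_norm (B m)) f v" for m
    by (rule weakly_converges_H1_cong[OF V(1) B(1) ae])
  have L: "weakly_converges (L_space q (B m)) (L_norm q (B m)) f v" for m
    by (rule weakly_converges_L_cong[OF V(2) q B(1) ae])
  have "weakly_converges (H1 (ball 0 R)) (H1_norm (ball 0 R)) f v \<and>
      weakly_converges (L_space q (ball 0 R)) (L_norm q (ball 0 R)) f v" for R
  proof -
    obtain m :: nat where "R \<le> real m" using real_arch_simple by blast
    then have sub: "ball 0 R \<subseteq> B m" unfolding B_def by (intro subset_ball) simp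
    show ?thesis
      using weakly_converges_H1_mono[OF H sub open_ball B(1)] weakly_converges_L_mono[OF L sub open_ball B(1)] q by simp
  qed
  then show ?thesis by blast
qed

lemma balls_imp_local:
  fixes v :: "real ^ 'n \<Rightarrow> real"
  assumes "\<And>R. R > 0 \<Longrightarrow> v \<in> H1 (ball 0 R)" "\<And>R. R > 0 \<Longrightarrow> v \<in> L_space q (ball 0 R)"
  shows "v \<in> H1_loc UNIV \<inter> L_loc q UNIV"
proof
  have ball: "\<exists>R>0. K \<subseteq> ball 0 R" if K: "compact K" for K :: "(real ^ 'n) set"
  proof -
    obtain b where "b > 0" "\<And>y. y \<in> K \<Longrightarrow> norm y \<le> b" using compact_imp_bounded[OF K] unfolding bounded_pos by blast
    then show ?thesis by (intro exI[of _ "b + 1"]) force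
  qed
  show "v \<in> H1_loc UNIV"
    unfolding H1_loc_def
  proof (intro CollectI allI impI)
    fix V :: "(real ^ 'n) set" assume V: "open V \<and> compact (closure V) \<and> closure V \<subseteq> UNIV"
    then obtain R where R: "R > 0" "closure V \<subseteq> ball 0 R" using ball by blast
    then have "V \<subseteq> ball 0 R" using closure_subset by blast
    then show "v \<in> H1 V" using H1_subset(1)[of V "ball 0 R"] assms(1)[OF R(1)] V by blast
  qed
  show "v \<in> L_loc q UNIV"
    unfolding L_loc_def
  proof (intro CollectI allI impI)
    fix K :: "(real ^ 'n) set" assume K: "compact K \<and> K \<subseteq> UNIV"
    then obtain R where R: "R > 0" "K \<subseteq> ball 0 R" using ball by blast
    show "v \<in> L_space q K"
      using L_space_subset[OF assms(2)[OF R(1)] R(2)] K borel_compact[of K] by simp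
  qed
qed

lemma LINT_le_ball_measure:
  fixes f :: "real ^ 'n \<Rightarrow> real"
  assumes sets: "sets \<nu> = sets borel" and f: "continuous_on UNIV f" "\<And>y. \<bar>f y\<bar> \<le> b" "\<And>y. y \<notin> ball 0 R \<Longrightarrow> f y = 0"
    and \<nu>: "emeasure \<nu> (ball 0 R) \<le> ennreal e" and e: "e \<ge> 0" "b \<ge> 0"
  shows "\<bar>LINT y|\<nu>. f y\<bar> \<le> b * e"
proof -
  have fm: "f \<in> borel_measurable \<nu>" using borel_measurable_continuous_onI[OF f(1)] sets measurable_cong_sets by blast
  have "ennreal (norm (LINT y|\<nu>. f y)) \<le> (\<integral>\<^sup>+y. ennreal (norm (f y)) \<partial>\<nu>)"
  proof (cases "integrable \<nu> f")
    case True then show ?thesis by (rule integral_norm_bound_ennreal)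
  next
    case False then show ?thesis by (simp add: not_integrable_integral_eq)
  qed
  also have "\<dots> \<le> (\<integral>\<^sup>+y. ennreal b * indicator (ball 0 R) y \<partial>\<nu>)"
    using f(2,3) by (intro nn_integral_mono) (auto simp: indicator_def intro!: ennreal_leI simp del: mem_ball)
  also have "\<dots> = ennreal b * emeasure \<nu> (ball 0 R)" by (rule nn_integral_cmult_indicator) (simp add: sets)
  also have "\<dots> \<le> ennreal b * ennreal e" by (intro mult_left_mono \<nu>) simp
  also have "\<dots> = ennreal (b * e)" using e by (simp add: ennreal_mult)
  finally show ?thesis using e by simp
qed

lemma compactly_supported_bounds:
  fixes f :: "real ^ 'n \<Rightarrow> real"
  assumes f: "continuous_on UNIV f" "compact (closure {y. f y \<noteq> 0})"
  obtains b R where "b \<ge> 0" "R > 0" "\<And>y. \<bar>f y\<bar> \<le> b" "\<And>y. y \<notin> ball 0 R \<Longrightarrow> f y = 0"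
proof -
  define K where "K = closure {y. f y \<noteq> 0}"
  have K: "compact K" "\<And>y. y \<notin> K \<Longrightarrow> f y = 0" using f closure_subset[of "{y. f y \<noteq> 0}"] by (auto simp: K_def)
  obtain r where r: "r > 0" "\<forall>y\<in>K. norm y \<le> r" using compact_imp_bounded[OF K(1)] unfolding bounded_pos by blast
  have fK: "compact (f ` K)" using K(1) f(1) by (meson compact_continuous_image continuous_on_subset subset_UNIV)
  obtain b where b: "b > 0" "\<forall>z\<in>f ` K. norm z \<le> b" using compact_imp_bounded[OF fK] unfolding bounded_pos by blast
  show ?thesis
  proof (rule that[of b "r + 1"])
    show "\<bar>f y\<bar> \<le> b" for y using b K(2)[of y] by (cases "y \<in> K") auto
    show "f y = 0" if "y \<notin> ball 0 (r + 1)" for y using that r K(2)[of y] by (cases "y \<in> K") auto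
  qed (use b r in auto)
qed

section \<open>Tangent functions and tangent measures\<close>

lemma scale_sequence: "(\<lambda>i. 1 / real (Suc i)) \<longlonglongrightarrow> 0" "1 / real (Suc i) > 0"
  using lim_inverse_n'[THEN LIMSEQ_Suc] by auto

lemma sets_blow_up_measure: "sets (blow_up_measure p x r \<mu>) = sets borel"
  by (simp add: blow_up_measure_def)

context stationary_at begin

abbreviation "\<nu> r \<equiv> blow_up_measure p x r (energy_measure p \<Omega> u)"
abbreviation "scaled_energy r R \<equiv> r powr (alpha p - real CARD('n)) * energy (r * R)"

lemma energy_nonneg: "0 \<le> energy r"
  unfolding energy_def by (intro Bochner_Integration.integral_nonneg) simp

lemma scaled_energy_nonneg: "0 \<le> scaled_energy r R"
  using energy_nonneg by simp

lemma scaled_energy_bound: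
  assumes n: "alpha p < real CARD('n)"
  obtains C where "C \<ge> 0" "\<And>r R. r > 0 \<Longrightarrow> R > 0 \<Longrightarrow> scaled_energy r R \<le> C * R powr (real CARD('n) - alpha p)"
proof -
  obtain C where C: "C \<ge> 0" "\<And>r. r > 0 \<Longrightarrow> energy r \<le> C * r powr (real CARD('n) - alpha p)"
    using energy_bound[OF n] by blast
  have "scaled_energy r R \<le> C * R powr (real CARD('n) - alpha p)" if r: "r > 0" "R > 0" for r R
  proof -
    have "scaled_energy r R \<le> r powr (alpha p - real CARD('n)) * (C * (r * R) powr (real CARD('n) - alpha p))"
      using C(2)[of "r * R"] r by (intro mult_left_mono) auto
    also have "\<dots> = (r powr (alpha p - real CARD('n)) * r powr (real CARD('n) - alpha p)) * (C * R powr (real CARD('n) - alpha p))"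
      using r by (simp add: powr_mult mult_ac)
    also have "r powr (alpha p - real CARD('n)) * r powr (real CARD('n) - alpha p) = 1" using r by (simp flip: powr_add)
    finally show ?thesis by simp
  qed
  with C(1) that show ?thesis by blast
qed

theorem tangent_measures_nonempty:
  assumes n: "alpha p < real CARD('n)"
  shows "tangent_measures p \<Omega> u x \<noteq> {}"
proof -
  obtain C where C: "C \<ge> 0" "\<And>r R. r > 0 \<Longrightarrow> R > 0 \<Longrightarrow> scaled_energy r R \<le> C * R powr (real CARD('n) - alpha p)"
    using scaled_energy_bound[OF n] by blast
  have al: "alpha p > 0" using p by (simp add: alpha_def)
  have "emeasure (\<nu> (1 / real (Suc i))) (ball 0 (real (Suc k))) \<le> ennreal ((p - 1) / 2 * C * real (Suc k) ^ CARD('n))" for i k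
  proof -
    have "(1 / real (Suc i)) powr (alpha p - real CARD('n)) * ((p - 1) / 2 * energy (1 / real (Suc i) * real (Suc k)))
      = (p - 1) / 2 * scaled_energy (1 / real (Suc i)) (real (Suc k))" by simp
    also have "\<dots> \<le> (p - 1) / 2 * (C * real (Suc k) powr (real CARD('n) - alpha p))"
      using p by (intro mult_left_mono C) auto
    also have "\<dots> \<le> (p - 1) / 2 * (C * real (Suc k) powr (real CARD('n)))"
      using p C(1) al by (intro mult_left_mono powr_mono) auto
    also have "real (Suc k) powr (real CARD('n)) = real (Suc k) ^ CARD('n)" by (rule powr_realpow) simp
    finally have "ennreal ((1 / real (Suc i)) powr (alpha p - real CARD('n)) * ((p - 1) / 2 * energy (1 / real (Suc i) * real (Suc k))))
      \<le> ennreal ((p - 1) / 2 * C * real (Suc k) ^ CARD('n))" by (intro ennreal_leI) (simp only: mult.assoc)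
    with blow_up_measure_ball[OF scale_sequence(2)] show ?thesis by (rule order_trans)
  qed
  from weak_star_compactness[of "\<lambda>i. \<nu> (1 / real (Suc i))", OF sets_blow_up_measure this]
  obtain r \<mu> where r: "strict_mono (r :: nat \<Rightarrow> nat)" "\<mu> \<in> radon_measures" "weak_star_converges (\<lambda>i. \<nu> (1 / real (Suc (r i)))) \<mu>" by blast
  have "(\<lambda>i. 1 / real (Suc (r i))) \<longlonglongrightarrow> 0" using LIMSEQ_subseq_LIMSEQ[OF scale_sequence(1) r(1)] by (simp add: o_def)
  then have "\<mu> \<in> tangent_measures p \<Omega> u x"
    unfolding tangent_measures_def using r(2,3) by (intro CollectI conjI exI[of _ "\<lambda>i. 1 / real (Suc (r i))"]) auto
  then show ?thesis by blast
qed

lemma ball_in_domain: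
  assumes "r \<longlonglongrightarrow> 0"
  shows "\<forall>\<^sub>F i in sequentially. ball x (r i * R) \<subseteq> \<Omega>"
proof -
  obtain d where d: "d > 0" "ball x d \<subseteq> \<Omega>" using x open_\<Omega> openE by blast
  have "(\<lambda>i. r i * R) \<longlonglongrightarrow> 0 * R" using assms by (intro tendsto_intros)
  then have "\<forall>\<^sub>F i in sequentially. r i * R < d" using d(1) by (intro order_tendstoD) auto
  then show ?thesis by eventually_elim (use d(2) in \<open>auto intro: order_trans[OF subset_ball]\<close>)
qed

text \<open>
  One diagonal extraction makes the integrals over all rational boxes converge on all balls of
  integer radius. On each ball the blow-ups then have a weak limit in \<open>L\<^bsup>p+1\<^esup>\<close> and one in \<open>H\<^sup>1\<close>;
  both have the same box integrals and so coincide almost everywhere.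
\<close>

theorem tangent_functions_nonempty:
  assumes n: "alpha p < real CARD('n)"
  shows "tangent_functions p u x \<noteq> {}"
proof -
  obtain C where C: "C \<ge> 0" "\<And>r R. r > 0 \<Longrightarrow> R > 0 \<Longrightarrow> scaled_energy r R \<le> C * R powr (real CARD('n) - alpha p)"
    using scaled_energy_bound[OF n] by blast
  have q: "p + 1 \<ge> 2" "p + 1 > 1" using p by auto
  define B where "B m = ball (0 :: real ^ 'n) (real (Suc m))" for m :: nat
  have B: "open (B m)" "B m \<in> lmeasurable" "B m \<in> sets lebesgue" for m by (auto simp: B_def)
  define K where "K m = C * real (Suc m) powr (real CARD('n) - alpha p)" for m
  have K0: "0 \<le> K m" for m using C(1) by (simp add: K_def)
  have bounds: "bl r \<in> L_space (p + 1) (B m)" "bl r \<in> H1 (B m)"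
    "(LINT y|lebesgue_on (B m). norm (bl r y) powr (p + 1)) \<le> K m" "H1_energy (B m) (bl r) \<le> measure lebesgue (B m) + K m + K m"
    if r: "r > 0" and sub: "ball x (r * real (Suc m)) \<subseteq> \<Omega>" for r m
    using blow_up_gradient[OF r sub] blow_up_norms[OF r _ sub] C(2)[OF r, of "real (Suc m)"]
    unfolding B_def K_def by auto
  define r where "r i = 1 / real (Suc i)" for i
  have r: "r \<longlonglongrightarrow> 0" "\<And>i. r i > 0" unfolding r_def by (rule scale_sequence)+
  (* k encodes a box and a ball *)
  define a where "a k i = (case prod_decode k of (j, m) \<Rightarrow> LINT y|lebesgue_on (B m). indicator (nth_box j) y * bl (r i) y)" for k i
  have "\<exists>N. bounded (a k ` {N..})" for k
  proof -
    obtain j m where k: "prod_decode k = (j, m)" by (cases "prod_decode k")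
    obtain c where c: "\<And>f. f \<in> L_space (p + 1) (B m) \<Longrightarrow> \<bar>LINT y|lebesgue_on (B m). indicator (nth_box j) y * f y\<bar> \<le> c * L_norm (p + 1) (B m) f"
      using box_functional[OF B(2) q(2) nth_box, of m j] unfolding bounded_functional_def by blast
    obtain N where N: "\<And>i. i \<ge> N \<Longrightarrow> ball x (r i * real (Suc m)) \<subseteq> \<Omega>"
      using ball_in_domain[OF r(1), of "real (Suc m)"] unfolding eventually_sequentially by blast
    have "\<bar>a k i\<bar> \<le> \<bar>c\<bar> * K m powr (1 / (p + 1))" if "i \<ge> N" for i
    proof -
      note b = bounds[OF r(2) N[OF that]]
      have "L_norm (p + 1) (B m) (bl (r i)) \<le> K m powr (1 / (p + 1))"
        unfolding L_norm_def using b(3) q by (intro powr_mono2) (auto intro!: Bochner_Integration.integral_nonneg)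
      then have "\<bar>c\<bar> * L_norm (p + 1) (B m) (bl (r i)) \<le> \<bar>c\<bar> * K m powr (1 / (p + 1))" by (intro mult_left_mono) auto
      moreover have "c * L_norm (p + 1) (B m) (bl (r i)) \<le> \<bar>c\<bar> * L_norm (p + 1) (B m) (bl (r i))"
        by (intro mult_right_mono) (auto simp: L_norm_def)
      ultimately show ?thesis using c[OF b(1)] by (simp add: a_def k)
    qed
    then show ?thesis unfolding bounded_iff by (intro exI[of _ N] exI[of _ "\<bar>c\<bar> * K m powr (1 / (p + 1))"]) auto
  qed
  from diagonal_convergent_subsequence[of a, OF this]
  obtain s where s: "strict_mono s" "\<And>k. convergent (\<lambda>i. a k (s i))" by blast
  define f where "f i = bl (r (s i))" for i
  have rs: "(\<lambda>i. r (s i)) \<longlonglongrightarrow> 0" using LIMSEQ_subseq_LIMSEQ[OF r(1) s(1)] by (simp add: o_def)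
  have conv: "convergent (\<lambda>i. LINT y|lebesgue_on (B m). indicator (nth_box j) y * f i y)" for j m
    using s(2)[of "prod_encode (j, m)"] by (simp add: a_def f_def)
  have "\<exists>v. weakly_converges (H1 (B m)) (H1_norm (B m)) f v \<and> weakly_converges (L_space (p + 1) (B m)) (L_norm (p + 1) (B m)) f v" for m
  proof -
    obtain N where N: "\<And>i. i \<ge> N \<Longrightarrow> ball x (r (s i) * real (Suc m)) \<subseteq> \<Omega>"
      using ball_in_domain[OF rs, of "real (Suc m)"] unfolding eventually_sequentially by blast
    (* the blow-ups are defined on the ball B m from index N on *)
    define g where "g i = f (i + N)" for i
    have sub: "ball x (r (s (i + N)) * real (Suc m)) \<subseteq> \<Omega>" for i by (rule N) simp
    note b = bounds[OF r(2) sub]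
    have gL: "g i \<in> L_space (p + 1) (B m)" and gH: "g i \<in> H1 (B m)" for i using b(1,2)[of i] by (auto simp: g_def f_def)
    have convg: "convergent (\<lambda>i. LINT y|lebesgue_on (B m). indicator (nth_box j) y * g i y)" for j
      using conv[of m j] unfolding g_def by (simp add: convergent_ignore_initial_segment[of "\<lambda>i. LINT y|lebesgue_on (B m). indicator (nth_box j) y * f i y"])
    have unshift: "(\<lambda>i. l (f i)) \<longlonglongrightarrow> c" if "(\<lambda>i. l (g i)) \<longlonglongrightarrow> c" for l :: "(real ^ 'n \<Rightarrow> real) \<Rightarrow> real" and c
      using that unfolding g_def by (rule LIMSEQ_offset)
    have ev: "\<forall>\<^sub>F i in sequentially. f i \<in> L_space (p + 1) (B m) \<and> f i \<in> H1 (B m)"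
      unfolding eventually_sequentially
    proof (intro exI[of _ N] allI impI)
      fix i assume "N \<le> i"
      then show "f i \<in> L_space (p + 1) (B m) \<and> f i \<in> H1 (B m)" using gL[of "i - N"] gH[of "i - N"] by (simp add: g_def)
    qed
    obtain v where v: "v \<in> L_space (p + 1) (B m)"
      "\<And>l. bounded_functional (L_space (p + 1) (B m)) (L_norm (p + 1) (B m)) l \<Longrightarrow> (\<lambda>n. l (g n)) \<longlonglongrightarrow> l v"
      using L_space_weak_limit[of "B m" "p + 1" g "K m", OF B(2) q(1) gL _ convg] b(3) by (auto simp: g_def f_def)
    interpret H: uniformly_convex_space "H1 (B m)" "H1_energy (B m)" 2 by (rule H1_uniformly_convex[OF B(1)])
    have N': "H1_norm (B m) = (\<lambda>u. H1_energy (B m) u powr (1 / 2))" by (rule H1_norm_eq)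
    have "\<exists>w\<in>H1 (B m). \<forall>l. H.functional l \<longrightarrow> (\<lambda>n. l (g n)) \<longlonglongrightarrow> l w"
    proof (rule H.weak_compactness[where T = "\<lambda>k f. LINT y|lebesgue_on (B m). indicator (nth_box k) y * f y", OF gH _ _ _ convg])
      show "H1_energy (B m) (g i) \<le> measure lebesgue (B m) + K m + K m" for i using b(4)[of i] by (simp add: g_def f_def)
      show "H.functional (\<lambda>f. LINT y|lebesgue_on (B m). indicator (nth_box k) y * f y)" for k
        using box_functional_H1[OF B(1)[of m] B(2)[of m] nth_box[of k]] unfolding N' .
      fix w assume w: "w \<in> H1 (B m)" "\<And>k. (LINT y|lebesgue_on (B m). indicator (nth_box k) y * w y) = 0"
      have "AE y in lebesgue_on (B m). w y = 0"
      proof (rule box_integrals_separate[OF B(2), of _ 2])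
        show "w \<in> L_space 2 (B m)" using w by (simp add: H1_def)
        fix S :: "(real ^ 'n) set" assume "S \<in> rational_boxes"
        then obtain k where "S = nth_box k" using range_nth_box by blast
        then show "(LINT y|lebesgue_on (B m). indicator S y * w y) = 0" using w(2) by simp
      qed simp
      then show "H1_energy (B m) w = 0" by (rule H1_energy_zero(2)[OF B(1)])
    qed
    then obtain w where w: "w \<in> H1 (B m)" "\<And>l. bounded_functional (H1 (B m)) (H1_norm (B m)) l \<Longrightarrow> (\<lambda>n. l (g n)) \<longlonglongrightarrow> l w"
      unfolding N' by blast
    have vw: "AE y in lebesgue_on (B m). w y = v y"
    proof (rule box_integrals_eq_imp_AE_eq[OF B(2), of 2])
      show "w \<in> L_space 2 (B m)" using w by (simp add: H1_def)
      show "v \<in> L_space 2 (B m)" using L_space_exponent_le[OF v(1) B(2), of 2] q by simp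
      fix S :: "(real ^ 'n) set" assume S: "S \<in> rational_boxes"
      show "(LINT y|lebesgue_on (B m). indicator S y * w y) = (LINT y|lebesgue_on (B m). indicator S y * v y)"
        by (rule LIMSEQ_unique[OF w(2)[OF box_functional_H1[OF B(1,2) S]] v(2)[OF box_functional[OF B(2) q(2) S]]])
    qed simp
    have "weakly_converges (L_space (p + 1) (B m)) (L_norm (p + 1) (B m)) f v"
      unfolding weakly_converges_def using ev v unshift by (auto elim: eventually_mono)
    moreover have "weakly_converges (H1 (B m)) (H1_norm (B m)) f w"
      unfolding weakly_converges_def using ev w unshift by (auto elim: eventually_mono)
    then have "weakly_converges (H1 (B m)) (H1_norm (B m)) f v"
      by (rule weakly_converges_H1_cong[OF _ B(1) vw])
    ultimately show ?thesis by blast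
  qed
  then obtain v where v: "\<And>R. R > 0 \<Longrightarrow> weakly_converges (H1 (ball 0 R)) (H1_norm (ball 0 R)) f v \<and>
      weakly_converges (L_space (p + 1) (ball 0 R)) (L_norm (p + 1) (ball 0 R)) f v"
    using glue_weak_limits[OF q(1), of f] unfolding B_def by blast
  have "v \<in> H1_loc UNIV \<inter> L_loc (p + 1) UNIV"
    by (rule balls_imp_local) (use v in \<open>auto simp: weakly_converges_def\<close>)
  then have "v \<in> tangent_functions p u x"
    unfolding tangent_functions_def using v rs r(2)
    by (intro CollectI conjI exI[of _ "\<lambda>i. r (s i)"]) (auto simp: f_def[abs_def])
  then show ?thesis by blast
qed

section \<open>Regular points\<close>

text \<open>
  Near a regular point the energy is of order \<open>r\<^bsup>n-2\<^esup>\<close>, and scaling it by \<open>r\<^bsup>\<alpha>-n\<^esup>\<close> leaves the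
  positive power \<open>\<alpha> - 2\<close> of \<open>r\<close>.
\<close>

lemma regular_scaled_energy:
  assumes reg: "x \<notin> sing \<Omega> u" and s: "\<And>i. s i > 0" "s \<longlonglongrightarrow> 0" and R: "R > 0"
  shows "(\<lambda>i. scaled_energy (s i) R) \<longlonglongrightarrow> 0"
proof -
  obtain r g where r: "r > 0" "ball x r \<subseteq> \<Omega>" "smooth_on (ball x r) g" "AE y in lebesgue_on (ball x r). u y = g y"
    using reg x unfolding sing_def by blast
  have sub: "cball x (r / 2) \<subseteq> ball x r" using r(1) by auto
  have gK: "compact (g ` cball x (r / 2))"
    using smooth_on_continuous[OF r(3)] sub by (intro compact_continuous_image) (auto intro: continuous_on_subset)
  obtain m where m: "\<forall>z\<in>g ` cball x (r / 2). norm z \<le> m" using compact_imp_bounded[OF gK] unfolding bounded_iff by blast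
  have "AE y in lebesgue. y \<in> ball x r \<longrightarrow> u y = g y" using r(4) by (simp add: AE_restrict_space_iff)
  then have "AE y in lebesgue. y \<in> ball x (r / 2) \<longrightarrow> \<bar>u y\<bar> \<le> m"
    by eventually_elim (use m r(1) in auto)
  then have ae: "AE y in lebesgue_on (ball x (r / 2)). \<bar>u y\<bar> \<le> m" by (simp add: AE_restrict_space_iff)
  have "ball x (r / 2) \<subseteq> \<Omega>" using sub r(2) ball_subset_cball by blast
  from energy_decay_bounded[OF _ this ae] obtain C r1 where C: "r1 > 0" "\<And>t. 0 < t \<Longrightarrow> t \<le> r1 \<Longrightarrow> energy t \<le> C * t powr (real CARD('n) - 2)"
    using r(1) by auto
  have al: "alpha p - 2 > 0" using p by (simp add: alpha_def field_simps)
  have "(\<lambda>i. s i * R) \<longlonglongrightarrow> 0 * R" using s by (intro tendsto_intros)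
  then have "\<forall>\<^sub>F i in sequentially. s i * R < r1" using C(1) by (intro order_tendstoD) auto
  then have "\<forall>\<^sub>F i in sequentially. scaled_energy (s i) R \<le> C * R powr (real CARD('n) - 2) * s i powr (alpha p - 2)"
  proof eventually_elim
    case (elim i)
    have "scaled_energy (s i) R \<le> s i powr (alpha p - real CARD('n)) * (C * (s i * R) powr (real CARD('n) - 2))"
      using C(2)[of "s i * R"] elim s(1)[of i] R by (intro mult_left_mono) auto
    also have "\<dots> = C * R powr (real CARD('n) - 2) * (s i powr (alpha p - real CARD('n)) * s i powr (real CARD('n) - 2))"
      using s(1)[of i] R by (simp add: powr_mult mult_ac)
    also have "s i powr (alpha p - real CARD('n)) * s i powr (real CARD('n) - 2) = s i powr (alpha p - 2)"
      by (simp flip: powr_add)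
    finally show ?case .
  qed
  moreover have "(\<lambda>i. C * R powr (real CARD('n) - 2) * s i powr (alpha p - 2)) \<longlonglongrightarrow> 0"
  proof (rule tendsto_mult_right_zero)
    show "(\<lambda>i. s i powr (alpha p - 2)) \<longlonglongrightarrow> 0"
      by (rule tendsto_zero_powrI[OF s(2) tendsto_const _ al]) (intro always_eventually allI less_imp_le s(1))
  qed
  ultimately show ?thesis
    by (intro tendsto_sandwich[OF always_eventually[OF allI[OF scaled_energy_nonneg]] _ tendsto_const])
qed

lemma regular_measure_integrals:
  assumes reg: "x \<notin> sing \<Omega> u" and s: "\<And>i. s i > 0" "s \<longlonglongrightarrow> 0"
    and f: "continuous_on UNIV f" "compact (closure {y. f y \<noteq> 0})"
  shows "(\<lambda>i. LINT y|\<nu> (s i). f y) \<longlonglongrightarrow> (0 :: real)"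
proof -
  obtain b R where b: "b \<ge> 0" "R > 0" "\<And>y. \<bar>f y\<bar> \<le> b" "\<And>y. y \<notin> ball 0 R \<Longrightarrow> f y = 0"
    using compactly_supported_bounds[OF f] by blast
  have "\<bar>LINT y|\<nu> (s i). f y\<bar> \<le> b * (s i powr (alpha p - real CARD('n)) * ((p - 1) / 2 * energy (s i * R)))" for i
    using p energy_nonneg
    by (intro LINT_le_ball_measure[OF sets_blow_up_measure f(1) b(3,4) blow_up_measure_ball[OF s(1)]] b(1)) auto
  then have le: "norm (LINT y|\<nu> (s i). f y) \<le> (b * ((p - 1) / 2)) * scaled_energy (s i) R" for i by (simp add: mult_ac)
  have "(\<lambda>i. (b * ((p - 1) / 2)) * scaled_energy (s i) R) \<longlonglongrightarrow> 0"
    by (intro tendsto_mult_right_zero regular_scaled_energy[OF reg s b(2)])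
  then show ?thesis by (rule Lim_null_comparison[rotated]) (intro always_eventually allI le)
qed

text \<open>
  Integrals of test functions over the rescaled measures tend to zero along every sequence of
  scales, so zero is a tangent measure and the only one: a measure vanishes on a ball if it
  integrates to zero a nonnegative continuous function that is positive there.
\<close>

theorem regular_tangent_measures:
  assumes reg: "x \<notin> sing \<Omega> u"
  shows "tangent_measures p \<Omega> u x = {null_measure borel}"
proof (intro set_eqI iffI)
  fix \<mu> assume "\<mu> \<in> tangent_measures p \<Omega> u x"
  then obtain s where \<mu>: "\<mu> \<in> radon_measures" and s: "\<And>i. s i > 0" "s \<longlonglongrightarrow> 0" "weak_star_converges (\<lambda>i. \<nu> (s i)) \<mu>"
    unfolding tangent_measures_def by blast
  have sets: "sets \<mu> = sets borel" and fin: "\<And>K. compact K \<Longrightarrow> emeasure \<mu> K < \<infinity>"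
    using \<mu> by (auto simp: radon_measures_def)
  have sp: "space \<mu> = UNIV" using sets_eq_imp_space_eq[OF sets] by simp
  have zero: "emeasure \<mu> (ball 0 (real k)) = 0" for k :: nat
  proof -
    define f where "f y = max 0 (min 1 (real k + 1 - norm y))" for y :: "real ^ 'n"
    have fc: "continuous_on UNIV f" unfolding f_def[abs_def] by (intro continuous_intros)
    have fs: "{y. f y \<noteq> 0} \<subseteq> cball 0 (real k + 1)" by (auto simp: f_def)
    have "closure {y. f y \<noteq> 0} \<subseteq> cball 0 (real k + 1)" by (rule closure_minimal[OF fs]) simp
    then have fk: "compact (closure {y. f y \<noteq> 0})"
      by (metis closed_closure compact_Int_closed compact_cball inf.absorb_iff2)
    have "(\<lambda>i. LINT y|\<nu> (s i). f y) \<longlonglongrightarrow> (LINT y|\<mu>. f y)"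
      using s(3) fc fk unfolding weak_star_converges_def by blast
    then have I0: "(LINT y|\<mu>. f y) = 0"
      using LIMSEQ_unique regular_measure_integrals[OF reg s(1,2) fc fk] by blast
    have fm: "f \<in> borel_measurable \<mu>" using borel_measurable_continuous_onI[OF fc] sets measurable_cong_sets by blast
    have fi: "integrable \<mu> f"
    proof (rule integrableI_bounded[OF fm])
      have "(\<integral>\<^sup>+y. ennreal (norm (f y)) \<partial>\<mu>) \<le> (\<integral>\<^sup>+y. indicator (cball 0 (real k + 1)) y \<partial>\<mu>)"
        using fs by (intro nn_integral_mono) (auto simp: indicator_def f_def)
      also have "\<dots> = emeasure \<mu> (cball 0 (real k + 1))" by (rule nn_integral_indicator) (simp add: sets)
      also have "\<dots> < \<infinity>" by (rule fin) simp
      finally show "(\<integral>\<^sup>+y. ennreal (norm (f y)) \<partial>\<mu>) < \<infinity>" .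
    qed
    have "AE y in \<mu>. f y = 0"
      using integral_nonneg_eq_0_iff_AE[OF fi] I0 by (auto simp: f_def)
    then have "AE y in \<mu>. y \<notin> ball 0 (real k)" by eventually_elim (auto simp: f_def max_def min_def split: if_splits)
    then show ?thesis by (subst (asm) AE_iff_measurable[of "ball 0 (real k)"]) (auto simp: sets sp)
  qed
  have "emeasure \<mu> (\<Union>k::nat. ball 0 (real k)) = 0"
    by (rule emeasure_UN_eq_0) (use zero sets in auto)
  moreover have "(\<Union>k::nat. ball 0 (real k)) = (UNIV :: (real ^ 'n) set)"
    using reals_Archimedean2 by auto
  ultimately have U0: "emeasure \<mu> UNIV = 0" by simp
  have "\<mu> = null_measure borel"
  proof (rule measure_eqI)
    fix A assume "A \<in> sets \<mu>"
    then have "emeasure \<mu> A \<le> emeasure \<mu> UNIV" using sp by (metis emeasure_space)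
    then show "emeasure \<mu> A = emeasure (null_measure borel) A" using U0 by simp
  qed (simp add: sets)
  then show "\<mu> \<in> {null_measure borel}" by simp
next
  fix \<mu> :: "(real ^ 'n) measure" assume "\<mu> \<in> {null_measure borel}"
  then have \<mu>: "\<mu> = null_measure borel" by simp
  have "weak_star_converges (\<lambda>i. \<nu> (1 / real (Suc i))) \<mu>"
    unfolding weak_star_converges_def \<mu>
    using regular_measure_integrals[OF reg scale_sequence(2) scale_sequence(1)] by (simp add: integral_null_measure)
  moreover have "\<mu> \<in> radon_measures" by (simp add: \<mu> radon_measures_def)
  ultimately show "\<mu> \<in> tangent_measures p \<Omega> u x"
    unfolding tangent_measures_def using scale_sequence by (intro CollectI conjI exI[of _ "\<lambda>i. 1 / real (Suc i)"]) auto
qed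

text \<open>
  The scaled energy controls the gradients in \<open>L\<^sup>2\<close> and the functions in \<open>L\<^bsup>p+1\<^esup>\<close>; on a ball the
  \<open>L\<^sup>2\<close> norm of the functions follows from Hoelder's inequality with exponent \<open>(p + 1) / 2\<close>.
\<close>

lemma regular_blow_up_norms:
  assumes reg: "x \<notin> sing \<Omega> u" and s: "\<And>i. s i > 0" "s \<longlonglongrightarrow> 0" and R: "R > 0"
  shows "(\<lambda>i. L_norm (p + 1) (ball 0 R) (bl (s i))) \<longlonglongrightarrow> 0" "(\<lambda>i. H1_norm (ball 0 R) (bl (s i))) \<longlonglongrightarrow> 0"
proof -
  let ?M = "lebesgue_on (ball (0 :: real ^ 'n) R)"
  have lm: "ball (0 :: real ^ 'n) R \<in> lmeasurable" by auto
  have se: "(\<lambda>i. scaled_energy (s i) R) \<longlonglongrightarrow> 0" by (rule regular_scaled_energy[OF reg s R])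
  have sub: "\<forall>\<^sub>F i in sequentially. ball x (s i * R) \<subseteq> \<Omega>" by (rule ball_in_domain[OF s(2)])
  have leLp: "\<forall>\<^sub>F i in sequentially. (LINT y|?M. norm (bl (s i) y) powr (p + 1)) \<le> scaled_energy (s i) R"
    using sub by eventually_elim (rule blow_up_gradient(4)[OF s(1)])
  have Lp: "(\<lambda>i. LINT y|?M. norm (bl (s i) y) powr (p + 1)) \<longlonglongrightarrow> 0"
    by (rule tendsto_sandwich[OF _ leLp tendsto_const se]) (intro always_eventually allI Bochner_Integration.integral_nonneg powr_ge_zero)
  have root: "(\<lambda>i. h i powr c) \<longlonglongrightarrow> 0" if "h \<longlonglongrightarrow> 0" "\<And>i. 0 \<le> h i" "c > 0" for h :: "nat \<Rightarrow> real" and c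
    by (rule tendsto_zero_powrI[OF that(1) tendsto_const _ that(3)]) (intro always_eventually allI that(2))
  show "(\<lambda>i. L_norm (p + 1) (ball 0 R) (bl (s i))) \<longlonglongrightarrow> 0"
    unfolding L_norm_def using p by (intro root Lp) (auto intro!: Bochner_Integration.integral_nonneg)
  define q where "q = (p + 1) / 2"
  have q: "q > 1" using p by (simp add: q_def)
  define c where "c = 1 + (LINT y|?M. norm (indicat_real UNIV (y :: real ^ 'n)) powr (q / (q - 1)))"
  have le: "\<forall>\<^sub>F i in sequentially. (LINT y|?M. norm (bl (s i) y) powr 2) \<le> c * (LINT y|?M. norm (bl (s i) y) powr (p + 1)) powr (1 / q)"
    using sub
  proof eventually_elim
    case (elim i)
    note b = blow_up_gradient[OF s(1) elim]
    have e: "norm ((bl (s i) y)\<^sup>2) powr q = norm (bl (s i) y) powr (p + 1)" for y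
    proof -
      have "norm ((bl (s i) y)\<^sup>2) = norm (bl (s i) y) powr 2" by simp
      then have "norm ((bl (s i) y)\<^sup>2) powr q = (norm (bl (s i) y) powr 2) powr q" by (rule arg_cong)
      also have "\<dots> = norm (bl (s i) y) powr (2 * q)" by (rule powr_powr)
      also have "2 * q = p + 1" by (simp add: q_def)
      finally show ?thesis .
    qed
    have "(\<lambda>y. (bl (s i) y)\<^sup>2) \<in> L_space q (ball 0 R)"
      using b(2) unfolding L_space_def mem_Collect_eq e by (auto intro: borel_measurable_power)
    from L_space_pairing(2)[OF q this indicator_L_space[OF lm, of UNIV]]
    have "\<bar>LINT y|?M. (bl (s i) y)\<^sup>2\<bar> \<le> c * (LINT y|?M. norm (bl (s i) y) powr (p + 1)) powr (1 / q)"
      unfolding L_norm_def e c_def by simp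
    then show ?case by simp
  qed
  have lim: "(\<lambda>i. c * (LINT y|?M. norm (bl (s i) y) powr (p + 1)) powr (1 / q)) \<longlonglongrightarrow> 0"
    using q by (intro tendsto_mult_right_zero root Lp) (auto intro!: Bochner_Integration.integral_nonneg)
  have L2: "(\<lambda>i. LINT y|?M. norm (bl (s i) y) powr 2) \<longlonglongrightarrow> 0"
    by (rule tendsto_sandwich[OF _ le tendsto_const lim]) (intro always_eventually allI Bochner_Integration.integral_nonneg powr_ge_zero)
  interpret H: uniformly_convex_space "H1 (ball (0 :: real ^ 'n) R)" "H1_energy (ball 0 R)" 2 by (rule H1_uniformly_convex) simp
  have le': "\<forall>\<^sub>F i in sequentially. H1_energy (ball 0 R) (bl (s i)) \<le> (LINT y|?M. norm (bl (s i) y) powr 2) + scaled_energy (s i) R"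
    using sub by eventually_elim (rule blow_up_norms(1)[OF s(1) R])
  have lim': "(\<lambda>i. (LINT y|?M. norm (bl (s i) y) powr 2) + scaled_energy (s i) R) \<longlonglongrightarrow> 0" using tendsto_add[OF L2 se] by simp
  have "(\<lambda>i. H1_energy (ball 0 R) (bl (s i))) \<longlonglongrightarrow> 0"
    by (rule tendsto_sandwich[OF _ le' tendsto_const lim']) (intro always_eventually allI H.nonneg)
  then show "(\<lambda>i. H1_norm (ball 0 R) (bl (s i))) \<longlonglongrightarrow> 0"
    unfolding H1_norm_eq by (intro root) (auto simp: H.nonneg)
qed

lemma strong_imp_weak_convergence:
  assumes "\<forall>\<^sub>F i in sequentially. f i \<in> X" "(\<lambda>i. N (f i)) \<longlonglongrightarrow> 0" "v \<in> X" "N v = 0"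
  shows "weakly_converges X N f v"
  unfolding weakly_converges_def
proof (intro conjI allI impI)
  fix l assume "bounded_functional X N l"
  then obtain C where C: "\<And>g. g \<in> X \<Longrightarrow> \<bar>l g\<bar> \<le> C * N g" unfolding bounded_functional_def by blast
  have "\<forall>\<^sub>F i in sequentially. norm (l (f i)) \<le> C * N (f i)" using assms(1) by eventually_elim (simp add: C)
  moreover have "(\<lambda>i. C * N (f i)) \<longlonglongrightarrow> 0" by (rule tendsto_mult_right_zero[OF assms(2)])
  ultimately have "(\<lambda>i. l (f i)) \<longlonglongrightarrow> 0" by (rule Lim_null_comparison)
  moreover have "l v = 0" using C[OF assms(3)] assms(4) by simp
  ultimately show "(\<lambda>i. l (f i)) \<longlonglongrightarrow> l v" by simp
qed (rule assms)+

text \<open>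
  The blow-ups tend to zero strongly along every sequence of scales. A weak limit has vanishing
  box integrals, so it is zero almost everywhere. Conversely a function that is zero almost
  everywhere has norm zero and is a weak limit, functionals being blind to it.
\<close>

theorem regular_tangent_functions:
  assumes reg: "x \<notin> sing \<Omega> u"
  shows "tangent_functions p u x = {v. AE y in lebesgue. v y = 0}"
proof (intro set_eqI iffI)
  have q: "p + 1 > 1" "p + 1 > 0" using p by auto
  fix v assume "v \<in> tangent_functions p u x"
  then obtain r where r: "\<And>i. r i > 0" "r \<longlonglongrightarrow> 0"
    "\<And>R. R > 0 \<Longrightarrow> weakly_converges (L_space (p + 1) (ball 0 R)) (L_norm (p + 1) (ball 0 R)) (\<lambda>i. bl (r i)) v"
    unfolding tangent_functions_def by blast
  have "AE y in lebesgue. y \<in> ball 0 (real (Suc k)) \<longrightarrow> v y = 0" for k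
  proof -
    let ?B = "ball (0 :: real ^ 'n) (real (Suc k))"
    have lm: "?B \<in> lmeasurable" by auto
    have R: "real (Suc k) > 0" by simp
    note wc = r(3)[OF R]
    have "AE y in lebesgue_on ?B. v y = 0"
    proof (rule box_integrals_separate[OF lm])
      show "v \<in> L_space (p + 1) ?B" using wc by (simp add: weakly_converges_def)
      fix S :: "(real ^ 'n) set" assume "S \<in> rational_boxes"
      note l = box_functional[OF lm q(1) this]
      obtain C where C: "\<And>g. g \<in> L_space (p + 1) ?B \<Longrightarrow> \<bar>LINT y|lebesgue_on ?B. indicator S y * g y\<bar> \<le> C * L_norm (p + 1) ?B g"
        using l unfolding bounded_functional_def by blast
      have "\<forall>\<^sub>F i in sequentially. norm (LINT y|lebesgue_on ?B. indicator S y * bl (r i) y) \<le> C * L_norm (p + 1) ?B (bl (r i))"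
      proof -
        have "\<forall>\<^sub>F i in sequentially. bl (r i) \<in> L_space (p + 1) ?B" using wc by (simp add: weakly_converges_def)
        then show ?thesis by eventually_elim (unfold real_norm_def, rule C)
      qed
      moreover have "(\<lambda>i. C * L_norm (p + 1) ?B (bl (r i))) \<longlonglongrightarrow> 0"
        by (intro tendsto_mult_right_zero regular_blow_up_norms(1)[OF reg r(1,2) R])
      ultimately have "(\<lambda>i. LINT y|lebesgue_on ?B. indicator S y * bl (r i) y) \<longlonglongrightarrow> 0" by (rule Lim_null_comparison)
      from LIMSEQ_unique[OF weakly_converges_functional[OF wc l] this]
      show "(LINT y|lebesgue_on ?B. indicator S y * v y) = 0" .
    qed (use q in simp)
    then show ?thesis by (simp add: AE_restrict_space_iff del: of_nat_Suc)
  qed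
  then have "AE y in lebesgue. \<forall>k. y \<in> ball 0 (real (Suc k)) \<longrightarrow> v y = 0" by (subst AE_all_countable) auto
  then have "AE y in lebesgue. v y = 0"
  proof eventually_elim
    case (elim y)
    obtain k :: nat where "norm y < real k" using reals_Archimedean2 by blast
    then have "y \<in> ball 0 (real (Suc k))" by simp
    then show ?case using elim by blast
  qed
  then show "v \<in> {v. AE y in lebesgue. v y = 0}" by simp
next
  have q: "p + 1 > 1" "p + 1 > 0" using p by auto
  fix v :: "real ^ 'n \<Rightarrow> real" assume "v \<in> {v. AE y in lebesgue. v y = 0}"
  then have v: "AE y in lebesgue. v y = 0" by simp
  have vR: "AE y in lebesgue_on (ball 0 R). v y = 0" for R
    using v by (auto simp: AE_restrict_space_iff elim: eventually_mono)
  have vH: "v \<in> H1 (ball 0 R)" "H1_norm (ball 0 R) v = 0" for R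
    using H1_energy_zero[OF open_ball vR] by (auto simp: H1_norm_eq)
  have z: "(\<lambda>y :: real ^ 'n. 0 :: real) \<in> L_space (p + 1) (ball 0 R)" for R
    by (simp add: L_space_def)
  have vL: "v \<in> L_space (p + 1) (ball 0 R)" for R
  proof (rule L_space_cong_AE[OF z])
    show "AE y in lebesgue_on (ball 0 R). 0 = v y" using vR[of R] by (auto elim: eventually_mono)
  qed simp
  have vN: "L_norm (p + 1) (ball 0 R) v = 0" for R
    unfolding L_norm_def by (simp only: AE_zero_imp_integral_powr_zero[OF vR]) simp
  define r where "r i = 1 / real (Suc i)" for i
  have r: "r \<longlonglongrightarrow> 0" "\<And>i. r i > 0" unfolding r_def by (rule scale_sequence)+
  have "weakly_converges (H1 (ball 0 R)) (H1_norm (ball 0 R)) (\<lambda>i. bl (r i)) v \<and>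
    weakly_converges (L_space (p + 1) (ball 0 R)) (L_norm (p + 1) (ball 0 R)) (\<lambda>i. bl (r i)) v" if R: "R > 0" for R
  proof -
    have ev: "\<forall>\<^sub>F i in sequentially. bl (r i) \<in> H1 (ball 0 R)" "\<forall>\<^sub>F i in sequentially. bl (r i) \<in> L_space (p + 1) (ball 0 R)"
      using ball_in_domain[OF r(1), of R] by (eventually_elim, use blow_up_gradient r(2) in blast)+
    show ?thesis
      by (intro conjI strong_imp_weak_convergence ev vH vL vN regular_blow_up_norms[OF reg r(2,1) R])
  qed
  moreover have "v \<in> H1_loc UNIV \<inter> L_loc (p + 1) UNIV"
    by (rule balls_imp_local[OF vH(1) vL])
  ultimately show "v \<in> tangent_functions p u x"
    unfolding tangent_functions_def using r by (intro CollectI conjI exI[of _ r]) auto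
qed

end

theorem proposition1p6:
  fixes \<Omega> :: "(real ^ 'n) set" and u :: "real ^ 'n \<Rightarrow> real" and p :: real and x :: "real ^ 'n"
  assumes "CARD('n) \<ge> 3"
    and "p > (real CARD('n) + 2) / (real CARD('n) - 2)"
    and "open \<Omega>" and "connected \<Omega>" and "bounded \<Omega>"
    and "stationary_solution p \<Omega> u"
    and "x \<in> \<Omega>"
  shows "tangent_functions p u x \<noteq> {} \<and> tangent_measures p \<Omega> u x \<noteq> {} \<and>
    (x \<notin> sing \<Omega> u \<longrightarrow>
      tangent_functions p u x = {v. AE y in lebesgue. v y = 0} \<and>
      tangent_measures p \<Omega> u x = {null_measure borel})"
proof -
  define n where "n = real CARD('n)"
  have n: "n > 2" using assms(1) by (simp add: n_def)
  have c: "n + 2 < p * (n - 2)" using assms(2) n by (simp add: n_def pos_divide_less_eq)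
  have "1 * (n - 2) < p * (n - 2)" using c by simp
  then have p: "p > 1" using n by (simp only: mult_less_cancel_right)
  interpret stationary_at p \<Omega> u x by standard (use assms p in auto)
  (* the lower bound on p, solved for n, says alpha p < n *)
  have "2 * (p + 1) < n * (p - 1)" using c by (simp add: algebra_simps)
  then have "alpha p < real CARD('n)" using p by (simp add: alpha_def n_def pos_divide_less_eq)
  then show ?thesis
    using tangent_functions_nonempty tangent_measures_nonempty regular_tangent_functions regular_tangent_measures by blast
qed

end
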